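(* Let $T_\tau=\mathbb{C}/(\mathbb{Z}+\tau\mathbb{Z})$ with $\tau=e^{2\pi i/3}$ be the equianharmonic torus. There exists no non-holomorphic proper minimal immersion of $T_\tau$ with one point removed into $\mathbb{R}^4$ with one end and total curvature $-8\pi$.
   Context: A minimal immersion of a Riemann surface in $\mathbb{R}^4$ is a conformal harmonic immersion. Total curvature is the integral $\int K\,dA$ of the Gaussian curvature of the metric induced from $\mathbb{R}^4$. "One end" means that the map is a proper map from the torus minus one point. A minimal immersion is non-holomorphic if it is not a complex curve for any isometric (orthogonal) complex structure on $\mathbb{R}^4$. *)

theory Defs
  imports "HOL-Analysis.Analysis"
begin

section \<open>The torus\<close>

definition lattice :: "complex \<Rightarrow> complex set" where
  "lattice \<tau> = {of_int m + of_int n * \<tau> | m n. True}"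

definition lattice_rel :: "complex \<Rightarrow> (complex \<times> complex) set" where
  "lattice_rel \<tau> = {(z, w). z - w \<in> lattice \<tau>}"

definition torus :: "complex \<Rightarrow> complex set set" where
  "torus \<tau> = UNIV // lattice_rel \<tau>"

definition torus_proj :: "complex \<Rightarrow> complex \<Rightarrow> complex set" where
  "torus_proj \<tau> z = lattice_rel \<tau> `` {z}"

definition torus_topology :: "complex \<Rightarrow> complex set topology" where
  "torus_topology \<tau> = topology (\<lambda>U. U \<subseteq> torus \<tau> \<and> open (torus_proj \<tau> -` U))"

lemma range_torus_proj: "range (torus_proj \<tau>) = torus \<tau>"
  by (auto simp: torus_def torus_proj_def quotient_def)

lemma openin_torus_topology:
  "openin (torus_topology \<tau>) U \<longleftrightarrow> U \<subseteq> torus \<tau> \<and> open (torus_proj \<tau> -` U)"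
proof -
  have "istopology (\<lambda>U. U \<subseteq> torus \<tau> \<and> open (torus_proj \<tau> -` U))"
    unfolding istopology_def by (auto simp: vimage_Union)
  then show ?thesis
    by (simp add: torus_topology_def topology_inverse')
qed

lemma topspace_torus_topology: "topspace (torus_topology \<tau>) = torus \<tau>"
proof
  show "topspace (torus_topology \<tau>) \<subseteq> torus \<tau>"
    using openin_topspace openin_torus_topology by blast
  have "torus_proj \<tau> -` torus \<tau> = UNIV"
    using range_torus_proj by blast
  then have "openin (torus_topology \<tau>) (torus \<tau>)"
    by (simp add: openin_torus_topology)
  then show "torus \<tau> \<subseteq> topspace (torus_topology \<tau>)"
    by (rule openin_subset)
qed

lemma quotient_map_torus_proj: "quotient_map euclidean (torus_topology \<tau>) (torus_proj \<tau>)"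
  by (auto simp: quotient_map_def topspace_torus_topology openin_torus_topology
      range_torus_proj vimage_def)

text \<open>
  When \<open>\<tau>\<close> is not real, \<^term>\<open>torus_proj \<tau>\<close> is a covering map and its local inverses are the
  holomorphic charts of the torus. A local property of a map \<open>X\<close> on an open set \<open>M\<close> of the torus
  is therefore a property of \<open>X \<circ> torus_proj \<tau>\<close> on the preimage of \<open>M\<close>, in the coordinate of
  the plane.
\<close>

section \<open>Minimal immersions\<close>

definition dderiv :: "complex \<Rightarrow> (complex \<Rightarrow> 'a::real_normed_vector) \<Rightarrow> complex \<Rightarrow> 'a" where
  "dderiv v f z = frechet_derivative f (at z) v"

definition C2_on :: "complex set \<Rightarrow> (complex \<Rightarrow> 'a::real_normed_vector) \<Rightarrow> bool" where
  "C2_on S f \<longleftrightarrow> f differentiable_on S \<and>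
     (\<forall>v. dderiv v f differentiable_on S) \<and>
     (\<forall>v w. continuous_on S (dderiv w (dderiv v f)))"

definition harmonic_on :: "complex set \<Rightarrow> (complex \<Rightarrow> 'a::real_normed_vector) \<Rightarrow> bool" where
  "harmonic_on S f \<longleftrightarrow> C2_on S f \<and>
     (\<forall>z\<in>S. dderiv 1 (dderiv 1 f) z + dderiv \<i> (dderiv \<i> f) z = 0)"

definition immersion_on :: "complex set \<Rightarrow> (complex \<Rightarrow> 'a::real_normed_vector) \<Rightarrow> bool" where
  "immersion_on S f \<longleftrightarrow> f differentiable_on S \<and> (\<forall>z\<in>S. inj (frechet_derivative f (at z)))"

definition conformal_on :: "complex set \<Rightarrow> (complex \<Rightarrow> 'a::real_inner) \<Rightarrow> bool" where
  "conformal_on S f \<longleftrightarrow> f differentiable_on S \<and>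
     (\<forall>z\<in>S. \<exists>c>0. \<forall>v w. dderiv v f z \<bullet> dderiv w f z = c * (v \<bullet> w))"

definition minimal_immersion ::
    "complex \<Rightarrow> complex set set \<Rightarrow> (complex set \<Rightarrow> real^4) \<Rightarrow> bool" where
  "minimal_immersion \<tau> M X \<longleftrightarrow>
     immersion_on (torus_proj \<tau> -` M) (X \<circ> torus_proj \<tau>) \<and>
     conformal_on (torus_proj \<tau> -` M) (X \<circ> torus_proj \<tau>) \<and>
     harmonic_on (torus_proj \<tau> -` M) (X \<circ> torus_proj \<tau>)"

definition orthogonal_complex_structure :: "(real^4 \<Rightarrow> real^4) \<Rightarrow> bool" where
  "orthogonal_complex_structure J \<longleftrightarrow> orthogonal_transformation J \<and> (\<forall>v. J (J v) = - v)"

definition complex_curve ::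
    "(real^4 \<Rightarrow> real^4) \<Rightarrow> complex \<Rightarrow> complex set set \<Rightarrow> (complex set \<Rightarrow> real^4) \<Rightarrow> bool" where
  "complex_curve J \<tau> M X \<longleftrightarrow>
     (\<forall>z\<in>torus_proj \<tau> -` M. \<forall>v.
        dderiv (\<i> * v) (X \<circ> torus_proj \<tau>) z = J (dderiv v (X \<circ> torus_proj \<tau>) z))"

text \<open>
  Both orientations of \<open>\<real>\<^sup>4\<close> are allowed for \<open>J\<close>. Since \<open>-J\<close> is an orthogonal complex structure
  whenever \<open>J\<close> is, antiholomorphic maps are excluded below as well.
\<close>

definition non_holomorphic ::
    "complex \<Rightarrow> complex set set \<Rightarrow> (complex set \<Rightarrow> real^4) \<Rightarrow> bool" where
  "non_holomorphic \<tau> M X \<longleftrightarrow>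
     \<not> (\<exists>J. orthogonal_complex_structure J \<and> complex_curve J \<tau> M X)"

section \<open>Gaussian curvature and total curvature\<close>

definition coord_vec :: "2 \<Rightarrow> complex" where
  "coord_vec i = (if i = 1 then 1 else \<i>)"

abbreviation pd :: "2 \<Rightarrow> (complex \<Rightarrow> 'a::real_normed_vector) \<Rightarrow> complex \<Rightarrow> 'a" where
  "pd i \<equiv> dderiv (coord_vec i)"

definition induced_metric :: "(complex \<Rightarrow> 'a::real_inner) \<Rightarrow> complex \<Rightarrow> real^2^2" where
  "induced_metric f z = (\<chi> i j. pd i f z \<bullet> pd j f z)"

text \<open>\<open>christoffel g k i j\<close> is the symbol with upper index \<open>k\<close> and lower indices \<open>i j\<close>.\<close>

definition christoffel :: "(complex \<Rightarrow> real^2^2) \<Rightarrow> 2 \<Rightarrow> 2 \<Rightarrow> 2 \<Rightarrow> complex \<Rightarrow> real" where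
  "christoffel g k i j z =
     (\<Sum>l\<in>UNIV. matrix_inv (g z) $ k $ l *
        (pd i (\<lambda>w. g w $ j $ l) z + pd j (\<lambda>w. g w $ i $ l) z - pd l (\<lambda>w. g w $ i $ j) z)) / 2"

text \<open>
  \<open>curvature_tensor g m i j k\<close> is the \<open>m\<close>-th component of
  \<open>R(\<partial>\<^sub>i, \<partial>\<^sub>j) \<partial>\<^sub>k = \<nabla>\<^sub>i \<nabla>\<^sub>j \<partial>\<^sub>k - \<nabla>\<^sub>j \<nabla>\<^sub>i \<partial>\<^sub>k\<close>, and
  the Gaussian curvature is \<open>g(R(\<partial>\<^sub>1, \<partial>\<^sub>2) \<partial>\<^sub>2, \<partial>\<^sub>1) / det g\<close>, positive on round spheres.
\<close>

definition curvature_tensor ::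
    "(complex \<Rightarrow> real^2^2) \<Rightarrow> 2 \<Rightarrow> 2 \<Rightarrow> 2 \<Rightarrow> 2 \<Rightarrow> complex \<Rightarrow> real" where
  "curvature_tensor g m i j k z =
     pd i (christoffel g m j k) z - pd j (christoffel g m i k) z +
     (\<Sum>l\<in>UNIV. christoffel g m i l z * christoffel g l j k z
               - christoffel g m j l z * christoffel g l i k z)"

definition gaussian_curvature :: "(complex \<Rightarrow> real^2^2) \<Rightarrow> complex \<Rightarrow> real" where
  "gaussian_curvature g z =
     (\<Sum>m\<in>UNIV. g z $ 1 $ m * curvature_tensor g m 1 2 2 z) / det (g z)"

definition fundamental_domain :: "complex \<Rightarrow> complex set" where
  "fundamental_domain \<tau> =
     {of_real s + of_real t * \<tau> | s t. 0 \<le> s \<and> s < 1 \<and> 0 \<le> t \<and> t < 1}"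

text \<open>
  The projection maps the fundamental domain bijectively onto the torus (for \<open>\<tau>\<close> not real), so
  integrals over \<open>M\<close> are computed there, with area element \<open>sqrt (det g) dx dy\<close>. If \<open>K dA\<close> is
  not integrable, the value is \<open>0\<close> by convention, hence a nonzero value entails integrability.
\<close>

definition total_curvature ::
    "complex \<Rightarrow> complex set set \<Rightarrow> (complex set \<Rightarrow> real^4) \<Rightarrow> real" where
  "total_curvature \<tau> M X =
     (let g = induced_metric (X \<circ> torus_proj \<tau>) in
      LINT z : fundamental_domain \<tau> \<inter> torus_proj \<tau> -` M | lborel.
        gaussian_curvature g z * sqrt (det (g z)))"

end

theory Submission
  imports Defs "HOL-Complex_Analysis.Complex_Analysis"
begin

text \<open>
  Let \<open>F\<close> be the lift to the plane of a minimal immersion \<open>X\<close> as in the statement, and let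
  \<open>\<phi> = F\<^sub>x - \<i> F\<^sub>y\<close>, a map into complex four-space with \<open>dF = Re (\<phi> dz)\<close>. Harmonicity says that
  \<open>\<phi>\<close> is holomorphic, conformality that \<open>\<Sum>j (\<phi> j)\<^sup>2 = 0\<close> and that \<open>\<phi>\<close> has no zeros. The
  curvature form is \<open>K dA = - \<Delta>u dx dy\<close> with \<open>u = ln |\<phi>|\<close> (\<open>gaussian_curvature_conformal\<close>). So
  \<open>\<Delta>u \<ge> 0\<close> is a density of total mass \<open>8 * pi\<close> on the torus. The proof shows that such an \<open>X\<close> is
  holomorphic for some orthogonal complex structure.

  The first part is the behaviour at the puncture. Finite mass limits the growth of the circle means
  of \<open>u\<close>, which are convex in the logarithm of the radius. This prevents zeros of the functions
  \<open>\<phi> i\<close> and \<open>\<phi> i - \<phi> k\<close> from accumulating (\<open>no_zeros_near_puncture\<close>), and by the great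
  Picard theorem the quotients of components have limits, so one component dominates the others. It has residue \<open>0\<close>,
  because there is only one puncture, and thus a primitive \<open>h\<close>, whose growth bounds that of \<open>X\<close>. If \<open>h\<close>
  had no pole, inverse branches of \<open>h\<close> would extend to arbitrarily large discs, as they cannot run into the
  puncture, where \<open>X\<close> is infinite (\<open>proper_implies_pole\<close>). Hence \<open>\<phi>\<close> is meromorphic
  (\<open>meromorphic_at_puncture\<close>). Its pole order \<open>n\<close> is the flux of the gradient of \<open>u\<close> around the
  puncture divided by \<open>2 * pi\<close>, and Green's formula on the rest of the torus gives
  \<open>2 * pi * n \<le> 8 * pi\<close> (\<open>pole_order_le_4\<close>).

  The second part uses the rotation \<open>z \<mapsto> \<rho> z\<close> of order six of the hexagonal lattice. Splitting \<open>\<phi>\<close>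
  by the characters of this rotation gives \<open>\<phi> = a + b P2 + c P3 + d P4\<close> with constant vectors and
  scalar elliptic functions \<open>Pn\<close> of pole order \<open>n\<close>, in effect the Weierstrass function and its first two
  derivatives. The components of \<open>\<Sum>j (\<phi> j)\<^sup>2 = 0\<close> for the various characters, together with the vanishing of the
  periods of \<open>Re (\<integral> \<phi> dz)\<close>, force \<open>a = b = 0\<close> and make \<open>c, d\<close> span an isotropic subspace
  (\<open>minimal_data_isotropic_plane\<close>). If \<open>c\<close> and \<open>d\<close> are dependent, then \<open>\<phi>\<close> has constant
  direction and the curvature vanishes. Otherwise they span an isotropic plane of dimension two, which is the
  space of vectors of type (1, 0) of an orthogonal complex structure
  (\<open>isotropic_plane_complex_structure\<close>), and \<open>X\<close> is holomorphic for it.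
\<close>

section \<open>Green's formula and the Laplacian of a logarithmic norm\<close>

text \<open>
  The real part is the outward flux of the plane field \<open>(P, Q)\<close> written as \<open>q = P - \<i> Q\<close>, and the whole is
  \<open>-\<i>\<close> times the contour integral of \<open>q\<close>. A gradient field corresponds to
  \<open>q = u\<^sub>x - \<i> u\<^sub>y\<close>, and its flux is then the integral of the Laplacian of \<open>u\<close>.
\<close>

definition rect_flux :: "(complex \<Rightarrow> complex) \<Rightarrow> real \<Rightarrow> real \<Rightarrow> real \<Rightarrow> real \<Rightarrow> complex" where
  "rect_flux q a b c d =
     integral {c..d} (\<lambda>y. q (Complex b y) - q (Complex a y)) +
     \<i> * integral {a..b} (\<lambda>x. q (Complex x d) - q (Complex x c))"

definition C1_with_partials ::
    "(complex \<Rightarrow> complex) \<Rightarrow> (complex \<Rightarrow> complex) \<Rightarrow> (complex \<Rightarrow> complex) \<Rightarrow> complex set \<Rightarrow> bool" where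
  "C1_with_partials q qx qy U \<longleftrightarrow>
     (\<forall>z\<in>U. (q has_derivative (\<lambda>v. Re v *\<^sub>R qx z + Im v *\<^sub>R qy z)) (at z)) \<and>
     continuous_on U qx \<and> continuous_on U qy"

lemma continuous_on_Complex [continuous_intros]:
  assumes "continuous_on A f" "continuous_on A g"
  shows "continuous_on A (\<lambda>x. Complex (f x) (g x))"
  unfolding Complex_eq using assms by (intro continuous_intros)

lemma C1_horizontal:
  assumes "C1_with_partials q qx qy U" "Complex x y \<in> U"
  shows "((\<lambda>x. q (Complex x y)) has_vector_derivative qx (Complex x y)) (at x within A)"
proof -
  have 1: "((\<lambda>x. Complex x y) has_derivative (\<lambda>h. of_real h)) (at x within A)"
    unfolding Complex_eq by (auto intro!: derivative_eq_intros)
  have 2: "(q has_derivative (\<lambda>v. Re v *\<^sub>R qx (Complex x y) + Im v *\<^sub>R qy (Complex x y)))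
      (at (Complex x y))"
    using assms by (auto simp: C1_with_partials_def)
  show ?thesis
    unfolding has_vector_derivative_def
    using has_derivative_compose[OF 1 2] by simp
qed

lemma C1_vertical:
  assumes "C1_with_partials q qx qy U" "Complex x y \<in> U"
  shows "((\<lambda>y. q (Complex x y)) has_vector_derivative qy (Complex x y)) (at y within A)"
proof -
  have 1: "((\<lambda>y. Complex x y) has_derivative (\<lambda>h. \<i> * of_real h)) (at y within A)"
    unfolding Complex_eq by (auto intro!: derivative_eq_intros)
  have 2: "(q has_derivative (\<lambda>v. Re v *\<^sub>R qx (Complex x y) + Im v *\<^sub>R qy (Complex x y)))
      (at (Complex x y))"
    using assms by (auto simp: C1_with_partials_def)
  show ?thesis
    unfolding has_vector_derivative_def
    using has_derivative_compose[OF 1 2] by simp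
qed

lemma C1_continuous:
  assumes "C1_with_partials q qx qy U"
  shows "continuous_on U q"
  using assms unfolding C1_with_partials_def
  by (meson continuous_at_imp_continuous_on has_derivative_continuous)

lemma continuous_on_pair_Complex:
  assumes "continuous_on U f" and "\<And>x y. x \<in> A \<Longrightarrow> y \<in> B \<Longrightarrow> Complex x y \<in> U"
  shows "continuous_on (A \<times> B) (\<lambda>p. f (Complex (fst p) (snd p)))"
  by (rule continuous_on_compose2[OF assms(1)]) (auto intro!: continuous_intros assms(2))

text \<open>
  Green's formula on a rectangle: integrate \<open>q\<^sub>x\<close> first in \<open>x\<close> and \<open>q\<^sub>y\<close> first in \<open>y\<close>. The integrand
  \<open>q\<^sub>x + \<i> q\<^sub>y\<close> is twice the antiholomorphic derivative of \<open>q\<close>.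
\<close>

lemma rect_flux_eq_integral:
  assumes C1: "C1_with_partials q qx qy U"
    and U: "\<And>x y. a \<le> x \<Longrightarrow> x \<le> b \<Longrightarrow> c \<le> y \<Longrightarrow> y \<le> d \<Longrightarrow> Complex x y \<in> U"
    and "a \<le> b" "c \<le> d"
  shows "rect_flux q a b c d =
    integral {c..d} (\<lambda>y. integral {a..b} (\<lambda>x. qx (Complex x y) + \<i> * qy (Complex x y)))"
proof -
  have cx: "continuous_on U qx" and cy: "continuous_on U qy"
    using C1 by (auto simp: C1_with_partials_def)
  have contx: "continuous_on (cbox (a,c) (b,d)) (\<lambda>p. qx (Complex (fst p) (snd p)))"
    unfolding cbox_Pair_eq by (rule continuous_on_pair_Complex[OF cx]) (auto intro: U)
  have conty: "continuous_on (cbox (a,c) (b,d)) (\<lambda>p. qy (Complex (fst p) (snd p)))"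
    unfolding cbox_Pair_eq by (rule continuous_on_pair_Complex[OF cy]) (auto intro: U)
  have conty': "continuous_on (cbox (c,a) (d,b)) (\<lambda>p. qy (Complex (snd p) (fst p)))"
    unfolding cbox_Pair_eq
    by (rule continuous_on_compose2[OF cy]) (auto intro!: continuous_intros U)
  have contx': "continuous_on (cbox (c,a) (d,b)) (\<lambda>p. qx (Complex (snd p) (fst p)))"
    unfolding cbox_Pair_eq
    by (rule continuous_on_compose2[OF cx]) (auto intro!: continuous_intros U)
  have lx: "continuous_on {a..b} (\<lambda>x. qx (Complex x y))"
    and ly: "continuous_on {a..b} (\<lambda>x. qy (Complex x y))" if "y \<in> {c..d}" for y
    using that by (auto intro!: continuous_on_compose2[OF cx] continuous_on_compose2[OF cy]
        continuous_intros U)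
  have ftcx: "integral {a..b} (\<lambda>x. qx (Complex x y)) = q (Complex b y) - q (Complex a y)"
    if "y \<in> {c..d}" for y
    by (rule integral_unique, rule fundamental_theorem_of_calculus)
      (use that assms in \<open>auto intro!: C1_horizontal[OF C1] U\<close>)
  have ftcy: "integral {c..d} (\<lambda>y. qy (Complex x y)) = q (Complex x d) - q (Complex x c)"
    if "x \<in> {a..b}" for x
    by (rule integral_unique, rule fundamental_theorem_of_calculus)
      (use that assms in \<open>auto intro!: C1_vertical[OF C1] U\<close>)
  have intx: "(\<lambda>y. integral {a..b} (\<lambda>x. qx (Complex x y))) integrable_on {c..d}"
    using integral_integrable_2dim[OF contx'] by simp
  have inty: "(\<lambda>y. integral {a..b} (\<lambda>x. qy (Complex x y))) integrable_on {c..d}"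
    using integral_integrable_2dim[OF conty'] by simp
  have swap: "integral {c..d} (\<lambda>y. integral {a..b} (\<lambda>x. qy (Complex x y)))
      = integral {a..b} (\<lambda>x. integral {c..d} (\<lambda>y. qy (Complex x y)))"
    using integral_swap_continuous[of c a d b "\<lambda>y x. qy (Complex x y)"] conty'
    by (simp add: case_prod_unfold)
  have "integral {c..d} (\<lambda>y. integral {a..b} (\<lambda>x. qx (Complex x y) + \<i> * qy (Complex x y)))
     = integral {c..d} (\<lambda>y. integral {a..b} (\<lambda>x. qx (Complex x y)) +
          \<i> * integral {a..b} (\<lambda>x. qy (Complex x y)))"
    by (intro integral_cong, subst integral_add)
      (auto intro!: integrable_continuous_real lx ly continuous_intros)
  also have "\<dots> = integral {c..d} (\<lambda>y. integral {a..b} (\<lambda>x. qx (Complex x y))) +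
      \<i> * integral {c..d} (\<lambda>y. integral {a..b} (\<lambda>x. qy (Complex x y)))"
    using integral_add[OF intx integrable_on_mult_right[OF inty, of \<i>]] by simp
  also have "\<dots> = rect_flux q a b c d"
    unfolding rect_flux_def swap
    by (intro arg_cong2[of _ _ _ _ "(+)"] arg_cong[of _ _ "(*) \<i>"] integral_cong ftcx ftcy)
  finally show ?thesis by simp
qed

lemma integral_complex_of_real_HK:
  fixes f :: "'a::euclidean_space \<Rightarrow> real"
  shows "integral A (\<lambda>x. complex_of_real (f x)) = of_real (integral A f)"
proof (cases "f integrable_on A")
  case True
  then show ?thesis
    by (intro integral_unique has_integral_of_real integrable_integral)
next
  case False
  then have "\<not> (\<lambda>x. complex_of_real (f x)) integrable_on A"
    using integrable_linear[OF _ bounded_linear_Re, of "\<lambda>x. complex_of_real (f x)" A] by (auto simp: o_def)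
  then show ?thesis
    using False by (simp add: not_integrable_integral)
qed

text \<open>
  A finite family \<open>\<Phi>\<close> of holomorphic functions is regarded as a curve in complex Euclidean space.
  For \<open>u = log_norm J \<Phi>\<close>, the function \<open>dlog_norm J \<Phi>\<close> is \<open>u\<^sub>x - \<i> u\<^sub>y\<close>, and \<open>lap_log_norm J \<Phi>\<close>
  is the Laplacian of \<open>u\<close>, in the form that shows its sign by the Cauchy-Schwarz inequality.
\<close>

definition norm_sq :: "'k set \<Rightarrow> ('k \<Rightarrow> complex \<Rightarrow> complex) \<Rightarrow> complex \<Rightarrow> real" where
  "norm_sq J \<Phi> z = (\<Sum>j\<in>J. (cmod (\<Phi> j z))\<^sup>2)"

definition herm :: "'k set \<Rightarrow> ('k \<Rightarrow> complex \<Rightarrow> complex) \<Rightarrow> complex \<Rightarrow> complex" where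
  "herm J \<Phi> z = (\<Sum>j\<in>J. deriv (\<Phi> j) z * cnj (\<Phi> j z))"

definition log_norm :: "'k set \<Rightarrow> ('k \<Rightarrow> complex \<Rightarrow> complex) \<Rightarrow> complex \<Rightarrow> real" where
  "log_norm J \<Phi> z = ln (norm_sq J \<Phi> z) / 2"

definition dlog_norm :: "'k set \<Rightarrow> ('k \<Rightarrow> complex \<Rightarrow> complex) \<Rightarrow> complex \<Rightarrow> complex" where
  "dlog_norm J \<Phi> z = herm J \<Phi> z / of_real (norm_sq J \<Phi> z)"

definition lap_log_norm :: "'k set \<Rightarrow> ('k \<Rightarrow> complex \<Rightarrow> complex) \<Rightarrow> complex \<Rightarrow> real" where
  "lap_log_norm J \<Phi> z =
     2 * (norm_sq J \<Phi> z * (\<Sum>j\<in>J. (cmod (deriv (\<Phi> j) z))\<^sup>2) - (cmod (herm J \<Phi> z))\<^sup>2)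
       / (norm_sq J \<Phi> z)\<^sup>2"

lemma norm_sq_nonneg: "norm_sq J \<Phi> z \<ge> 0"
  by (simp add: norm_sq_def sum_nonneg)

lemma norm_sq_pos_iff: "finite J \<Longrightarrow> norm_sq J \<Phi> z > 0 \<longleftrightarrow> (\<exists>j\<in>J. \<Phi> j z \<noteq> 0)"
  using norm_sq_nonneg[of J \<Phi> z]
  by (auto simp: norm_sq_def less_le sum_nonneg_eq_0_iff)

lemma norm_sq_complex: "of_real (norm_sq J \<Phi> z) = (\<Sum>j\<in>J. \<Phi> j z * cnj (\<Phi> j z))"
  by (simp add: norm_sq_def complex_norm_square[symmetric])

lemma lap_log_norm_nonneg: "lap_log_norm J \<Phi> z \<ge> 0"
proof (cases "finite J")
  case True
  have "cmod (herm J \<Phi> z) \<le> (\<Sum>j\<in>J. cmod (deriv (\<Phi> j) z) * cmod (\<Phi> j z))"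
    unfolding herm_def by (rule order_trans[OF norm_sum]) (simp add: norm_mult)
  then have "(cmod (herm J \<Phi> z))\<^sup>2 \<le> (\<Sum>j\<in>J. cmod (deriv (\<Phi> j) z) * cmod (\<Phi> j z))\<^sup>2"
    by (simp add: power_mono)
  also have "\<dots> \<le> (\<Sum>j\<in>J. (cmod (deriv (\<Phi> j) z))\<^sup>2) * (\<Sum>j\<in>J. (cmod (\<Phi> j z))\<^sup>2)"
    by (rule Cauchy_Schwarz_ineq_sum)
  finally show ?thesis
    by (simp add: lap_log_norm_def norm_sq_def mult.commute)
qed (simp add: lap_log_norm_def norm_sq_def)

context
  fixes J :: "'k set" and \<Phi> :: "'k \<Rightarrow> complex \<Rightarrow> complex" and U :: "complex set"
  assumes J: "finite J" and U: "open U" and hol: "\<And>j. j \<in> J \<Longrightarrow> \<Phi> j holomorphic_on U"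
begin

lemma holomorphic_family_derivative:
  assumes "z \<in> U" "j \<in> J"
  shows "(\<Phi> j has_derivative (\<lambda>v. deriv (\<Phi> j) z * v)) (at z)"
    and "(deriv (\<Phi> j) has_derivative (\<lambda>v. deriv (deriv (\<Phi> j)) z * v)) (at z)"
proof -
  show "(\<Phi> j has_derivative (\<lambda>v. deriv (\<Phi> j) z * v)) (at z)"
    using holomorphic_derivI[OF hol[OF assms(2)] U assms(1)]
    by (simp add: has_field_derivative_def)
  show "(deriv (\<Phi> j) has_derivative (\<lambda>v. deriv (deriv (\<Phi> j)) z * v)) (at z)"
    using holomorphic_derivI[OF holomorphic_deriv[OF hol[OF assms(2)] U] U assms(1)]
    by (simp add: has_field_derivative_def)
qed

lemma norm_sq_has_derivative:
  assumes "z \<in> U"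
  shows "(norm_sq J \<Phi> has_derivative (\<lambda>v. 2 * Re (herm J \<Phi> z * v))) (at z)"
proof -
  have "((\<lambda>z. \<Sum>j\<in>J. (cmod (\<Phi> j z))\<^sup>2) has_derivative
      (\<lambda>v. \<Sum>j\<in>J. 2 * Re (deriv (\<Phi> j) z * cnj (\<Phi> j z) * v))) (at z)"
  proof (rule has_derivative_sum)
    fix j assume "j \<in> J"
    note [derivative_intros] = holomorphic_family_derivative(1)[OF assms \<open>j \<in> J\<close>]
    show "((\<lambda>z. (cmod (\<Phi> j z))\<^sup>2) has_derivative
        (\<lambda>v. 2 * Re (deriv (\<Phi> j) z * cnj (\<Phi> j z) * v))) (at z)"
      unfolding cmod_power2
      by (auto intro!: derivative_eq_intros simp: algebra_simps fun_eq_iff)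
  qed
  then show ?thesis
    unfolding norm_sq_def herm_def by (simp add: sum_distrib_left sum_distrib_right Re_sum)
qed

lemma herm_has_derivative:
  assumes "z \<in> U"
  shows "(herm J \<Phi> has_derivative (\<lambda>v. (\<Sum>j\<in>J. deriv (deriv (\<Phi> j)) z * cnj (\<Phi> j z)) * v
     + of_real (\<Sum>j\<in>J. (cmod (deriv (\<Phi> j) z))\<^sup>2) * cnj v)) (at z)"
proof -
  have "((\<lambda>z. \<Sum>j\<in>J. deriv (\<Phi> j) z * cnj (\<Phi> j z)) has_derivative
      (\<lambda>v. \<Sum>j\<in>J. deriv (deriv (\<Phi> j)) z * cnj (\<Phi> j z) * v +
         of_real ((cmod (deriv (\<Phi> j) z))\<^sup>2) * cnj v)) (at z)"
  proof (rule has_derivative_sum)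
    fix j assume "j \<in> J"
    note d = holomorphic_family_derivative[OF assms \<open>j \<in> J\<close>]
    have "((\<lambda>z. cnj (\<Phi> j z)) has_derivative (\<lambda>v. cnj (deriv (\<Phi> j) z * v))) (at z)"
      by (rule bounded_linear.has_derivative[OF bounded_linear_cnj d(1)])
    then have "((\<lambda>z. deriv (\<Phi> j) z * cnj (\<Phi> j z)) has_derivative
        (\<lambda>v. deriv (\<Phi> j) z * cnj (deriv (\<Phi> j) z * v)
           + deriv (deriv (\<Phi> j)) z * v * cnj (\<Phi> j z))) (at z)"
      by (rule has_derivative_mult[OF d(2)])
    then show "((\<lambda>z. deriv (\<Phi> j) z * cnj (\<Phi> j z)) has_derivative
        (\<lambda>v. deriv (deriv (\<Phi> j)) z * cnj (\<Phi> j z) * v +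
         of_real ((cmod (deriv (\<Phi> j) z))\<^sup>2) * cnj v)) (at z)"
      by (simp add: complex_norm_square[symmetric] algebra_simps flip: of_real_power)
  qed
  then show ?thesis
    unfolding herm_def by (simp add: sum_distrib_left sum_distrib_right sum.distrib)
qed

lemma log_norm_has_derivative:
  assumes "z \<in> U" "norm_sq J \<Phi> z > 0"
  shows "(log_norm J \<Phi> has_derivative (\<lambda>v. Re (dlog_norm J \<Phi> z * v))) (at z)"
  unfolding log_norm_def dlog_norm_def using assms
  by (auto intro!: derivative_eq_intros norm_sq_has_derivative simp: fun_eq_iff field_simps
      Re_divide_of_real Im_divide_of_real)

text \<open>
  The directional derivative of \<open>dlog_norm J \<Phi>\<close> by the quotient rule.
\<close>

definition dlog_norm_dir :: "complex \<Rightarrow> complex \<Rightarrow> complex" where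
  "dlog_norm_dir v z =
     ((\<Sum>j\<in>J. deriv (deriv (\<Phi> j)) z * cnj (\<Phi> j z)) * v
        + of_real (\<Sum>j\<in>J. (cmod (deriv (\<Phi> j) z))\<^sup>2) * cnj v) / of_real (norm_sq J \<Phi> z)
     - herm J \<Phi> z * of_real (2 * Re (herm J \<Phi> z * v)) / of_real ((norm_sq J \<Phi> z)\<^sup>2)"

lemma dlog_norm_has_derivative:
  assumes "z \<in> U" "norm_sq J \<Phi> z > 0"
  shows "(dlog_norm J \<Phi> has_derivative (\<lambda>v. dlog_norm_dir v z)) (at z)"
proof -
  have 1: "((\<lambda>z. complex_of_real (norm_sq J \<Phi> z)) has_derivative
      (\<lambda>v. of_real (2 * Re (herm J \<Phi> z * v)))) (at z)"
    by (rule bounded_linear.has_derivative[OF bounded_linear_of_real norm_sq_has_derivative])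
      (use assms in auto)
  have "((\<lambda>z. herm J \<Phi> z / complex_of_real (norm_sq J \<Phi> z)) has_derivative
     (\<lambda>v. (((\<Sum>j\<in>J. deriv (deriv (\<Phi> j)) z * cnj (\<Phi> j z)) * v
        + of_real (\<Sum>j\<in>J. (cmod (deriv (\<Phi> j) z))\<^sup>2) * cnj v) * of_real (norm_sq J \<Phi> z)
        - herm J \<Phi> z * of_real (2 * Re (herm J \<Phi> z * v)))
        / (of_real (norm_sq J \<Phi> z) * of_real (norm_sq J \<Phi> z)))) (at z)"
    by (rule has_derivative_divide'[OF herm_has_derivative 1]) (use assms in auto)
  moreover have "(\<lambda>z. herm J \<Phi> z / complex_of_real (norm_sq J \<Phi> z)) = dlog_norm J \<Phi>"
    by (simp add: dlog_norm_def fun_eq_iff)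
  moreover have "(\<lambda>v. (((\<Sum>j\<in>J. deriv (deriv (\<Phi> j)) z * cnj (\<Phi> j z)) * v
        + of_real (\<Sum>j\<in>J. (cmod (deriv (\<Phi> j) z))\<^sup>2) * cnj v) * of_real (norm_sq J \<Phi> z)
        - herm J \<Phi> z * of_real (2 * Re (herm J \<Phi> z * v)))
        / (of_real (norm_sq J \<Phi> z) * of_real (norm_sq J \<Phi> z))) = (\<lambda>v. dlog_norm_dir v z)"
    using assms(2) unfolding dlog_norm_dir_def
    by (intro ext) (simp add: diff_divide_distrib power2_eq_square)
  ultimately show ?thesis by simp
qed

lemma dlog_norm_C1:
  assumes "\<And>z. z \<in> U \<Longrightarrow> norm_sq J \<Phi> z > 0"
  shows "C1_with_partials (dlog_norm J \<Phi>) (dlog_norm_dir 1) (dlog_norm_dir \<i>) U"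
proof -
  have c0: "continuous_on U (\<Phi> j)" and c1: "continuous_on U (deriv (\<Phi> j))"
    and c2: "continuous_on U (deriv (deriv (\<Phi> j)))" if "j \<in> J" for j
    using hol[OF that] U by (auto intro!: holomorphic_on_imp_continuous_on holomorphic_deriv)
  have cn: "continuous_on U (norm_sq J \<Phi>)"
    unfolding norm_sq_def by (intro continuous_intros c0)
  have ch: "continuous_on U (herm J \<Phi>)"
    unfolding herm_def by (intro continuous_intros c0 c1)
  have cont: "continuous_on U (dlog_norm_dir v)" for v
    unfolding dlog_norm_dir_def using assms
    by (intro continuous_intros c0 c1 c2 cn ch) force+
  have lin: "dlog_norm_dir v z = Re v *\<^sub>R dlog_norm_dir 1 z + Im v *\<^sub>R dlog_norm_dir \<i> z"
    if "z \<in> U" for v z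
  proof -
    interpret bounded_linear "\<lambda>v. dlog_norm_dir v z"
      using has_derivative_bounded_linear dlog_norm_has_derivative[OF that assms[OF that]] by blast
    have "dlog_norm_dir (Re v *\<^sub>R 1 + Im v *\<^sub>R \<i>) z
        = Re v *\<^sub>R dlog_norm_dir 1 z + Im v *\<^sub>R dlog_norm_dir \<i> z"
      by (simp only: add scaleR)
    moreover have "Re v *\<^sub>R 1 + Im v *\<^sub>R \<i> = v"
      by (simp add: complex_eq_iff)
    ultimately show ?thesis by simp
  qed
  show ?thesis
    unfolding C1_with_partials_def
  proof (intro conjI ballI cont)
    fix z assume z: "z \<in> U"
    have "(\<lambda>v. dlog_norm_dir v z) = (\<lambda>v. Re v *\<^sub>R dlog_norm_dir 1 z + Im v *\<^sub>R dlog_norm_dir \<i> z)"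
      using lin[OF z] by (intro ext)
    then show "(dlog_norm J \<Phi> has_derivative
        (\<lambda>v. Re v *\<^sub>R dlog_norm_dir 1 z + Im v *\<^sub>R dlog_norm_dir \<i> z)) (at z)"
      using dlog_norm_has_derivative[OF z assms[OF z]] by (simp only:)
  qed
qed

lemma dlog_norm_dbar:
  assumes "z \<in> U" "norm_sq J \<Phi> z > 0"
  shows "dlog_norm_dir 1 z + \<i> * dlog_norm_dir \<i> z = of_real (lap_log_norm J \<Phi> z)"
proof -
  define h where "h = herm J \<Phi> z"
  define s where "s = norm_sq J \<Phi> z"
  define a where "a = (\<Sum>j\<in>J. deriv (deriv (\<Phi> j)) z * cnj (\<Phi> j z))"
  define b where "b = (\<Sum>j\<in>J. (cmod (deriv (\<Phi> j) z))\<^sup>2)"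
  have s: "s > 0" using assms s_def by simp
  have hh: "h * of_real (Re h) - \<i> * (h * of_real (Im h)) = of_real ((cmod h)\<^sup>2)"
    unfolding cmod_power2 by (simp add: complex_eq_iff power2_eq_square algebra_simps)
  have "dlog_norm_dir 1 z + \<i> * dlog_norm_dir \<i> z
      = 2 * (of_real b / of_real s) - 2 * (h * of_real (Re h) - \<i> * (h * of_real (Im h))) / of_real (s\<^sup>2)"
    unfolding dlog_norm_dir_def h_def[symmetric] s_def[symmetric] a_def[symmetric] b_def[symmetric]
    using s by (simp add: field_simps)
  also have "\<dots> = of_real (2 * (s * b - (cmod h)\<^sup>2) / s\<^sup>2)"
    unfolding hh using s by (simp add: field_simps power2_eq_square)
  finally show ?thesis
    by (simp add: lap_log_norm_def h_def s_def b_def)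
qed

text \<open>
  The link between curvature and asymptotics: the mass of the Laplacian in a rectangle is a boundary
  integral, which periodicity and local expansions can evaluate.
\<close>

lemma rect_flux_dlog_norm:
  assumes pos: "\<And>z. z \<in> U \<Longrightarrow> norm_sq J \<Phi> z > 0"
    and sub: "\<And>x y. a \<le> x \<Longrightarrow> x \<le> b \<Longrightarrow> c \<le> y \<Longrightarrow> y \<le> d \<Longrightarrow> Complex x y \<in> U"
    and "a \<le> b" "c \<le> d"
  shows "rect_flux (dlog_norm J \<Phi>) a b c d =
    of_real (integral {c..d} (\<lambda>y. integral {a..b} (\<lambda>x. lap_log_norm J \<Phi> (Complex x y))))"
proof -
  have "rect_flux (dlog_norm J \<Phi>) a b c d =
    integral {c..d} (\<lambda>y. integral {a..b} (\<lambda>x. dlog_norm_dir 1 (Complex x y)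
       + \<i> * dlog_norm_dir \<i> (Complex x y)))"
    by (rule rect_flux_eq_integral[OF dlog_norm_C1]) (use assms in auto)
  also have "\<dots> = integral {c..d} (\<lambda>y. integral {a..b} (\<lambda>x.
      of_real (lap_log_norm J \<Phi> (Complex x y))))"
    by (intro integral_cong dlog_norm_dbar) (use assms in auto)
  also have "\<dots> = of_real (integral {c..d} (\<lambda>y. integral {a..b} (\<lambda>x. lap_log_norm J \<Phi> (Complex x y))))"
    by (simp add: integral_complex_of_real_HK)
  finally show ?thesis .
qed

lemma continuous_on_lap_log_norm:
  assumes "\<And>z. z \<in> U \<Longrightarrow> norm_sq J \<Phi> z > 0"
  shows "continuous_on U (lap_log_norm J \<Phi>)"
proof -
  have c0: "continuous_on U (\<Phi> j)" and c1: "continuous_on U (deriv (\<Phi> j))"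
    if "j \<in> J" for j
    using hol[OF that] U by (auto intro!: holomorphic_on_imp_continuous_on holomorphic_deriv)
  have cn: "continuous_on U (norm_sq J \<Phi>)"
    unfolding norm_sq_def by (intro continuous_intros c0)
  have ch: "continuous_on U (herm J \<Phi>)"
    unfolding herm_def by (intro continuous_intros c0 c1)
  show ?thesis
    unfolding lap_log_norm_def using assms
    by (intro continuous_intros c0 c1 cn ch) force+
qed

end

section \<open>The Weierstrass representation and Gaussian curvature\<close>

text \<open>
  Schwarz's theorem. It is needed because the second Cauchy-Riemann equation for the Weierstrass data
  of a harmonic map is the equality of its mixed partial derivatives.
\<close>

lemma mixed_partials_eq:
  fixes g gx gy gxx gxy gyx gyy :: "complex \<Rightarrow> real"
  assumes U: "open U" "z0 \<in> U"
    and g: "\<And>z. z \<in> U \<Longrightarrow> (g has_derivative (\<lambda>v. Re v * gx z + Im v * gy z)) (at z)"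
    and gx: "\<And>z. z \<in> U \<Longrightarrow> (gx has_derivative (\<lambda>v. Re v * gxx z + Im v * gxy z)) (at z)"
    and gy: "\<And>z. z \<in> U \<Longrightarrow> (gy has_derivative (\<lambda>v. Re v * gyx z + Im v * gyy z)) (at z)"
    and cont: "continuous_on U gxy" "continuous_on U gyx"
  shows "gxy z0 = gyx z0"
proof (rule ccontr)
  assume ne: "gxy z0 \<noteq> gyx z0"
  define e where "e = \<bar>gxy z0 - gyx z0\<bar> / 2"
  have e: "e > 0" using ne by (simp add: e_def)
  have hor: "((\<lambda>x. k (Complex x y)) has_real_derivative kx (Complex x y)) (at x)"
    and ver: "((\<lambda>y. k (Complex x y)) has_real_derivative ky (Complex x y)) (at y)"
    if "Complex x y \<in> U" "\<And>z. z \<in> U \<Longrightarrow> (k has_derivative (\<lambda>v. Re v * kx z + Im v * ky z)) (at z)"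
    for k kx ky :: "complex \<Rightarrow> real" and x y
  proof -
    have 1: "((\<lambda>x. Complex x y) has_derivative (\<lambda>h. of_real h)) (at x)"
      unfolding Complex_eq by (auto intro!: derivative_eq_intros)
    have 2: "((\<lambda>y. Complex x y) has_derivative (\<lambda>h. \<i> * of_real h)) (at y)"
      unfolding Complex_eq by (auto intro!: derivative_eq_intros)
    show "((\<lambda>x. k (Complex x y)) has_real_derivative kx (Complex x y)) (at x)"
      using has_derivative_compose[OF 1 that(2)[OF that(1)]]
      by (simp add: has_field_derivative_def mult_commute_abs)
    show "((\<lambda>y. k (Complex x y)) has_real_derivative ky (Complex x y)) (at y)"
      using has_derivative_compose[OF 2 that(2)[OF that(1)]]
      by (simp add: has_field_derivative_def mult_commute_abs)
  qed
  obtain r0 where r0: "r0 > 0" "ball z0 r0 \<subseteq> U"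
    using U open_contains_ball by metis
  obtain r1 where r1: "r1 > 0" "\<And>z. z \<in> U \<Longrightarrow> dist z z0 < r1 \<Longrightarrow> \<bar>gxy z - gxy z0\<bar> < e"
    using cont(1) U e unfolding continuous_on_iff dist_real_def by metis
  obtain r2 where r2: "r2 > 0" "\<And>z. z \<in> U \<Longrightarrow> dist z z0 < r2 \<Longrightarrow> \<bar>gyx z - gyx z0\<bar> < e"
    using cont(2) U e unfolding continuous_on_iff dist_real_def by metis
  define h where "h = Min {r0, r1, r2} / 3"
  have h: "h > 0" "2 * h < r0" "2 * h < r1" "2 * h < r2"
    using r0(1) r1(1) r2(1) by (auto simp: h_def min_def)
  define x0 where "x0 = Re z0"
  define y0 where "y0 = Im z0"
  have near: "dist (Complex x y) z0 \<le> 2 * h"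
    if "x \<in> {x0..x0+h}" "y \<in> {y0..y0+h}" for x y
  proof -
    have "dist (Complex x y) z0 \<le> \<bar>x - x0\<bar> + \<bar>y - y0\<bar>"
      using cmod_le[of "Complex x y - z0"] by (simp add: dist_norm x0_def y0_def)
    then show ?thesis using that by auto
  qed
  have inU: "Complex x y \<in> U" if "x \<in> {x0..x0+h}" "y \<in> {y0..y0+h}" for x y
    using near[OF that] h(2) r0(2) by (auto simp: subset_iff dist_commute)
  define \<Delta> where "\<Delta> = g (Complex (x0+h) (y0+h)) - g (Complex (x0+h) y0)
     - g (Complex x0 (y0+h)) + g (Complex x0 y0)"
  \<comment> \<open>The second difference \<open>\<Delta>\<close> equals \<open>h\<^sup>2\<close> times either mixed partial at a nearby point.\<close>
  obtain x y where xy: "x \<in> {x0..x0+h}" "y \<in> {y0..y0+h}" "\<Delta> = h * h * gxy (Complex x y)"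
  proof -
    have "\<exists>x. x0 < x \<and> x < x0 + h \<and>
       (g (Complex (x0+h) (y0+h)) - g (Complex (x0+h) y0)) - (g (Complex x0 (y0+h)) - g (Complex x0 y0))
        = (x0 + h - x0) * (gx (Complex x (y0+h)) - gx (Complex x y0))"
      by (rule MVT2) (use h in \<open>auto intro!: derivative_intros hor[OF _ g] inU\<close>)
    then obtain x where x: "x0 < x" "x < x0 + h"
      "\<Delta> = h * (gx (Complex x (y0+h)) - gx (Complex x y0))"
      unfolding \<Delta>_def by auto
    have "\<exists>y. y0 < y \<and> y < y0 + h \<and>
       gx (Complex x (y0+h)) - gx (Complex x y0) = (y0 + h - y0) * gxy (Complex x y)"
      by (rule MVT2) (use h x in \<open>auto intro!: derivative_intros ver[OF _ gx] inU\<close>)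
    then obtain y where y: "y0 < y" "y < y0 + h"
      "gx (Complex x (y0+h)) - gx (Complex x y0) = h * gxy (Complex x y)" by auto
    show thesis by (rule that[of x y]) (use x y in simp_all)
  qed
  obtain x' y' where xy': "x' \<in> {x0..x0+h}" "y' \<in> {y0..y0+h}" "\<Delta> = h * h * gyx (Complex x' y')"
  proof -
    have "\<exists>y. y0 < y \<and> y < y0 + h \<and>
       (g (Complex (x0+h) (y0+h)) - g (Complex x0 (y0+h))) - (g (Complex (x0+h) y0) - g (Complex x0 y0))
        = (y0 + h - y0) * (gy (Complex (x0+h) y) - gy (Complex x0 y))"
      by (rule MVT2) (use h in \<open>auto intro!: derivative_intros ver[OF _ g] inU\<close>)
    then obtain y where y: "y0 < y" "y < y0 + h"
      "\<Delta> = h * (gy (Complex (x0+h) y) - gy (Complex x0 y))"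
      unfolding \<Delta>_def by auto
    have "\<exists>x. x0 < x \<and> x < x0 + h \<and>
       gy (Complex (x0+h) y) - gy (Complex x0 y) = (x0 + h - x0) * gyx (Complex x y)"
      by (rule MVT2) (use h y in \<open>auto intro!: derivative_intros hor[OF _ gy] inU\<close>)
    then obtain x where x: "x0 < x" "x < x0 + h"
      "gy (Complex (x0+h) y) - gy (Complex x0 y) = h * gyx (Complex x y)" by auto
    show thesis by (rule that[of x y]) (use x y in simp_all)
  qed
  have "gxy (Complex x y) = gyx (Complex x' y')"
    using xy(3) xy'(3) h(1) by simp
  moreover have "\<bar>gxy (Complex x y) - gxy z0\<bar> < e"
    using r1(2)[OF inU[OF xy(1,2)]] near[OF xy(1,2)] h by simp
  moreover have "\<bar>gyx (Complex x' y') - gyx z0\<bar> < e"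
    using r2(2)[OF inU[OF xy'(1,2)]] near[OF xy'(1,2)] h by simp
  ultimately have "\<bar>gxy z0 - gyx z0\<bar> < 2 * e" by linarith
  then show False by (simp add: e_def)
qed

lemma dderiv_eqI: "(f has_derivative f') (at z) \<Longrightarrow> dderiv v f z = f' v"
  unfolding dderiv_def by (metis frechet_derivative_at)

lemma dderiv_linear:
  assumes "f differentiable (at z)"
  shows "(f has_derivative (\<lambda>v. Re v *\<^sub>R dderiv 1 f z + Im v *\<^sub>R dderiv \<i> f z)) (at z)"
proof -
  have d: "(f has_derivative (\<lambda>v. dderiv v f z)) (at z)"
    using assms frechet_derivative_works unfolding dderiv_def by blast
  interpret bounded_linear "\<lambda>v. dderiv v f z"
    using d by (rule has_derivative_bounded_linear)
  have "dderiv v f z = Re v *\<^sub>R dderiv 1 f z + Im v *\<^sub>R dderiv \<i> f z" for v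
  proof -
    have "v = Re v *\<^sub>R 1 + Im v *\<^sub>R \<i>" by (simp add: complex_eq_iff)
    then show ?thesis by (metis add scaleR)
  qed
  then have "(\<lambda>v. dderiv v f z) = (\<lambda>v. Re v *\<^sub>R dderiv 1 f z + Im v *\<^sub>R dderiv \<i> f z)"
    by (rule ext)
  then show ?thesis
    by (rule back_subst[of "\<lambda>h. (f has_derivative h) (at z)", OF d])
qed

text \<open>
  The functions \<open>\<phi>\<^sub>j = \<partial>\<^sub>x F\<^sub>j - \<i> \<partial>\<^sub>y F\<^sub>j\<close> of the Weierstrass representation, for which
  \<open>dF = Re (\<phi> dz)\<close>.
\<close>

definition weierstrass_data :: "(complex \<Rightarrow> real^4) \<Rightarrow> 4 \<Rightarrow> complex \<Rightarrow> complex" where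
  "weierstrass_data F j z = Complex (dderiv 1 F z $ j) (- (dderiv \<i> F z $ j))"

lemma weierstrass_data_derivative:
  assumes "F differentiable (at z)"
  shows "(F has_derivative (\<lambda>v. \<chi> j. Re (weierstrass_data F j z * v))) (at z)"
proof -
  have "(\<lambda>v. Re v *\<^sub>R dderiv 1 F z + Im v *\<^sub>R dderiv \<i> F z)
      = (\<lambda>v. \<chi> j. Re (weierstrass_data F j z * v))"
    by (auto simp: vec_eq_iff weierstrass_data_def)
  then show ?thesis using dderiv_linear[OF assms] by simp
qed

lemma harmonic_imp_weierstrass_data_holomorphic:
  assumes U: "open U" and harm: "harmonic_on U F"
  shows "weierstrass_data F j holomorphic_on U"
proof -
  have C2: "C2_on U F" using harm by (simp add: harmonic_on_def)
  have d0: "F differentiable (at z)" if "z \<in> U" for z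
    using C2 that U by (simp add: C2_on_def differentiable_on_eq_differentiable_at)
  have d1: "dderiv v F differentiable (at z)" if "z \<in> U" for z v
    using C2 that U by (simp add: C2_on_def differentiable_on_eq_differentiable_at)
  have c2: "continuous_on U (\<lambda>z. dderiv w (dderiv v F) z $ j)" for v w
    using C2 by (auto simp: C2_on_def intro!: continuous_intros)
  have comp: "((\<lambda>z. G z $ j) has_derivative (\<lambda>v. Re v * (dderiv 1 G z $ j) + Im v * (dderiv \<i> G z $ j))) (at z)"
    if "G differentiable (at z)" for G :: "complex \<Rightarrow> real^4" and z
    using bounded_linear.has_derivative[OF bounded_linear_vec_nth dderiv_linear[OF that], of j] by simp
  define gxx where "gxx z = dderiv 1 (dderiv 1 F) z $ j" for z
  define gxy where "gxy z = dderiv \<i> (dderiv 1 F) z $ j" for z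
  define gyx where "gyx z = dderiv 1 (dderiv \<i> F) z $ j" for z
  define gyy where "gyy z = dderiv \<i> (dderiv \<i> F) z $ j" for z
  have gx: "((\<lambda>z. dderiv 1 F z $ j) has_derivative (\<lambda>v. Re v * gxx z + Im v * gxy z)) (at z)"
    and gy: "((\<lambda>z. dderiv \<i> F z $ j) has_derivative (\<lambda>v. Re v * gyx z + Im v * gyy z)) (at z)"
    if "z \<in> U" for z
    using comp[OF d1[OF that]] unfolding gxx_def gxy_def gyx_def gyy_def by auto
  have mixed: "gxy z = gyx z" if "z \<in> U" for z
    by (rule mixed_partials_eq[OF U that comp[OF d0] gx gy])
      (use c2 in \<open>auto simp: gxy_def gyx_def\<close>)
  have lap: "gyy z = - gxx z" if "z \<in> U" for z
  proof -
    have "dderiv 1 (dderiv 1 F) z + dderiv \<i> (dderiv \<i> F) z = 0"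
      using harm that by (simp add: harmonic_on_def)
    then have "(dderiv 1 (dderiv 1 F) z + dderiv \<i> (dderiv \<i> F) z) $ j = 0 $ j" by simp
    then show ?thesis by (simp add: gxx_def gyy_def)
  qed
  have "(weierstrass_data F j has_field_derivative Complex (gxx z) (- gxy z)) (at z)" if "z \<in> U" for z
  proof -
    have "((\<lambda>z. of_real (dderiv 1 F z $ j) + \<i> * of_real (- (dderiv \<i> F z $ j))) has_derivative
      (\<lambda>v. of_real (Re v * gxx z + Im v * gxy z) + \<i> * of_real (- (Re v * gyx z + Im v * gyy z)))) (at z)"
      using gx[OF that] gy[OF that]
      by (intro derivative_intros)
    moreover have "(\<lambda>v. of_real (Re v * gxx z + Im v * gxy z) + \<i> * of_real (- (Re v * gyx z + Im v * gyy z)))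
        = (*) (Complex (gxx z) (- gxy z))"
      using mixed[OF that] lap[OF that] by (auto simp: fun_eq_iff complex_eq_iff)
    ultimately show ?thesis
      unfolding weierstrass_data_def[abs_def] Complex_eq has_field_derivative_def by simp
  qed
  then show ?thesis using U holomorphic_on_open by blast
qed

text \<open>
  Conformality says that the two partial derivatives are orthogonal and of equal length \<open>sqrt c\<close>; these are
  the imaginary and real part of the first equation, and the induced metric is \<open>c = norm_sq / 2\<close>
  times the Euclidean one.
\<close>

lemma weierstrass_data_conformal:
  assumes U: "open U" and conf: "conformal_on U F" and z: "z \<in> U"
  shows "(\<Sum>j\<in>UNIV. (weierstrass_data F j z)\<^sup>2) = 0"
    and "norm_sq UNIV (weierstrass_data F) z > 0"
    and "induced_metric F z = (\<chi> i j. if i = j then norm_sq UNIV (weierstrass_data F) z / 2 else 0)"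
proof -
  obtain c where c: "c > 0" "\<And>v w. dderiv v F z \<bullet> dderiv w F z = c * (v \<bullet> w)"
    using conf z by (auto simp: conformal_on_def)
  have 11: "(\<Sum>j\<in>UNIV. dderiv 1 F z $ j * dderiv 1 F z $ j) = c"
    using c(2)[of 1 1] by (simp add: inner_vec_def inner_complex_def)
  have ii: "(\<Sum>j\<in>UNIV. dderiv \<i> F z $ j * dderiv \<i> F z $ j) = c"
    using c(2)[of \<i> \<i>] by (simp add: inner_vec_def inner_complex_def)
  have mix: "(\<Sum>j\<in>UNIV. dderiv 1 F z $ j * dderiv \<i> F z $ j) = 0"
    using c(2)[of 1 \<i>] by (simp add: inner_vec_def inner_complex_def)
  have n: "norm_sq UNIV (weierstrass_data F) z = 2 * c"
  proof -
    have "(cmod (weierstrass_data F j z))\<^sup>2 = dderiv 1 F z $ j * dderiv 1 F z $ j + dderiv \<i> F z $ j * dderiv \<i> F z $ j" for j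
      unfolding cmod_power2 by (simp add: weierstrass_data_def power2_eq_square)
    then show ?thesis unfolding norm_sq_def by (simp only: sum.distrib 11 ii mult_2)
  qed
  show "norm_sq UNIV (weierstrass_data F) z > 0" using n c by simp
  have 1: "(weierstrass_data F j z)\<^sup>2 = of_real (dderiv 1 F z $ j * dderiv 1 F z $ j) -
      of_real (dderiv \<i> F z $ j * dderiv \<i> F z $ j) - 2 * \<i> * of_real (dderiv 1 F z $ j * dderiv \<i> F z $ j)" for j
    by (simp add: weierstrass_data_def complex_eq_iff power2_eq_square)
  show "(\<Sum>j\<in>UNIV. (weierstrass_data F j z)\<^sup>2) = 0"
    unfolding 1 sum_subtractf
    by (simp only: of_real_sum[symmetric] 11 ii mix sum_distrib_left[symmetric]) simp
  have "coord_vec i \<bullet> coord_vec j = (if i = j then 1 else 0)" for i j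
    using exhaust_2[of i] exhaust_2[of j] by (auto simp: coord_vec_def inner_complex_def)
  then show "induced_metric F z = (\<chi> i j. if i = j then norm_sq UNIV (weierstrass_data F) z / 2 else 0)"
    unfolding induced_metric_def n c(2) by (simp add: vec_eq_iff)
qed

lemma matrix_inv_scalar_2:
  fixes c :: real
  assumes "c \<noteq> 0"
  shows "matrix_inv ((\<chi> i j. if i = j then c else 0) :: real^2^2) = (\<chi> i j. if i = j then 1 / c else 0)"
proof -
  let ?A = "(\<chi> i j. if i = j then c else 0) :: real^2^2"
  let ?B = "(\<chi> i j. if i = j then 1 / c else 0) :: real^2^2"
  have AB: "?A ** ?B = mat 1" and BA: "?B ** ?A = mat 1"
    using assms by (simp_all add: matrix_matrix_mult_def mat_def vec_eq_iff forall_2 sum_2)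
  have "\<exists>B. ?A ** B = mat 1 \<and> B ** ?A = mat 1"
    using AB BA by blast
  then have "matrix_inv ?A ** ?A = mat 1"
    unfolding matrix_inv_def by (rule someI_ex[THEN conjunct2])
  then have "matrix_inv ?A ** (?A ** ?B) = ?B"
    unfolding matrix_mul_assoc by (simp only: matrix_mul_lid)
  then show ?thesis unfolding AB by (simp only: matrix_mul_rid)
qed

text \<open>
  For a conformal metric \<open>exp (2 u)\<close> the Christoffel symbols are combinations of the first derivatives of
  \<open>u\<close>, their quadratic terms cancel in the curvature tensor, and \<open>K dA = - \<Delta>u dx dy\<close> remains. Adding a
  constant to \<open>u\<close> changes nothing, so \<open>u = log_norm\<close> serves although the metric is \<open>norm_sq / 2\<close>.
\<close>

lemma gaussian_curvature_conformal:
  fixes \<phi> :: "'k::finite \<Rightarrow> complex \<Rightarrow> complex"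
  assumes U: "open U" and hol: "\<And>j. \<phi> j holomorphic_on U"
    and pos: "\<And>z. z \<in> U \<Longrightarrow> norm_sq UNIV \<phi> z > 0"
    and g: "\<And>z. z \<in> U \<Longrightarrow> g z = (\<chi> i j. if i = j then norm_sq UNIV \<phi> z / 2 else 0)"
    and z: "z \<in> U"
  shows "gaussian_curvature g z * sqrt (det (g z)) = - lap_log_norm UNIV \<phi> z"
proof -
  note [simp] = finite_class.finite_UNIV
  define \<alpha> where "\<alpha> i z = Re (dlog_norm UNIV \<phi> z * coord_vec i)" for i z
  have gij: "dderiv v (\<lambda>w. g w $ i $ j) z = (if i = j then Re (herm UNIV \<phi> z * v) else 0)"
    if "z \<in> U" for z i j v
  proof -
    have "((\<lambda>w. norm_sq UNIV \<phi> w / 2) has_derivative (\<lambda>v. Re (herm UNIV \<phi> z * v))) (at z)"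
      using bounded_linear.has_derivative[OF bounded_linear_mult_right[of "1/2"]
          norm_sq_has_derivative[where \<Phi> = \<phi>, OF finite_class.finite_UNIV U hol that]] by (simp add: diff_divide_distrib)
    then have "((\<lambda>w. if i = j then norm_sq UNIV \<phi> w / 2 else 0) has_derivative
        (\<lambda>v. if i = j then Re (herm UNIV \<phi> z * v) else 0)) (at z)"
      by (cases "i = j") simp_all
    then have "((\<lambda>w. g w $ i $ j) has_derivative
        (\<lambda>v. if i = j then Re (herm UNIV \<phi> z * v) else 0)) (at z)"
      by (rule has_derivative_transform_within_open[OF _ U that]) (simp add: g)
    then show ?thesis by (rule dderiv_eqI)
  qed
  have chr: "christoffel g k i j z = (if j = k then \<alpha> i z else 0) + (if i = k then \<alpha> j z else 0)
      - (if i = j then \<alpha> k z else 0)" if "z \<in> U" for z i j k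
  proof -
    have n: "norm_sq UNIV \<phi> z \<noteq> 0" using pos[OF that] by simp
    have inv: "matrix_inv (g z) = (\<chi> i j. if i = j then 1 / (norm_sq UNIV \<phi> z / 2) else 0)"
      unfolding g[OF that] by (rule matrix_inv_scalar_2) (use n in simp)
    have \<alpha>: "\<alpha> i z = Re (herm UNIV \<phi> z * coord_vec i) / norm_sq UNIV \<phi> z" for i
      by (simp add: \<alpha>_def dlog_norm_def Re_divide_of_real Im_divide_of_real diff_divide_distrib)
    have "christoffel g k i j z = (1 / norm_sq UNIV \<phi> z) *
       ((if j = k then Re (herm UNIV \<phi> z * coord_vec i) else 0)
       + (if i = k then Re (herm UNIV \<phi> z * coord_vec j) else 0)
       - (if i = j then Re (herm UNIV \<phi> z * coord_vec k) else 0))"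
      unfolding christoffel_def gij[OF that] inv
      using exhaust_2[of i] exhaust_2[of j] exhaust_2[of k] by (elim disjE) (simp_all add: sum_2 n field_simps)
    also have "\<dots> = (if j = k then \<alpha> i z else 0) + (if i = k then \<alpha> j z else 0)
      - (if i = j then \<alpha> k z else 0)"
      unfolding \<alpha> using n by (simp add: field_simps)
    finally show ?thesis .
  qed
  define d where "d = dlog_norm_dir UNIV \<phi>"
  have \<alpha>': "(\<alpha> i has_derivative (\<lambda>v. Re (d v z * coord_vec i))) (at z)" for i
    unfolding \<alpha>_def[abs_def] d_def
    by (intro bounded_linear.has_derivative[OF bounded_linear_Re]
        bounded_linear.has_derivative[OF bounded_linear_mult_left]
        dlog_norm_has_derivative[where \<Phi> = \<phi>, OF finite_class.finite_UNIV U hol z pos[OF z]])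
  have \<alpha>'': "((\<lambda>z. if b then \<alpha> i z else 0) has_derivative
      (\<lambda>v. if b then Re (d v z * coord_vec i) else 0)) (at z)" for b i
    by (cases b) (simp_all only: if_True if_False \<alpha>' has_derivative_const)
  have chr': "dderiv v (christoffel g k i j) z = (if j = k then Re (d v z * coord_vec i) else 0)
      + (if i = k then Re (d v z * coord_vec j) else 0)
      - (if i = j then Re (d v z * coord_vec k) else 0)" for v i j k
  proof -
    have "((\<lambda>z. (if j = k then \<alpha> i z else 0) + (if i = k then \<alpha> j z else 0)
      - (if i = j then \<alpha> k z else 0)) has_derivative
      (\<lambda>v. (if j = k then Re (d v z * coord_vec i) else 0) + (if i = k then Re (d v z * coord_vec j) else 0)
      - (if i = j then Re (d v z * coord_vec k) else 0))) (at z)"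
      by (intro has_derivative_diff has_derivative_add \<alpha>'')
    then have "(christoffel g k i j has_derivative
      (\<lambda>v. (if j = k then Re (d v z * coord_vec i) else 0) + (if i = k then Re (d v z * coord_vec j) else 0)
      - (if i = j then Re (d v z * coord_vec k) else 0))) (at z)"
      by (rule has_derivative_transform_within_open[OF _ U z]) (simp add: chr)
    then show ?thesis by (rule dderiv_eqI)
  qed
  have R: "curvature_tensor g 1 1 2 2 z = - Re (d 1 z + \<i> * d \<i> z)"
    unfolding curvature_tensor_def chr' chr[OF z] by (simp add: sum_2 coord_vec_def)
  have "d 1 z + \<i> * d \<i> z = of_real (lap_log_norm UNIV \<phi> z)"
    unfolding d_def
    by (rule dlog_norm_dbar[where \<Phi> = \<phi>, OF finite_class.finite_UNIV U hol z pos[OF z]])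
  then have R': "curvature_tensor g 1 1 2 2 z = - lap_log_norm UNIV \<phi> z"
    using R by simp
  have det: "det (g z) = (norm_sq UNIV \<phi> z / 2)\<^sup>2"
    unfolding g[OF z] det_2 by (simp add: power2_eq_square)
  have "gaussian_curvature g z = (norm_sq UNIV \<phi> z / 2) * (- lap_log_norm UNIV \<phi> z) / (norm_sq UNIV \<phi> z / 2)\<^sup>2"
    unfolding gaussian_curvature_def det using R' by (simp add: sum_2 g[OF z])
  moreover have "sqrt (det (g z)) = norm_sq UNIV \<phi> z / 2"
    unfolding det real_sqrt_abs using pos[OF z] by simp
  ultimately have "gaussian_curvature g z * sqrt (det (g z)) = (norm_sq UNIV \<phi> z / 2) *
      (- lap_log_norm UNIV \<phi> z) / (norm_sq UNIV \<phi> z / 2)\<^sup>2 * (norm_sq UNIV \<phi> z / 2)"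
    by (simp only:)
  then show ?thesis
    using pos[OF z] by (simp add: power2_eq_square)
qed

section \<open>Properness and poles of primitives\<close>

text \<open>
  Zero residue is exactly the condition for a single-valued primitive around the puncture.
\<close>

lemma primitive_punctured_disc:
  assumes r: "r > 0" and f: "f holomorphic_on ball 0 r - {0}" and res: "residue f 0 = 0"
  obtains h where "\<And>z. z \<in> ball 0 r - {0} \<Longrightarrow> (h has_field_derivative f z) (at z)"
proof -
  \<comment> \<open>On the half-plane covering the punctured disc a primitive exists by convexity; it descends
    because the residue is its increment over one turn.\<close>
  define S where "S = {s::complex. Re s < ln r}"
  define k where "k s = f (exp s) * exp s" for s
  have S: "convex S" "open S"
    unfolding S_def by (auto simp: convex_halfspace_Re_lt open_halfspace_Re_lt)
  have expS: "exp s \<in> ball 0 r - {0}" if "s \<in> S" for s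
  proof -
    have "exp (Re s) < exp (ln r)" using that by (simp only: exp_less_cancel_iff S_def mem_Collect_eq)
    then show ?thesis using r by simp
  qed
  have k: "k holomorphic_on S"
  proof -
    have "(f \<circ> exp) holomorphic_on S"
      by (rule holomorphic_on_compose_gen[OF holomorphic_on_exp f], rule image_subsetI, rule expS)
    then have "(\<lambda>s. (f \<circ> exp) s * exp s) holomorphic_on S"
      by (intro holomorphic_on_mult holomorphic_on_exp)
    then show ?thesis by (simp add: k_def[abs_def])
  qed
  have "\<exists>G. \<forall>s\<in>S. (G has_field_derivative k s) (at s within S)"
  proof (rule holomorphic_convex_primitive'[OF S k])
    fix g assume "\<And>x. x \<in> S \<Longrightarrow> (g has_field_derivative k x) (at x within S)"
    then show "\<exists>G. \<forall>s\<in>S. (G has_field_derivative k s) (at s within S)"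
      by (intro exI[of _ g] ballI)
  qed
  then obtain G where G0: "\<And>s. s \<in> S \<Longrightarrow> (G has_field_derivative k s) (at s within S)"
    by blast
  have G: "(G has_field_derivative k s) (at s)" if "s \<in> S" for s
    using G0[OF that] unfolding at_within_open[OF that S(2)] .
  define p where "p = 2 * of_real pi * \<i>"
  have Sp: "s + of_int n * p \<in> S \<longleftrightarrow> s \<in> S" for s n
    by (simp add: S_def p_def)
  have kp: "k (s + p) = k s" for s
    by (simp add: k_def p_def exp_add exp_two_pi_i)
  define \<rho> where "\<rho> = r / 2"
  define s0 where "s0 = complex_of_real (ln \<rho>)"
  have \<rho>: "\<rho> > 0" "\<rho> < r" using r by (auto simp: \<rho>_def)
  have s0: "s0 \<in> S" using \<rho> r by (simp add: S_def s0_def)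
  have "G (s0 + p) - G s0 = 0"
  proof -
    have "(f has_contour_integral 2 * pi * \<i> * residue f 0) (circlepath 0 \<rho>)"
      by (rule base_residue[OF open_ball _ \<rho>(1) f]) (use r \<rho> in auto)
    then have "((\<lambda>t. f (circlepath 0 \<rho> t) * (2 * pi * \<i> * \<rho> * exp (2 * of_real pi * \<i> * t))) has_integral 0) {0..1}"
      by (simp add: res has_contour_integral vector_derivative_circlepath)
    moreover have "f (circlepath 0 \<rho> t) * (2 * pi * \<i> * \<rho> * exp (2 * of_real pi * \<i> * t)) = p * k (s0 + of_real t * p)" for t
    proof -
      have "exp (s0 + of_real t * p) = \<rho> * exp (2 * of_real pi * \<i> * t)"
        using \<rho> by (simp add: exp_add s0_def p_def mult_ac exp_of_real)
      then show ?thesis by (simp add: k_def circlepath p_def mult_ac)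
    qed
    ultimately have 1: "((\<lambda>t. p * k (s0 + of_real t * p)) has_integral 0) {0..1}" by simp
    have "((\<lambda>t. p * k (s0 + of_real t * p)) has_integral G (s0 + of_real 1 * p) - G (s0 + of_real 0 * p)) {0..1}"
    proof (rule fundamental_theorem_of_calculus)
      fix t :: real
      have "s0 + of_real t * p \<in> S" using s0 by (simp add: S_def p_def)
      note d = G[OF this]
      have "((\<lambda>t. s0 + of_real t * p) has_vector_derivative p) (at t within {0..1})"
        by (auto intro!: derivative_eq_intros)
      from field_vector_diff_chain_within[OF this has_field_derivative_at_within[OF d]]
      show "((\<lambda>t. G (s0 + of_real t * p)) has_vector_derivative p * k (s0 + of_real t * p)) (at t within {0..1})"
        by (simp add: o_def)
    qed simp
    from has_integral_unique[OF this 1] show ?thesis by simp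
  qed
  moreover have "(\<lambda>s. G (s + p) - G s) constant_on S"
  proof (rule has_field_derivative_0_imp_constant_on)
    fix s assume s: "s \<in> S"
    have "s + p \<in> S" using Sp[of s 1] s by simp
    have "((\<lambda>s. G (s + p)) has_field_derivative k (s + p)) (at s)"
      using G[OF \<open>s + p \<in> S\<close>] by (simp add: DERIV_shift)
    then show "((\<lambda>s. G (s + p) - G s) has_field_derivative 0) (at s)"
      using DERIV_diff[OF _ G[OF s]] by (fastforce simp: kp)
  qed (use S convex_connected in auto)
  ultimately have Gp: "G (s + p) = G s" if "s \<in> S" for s
    using that s0 unfolding constant_on_def by (metis eq_iff_diff_eq_0)
  have Gnp: "G (s + of_nat n * p) = G s" if "s \<in> S" for s n
  proof (induction n)
    case (Suc n)
    have "s + of_nat n * p \<in> S" using Sp[of s "int n"] that by simp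
    from Gp[OF this] Suc show ?case by (simp add: algebra_simps)
  qed simp
  have Gzp: "G (s + of_int n * p) = G s" if "s \<in> S" for s n
  proof (cases "n \<ge> 0")
    case True
    then show ?thesis using Gnp[OF that, of "nat n"] by simp
  next
    case False
    have "s + of_int n * p \<in> S" using Sp that by blast
    from Gnp[OF this, of "nat (- n)"] show ?thesis using False by simp
  qed
  define h where "h z = G (Ln z)" for z
  show thesis
  proof (rule that[of h])
    fix z0 :: complex assume z0: "z0 \<in> ball 0 r - {0}"
    define l where "l w = Ln (w / z0) + Ln z0" for w
    define U where "U = {w. w / z0 \<notin> \<real>\<^sub>\<le>\<^sub>0} \<inter> (ball 0 r - {0})"
    have lS: "l w \<in> S" "exp (l w) = w" if "w \<in> ball 0 r - {0}" for w
    proof -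
      show e: "exp (l w) = w" using that z0 by (simp add: l_def exp_add)
      have "exp (Re (l w)) = cmod w" by (metis e norm_exp_eq_Re)
      then have "Re (l w) = ln (cmod w)" by (metis ln_exp)
      then show "l w \<in> S" using that r by (auto simp: S_def)
    qed
    have "open {w. w / z0 \<notin> \<real>\<^sub>\<le>\<^sub>0}"
    proof -
      have "{w. w / z0 \<notin> \<real>\<^sub>\<le>\<^sub>0} = (\<lambda>w. w / z0) -` (- \<real>\<^sub>\<le>\<^sub>0)" by auto
      moreover have "open ((\<lambda>w. w / z0) -` (- \<real>\<^sub>\<le>\<^sub>0))"
        using z0 by (intro open_vimage continuous_intros) (auto simp: closed_nonpos_Reals_complex open_Compl)
      ultimately show ?thesis by simp
    qed
    then have U: "open U" "z0 \<in> U" using z0 by (auto simp: U_def intro!: open_Int open_delete)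
    have "(l has_field_derivative 1 / z0) (at z0)"
      unfolding l_def[abs_def] using z0 by (auto intro!: derivative_eq_intros)
    from DERIV_chain2[OF G[OF lS(1)[OF z0]] this]
    have "((\<lambda>w. G (l w)) has_field_derivative k (l z0) * (1 / z0)) (at z0)" .
    moreover have "k (l z0) * (1 / z0) = f z0" using z0 lS(2)[OF z0] by (simp add: k_def)
    ultimately have "((\<lambda>w. G (l w)) has_field_derivative f z0) (at z0)" by simp
    then show "(h has_field_derivative f z0) (at z0)"
    proof (rule has_field_derivative_transform_within_open[OF _ U])
      fix w assume "w \<in> U"
      then have w: "w \<in> ball 0 r - {0}" by (simp add: U_def)
      have "exp (Ln w) = exp (l w)" using w lS(2)[OF w] by simp
      then obtain n :: int where "Ln w = l w + of_int n * p"
        unfolding exp_eq p_def by (auto simp: mult_ac)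
      then show "G (l w) = h w" using Gzp[OF lS(1)[OF w]] by (simp add: h_def)
    qed
  qed
qed

lemma LIMSEQ_dist_transform:
  assumes "w \<longlonglongrightarrow> d" "(\<lambda>n. dist (w n) (v n)) \<longlonglongrightarrow> 0"
  shows "v \<longlonglongrightarrow> d"
proof -
  have "(\<lambda>n. dist (w n) (v n) + dist (w n) d) \<longlonglongrightarrow> 0 + 0"
    by (intro tendsto_add assms(2) tendsto_dist_iff[THEN iffD1] assms(1))
  then have lim: "(\<lambda>n. dist (w n) (v n) + dist (w n) d) \<longlonglongrightarrow> 0" by simp
  have "norm (dist (v n) d) \<le> dist (w n) (v n) + dist (w n) d" for n
    using dist_triangle[of "v n" d "w n"] by (simp add: dist_commute)
  then have "(\<lambda>n. dist (v n) d) \<longlonglongrightarrow> 0"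
    by (intro Lim_null_comparison[OF _ lim] always_eventually allI)
  then show ?thesis by (rule tendsto_dist_iff[THEN iffD2])
qed

text \<open>
  If injectivity failed on every neighbourhood, two sequences of distinct points with equal images
  would accumulate on \<open>L\<close>; their limits coincide by injectivity on \<open>L\<close>, against local injectivity there.
\<close>

lemma inj_on_neighbourhood_of_compact:
  fixes h :: "'a::metric_space \<Rightarrow> 'b::metric_space"
  assumes L: "compact L" "L \<subseteq> D" "open D" and h: "continuous_on D h" and inj: "inj_on h L"
    and loc: "\<And>z. z \<in> L \<Longrightarrow> \<exists>r>0. inj_on h (ball z r)"
  shows "\<exists>e>0. inj_on h (\<Union>x\<in>L. ball x e) \<and> (\<Union>x\<in>L. ball x e) \<subseteq> D"
proof (rule ccontr)
  assume neg: "\<not> ?thesis"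
  obtain e0 where e0: "e0 > 0" "(\<Union>x\<in>L. ball x e0) \<subseteq> D"
    using compact_subset_open_imp_ball_epsilon_subset[OF L(1,3,2)] by blast
  define e where "e n = min e0 (1 / Suc n)" for n :: nat
  have e: "e n > 0" "e n \<le> e0" "e n \<le> 1 / Suc n" for n using e0 by (auto simp: e_def)
  have "\<exists>x y l m. l \<in> L \<and> m \<in> L \<and> dist l x < e n \<and> dist m y < e n \<and> x \<noteq> y \<and> h x = h y" for n
  proof -
    have "(\<Union>x\<in>L. ball x (e n)) \<subseteq> D"
    proof -
      have "ball x (e n) \<subseteq> ball x e0" for x using e(2) by (rule subset_ball)
      then show ?thesis using e0(2) by blast
    qed
    then have "\<not> inj_on h (\<Union>x\<in>L. ball x (e n))" using neg e(1) by blast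
    then obtain x y where xy: "x \<in> (\<Union>x\<in>L. ball x (e n))" "y \<in> (\<Union>x\<in>L. ball x (e n))" "h x = h y" "x \<noteq> y"
      unfolding inj_on_def by blast
    then obtain l m where "l \<in> L" "m \<in> L" "x \<in> ball l (e n)" "y \<in> ball m (e n)" by blast
    with xy(3,4) show ?thesis
      by (intro exI[of _ x] exI[of _ y] exI[of _ l] exI[of _ m]) simp
  qed
  then obtain x y l m where xy: "\<And>n. l n \<in> L" "\<And>n. m n \<in> L" "\<And>n. dist (l n) (x n) < e n"
    "\<And>n. dist (m n) (y n) < e n" "\<And>n. x n \<noteq> y n" "\<And>n. h (x n) = h (y n)"
    by metis
  have e_lim: "e \<longlonglongrightarrow> 0"
    by (rule tendsto_sandwich[OF _ _ tendsto_const LIMSEQ_Suc[OF lim_1_over_n]])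
      (use e in \<open>auto intro!: always_eventually less_imp_le\<close>)
  have "compact (L \<times> L)" using L by (simp add: compact_Times)
  then obtain c r where c: "c \<in> L \<times> L" "strict_mono (r :: nat \<Rightarrow> nat)" "((\<lambda>n. (l n, m n)) \<circ> r) \<longlonglongrightarrow> c"
  proof -
    have 1: "\<forall>n. (\<lambda>n. (l n, m n)) n \<in> L \<times> L" using xy(1,2) by simp
    have 2: "seq_compact (L \<times> L)"
      using \<open>compact (L \<times> L)\<close> by (simp only: compact_eq_seq_compact_metric)
    show ?thesis
      by (rule seq_compactE[OF 2 1]) (rule that)
  qed
  obtain a b where ab: "c = (a, b)" "a \<in> L" "b \<in> L" using c(1) by auto
  have la: "(\<lambda>n. l (r n)) \<longlonglongrightarrow> a" and mb: "(\<lambda>n. m (r n)) \<longlonglongrightarrow> b"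
    using tendsto_fst[OF c(3)] tendsto_snd[OF c(3)] by (simp_all add: ab o_def)
  have er: "(\<lambda>n. e (r n)) \<longlonglongrightarrow> 0"
    using LIMSEQ_subseq_LIMSEQ[OF e_lim c(2)] by (simp add: o_def)
  have near: "(\<lambda>n. v (r n)) \<longlonglongrightarrow> d" if "(\<lambda>n. w (r n)) \<longlonglongrightarrow> d" "\<And>n. dist (w n) (v n) < e n" for v w :: "nat \<Rightarrow> 'a" and d
  proof -
    have "(\<lambda>n. dist (w (r n)) (v (r n))) \<longlonglongrightarrow> 0"
      by (rule tendsto_sandwich[OF _ _ tendsto_const er])
        (use that(2) in \<open>auto intro!: always_eventually less_imp_le\<close>)
    then show ?thesis by (rule LIMSEQ_dist_transform[OF that(1)])
  qed
  have xa: "(\<lambda>n. x (r n)) \<longlonglongrightarrow> a" and yb: "(\<lambda>n. y (r n)) \<longlonglongrightarrow> b"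
    using near[OF la xy(3)] near[OF mb xy(4)] .
  have inD: "x n \<in> D" "y n \<in> D" for n
  proof -
    have "x n \<in> ball (l n) e0" "y n \<in> ball (m n) e0"
      using xy(3)[of n] xy(4)[of n] e(2)[of n] by simp_all
    then show "x n \<in> D" "y n \<in> D" using e0(2) xy(1)[of n] xy(2)[of n] by blast+
  qed
  have "(\<lambda>n. h (x (r n))) \<longlonglongrightarrow> h a" "(\<lambda>n. h (y (r n))) \<longlonglongrightarrow> h b"
    using ab L inD by (auto intro!: continuous_on_tendsto_compose[OF h] xa yb)
  then have "h a = h b" using xy(6) by (simp add: LIMSEQ_unique)
  then have "a = b" using inj ab by (auto dest: inj_onD)
  obtain \<rho> where \<rho>: "\<rho> > 0" "inj_on h (ball a \<rho>)" using loc ab by blast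
  have "eventually (\<lambda>n. dist (x (r n)) a < \<rho> \<and> dist (y (r n)) a < \<rho>) sequentially"
    using tendstoD[OF xa \<rho>(1)] tendstoD[OF yb \<rho>(1)] \<open>a = b\<close> by (auto intro: eventually_conj)
  then obtain n where "x (r n) \<in> ball a \<rho>" "y (r n) \<in> ball a \<rho>"
    unfolding eventually_sequentially by (auto simp: dist_commute)
  then show False using \<rho>(2) xy(5,6) by (meson inj_onD)
qed

text \<open>
  A holomorphic right inverse of \<open>h\<close> on the disc of radius \<open>\<rho>\<close> about \<open>h z0\<close>, with values in \<open>D\<close> and
  starting at \<open>z0\<close>. Uniqueness and the passage to the limit below turn the set of admissible radii into an
  interval containing its supremum, if finite.
\<close>

definition inverse_branch :: "(complex \<Rightarrow> complex) \<Rightarrow> complex set \<Rightarrow> complex \<Rightarrow> real \<Rightarrow> (complex \<Rightarrow> complex) \<Rightarrow> bool" where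
  "inverse_branch h D z0 \<rho> \<psi> \<longleftrightarrow> \<psi> holomorphic_on ball (h z0) \<rho> \<and> \<psi> (h z0) = z0 \<and>
     \<psi> ` ball (h z0) \<rho> \<subseteq> D \<and> (\<forall>\<zeta>\<in>ball (h z0) \<rho>. h (\<psi> \<zeta>) = \<zeta>)"

lemma inverse_branch_subset:
  "inverse_branch h D z0 \<rho> \<psi> \<Longrightarrow> \<rho>' \<le> \<rho> \<Longrightarrow> inverse_branch h D z0 \<rho>' \<psi>"
  unfolding inverse_branch_def
  by (meson holomorphic_on_subset image_mono order_trans subset_ball subsetD)

lemma inverse_branch_of_injective:
  assumes h: "h holomorphic_on N" "open N" "inj_on h N" and N: "z0 \<in> N" "N \<subseteq> D"
    and \<rho>: "ball (h z0) \<rho> \<subseteq> h ` N"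
  shows "\<exists>\<psi>. inverse_branch h D z0 \<rho> \<psi>"
proof -
  have "\<exists>g. g holomorphic_on (h ` N) \<and> (\<forall>z\<in>N. g (h z) = z)"
  proof (rule holomorphic_has_inverse[OF h])
    fix g assume g: "g holomorphic_on (h ` N)" "\<And>z. z \<in> N \<Longrightarrow> g (h z) = z"
    show "\<exists>g. g holomorphic_on (h ` N) \<and> (\<forall>z\<in>N. g (h z) = z)"
      by (intro exI[of _ g] conjI ballI g)
  qed
  then obtain g where g: "g holomorphic_on (h ` N)" "\<forall>z\<in>N. g (h z) = z"
    by (elim exE conjE)
  have "g holomorphic_on ball (h z0) \<rho>" using g(1) \<rho> by (rule holomorphic_on_subset)
  moreover have "g \<zeta> \<in> N \<and> h (g \<zeta>) = \<zeta>" if \<zeta>: "\<zeta> \<in> ball (h z0) \<rho>" for \<zeta>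
  proof -
    obtain z where "z \<in> N" "\<zeta> = h z" using \<zeta> \<rho> by blast
    then show ?thesis using g(2) by simp
  qed
  ultimately have "inverse_branch h D z0 \<rho> g"
    unfolding inverse_branch_def using bspec[OF g(2) N(1)] N(2)
    by (intro conjI ballI image_subsetI) (simp_all add: subset_iff)
  then show ?thesis by blast
qed

context
  fixes h :: "complex \<Rightarrow> complex" and D :: "complex set"
  assumes D: "open D" and h: "h holomorphic_on D" and h': "\<And>z. z \<in> D \<Longrightarrow> deriv h z \<noteq> 0"
begin

lemma inverse_branch_exists:
  assumes "z0 \<in> D"
  shows "\<exists>\<rho>>0. \<exists>\<psi>. inverse_branch h D z0 \<rho> \<psi>"
proof -
  obtain r where r: "r > 0" "ball z0 r \<subseteq> D" "inj_on h (ball z0 r)"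
    using has_complex_derivative_locally_injective[OF h assms D h'[OF assms]] by blast
  have hol: "h holomorphic_on ball z0 r" using h r(2) by (rule holomorphic_on_subset)
  have "open (h ` ball z0 r)" by (rule open_mapping_thm3[OF hol open_ball r(3)])
  moreover have "h z0 \<in> h ` ball z0 r" using r(1) by simp
  ultimately obtain \<rho> where \<rho>: "\<rho> > 0" "ball (h z0) \<rho> \<subseteq> h ` ball z0 r"
    unfolding open_contains_ball by blast
  have "z0 \<in> ball z0 r" using r(1) by simp
  from inverse_branch_of_injective[OF hol open_ball r(3) this r(2) \<rho>(2)] \<rho>(1) show ?thesis by blast
qed

text \<open>
  Near the centre both branches invert the injective restriction of \<open>h\<close> near \<open>z0\<close>; then the identity theorem
  applies.
\<close>

lemma inverse_branch_unique:
  assumes z0: "z0 \<in> D" and \<psi>: "inverse_branch h D z0 \<rho> \<psi>1" "inverse_branch h D z0 \<rho> \<psi>2"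
    and \<zeta>: "\<zeta> \<in> ball (h z0) \<rho>"
  shows "\<psi>1 \<zeta> = \<psi>2 \<zeta>"
proof -
  let ?B = "ball (h z0) \<rho>"
  have \<rho>: "\<rho> > 0" using \<zeta> by (metis ball_eq_empty empty_iff not_le)
  obtain r where r: "r > 0" "inj_on h (ball z0 r)"
    using has_complex_derivative_locally_injective[OF h z0 D h'[OF z0]] by blast
  have near: "\<exists>d>0. \<forall>\<zeta>. dist \<zeta> (h z0) < d \<longrightarrow> \<psi> \<zeta> \<in> ball z0 r" if "inverse_branch h D z0 \<rho> \<psi>" for \<psi>
  proof -
    have c: "continuous_on ?B \<psi>" and \<psi>0: "\<psi> (h z0) = z0"
      using that by (auto simp: inverse_branch_def holomorphic_on_imp_continuous_on)
    have "isCont \<psi> (h z0)"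
      using c \<rho> by (simp add: continuous_on_eq_continuous_at)
    then obtain d where "d > 0" "\<And>\<zeta>. dist \<zeta> (h z0) < d \<Longrightarrow> dist (\<psi> \<zeta>) (\<psi> (h z0)) < r"
      using r(1) unfolding continuous_at_eps_delta by blast
    then show ?thesis by (auto simp: \<psi>0 dist_commute)
  qed
  obtain d1 where d1: "d1 > 0" "\<And>\<zeta>. dist \<zeta> (h z0) < d1 \<Longrightarrow> \<psi>1 \<zeta> \<in> ball z0 r" using near[OF \<psi>(1)] by blast
  obtain d2 where d2: "d2 > 0" "\<And>\<zeta>. dist \<zeta> (h z0) < d2 \<Longrightarrow> \<psi>2 \<zeta> \<in> ball z0 r" using near[OF \<psi>(2)] by blast
  define d where "d = min \<rho> (min d1 d2)"
  show ?thesis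
  proof (rule analytic_continuation_open[of "ball (h z0) d" ?B \<psi>1 \<psi>2])
    show "ball (h z0) d \<noteq> {}" "ball (h z0) d \<subseteq> ?B" using \<rho> d1 d2 by (auto simp: d_def)
    show "\<psi>1 holomorphic_on ?B" "\<psi>2 holomorphic_on ?B" using \<psi> by (auto simp: inverse_branch_def)
    fix z assume z: "z \<in> ball (h z0) d"
    then have "\<psi>1 z \<in> ball z0 r" "\<psi>2 z \<in> ball z0 r"
      using d1(2)[of z] d2(2)[of z] by (auto simp: d_def dist_commute)
    moreover have "h (\<psi>1 z) = h (\<psi>2 z)" using \<psi> z by (simp add: inverse_branch_def d_def)
    ultimately show "\<psi>1 z = \<psi>2 z" using r(2) by (meson inj_onD)
  qed (use \<zeta> in auto)
qed

lemma inverse_branch_limit: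
  assumes z0: "z0 \<in> D" and R: "R > 0" and ex: "\<And>\<rho>. 0 < \<rho> \<Longrightarrow> \<rho> < R \<Longrightarrow> \<exists>\<psi>. inverse_branch h D z0 \<rho> \<psi>"
  shows "\<exists>\<psi>. inverse_branch h D z0 R \<psi>"
proof -
  define \<psi>0 where "\<psi>0 \<rho> = (SOME \<psi>. inverse_branch h D z0 \<rho> \<psi>)" for \<rho>
  have \<psi>0: "inverse_branch h D z0 \<rho> (\<psi>0 \<rho>)" if "0 < \<rho>" "\<rho> < R" for \<rho>
    unfolding \<psi>0_def using ex[OF that] by (rule someI_ex)
  define \<psi> where "\<psi> \<zeta> = \<psi>0 ((dist (h z0) \<zeta> + R) / 2) \<zeta>" for \<zeta>
  have agree: "\<psi> \<zeta> = \<psi>0 \<rho> \<zeta>" if "0 < \<rho>" "\<rho> < R" "\<zeta> \<in> ball (h z0) \<rho>" for \<rho> \<zeta>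
  proof -
    define \<rho>' where "\<rho>' = (dist (h z0) \<zeta> + R) / 2"
    have \<rho>': "0 < \<rho>'" "\<rho>' < R" "dist (h z0) \<zeta> < \<rho>'"
      using that R zero_le_dist[of "h z0" \<zeta>] by (auto simp: \<rho>'_def intro!: add_nonneg_pos)
    have m: "min \<rho> \<rho>' \<le> \<rho>" "min \<rho> \<rho>' \<le> \<rho>'" by auto
    have "\<psi>0 \<rho>' \<zeta> = \<psi>0 \<rho> \<zeta>"
      by (rule inverse_branch_unique[OF z0 inverse_branch_subset[OF \<psi>0[OF \<rho>'(1,2)] m(2)] inverse_branch_subset[OF \<psi>0[OF that(1,2)] m(1)]])
        (use that \<rho>' in auto)
    then show ?thesis by (simp add: \<psi>_def \<rho>'_def)
  qed
  have loc: "\<exists>\<rho>. 0 < \<rho> \<and> \<rho> < R \<and> \<zeta> \<in> ball (h z0) \<rho>" if "\<zeta> \<in> ball (h z0) R" for \<zeta>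
    using that R by (intro exI[of _ "(dist (h z0) \<zeta> + R) / 2"]) (auto intro!: add_nonneg_pos)
  have "inverse_branch h D z0 R \<psi>"
    unfolding inverse_branch_def
  proof (intro conjI ballI)
    have "\<psi> field_differentiable at \<zeta>" if \<zeta>: "\<zeta> \<in> ball (h z0) R" for \<zeta>
    proof -
      obtain \<rho> where \<rho>: "0 < \<rho>" "\<rho> < R" "\<zeta> \<in> ball (h z0) \<rho>" using loc[OF \<zeta>] by blast
      have "\<psi>0 \<rho> holomorphic_on ball (h z0) \<rho>" using \<psi>0[OF \<rho>(1,2)] by (simp add: inverse_branch_def)
      then have "\<psi> holomorphic_on ball (h z0) \<rho>"
        by (rule holomorphic_transform) (simp add: agree[OF \<rho>(1,2)])
      then show ?thesis using \<rho>(3) holomorphic_on_imp_differentiable_at open_ball by blast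
    qed
    then show "\<psi> holomorphic_on ball (h z0) R"
      by (meson field_differentiable_at_within holomorphic_on_def)
    have "R / 2 < R" "0 < R / 2" "h z0 \<in> ball (h z0) (R / 2)" using R by auto
    then show "\<psi> (h z0) = z0" using agree[of "R/2" "h z0"] \<psi>0[of "R/2"] by (simp add: inverse_branch_def)
    show "\<psi> ` ball (h z0) R \<subseteq> D"
    proof
      fix z assume "z \<in> \<psi> ` ball (h z0) R"
      then obtain \<zeta> where \<zeta>: "z = \<psi> \<zeta>" "\<zeta> \<in> ball (h z0) R" by blast
      obtain \<rho> where \<rho>: "0 < \<rho>" "\<rho> < R" "\<zeta> \<in> ball (h z0) \<rho>" using loc[OF \<zeta>(2)] by blast
      then show "z \<in> D" using \<psi>0[OF \<rho>(1,2)] agree[OF \<rho>] \<zeta>(1) unfolding inverse_branch_def by blast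
    qed
    fix \<zeta> assume "\<zeta> \<in> ball (h z0) R"
    then obtain \<rho> where \<rho>: "0 < \<rho>" "\<rho> < R" "\<zeta> \<in> ball (h z0) \<rho>" using loc by blast
    then show "h (\<psi> \<zeta>) = \<zeta>" using \<psi>0[OF \<rho>(1,2)] agree[OF \<rho>] unfolding inverse_branch_def by simp
  qed
  then show ?thesis by blast
qed

lemma inverse_branch_deriv:
  assumes "inverse_branch h D z0 \<rho> \<psi>" "\<zeta> \<in> ball (h z0) \<rho>"
  shows "(\<psi> has_field_derivative deriv \<psi> \<zeta>) (at \<zeta>)" and "deriv h (\<psi> \<zeta>) * deriv \<psi> \<zeta> = 1"
proof -
  have hol: "\<psi> holomorphic_on ball (h z0) \<rho>" using assms(1) by (simp add: inverse_branch_def)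
  show d: "(\<psi> has_field_derivative deriv \<psi> \<zeta>) (at \<zeta>)"
    by (rule holomorphic_derivI[OF hol open_ball assms(2)])
  have "\<psi> \<zeta> \<in> D" using assms by (auto simp: inverse_branch_def)
  from DERIV_chain2[OF holomorphic_derivI[OF h D this] d]
  have 1: "((\<lambda>x. h (\<psi> x)) has_field_derivative deriv h (\<psi> \<zeta>) * deriv \<psi> \<zeta>) (at \<zeta>)" .
  have "((\<lambda>x. x) has_field_derivative deriv h (\<psi> \<zeta>) * deriv \<psi> \<zeta>) (at \<zeta>)"
    by (rule has_field_derivative_transform_within_open[OF 1 open_ball assms(2)])
      (use assms(1) in \<open>simp add: inverse_branch_def\<close>)
  then show "deriv h (\<psi> \<zeta>) * deriv \<psi> \<zeta> = 1"
    using DERIV_unique[OF _ DERIV_ident] by blast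
qed

end

text \<open>
  Osserman's argument with properness in place of completeness. Let \<open>R\<close> be the supremum of the radii on
  which the inverse branch of \<open>h\<close> at \<open>z0\<close> exists. Since the derivative of \<open>Y\<close> is bounded by that of \<open>h\<close>,
  \<open>Y\<close> is Lipschitz along the branch. Hence \<open>Y\<close> is bounded there, so the branch stays away from the puncture; and
  it stays away from the circle of radius \<open>\<epsilon>\<close>, where \<open>Y\<close> is too small compared with its value at \<open>z0\<close>.
  The branch therefore has a continuous extension to the closed disc with values inside \<open>D\<close>, where \<open>h\<close> is
  injective near its compact image, and so it extends to a larger disc.
\<close>

lemma osserman_branch_everywhere:
  fixes h :: "complex \<Rightarrow> complex" and Y :: "complex \<Rightarrow> 'b::real_normed_vector"
  assumes \<epsilon>: "0 < \<epsilon>" "\<epsilon> < r"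
    and h: "h holomorphic_on ball 0 r - {0}" and h': "\<And>z. z \<in> ball 0 r - {0} \<Longrightarrow> deriv h z \<noteq> 0"
    and Y: "\<And>z. z \<in> ball 0 r - {0} \<Longrightarrow> (Y has_derivative Y' z) (at z)"
    and Y': "\<And>z v. z \<in> ball 0 r - {0} \<Longrightarrow> norm (Y' z v) \<le> C * cmod (deriv h z) * cmod v"
    and C: "C \<ge> 0"
    and inf: "filterlim (\<lambda>z. norm (Y z)) at_top (at 0)"
    and B: "\<And>z. cmod z = \<epsilon> \<Longrightarrow> cmod (h z) \<le> B" and B': "\<And>z. cmod z = \<epsilon> \<Longrightarrow> norm (Y z) \<le> B'"
    and z0: "z0 \<in> ball 0 \<epsilon> - {0}" and big: "norm (Y z0) > B' + C * (B + cmod (h z0))"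
    and \<rho>: "\<rho> > 0"
  shows "\<exists>\<psi>. inverse_branch h (ball 0 \<epsilon> - {0}) z0 \<rho> \<psi>"
proof (rule ccontr)
  define D :: "complex set" where "D = ball 0 \<epsilon> - {0}"
  assume "\<nexists>\<psi>. inverse_branch h (ball 0 \<epsilon> - {0}) z0 \<rho> \<psi>"
  then have no: "\<nexists>\<psi>. inverse_branch h D z0 \<rho> \<psi>" by (simp add: D_def)
  have Dr: "D \<subseteq> ball 0 r - {0}" using \<epsilon> by (auto simp: D_def)
  have oD: "open D" by (auto simp: D_def intro!: open_delete)
  have hD: "h holomorphic_on D" using h Dr by (rule holomorphic_on_subset)
  have hD': "\<And>z. z \<in> D \<Longrightarrow> deriv h z \<noteq> 0" using h' Dr by blast
  have z0D: "z0 \<in> D" using z0 by (simp add: D_def)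
  note branch = inverse_branch_limit[OF oD hD hD' z0D] inverse_branch_exists[OF oD hD hD' z0D]
  define A where "A = {\<rho>. \<rho> > 0 \<and> (\<exists>\<psi>. inverse_branch h D z0 \<rho> \<psi>)}"
  have Ane: "A \<noteq> {}" using branch(2) by (auto simp: A_def)
  have Aub: "x \<le> \<rho>" if "x \<in> A" for x
  proof (rule ccontr)
    assume "\<not> x \<le> \<rho>"
    then have "\<exists>\<psi>. inverse_branch h D z0 \<rho> \<psi>" using that inverse_branch_subset[of h D z0 x _ \<rho>] by (auto simp: A_def)
    then show False using no by blast
  qed
  define R where "R = Sup A"
  have bddA: "bdd_above A" using Aub by (rule bdd_aboveI)
  have RA: "x \<le> R" if "x \<in> A" for x using that bddA by (simp add: R_def cSup_upper)
  have R0: "R > 0" using Ane RA by (force simp: A_def)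
  obtain \<psi> where \<psi>: "inverse_branch h D z0 R \<psi>"
  proof -
    have "\<exists>\<psi>. inverse_branch h D z0 \<sigma> \<psi>" if \<sigma>: "0 < \<sigma>" "\<sigma> < R" for \<sigma>
    proof -
      obtain x where "x \<in> A" "\<sigma> < x" using less_cSupE[OF \<sigma>(2)[unfolded R_def] Ane] by blast
      then show ?thesis using inverse_branch_subset[of h D z0 x _ \<sigma>] by (auto simp: A_def)
    qed
    note ex = this
    have "\<exists>\<psi>. inverse_branch h D z0 R \<psi>"
      by (rule branch(1), assumption, rule R0, rule ex)
    then show thesis using that by blast
  qed
  let ?\<zeta>0 = "h z0"
  let ?B = "ball ?\<zeta>0 R"
  have \<psi>D: "\<psi> \<zeta> \<in> D" and h\<psi>: "h (\<psi> \<zeta>) = \<zeta>" if "\<zeta> \<in> ?B" for \<zeta>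
    using \<psi> that by (auto simp: inverse_branch_def)
  have \<psi>0: "\<psi> ?\<zeta>0 = z0" using \<psi> by (simp add: inverse_branch_def)
  have \<psi>d: "(\<psi> has_derivative (\<lambda>v. deriv \<psi> \<zeta> * v)) (at \<zeta>)" "deriv h (\<psi> \<zeta>) * deriv \<psi> \<zeta> = 1" if "\<zeta> \<in> ?B" for \<zeta>
    using inverse_branch_deriv[OF oD hD hD' \<psi> that] by (auto simp: has_field_derivative_def)
  have YL: "norm (Y (\<psi> \<zeta>) - Y z0) \<le> C * cmod (\<zeta> - ?\<zeta>0)" if \<zeta>: "\<zeta> \<in> ?B" for \<zeta>
  proof -
    have "norm (Y (\<psi> \<zeta>) - Y (\<psi> ?\<zeta>0)) \<le> C * norm (\<zeta> - ?\<zeta>0)"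
    proof (rule differentiable_bound[of ?B "\<lambda>\<zeta>. Y (\<psi> \<zeta>)" "\<lambda>\<zeta> v. Y' (\<psi> \<zeta>) (deriv \<psi> \<zeta> * v)"])
      fix x assume x: "x \<in> ?B"
      have in_r: "\<psi> x \<in> ball 0 r - {0}" using \<psi>D[OF x] Dr by blast
      show "((\<lambda>\<zeta>. Y (\<psi> \<zeta>)) has_derivative (\<lambda>v. Y' (\<psi> x) (deriv \<psi> x * v))) (at x within ?B)"
        using has_derivative_compose[OF \<psi>d(1)[OF x] Y[OF in_r]] by (rule has_derivative_at_withinI)
      show "onorm (\<lambda>v. Y' (\<psi> x) (deriv \<psi> x * v)) \<le> C"
      proof (rule onorm_le)
        fix v
        have "norm (Y' (\<psi> x) (deriv \<psi> x * v)) \<le> C * cmod (deriv h (\<psi> x)) * cmod (deriv \<psi> x * v)" by (rule Y'[OF in_r])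
        also have "\<dots> = C * cmod (deriv h (\<psi> x) * deriv \<psi> x) * cmod v" by (simp add: norm_mult)
        finally show "norm (Y' (\<psi> x) (deriv \<psi> x * v)) \<le> C * norm v" using \<psi>d(2)[OF x] by simp
      qed
    qed (use \<zeta> R0 in auto)
    then show ?thesis by (simp add: \<psi>0)
  qed
  \<comment> \<open>\<open>Y\<close> is bounded along the branch but tends to infinity at the puncture.\<close>
  obtain \<delta> where \<delta>: "\<delta> > 0" "\<And>z. z \<noteq> 0 \<Longrightarrow> cmod z < \<delta> \<Longrightarrow> norm (Y z) > norm (Y z0) + C * R"
  proof -
    have "eventually (\<lambda>z. norm (Y z) > norm (Y z0) + C * R) (at 0)"
      using inf unfolding filterlim_at_top_dense by blast
    then obtain d where "d > 0" "\<forall>z. z \<noteq> 0 \<and> dist z 0 < d \<longrightarrow> norm (Y z) > norm (Y z0) + C * R"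
      unfolding eventually_at by blast
    then show thesis by (intro that[of d]) simp_all
  qed
  have far: "cmod (\<psi> \<zeta>) \<ge> \<delta>" if \<zeta>: "\<zeta> \<in> ?B" for \<zeta>
  proof (rule ccontr)
    assume "\<not> cmod (\<psi> \<zeta>) \<ge> \<delta>"
    then have "norm (Y (\<psi> \<zeta>)) > norm (Y z0) + C * R" using \<delta>(2) \<psi>D[OF \<zeta>] by (auto simp: D_def)
    moreover have "C * cmod (\<zeta> - ?\<zeta>0) \<le> C * R" using C \<zeta> by (intro mult_left_mono) (auto simp: dist_norm norm_minus_commute)
    ultimately show False using YL[OF \<zeta>] norm_triangle_ineq2[of "Y (\<psi> \<zeta>)" "Y z0"] by linarith
  qed
  define K where "K = cball (0::complex) \<epsilon> - ball 0 \<delta>"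
  have K: "compact K" "K \<subseteq> ball 0 r - {0}"
    using \<epsilon> \<delta>(1) by (auto simp: K_def compact_diff)
  have \<psi>K: "\<psi> \<zeta> \<in> K" if "\<zeta> \<in> ?B" for \<zeta>
    using far[OF that] \<psi>D[OF that] by (auto simp: K_def D_def)
  have Kne: "K \<noteq> {}" using \<psi>K[of ?\<zeta>0] R0 by auto
  have "continuous_on K (\<lambda>z. cmod (deriv h z))"
    by (intro continuous_intros continuous_on_subset[OF _ K(2)] holomorphic_on_imp_continuous_on holomorphic_deriv h open_delete open_ball)
  then obtain zm where zm: "zm \<in> K" "\<And>z. z \<in> K \<Longrightarrow> cmod (deriv h zm) \<le> cmod (deriv h z)"
    using continuous_attains_inf[OF K(1) Kne] by blast
  define m where "m = cmod (deriv h zm)"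
  have "zm \<in> ball 0 r - {0}" using zm(1) K(2) by (rule rev_subsetD)
  from h'[OF this] have m: "m > 0" by (simp add: m_def)
  have \<psi>L: "norm (\<psi> x - \<psi> y) \<le> (1 / m) * norm (x - y)" if "x \<in> ?B" "y \<in> ?B" for x y
  proof (rule differentiable_bound[of ?B \<psi> "\<lambda>\<zeta> v. deriv \<psi> \<zeta> * v"])
    fix x assume x: "x \<in> ?B"
    show "(\<psi> has_derivative (\<lambda>v. deriv \<psi> x * v)) (at x within ?B)"
      using \<psi>d(1)[OF x] by (rule has_derivative_at_withinI)
    have "cmod (deriv \<psi> x) \<le> 1 / m"
    proof -
      have "m * cmod (deriv \<psi> x) \<le> cmod (deriv h (\<psi> x)) * cmod (deriv \<psi> x)"
        using zm(2)[OF \<psi>K[OF x]] by (intro mult_right_mono) (auto simp: m_def)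
      also have "\<dots> = 1" using \<psi>d(2)[OF x] by (metis norm_mult norm_one)
      finally show ?thesis using m by (simp add: field_simps)
    qed
    then have "norm (deriv \<psi> x * v) \<le> 1 / m * norm v" for v
      unfolding norm_mult by (rule mult_right_mono) simp
    then show "onorm (\<lambda>v. deriv \<psi> x * v) \<le> 1 / m" by (rule onorm_le)
  qed (use that in auto)
  have "uniformly_continuous_on ?B \<psi>"
  proof -
    have "(1 / m)-lipschitz_on ?B \<psi>"
      using \<psi>L m by (intro lipschitz_onI) (auto simp: dist_norm)
    then show ?thesis by (rule lipschitz_on_uniformly_continuous)
  qed
  then have "\<exists>\<Psi>. uniformly_continuous_on (closure ?B) \<Psi> \<and> (\<forall>x\<in>?B. \<psi> x = \<Psi> x)"
  proof (rule uniformly_continuous_on_extension_on_closure)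
    fix g assume g: "uniformly_continuous_on (closure ?B) g" "\<And>x. x \<in> ?B \<Longrightarrow> \<psi> x = g x"
    show "\<exists>\<Psi>. uniformly_continuous_on (closure ?B) \<Psi> \<and> (\<forall>x\<in>?B. \<psi> x = \<Psi> x)"
      by (intro exI[of _ g] conjI ballI g)
  qed
  then obtain \<Psi> where \<Psi>u: "uniformly_continuous_on (closure ?B) \<Psi>" and \<Psi>\<psi>0: "\<forall>x\<in>?B. \<psi> x = \<Psi> x"
    by (elim exE conjE)
  have \<Psi>\<psi>: "\<psi> x = \<Psi> x" if "x \<in> ?B" for x using \<Psi>\<psi>0 that by (rule bspec)
  have clB: "closure ?B = cball ?\<zeta>0 R" using R0 by simp
  have \<Psi>c: "continuous_on (closure ?B) \<Psi>" using \<Psi>u by (rule uniformly_continuous_imp_continuous)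
  have \<Psi>K: "\<Psi> x \<in> K" if "x \<in> closure ?B" for x
  proof -
    have "\<Psi> ` closure ?B \<subseteq> K"
      by (rule image_closure_subset[OF \<Psi>c]) (use K(1) \<psi>K \<Psi>\<psi> in \<open>auto simp: compact_imp_closed\<close>)
    then show ?thesis using that by blast
  qed
  have \<Psi>r: "\<Psi> x \<in> ball 0 r - {0}" if "x \<in> closure ?B" for x using \<Psi>K[OF that] K(2) by blast
  have h\<Psi>: "h (\<Psi> x) = x" if "x \<in> closure ?B" for x
  proof -
    have "continuous_on (closure ?B) (\<lambda>x. h (\<Psi> x))"
      by (rule continuous_on_compose2[OF holomorphic_on_imp_continuous_on[OF h] \<Psi>c]) (rule image_subsetI, rule \<Psi>r)
    then have "continuous_on (closure ?B) (\<lambda>x. h (\<Psi> x) - x)" by (intro continuous_intros)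
    from continuous_constant_on_closure[OF this, of 0 x] show ?thesis
      using that h\<psi> \<Psi>\<psi> by auto
  qed
  have Y\<Psi>: "norm (Y (\<Psi> x) - Y z0) \<le> C * cmod (x - ?\<zeta>0)" if "x \<in> closure ?B" for x
  proof -
    have "continuous_on (ball 0 r - {0}) Y"
      using Y by (meson continuous_at_imp_continuous_on has_derivative_continuous)
    then have "continuous_on (closure ?B) (\<lambda>x. Y (\<Psi> x))"
      by (rule continuous_on_compose2[OF _ \<Psi>c]) (rule image_subsetI, rule \<Psi>r)
    then have "continuous_on (closure ?B) (\<lambda>x. norm (Y (\<Psi> x) - Y z0) - C * cmod (x - ?\<zeta>0))"
      by (intro continuous_intros)
    from continuous_le_on_closure[OF this that, of 0] show ?thesis
      using YL \<Psi>\<psi> by auto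
  qed
  have \<Psi>D: "\<Psi> x \<in> D" if x: "x \<in> closure ?B" for x
  proof (rule ccontr)
    assume "\<Psi> x \<notin> D"
    then have e: "cmod (\<Psi> x) = \<epsilon>" using \<Psi>K[OF x] \<Psi>r[OF x] by (auto simp: K_def D_def)
    have "cmod x \<le> B" using B[OF e] h\<Psi>[OF x] by simp
    then have "C * cmod (x - ?\<zeta>0) \<le> C * (B + cmod ?\<zeta>0)"
      using C norm_triangle_ineq4[of x ?\<zeta>0] by (intro mult_left_mono) auto
    then show False
      using Y\<Psi>[OF x] B'[OF e] big norm_triangle_ineq3[of "Y z0" "Y (\<Psi> x)"] by (simp add: norm_minus_commute)
  qed
  define L where "L = \<Psi> ` closure ?B"
  have L: "compact L" "L \<subseteq> D"
    using \<Psi>D \<Psi>c by (auto simp: L_def clB intro!: compact_continuous_image)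
  have injL: "inj_on h L"
    by (rule inj_onI) (use h\<Psi> in \<open>auto simp: L_def\<close>)
  have "\<exists>e>0. inj_on h (\<Union>x\<in>L. ball x e) \<and> (\<Union>x\<in>L. ball x e) \<subseteq> D"
  proof (rule inj_on_neighbourhood_of_compact[OF L oD holomorphic_on_imp_continuous_on[OF hD] injL])
    fix z assume "z \<in> L"
    then have zD: "z \<in> D" using L by blast
    obtain r' where "r' > 0" "inj_on h (ball z r')"
      using has_complex_derivative_locally_injective[OF hD zD oD hD'[OF zD]] by blast
    then show "\<exists>r>0. inj_on h (ball z r)" by blast
  qed
  then obtain e where e: "e > 0" "inj_on h (\<Union>x\<in>L. ball x e)" "(\<Union>x\<in>L. ball x e) \<subseteq> D" by blast
  define N where "N = (\<Union>x\<in>L. ball x e)"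
  have N: "open N" "inj_on h N" "N \<subseteq> D" "L \<subseteq> N" using e by (auto simp: N_def)
  have hN: "h holomorphic_on N" using hD N(3) by (rule holomorphic_on_subset)
  have "cball ?\<zeta>0 R \<subseteq> h ` N"
  proof
    fix x assume "x \<in> cball ?\<zeta>0 R"
    then have x: "x \<in> closure ?B" by (simp add: clB)
    then have "h (\<Psi> x) \<in> h ` N" using N(4) by (auto simp: L_def)
    then show "x \<in> h ` N" using h\<Psi>[OF x] by simp
  qed
  then obtain d where d: "d > 0" "(\<Union>x\<in>cball ?\<zeta>0 R. ball x d) \<subseteq> h ` N"
    using compact_subset_open_imp_ball_epsilon_subset[OF compact_cball open_mapping_thm3[OF hN N(1,2)]] by blast
  have "ball ?\<zeta>0 (R + d) \<subseteq> (\<Union>x\<in>cball ?\<zeta>0 R. ball x d)"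
  proof
    fix y assume y: "y \<in> ball ?\<zeta>0 (R + d)"
    show "y \<in> (\<Union>x\<in>cball ?\<zeta>0 R. ball x d)"
    proof (cases "dist ?\<zeta>0 y \<le> R")
      case True
      then show ?thesis using d(1) by (intro UN_I[of y]) auto
    next
      case False
      define t where "t = R / dist ?\<zeta>0 y"
      define x where "x = ?\<zeta>0 + t *\<^sub>R (y - ?\<zeta>0)"
      have pos: "dist ?\<zeta>0 y > 0" using False R0 by linarith
      have t: "0 \<le> t" "t \<le> 1" using False R0 pos by (auto simp: t_def)
      have 1: "dist ?\<zeta>0 x = R"
        using t pos R0 by (simp add: x_def dist_norm t_def norm_minus_commute)
      have "y - x = (1 - t) *\<^sub>R (y - ?\<zeta>0)" by (simp add: x_def algebra_simps)
      then have "norm (y - x) = (1 - t) * norm (y - ?\<zeta>0)"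
        using t by simp
      then have "dist x y = (1 - t) * dist ?\<zeta>0 y"
        by (simp add: dist_norm norm_minus_commute)
      also have "\<dots> = dist ?\<zeta>0 y - R" using pos by (simp add: t_def field_simps)
      finally have "dist x y < d" using y by simp
      then show ?thesis using 1 by (intro UN_I[of x]) auto
    qed
  qed
  then have sub: "ball ?\<zeta>0 (R + d) \<subseteq> h ` N" using d(2) by blast
  have "z0 \<in> N"
  proof -
    have "?\<zeta>0 \<in> ?B" using R0 by simp
    then have "\<Psi> ?\<zeta>0 = z0" "?\<zeta>0 \<in> closure ?B" using \<Psi>\<psi> \<psi>0 closure_subset by auto
    then show ?thesis using N(4) by (force simp: L_def)
  qed
  from inverse_branch_of_injective[OF hN N(1,2) this N(3) sub]
  have "R + d \<in> A" using R0 d(1) by (auto simp: A_def)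
  then show False using RA d(1) by fastforce
qed

text \<open>
  Were \<open>h\<close> bounded by \<open>K\<close> along a sequence tending to the puncture, then at a point \<open>z0\<close> of the sequence
  where \<open>Y\<close> is large enough the inverse branch would exist on discs of any radius, with values in a fixed bounded
  set. Cauchy's inequality contradicts this.
\<close>

theorem proper_implies_pole:
  fixes h :: "complex \<Rightarrow> complex" and Y :: "complex \<Rightarrow> 'b::real_normed_vector"
  assumes r: "0 < r"
    and h: "h holomorphic_on ball 0 r - {0}" and h': "\<And>z. z \<in> ball 0 r - {0} \<Longrightarrow> deriv h z \<noteq> 0"
    and Y: "\<And>z. z \<in> ball 0 r - {0} \<Longrightarrow> (Y has_derivative Y' z) (at z)"
    and Y': "\<And>z v. z \<in> ball 0 r - {0} \<Longrightarrow> norm (Y' z v) \<le> C * cmod (deriv h z) * cmod v"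
    and C: "C \<ge> 0"
    and inf: "filterlim (\<lambda>z. norm (Y z)) at_top (at 0)"
  shows "filterlim h at_infinity (at 0)"
proof (rule ccontr)
  assume "\<not> filterlim h at_infinity (at 0)"
  then obtain K where K: "\<not> eventually (\<lambda>z. K \<le> cmod (h z)) (at 0)"
    unfolding filterlim_at_infinity[OF order_refl] by blast
  define \<epsilon> where "\<epsilon> = r / 2"
  have \<epsilon>: "0 < \<epsilon>" "\<epsilon> < r" using r by (auto simp: \<epsilon>_def)
  have sph: "compact (sphere (0::complex) \<epsilon>)" "sphere (0::complex) \<epsilon> \<subseteq> ball 0 r - {0}"
    using \<epsilon> by auto
  have contY: "continuous_on (ball 0 r - {0}) Y"
    using Y by (meson continuous_at_imp_continuous_on has_derivative_continuous)
  have "bounded (h ` sphere 0 \<epsilon>)" "bounded (Y ` sphere 0 \<epsilon>)"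
    using sph holomorphic_on_imp_continuous_on[OF h] contY
    by (auto intro!: compact_imp_bounded compact_continuous_image intro: continuous_on_subset)
  then obtain B B' where B: "\<And>z. cmod z = \<epsilon> \<Longrightarrow> cmod (h z) \<le> B" and B': "\<And>z. cmod z = \<epsilon> \<Longrightarrow> norm (Y z) \<le> B'"
    unfolding bounded_iff by (metis dist_0_norm imageI mem_sphere)
  have "eventually (\<lambda>z. norm (Y z) > B' + C * (B + K)) (at 0)"
    using inf unfolding filterlim_at_top_dense by blast
  then obtain \<delta> where \<delta>: "\<delta> > 0" "\<And>z. z \<noteq> 0 \<Longrightarrow> cmod z < \<delta> \<Longrightarrow> norm (Y z) > B' + C * (B + K)"
    unfolding eventually_at dist_0_norm dist_norm diff_zero by blast
  obtain z0 where z0: "z0 \<noteq> 0" "cmod z0 < min \<delta> \<epsilon>" "cmod (h z0) < K"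
  proof -
    have "0 < min \<delta> \<epsilon>" using \<delta>(1) \<epsilon>(1) by simp
    then have "\<not> (\<forall>z\<in>UNIV. z \<noteq> 0 \<and> dist z 0 < min \<delta> \<epsilon> \<longrightarrow> K \<le> cmod (h z))"
      using K unfolding eventually_at by blast
    then show thesis using that by (auto simp: not_le)
  qed
  have big: "norm (Y z0) > B' + C * (B + cmod (h z0))"
  proof -
    have "C * (B + cmod (h z0)) \<le> C * (B + K)" using C z0(3) by (intro mult_left_mono) auto
    then show ?thesis using \<delta>(2)[of z0] z0 by simp
  qed
  have z0D: "z0 \<in> ball 0 \<epsilon> - {0}" using z0 by simp
  have br: "\<exists>\<psi>. inverse_branch h (ball 0 \<epsilon> - {0}) z0 \<rho> \<psi>" if "\<rho> > 0" for \<rho>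
    by (rule osserman_branch_everywhere[OF \<epsilon> h h' Y Y' C inf B B' z0D big that])
  have D: "open (ball 0 \<epsilon> - {0::complex})" "ball 0 \<epsilon> - {0} \<subseteq> ball (0::complex) r - {0}"
    using \<epsilon> by (auto intro!: open_delete)
  have d0: "deriv h z0 \<noteq> 0" using h' z0D D(2) by blast
  \<comment> \<open>A branch on the disc of radius \<open>\<rho>\<close> takes values of size at most \<open>\<epsilon>\<close>, so its derivative
    \<open>1 / deriv h z0\<close> at the centre is at most \<open>\<epsilon> / \<rho>\<close>; this \<open>\<rho>\<close> is too large for that.\<close>
  define \<rho> where "\<rho> = 2 * \<epsilon> * cmod (deriv h z0) + 1"
  have \<rho>: "\<rho> > 0" using \<epsilon> by (simp add: \<rho>_def add_nonneg_pos)
  obtain \<psi> where \<psi>: "inverse_branch h (ball 0 \<epsilon> - {0}) z0 (2 * \<rho>) \<psi>" using br[of "2 * \<rho>"] \<rho> by auto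
  have sub: "cball (h z0) \<rho> \<subseteq> ball (h z0) (2 * \<rho>)" using \<rho> by auto
  have hol: "\<psi> holomorphic_on ball (h z0) (2 * \<rho>)" using \<psi> by (simp add: inverse_branch_def)
  have "norm ((deriv ^^ 1) \<psi> (h z0)) \<le> fact 1 * \<epsilon> / \<rho> ^ 1"
  proof (rule Cauchy_inequality[OF _ _ \<rho>])
    show "\<psi> holomorphic_on ball (h z0) \<rho>" by (rule holomorphic_on_subset[OF hol]) (use \<rho> in auto)
    show "continuous_on (cball (h z0) \<rho>) \<psi>"
      by (rule continuous_on_subset[OF holomorphic_on_imp_continuous_on[OF hol] sub])
    fix x assume "cmod (h z0 - x) = \<rho>"
    then have "x \<in> ball (h z0) (2 * \<rho>)" using \<rho> by (simp add: dist_norm)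
    then have "\<psi> x \<in> ball 0 \<epsilon> - {0}" using \<psi> unfolding inverse_branch_def by blast
    then show "cmod (\<psi> x) \<le> \<epsilon>" by simp
  qed
  then have "cmod (deriv \<psi> (h z0)) * \<rho> \<le> \<epsilon>" using \<rho> by (simp add: field_simps)
  then have "cmod (deriv h z0) * (cmod (deriv \<psi> (h z0)) * \<rho>) \<le> cmod (deriv h z0) * \<epsilon>"
    by (intro mult_left_mono) auto
  moreover have "deriv h (\<psi> (h z0)) * deriv \<psi> (h z0) = 1"
    by (rule inverse_branch_deriv(2)[OF D(1) holomorphic_on_subset[OF h D(2)] _ \<psi>]) (use h' D(2) \<rho> in auto)
  then have "cmod (deriv h z0) * cmod (deriv \<psi> (h z0)) = 1"
    using \<psi> by (metis inverse_branch_def norm_mult norm_one)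
  then have "cmod (deriv h z0) * (cmod (deriv \<psi> (h z0)) * \<rho>) = \<rho>" by (metis mult.assoc mult_1)
  moreover have "cmod (deriv h z0) * \<epsilon> \<ge> 0" using \<epsilon> by simp
  ultimately show False by (simp add: \<rho>_def algebra_simps)
qed

section \<open>Lebesgue integration in the plane\<close>

lemma AE_Re_neq: "AE z in lborel. Re z \<noteq> c"
proof -
  have "negligible {z::complex. 1 \<bullet> z = c}"
    by (rule negligible_hyperplane) auto
  then have "AE z in lebesgue. z \<notin> {z::complex. 1 \<bullet> z = c}"
    by (intro AE_not_in) (simp add: negligible_iff_null_sets)
  then show ?thesis by (simp add: inner_complex_def AE_completion_iff)
qed

lemma AE_Im_neq: "AE z in lborel. Im z \<noteq> c"
proof -
  have "negligible {z::complex. \<i> \<bullet> z = c}"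
    by (rule negligible_hyperplane) auto
  then have "AE z in lebesgue. z \<notin> {z::complex. \<i> \<bullet> z = c}"
    by (intro AE_not_in) (simp add: negligible_iff_null_sets)
  then show ?thesis by (simp add: inner_complex_def AE_completion_iff)
qed

text \<open>
  Lebesgue measure on the complex plane is identified with that of two coordinate models: pairs, for
  Fubini's theorem, and vectors, for the change of variables formula.
\<close>

lemma lborel_complex_eq_distr_pair:
  "(lborel :: complex measure) = distr lborel borel (\<lambda>p. Complex (fst p) (snd p))"
proof (rule lborel_eqI)
  fix l u :: complex assume *: "\<And>b. b \<in> Basis \<Longrightarrow> l \<bullet> b \<le> u \<bullet> b"
  have le: "Re l \<le> Re u" "Im l \<le> Im u"
    using *[of 1] *[of \<i>] by (auto simp: Basis_complex_def)
  have meas: "(\<lambda>p. Complex (fst p) (snd p)) \<in> borel_measurable (lborel :: (real \<times> real) measure)"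
    by (simp, intro borel_measurable_continuous_onI continuous_intros)
  have "(\<lambda>p. Complex (fst p) (snd p)) -` box l u = box (Re l, Im l) (Re u, Im u)"
    by (auto simp: in_box_complex_iff mem_box Basis_prod_def)
  then show "emeasure (distr lborel borel (\<lambda>p. Complex (fst p) (snd p))) (box l u) = (\<Prod>b\<in>Basis. (u - l) \<bullet> b)"
    using le by (subst emeasure_distr[OF meas])
      (auto simp: emeasure_lborel_box_eq Basis_complex_def Basis_prod_def prod.union_disjoint)
qed simp

lemma lborel_complex_eq_distr_vec:
  "(lborel :: complex measure) = distr lborel borel (\<lambda>v::real^2. Complex (v $ 1) (v $ 2))"
proof (rule lborel_eqI)
  fix l u :: complex assume *: "\<And>b. b \<in> Basis \<Longrightarrow> l \<bullet> b \<le> u \<bullet> b"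
  have le: "Re l \<le> Re u" "Im l \<le> Im u"
    using *[of 1] *[of \<i>] by (auto simp: Basis_complex_def)
  have "continuous_on UNIV (\<lambda>v::real^2. Complex (v $ 1) (v $ 2))"
    by (intro continuous_intros)
  then have meas: "(\<lambda>v::real^2. Complex (v $ 1) (v $ 2)) \<in> borel_measurable lborel"
    by (simp add: borel_measurable_continuous_onI)
  have "(\<lambda>v::real^2. Complex (v $ 1) (v $ 2)) -` box l u
      = box (vector [Re l, Im l]) (vector [Re u, Im u])"
    by (auto simp: in_box_complex_iff mem_box_cart forall_2)
  then show "emeasure (distr lborel borel (\<lambda>v::real^2. Complex (v $ 1) (v $ 2))) (box l u)
      = (\<Prod>b\<in>Basis. (u - l) \<bullet> b)"
    using le by (subst emeasure_distr[OF meas])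
      (auto simp: emeasure_lborel_box_eq Basis_complex_def Basis_vec_def UNIV_2 inner_axis'
         inner_axis prod.insert axis_eq_axis)
qed simp

lemma nn_integral_absolutely_integrable:
  fixes g :: "'a::euclidean_space \<Rightarrow> real"
  assumes "g absolutely_integrable_on S" "\<And>x. x \<in> S \<Longrightarrow> g x \<ge> 0"
  shows "(\<integral>\<^sup>+x. ennreal (g x) * indicator S x \<partial>lborel) = ennreal (integral S g)"
proof -
  have "(\<integral>\<^sup>+x. ennreal (g x) * indicator S x \<partial>lborel)
      = (\<integral>\<^sup>+x. ennreal (indicator S x *\<^sub>R g x) \<partial>lebesgue)"
    by (subst nn_integral_completion, intro nn_integral_cong) (simp add: indicator_def)
  also have "\<dots> = ennreal (integral\<^sup>L lebesgue (\<lambda>x. indicator S x *\<^sub>R g x))"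
    by (rule nn_integral_eq_integral) (use assms in \<open>auto simp: set_integrable_def indicator_def\<close>)
  also have "integral\<^sup>L lebesgue (\<lambda>x. indicator S x *\<^sub>R g x) = integral S g"
    using set_lebesgue_integral_eq_integral(2)[OF assms(1)] by (simp add: set_lebesgue_integral_def)
  finally show ?thesis .
qed

definition crect :: "real \<Rightarrow> real \<Rightarrow> real \<Rightarrow> real \<Rightarrow> complex set" where
  "crect a b c d = {z. a \<le> Re z \<and> Re z \<le> b \<and> c \<le> Im z \<and> Im z \<le> d}"

lemma crect_eq_cbox: "crect a b c d = cbox (Complex a c) (Complex b d)"
  by (auto simp: crect_def in_cbox_complex_iff)

lemma sets_crect [measurable]: "crect a b c d \<in> sets borel"
  by (simp add: crect_eq_cbox)

lemma nn_integral_crect: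
  assumes f: "continuous_on (crect a b c d) f" "\<And>z. z \<in> crect a b c d \<Longrightarrow> f z \<ge> 0"
  shows "(\<integral>\<^sup>+z. ennreal (f z) * indicator (crect a b c d) z \<partial>lborel) =
    ennreal (integral {c..d} (\<lambda>y. integral {a..b} (\<lambda>x. f (Complex x y))))"
proof -
  let ?g = "\<lambda>p. f (Complex (fst p) (snd p))"
  have cont: "continuous_on (cbox (a,c) (b,d)) ?g"
    unfolding cbox_Pair_eq by (rule continuous_on_pair_Complex[OF f(1)]) (auto simp: crect_def)
  have meas: "(\<lambda>z. ennreal (f z) * indicator (crect a b c d) z) \<in> borel_measurable borel"
  proof -
    have "(\<lambda>z. indicator (crect a b c d) z *\<^sub>R f z) \<in> borel_measurable borel"
      by (rule borel_measurable_continuous_on_indicator[OF _ f(1)]) measurable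
    then have "(\<lambda>z. ennreal (indicator (crect a b c d) z *\<^sub>R f z)) \<in> borel_measurable borel"
      by measurable
    moreover have "(\<lambda>z. ennreal (indicator (crect a b c d) z *\<^sub>R f z))
        = (\<lambda>z. ennreal (f z) * indicator (crect a b c d) z)"
      by (auto simp: indicator_def fun_eq_iff)
    ultimately show ?thesis by simp
  qed
  have mC: "(\<lambda>p. Complex (fst p) (snd p)) \<in> borel_measurable (lborel :: (real \<times> real) measure)"
    by (simp, intro borel_measurable_continuous_onI continuous_intros)
  have "(\<integral>\<^sup>+z. ennreal (f z) * indicator (crect a b c d) z \<partial>lborel)
      = (\<integral>\<^sup>+p. ennreal (?g p) * indicator (cbox (a,c) (b,d)) p \<partial>lborel)"
    unfolding lborel_complex_eq_distr_pair
    by (subst nn_integral_distr)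
      (use mC meas in \<open>auto intro!: nn_integral_cong simp: indicator_def crect_def cbox_Pair_eq\<close>)
  also have "\<dots> = ennreal (integral (cbox (a,c) (b,d)) ?g)"
    by (rule nn_integral_absolutely_integrable)
      (use absolutely_integrable_continuous[OF cont] f in \<open>auto simp: crect_def cbox_Pair_eq\<close>)
  also have "integral (cbox (a,c) (b,d)) ?g = integral (cbox (c,a) (d,b)) (\<lambda>p. f (Complex (snd p) (fst p)))"
    using integral_swap_2dim[of a c b d "\<lambda>x y. f (Complex x y)"] cont by (simp add: case_prod_unfold)
  also have "\<dots> = integral {c..d} (\<lambda>y. integral {a..b} (\<lambda>x. f (Complex x y)))"
  proof (subst integral_prod_continuous)
    show "continuous_on (cbox (c, a) (d, b)) (\<lambda>p. f (Complex (snd p) (fst p)))"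
      unfolding cbox_Pair_eq
      by (rule continuous_on_compose2[OF f(1)]) (auto intro!: continuous_intros simp: crect_def)
  qed simp
  finally show ?thesis .
qed

text \<open>
  Cut \<open>A\<close> into the pieces \<open>A \<inter> (B - l)\<close> and move them into \<open>B\<close> by their lattice vectors; the moved pieces
  are disjoint because \<open>A\<close> contains no two equivalent points.
\<close>

lemma nn_integral_tiling_le:
  fixes f :: "'a::euclidean_space \<Rightarrow> ennreal"
  assumes f [measurable]: "f \<in> borel_measurable borel"
    and L: "countable L" "infinite L" "\<And>l m. l \<in> L \<Longrightarrow> m \<in> L \<Longrightarrow> l - m \<in> L"
    and per: "\<And>z l. l \<in> L \<Longrightarrow> f (z + l) = f z"
    and B [measurable]: "B \<in> sets borel" and cover: "\<And>z. \<exists>l\<in>L. z + l \<in> B"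
    and A [measurable]: "A \<in> sets borel"
    and inj: "\<And>z w. z \<in> A \<Longrightarrow> w \<in> A \<Longrightarrow> z - w \<in> L \<Longrightarrow> z = w"
  shows "(\<integral>\<^sup>+z. f z * indicator A z \<partial>lborel) \<le> (\<integral>\<^sup>+z. f z * indicator B z \<partial>lborel)"
proof -
  define e where "e = from_nat_into L"
  have e: "bij_betw e UNIV L"
    using L bij_betw_from_nat_into e_def by blast
  then have eL: "e n \<in> L" for n
    by (auto simp: bij_betw_def)
  define A' where "A' n = {w. w - e n \<in> A}" for n
  have A'[measurable]: "A' n \<in> sets borel" for n
    unfolding A'_def by measurable
  have disj: "disjoint_family A'"
  proof (rule ccontr)
    assume "\<not> disjoint_family A'"
    then obtain m n w where mn: "m \<noteq> n" "w - e m \<in> A" "w - e n \<in> A"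
      by (auto simp: disjoint_family_on_def A'_def)
    have "(w - e m) - (w - e n) \<in> L"
      using L(3)[OF eL eL, of n m] by simp
    then have "w - e m = w - e n"
      using inj mn by blast
    then have "m = n"
      using e by (auto simp: bij_betw_def inj_on_def)
    with mn show False by simp
  qed
  have "(\<integral>\<^sup>+z. f z * indicator A z \<partial>lborel)
      \<le> (\<integral>\<^sup>+z. (\<Sum>n. f z * indicator A z * indicator B (z + e n)) \<partial>lborel)"
  proof (intro nn_integral_mono)
    fix z
    obtain n where n: "z + e n \<in> B"
      using cover[of z] e by (auto simp: bij_betw_def)
    have "f z * indicator A z = f z * indicator A z * indicator B (z + e n)"
      using n by simp
    also have "\<dots> \<le> (\<Sum>n. f z * indicator A z * indicator B (z + e n))"
      using sum_le_suminf[of "\<lambda>n. f z * indicator A z * indicator B (z + e n)" "{n}"]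
      by (simp del: ennreal_suminf_cmult sum_mult_indicator)
    finally show "f z * indicator A z \<le> (\<Sum>n. f z * indicator A z * indicator B (z + e n))" .
  qed
  also have "\<dots> = (\<Sum>n. \<integral>\<^sup>+z. f z * indicator A z * indicator B (z + e n) \<partial>lborel)"
    by (rule nn_integral_suminf) measurable
  also have "\<dots> = (\<Sum>n. \<integral>\<^sup>+w. f w * indicator B w * indicator (A' n) w \<partial>lborel)"
  proof (intro suminf_cong)
    fix n
    have "(\<integral>\<^sup>+w. f w * indicator B w * indicator (A' n) w \<partial>lborel) =
        (\<integral>\<^sup>+w. f w * indicator B w * indicator (A' n) w \<partial>(distr lborel borel ((+) (e n))))"
      by (simp add: lborel_distr_plus)
    also have "\<dots> = (\<integral>\<^sup>+z. f z * indicator A z * indicator B (z + e n) \<partial>lborel)"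
      by (subst nn_integral_distr)
        (auto intro!: nn_integral_cong simp: per[OF eL] add.commute[of "e n"] A'_def indicator_def)
    finally show "(\<integral>\<^sup>+z. f z * indicator A z * indicator B (z + e n) \<partial>lborel)
      = (\<integral>\<^sup>+w. f w * indicator B w * indicator (A' n) w \<partial>lborel)" by simp
  qed
  also have "\<dots> = (\<integral>\<^sup>+w. (\<Sum>n. f w * indicator B w * indicator (A' n) w) \<partial>lborel)"
    by (rule nn_integral_suminf[symmetric]) measurable
  also have "\<dots> \<le> (\<integral>\<^sup>+w. f w * indicator B w \<partial>lborel)"
  proof (intro nn_integral_mono)
    fix w
    have "(\<Sum>n. f w * indicator B w * indicator (A' n) w)
        = f w * indicator B w * (\<Sum>n. indicator (A' n) w)"
      by (rule ennreal_suminf_cmult)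
    also have "(\<Sum>n. indicator (A' n) w) = (indicator (\<Union>n. A' n) w :: ennreal)"
      by (rule suminf_indicator[OF disj])
    also have "f w * indicator B w * \<dots> \<le> f w * indicator B w * 1"
      by (intro mult_left_mono) (auto simp: indicator_def)
    finally show "(\<Sum>n. f w * indicator B w * indicator (A' n) w) \<le> f w * indicator B w" by simp
  qed
  finally show ?thesis .
qed

lemma exp_image_strip:
  "exp ` {s. a \<le> Re s \<and> Re s \<le> b \<and> 0 \<le> Im s \<and> Im s < 2 * pi} = {z. exp a \<le> cmod z \<and> cmod z \<le> exp b}"
proof (intro equalityI subsetI)
  fix z assume z: "z \<in> {z. exp a \<le> cmod z \<and> cmod z \<le> exp b}"
  then have z0: "z \<noteq> 0" using not_exp_le_zero by auto
  define s where "s = Complex (ln (cmod z)) (Arg2pi z)"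
  have "exp s = z"
    using z0 Arg2pi_eq[of z] by (simp add: s_def Complex_eq exp_add exp_of_real)
  moreover have "ln (cmod z) \<le> b"
    using z z0 by (metis (mono_tags) mem_Collect_eq exp_ln exp_le_cancel_iff zero_less_norm_iff)
  then have "a \<le> Re s \<and> Re s \<le> b \<and> 0 \<le> Im s \<and> Im s < 2 * pi"
    using z z0 Arg2pi_ge_0[of z] Arg2pi_lt_2pi[of z] by (simp add: s_def ln_ge_iff)
  ultimately show "z \<in> exp ` {s. a \<le> Re s \<and> Re s \<le> b \<and> 0 \<le> Im s \<and> Im s < 2 * pi}"
    by force
qed auto

text \<open>
  Polar coordinates in the form of the substitution \<open>z = exp s\<close>, with Jacobian \<open>(cmod (exp s))\<^sup>2\<close>. The
  strip of height \<open>2 * pi\<close> is taken half open, which makes \<open>exp\<close> injective on it.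
\<close>

lemma nn_integral_annulus_exp:
  fixes f :: "complex \<Rightarrow> real"
  assumes ab: "a \<le> b"
    and f: "continuous_on {z. exp a \<le> cmod z \<and> cmod z \<le> exp b} f"
    and nonneg: "\<And>z. exp a \<le> cmod z \<Longrightarrow> cmod z \<le> exp b \<Longrightarrow> f z \<ge> 0"
  shows "ennreal (integral {0..2*pi} (\<lambda>y. integral {a..b} (\<lambda>x.
            (cmod (exp (Complex x y)))\<^sup>2 * f (exp (Complex x y)))))
    = (\<integral>\<^sup>+z. ennreal (f z) * indicator {z. exp a \<le> cmod z \<and> cmod z \<le> exp b} z \<partial>lborel)"
proof -
  define A where "A = {z::complex. exp a \<le> cmod z \<and> cmod z \<le> exp b}"
  define S where "S = {s::complex. a \<le> Re s \<and> Re s \<le> b \<and> 0 \<le> Im s \<and> Im s < 2 * pi}"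
  define h where "h s = (cmod (exp s))\<^sup>2 * f (exp s)" for s :: complex
  define \<phi> where "\<phi> v = Complex (v $ 1) (v $ 2)" for v :: "real^2"
  define \<psi> where "\<psi> z = (vector [Re z, Im z] :: real^2)" for z
  define g where "g v = \<psi> (exp (\<phi> v))" for v
  define g' where "g' v w = \<psi> (exp (\<phi> v) * \<phi> w)" for v w
  have \<phi>\<psi> [simp]: "\<phi> (\<psi> z) = z" for z by (simp add: \<phi>_def \<psi>_def)
  have \<psi>\<phi> [simp]: "\<psi> (\<phi> v) = v" for v by (simp add: \<phi>_def \<psi>_def vec_eq_iff forall_2)
  have cont\<phi>: "continuous_on X \<phi>" for X
    unfolding \<phi>_def by (intro continuous_intros)
  have lin\<psi>: "bounded_linear \<psi>"
    by (auto simp: \<psi>_def linear_conv_bounded_linear[symmetric] linear_iff vec_eq_iff forall_2)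
  have lin\<phi>: "bounded_linear \<phi>"
    by (auto simp: \<phi>_def linear_conv_bounded_linear[symmetric] linear_iff complex_eq_iff)
  have cont\<psi>: "continuous_on X \<psi>" for X
    using lin\<psi> by (simp add: linear_continuous_on)
  have m\<phi>: "\<phi> \<in> borel_measurable lborel"
    using cont\<phi>[of UNIV] by (simp add: borel_measurable_continuous_onI)
  have distr: "(lborel :: complex measure) = distr lborel borel \<phi>"
    unfolding \<phi>_def by (rule lborel_complex_eq_distr_vec)
  have compA: "compact A"
  proof -
    have "A = cball 0 (exp b) - ball 0 (exp a)" by (auto simp: A_def)
    then show ?thesis by (simp add: compact_diff)
  qed
  have hc: "continuous_on (crect a b 0 (2*pi)) h"
    unfolding h_def
    by (intro continuous_intros continuous_on_compose2[OF f]) (auto simp: crect_def)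
  have hn: "h s \<ge> 0" if "s \<in> crect a b 0 (2*pi)" for s
    using that nonneg[of "exp s"] by (auto simp: h_def crect_def)
  have SK: "S \<subseteq> crect a b 0 (2*pi)" by (auto simp: S_def crect_def)
  have Sm: "S \<in> sets borel"
  proof -
    have "S = crect a b 0 (2*pi) \<inter> {s. Im s < 2 * pi}" by (auto simp: S_def crect_def)
    moreover have "open {s. Im s < 2 * pi}" by (rule open_halfspace_Im_lt)
    ultimately show ?thesis by auto
  qed
  have S'm: "\<phi> -` S \<in> sets lebesgue"
    using measurable_sets[OF m\<phi> Sm] by (simp add: sets_completionI_sets)
  have null: "AE s in lborel. Im (s::complex) \<noteq> 2 * pi" by (rule AE_Im_neq)
  have K_eq_S: "(\<integral>\<^sup>+s. ennreal (h s) * indicator (crect a b 0 (2*pi)) s \<partial>lborel)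
      = (\<integral>\<^sup>+s. ennreal (h s) * indicator S s \<partial>lborel)"
    by (rule nn_integral_cong_AE, rule eventually_mono[OF null])
      (auto simp: indicator_def S_def crect_def)
  have mS: "(\<lambda>s. ennreal (h s) * indicator S s) \<in> borel_measurable borel"
  proof -
    have "(\<lambda>z. indicator S z *\<^sub>R h z) \<in> borel_measurable borel"
      by (rule borel_measurable_continuous_on_indicator[OF Sm continuous_on_subset[OF hc SK]])
    then have "(\<lambda>z. ennreal (indicator S z *\<^sub>R h z)) \<in> borel_measurable borel"
      by measurable
    moreover have "(\<lambda>z. ennreal (indicator S z *\<^sub>R h z)) = (\<lambda>z. ennreal (h z) * indicator S z)"
      by (auto simp: indicator_def fun_eq_iff)
    ultimately show ?thesis by simp
  qed
  have mA: "(\<lambda>s. ennreal (f s) * indicator A s) \<in> borel_measurable borel"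
  proof -
    have "(\<lambda>z. indicator A z *\<^sub>R f z) \<in> borel_measurable borel"
      by (rule borel_measurable_continuous_on_indicator) (use compA f A_def in \<open>auto simp: borel_compact\<close>)
    then have "(\<lambda>z. ennreal (indicator A z *\<^sub>R f z)) \<in> borel_measurable borel"
      by measurable
    moreover have "(\<lambda>z. ennreal (indicator A z *\<^sub>R f z)) = (\<lambda>z. ennreal (f z) * indicator A z)"
      by (auto simp: indicator_def fun_eq_iff)
    ultimately show ?thesis by simp
  qed
  have trans: "(\<integral>\<^sup>+z. k z \<partial>lborel) = (\<integral>\<^sup>+v. k (\<phi> v) \<partial>lborel)" if "k \<in> borel_measurable borel"
    for k :: "complex \<Rightarrow> ennreal"
    by (subst distr, subst nn_integral_distr) (use m\<phi> that in auto)
  have der: "(g has_derivative g' v) (at v within \<phi> -` S)" for v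
  proof -
    have 1: "(\<phi> has_derivative \<phi>) (at v within \<phi> -` S)"
      by (rule bounded_linear_imp_has_derivative[OF lin\<phi>])
    have 2: "(exp has_derivative (\<lambda>w. exp (\<phi> v) * w)) (at (\<phi> v))"
      using DERIV_exp[of "\<phi> v"] by (simp add: has_field_derivative_def)
    show ?thesis
      unfolding g_def g'_def
      by (rule bounded_linear.has_derivative[OF lin\<psi> has_derivative_compose[OF 1 2]])
  qed
  have det: "det (matrix (g' v)) = (cmod (exp (\<phi> v)))\<^sup>2" for v
    unfolding det_2 matrix_def g'_def \<psi>_def
    unfolding cmod_power2 by (simp add: \<phi>_def axis_def power2_eq_square del: norm_exp_eq_Re)
  have injexp: "inj_on exp S"
  proof (rule inj_onI)
    fix x y assume xy: "x \<in> S" "y \<in> S" "exp x = exp y"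
    then obtain n :: int where n: "x = y + (of_int (2 * n) * pi) * \<i>"
      by (auto simp: exp_eq)
    then have I: "Im x = Im y + 2 * of_int n * pi" and R: "Re x = Re y" by auto
    have "\<bar>Im x - Im y\<bar> < 2 * pi"
      using xy by (auto simp: S_def abs_less_iff)
    then have "\<bar>of_int n :: real\<bar> < 1"
      using I by (simp add: abs_mult)
    then have "n = 0" by linarith
    then show "x = y" using n by simp
  qed
  have inj: "inj_on g (\<phi> -` S)"
  proof (rule inj_onI)
    fix v w assume vw: "v \<in> \<phi> -` S" "w \<in> \<phi> -` S" "g v = g w"
    then have "\<phi> (g v) = \<phi> (g w)" by simp
    then have "exp (\<phi> v) = exp (\<phi> w)" by (simp only: g_def \<phi>\<psi>)
    then have "\<phi> v = \<phi> w" using injexp vw by (auto dest: inj_onD)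
    then have "\<psi> (\<phi> v) = \<psi> (\<phi> w)" by simp
    then show "v = w" by (simp only: \<psi>\<phi>)
  qed
  have vim: "\<phi> -` X = \<psi> ` X" for X
  proof (intro equalityI subsetI)
    fix v assume "v \<in> \<phi> -` X"
    then have "\<psi> (\<phi> v) \<in> \<psi> ` X" by blast
    then show "v \<in> \<psi> ` X" by (simp only: \<psi>\<phi>)
  qed auto
  have img: "g ` (\<phi> -` S) = \<phi> -` A"
  proof -
    have "A = exp ` S" unfolding A_def S_def by (rule exp_image_strip[symmetric])
    moreover have "\<phi> -` S = \<psi> ` S" "\<phi> -` A = \<psi> ` A"
      by (simp_all only: vim)
    ultimately show ?thesis by (simp add: g_def image_image)
  qed
  have compA': "compact (\<phi> -` A)"
  proof -
    have "\<phi> -` A = \<psi> ` A" by (rule vim)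
    then show ?thesis using compA cont\<psi> by (simp add: compact_continuous_image)
  qed
  have fA: "(\<lambda>v. f (\<phi> v)) absolutely_integrable_on \<phi> -` A"
  proof -
    have "continuous_on (\<phi> -` A) (\<lambda>v. f (\<phi> v))"
      by (rule continuous_on_compose2[OF f[folded A_def] cont\<phi>]) auto
    then show ?thesis
      using borel_integrable_compact[OF compA', of "\<lambda>v. f (\<phi> v)"]
      by (auto simp: set_integrable_def intro!: integrable_completion[THEN iffD2])
  qed
  have fA1: "(\<lambda>v. vec (f (\<phi> v)) :: real^1) absolutely_integrable_on \<phi> -` A"
    using fA by (simp add: absolutely_integrable_on_1_iff)
  have cv: "(\<lambda>v. \<bar>det (matrix (g' v))\<bar> *\<^sub>R (vec (f (\<phi> (g v))) :: real^1)) absolutely_integrable_on \<phi> -` S \<and>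
      integral (\<phi> -` S) (\<lambda>v. \<bar>det (matrix (g' v))\<bar> *\<^sub>R (vec (f (\<phi> (g v))) :: real^1))
      = integral (\<phi> -` A) (\<lambda>v. vec (f (\<phi> v)))"
    using has_absolute_integral_change_of_variables[OF S'm der inj,
        of "\<lambda>v. vec (f (\<phi> v)) :: real^1"] fA1 img by auto
  have h_eq: "(\<bar>det (matrix (g' v))\<bar> *\<^sub>R (vec (f (\<phi> (g v))) :: real^1)) $ 1 = h (\<phi> v)" for v
    unfolding det by (simp add: h_def g_def)
  have hS: "(\<lambda>v. h (\<phi> v)) absolutely_integrable_on \<phi> -` S"
    using cv unfolding absolutely_integrable_on_1_iff h_eq by simp
  have int_eq: "integral (\<phi> -` S) (\<lambda>v. h (\<phi> v)) = integral (\<phi> -` A) (\<lambda>v. f (\<phi> v))"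
    using cv unfolding integral_on_1_eq h_eq by (simp add: vec_eq_iff)
  have "ennreal (integral {0..2*pi} (\<lambda>y. integral {a..b} (\<lambda>x. h (Complex x y))))
      = (\<integral>\<^sup>+s. ennreal (h s) * indicator S s \<partial>lborel)"
    using nn_integral_crect[OF hc hn] K_eq_S by simp
  also have "\<dots> = (\<integral>\<^sup>+v. ennreal (h (\<phi> v)) * indicator (\<phi> -` S) v \<partial>lborel)"
    by (subst trans[OF mS]) (simp add: indicator_def)
  also have "\<dots> = ennreal (integral (\<phi> -` S) (\<lambda>v. h (\<phi> v)))"
    by (rule nn_integral_absolutely_integrable[OF hS]) (use hn SK in auto)
  also have "\<dots> = ennreal (integral (\<phi> -` A) (\<lambda>v. f (\<phi> v)))"
    by (simp add: int_eq)
  also have "\<dots> = (\<integral>\<^sup>+v. ennreal (f (\<phi> v)) * indicator (\<phi> -` A) v \<partial>lborel)"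
    by (rule nn_integral_absolutely_integrable[OF fA, symmetric]) (use nonneg in \<open>auto simp: A_def\<close>)
  also have "\<dots> = (\<integral>\<^sup>+z. ennreal (f z) * indicator A z \<partial>lborel)"
    by (subst trans[OF mA]) (simp add: indicator_def)
  finally show ?thesis
    unfolding h_def A_def .
qed

section \<open>The hexagonal lattice and its torus\<close>

definition eq_tau :: complex where "eq_tau = exp (2 * of_real pi * \<i> / 3)"

text \<open>
  The primitive sixth root of unity, a symmetry of the hexagonal lattice.
\<close>

definition eq_rho :: complex where "eq_rho = 1 + eq_tau"

abbreviation Lat :: "complex set" where "Lat \<equiv> lattice eq_tau"

lemma eq_tau_Complex: "eq_tau = Complex (-1/2) (sqrt 3 / 2)"
proof -
  have "eq_tau = cis (2 * (pi / 3))"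
    by (simp add: eq_tau_def cis_conv_exp mult.commute)
  then show ?thesis
    using cos_120 sin_120 by (simp add: complex_eq_iff)
qed

lemma eq_rho_Complex: "eq_rho = Complex (1/2) (sqrt 3 / 2)"
  by (simp add: eq_rho_def eq_tau_Complex complex_eq_iff)

lemma eq_rho_square: "eq_rho\<^sup>2 = eq_tau"
  by (simp add: eq_rho_Complex eq_tau_Complex complex_eq_iff power2_eq_square)

lemma eq_rho_cube: "eq_rho ^ 3 = - 1"
  by (simp add: eq_rho_Complex complex_eq_iff power3_eq_cube)

lemma norm_eq_rho: "cmod eq_rho = 1"
  by (simp add: eq_rho_Complex cmod_def power2_eq_square)

lemma eq_rho_pow6: "eq_rho ^ 6 = 1"
  using power_mult[of eq_rho 3 2] by (simp add: eq_rho_cube)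

lemma eq_rho_pow_eq_1_iff: "eq_rho ^ n = 1 \<longleftrightarrow> 6 dvd n"
proof -
  have 1: "eq_rho ^ n = eq_rho ^ (n mod 6)"
  proof -
    have "eq_rho ^ n = eq_rho ^ (6 * (n div 6) + n mod 6)" by simp
    also have "\<dots> = (eq_rho ^ 6) ^ (n div 6) * eq_rho ^ (n mod 6)"
      by (simp only: power_add power_mult)
    finally show ?thesis by (simp add: eq_rho_pow6)
  qed
  have "n mod 6 \<in> {0,1,2,3,4,5}" by auto
  moreover have "eq_rho ^ 1 \<noteq> 1" "eq_rho ^ 2 \<noteq> 1" "eq_rho ^ 3 \<noteq> 1" "eq_rho ^ 4 \<noteq> 1" "eq_rho ^ 5 \<noteq> 1"
    by (auto simp: eq_rho_Complex complex_eq_iff power2_eq_square eval_nat_numeral)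
  ultimately show ?thesis unfolding 1 by (auto simp: dvd_eq_mod_eq_0)
qed

lemma Lat_iff: "z \<in> Lat \<longleftrightarrow> (\<exists>m n :: int. z = of_int m + of_int n * eq_tau)"
  by (auto simp: lattice_def)

lemma Lat_0 [simp]: "0 \<in> Lat"
  unfolding Lat_iff by (intro exI[of _ 0]) simp

lemma Lat_add: "a \<in> Lat \<Longrightarrow> b \<in> Lat \<Longrightarrow> a + b \<in> Lat"
proof -
  assume "a \<in> Lat" "b \<in> Lat"
  then obtain m n m' n' :: int where "a = of_int m + of_int n * eq_tau" "b = of_int m' + of_int n' * eq_tau"
    unfolding Lat_iff by auto
  then show "a + b \<in> Lat"
    unfolding Lat_iff by (intro exI[of _ "m + m'"] exI[of _ "n + n'"]) (simp add: algebra_simps)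
qed

lemma Lat_uminus: "a \<in> Lat \<Longrightarrow> - a \<in> Lat"
proof -
  assume "a \<in> Lat"
  then obtain m n :: int where "a = of_int m + of_int n * eq_tau"
    unfolding Lat_iff by auto
  then show "- a \<in> Lat"
    unfolding Lat_iff by (intro exI[of _ "- m"] exI[of _ "- n"]) (simp add: algebra_simps)
qed

lemma Lat_uminus_iff [simp]: "- a \<in> Lat \<longleftrightarrow> a \<in> Lat"
  using Lat_uminus by force

lemma Lat_diff: "a \<in> Lat \<Longrightarrow> b \<in> Lat \<Longrightarrow> a - b \<in> Lat"
  using Lat_add[of a "-b"] by simp

lemma Lat_add_iff [simp]: "l \<in> Lat \<Longrightarrow> z + l \<in> Lat \<longleftrightarrow> z \<in> Lat"
  using Lat_add[of z l] Lat_diff[of "z + l" l] by auto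

lemma one_in_Lat [simp]: "1 \<in> Lat" and tau_in_Lat [simp]: "eq_tau \<in> Lat"
  unfolding Lat_iff by (rule exI[of _ 1], rule exI[of _ 0], simp) (rule exI[of _ 0], rule exI[of _ 1], simp)

lemma Lat_mult_rho: "a \<in> Lat \<Longrightarrow> eq_rho * a \<in> Lat"
proof -
  assume "a \<in> Lat"
  then obtain m n :: int where a: "a = of_int m + of_int n * eq_tau"
    unfolding Lat_iff by auto
  \<comment> \<open>\<open>eq_rho\<close> maps the basis \<open>1, eq_tau\<close> to \<open>1 + eq_tau, -1\<close>.\<close>
  have "eq_rho * eq_tau = - 1"
    using eq_rho_cube by (simp add: eq_rho_square[symmetric] power3_eq_cube power2_eq_square mult.assoc)
  then have *: "eq_rho * (of_int n * eq_tau) = - of_int n"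
    by (metis mult.left_commute mult_minus1_right)
  have "eq_rho * a = of_int (m - n) + of_int m * eq_tau"
    unfolding a ring_distribs * by (simp add: eq_rho_def algebra_simps)
  then show "eq_rho * a \<in> Lat" unfolding Lat_iff by blast
qed

lemma Lat_mult_rho_pow: "a \<in> Lat \<Longrightarrow> eq_rho ^ n * a \<in> Lat"
  by (induction n) (auto simp: mult.assoc Lat_mult_rho)

lemma Lat_mult_rho_iff: "eq_rho ^ n * a \<in> Lat \<longleftrightarrow> a \<in> Lat"
proof
  assume "eq_rho ^ n * a \<in> Lat"
  then have "eq_rho ^ (5 * n) * (eq_rho ^ n * a) \<in> Lat" by (rule Lat_mult_rho_pow)
  moreover have "eq_rho ^ (5 * n) * (eq_rho ^ n * a) = (eq_rho ^ 6) ^ n * a"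
    by (simp add: power_mult[symmetric] power_add[symmetric] mult.assoc[symmetric])
  ultimately show "a \<in> Lat" by (simp add: eq_rho_pow6)
qed (rule Lat_mult_rho_pow)

text \<open>
  The norm form \<open>m\<^sup>2 - m n + n\<^sup>2\<close> takes positive integer values away from the origin.
\<close>

lemma Lat_nonzero_norm:
  assumes "l \<in> Lat" "l \<noteq> 0"
  shows "cmod l \<ge> 1"
proof -
  obtain m n :: int where l: "l = of_int m + of_int n * eq_tau"
    using assms unfolding Lat_iff by auto
  have "(cmod l)\<^sup>2 = (real_of_int m - real_of_int n / 2)\<^sup>2 + (real_of_int n * (sqrt 3 / 2))\<^sup>2"
    by (simp add: l cmod_power2 eq_tau_Complex)
  also have "\<dots> = of_int (m * m - m * n + n * n)"
    by (simp add: power2_eq_square algebra_simps)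
  finally have N: "(cmod l)\<^sup>2 = of_int (m * m - m * n + n * n)" .
  have "cmod l > 0" using assms by simp
  then have "(cmod l)\<^sup>2 > 0" by simp
  then have "0 < m * m - m * n + n * n" unfolding N by (simp only: of_int_0_less_iff)
  then have "m * m - m * n + n * n \<ge> 1" by simp
  then have "(cmod l)\<^sup>2 \<ge> 1" unfolding N by (metis of_int_1 of_int_le_iff)
  then show ?thesis
    using power2_le_imp_le[of 1 "cmod l"] by simp
qed

lemma countable_Lat: "countable Lat"
proof -
  have "Lat = (\<lambda>(m, n). of_int m + of_int n * eq_tau) ` (UNIV :: (int \<times> int) set)"
    by (auto simp: lattice_def)
  then show ?thesis by simp
qed

lemma infinite_Lat: "infinite Lat"
proof -
  have "range (of_nat :: nat \<Rightarrow> complex) \<subseteq> Lat"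
  proof clarify
    fix n :: nat show "complex_of_nat n \<in> Lat"
      unfolding Lat_iff by (intro exI[of _ "int n"] exI[of _ 0]) simp
  qed
  moreover have "infinite (range (of_nat :: nat \<Rightarrow> complex))"
    by (simp add: range_inj_infinite inj_of_nat)
  ultimately show ?thesis using finite_subset by blast
qed

lemma closed_Lat: "closed Lat"
  by (rule discrete_imp_closed[of 1])
    (use Lat_nonzero_norm Lat_diff in \<open>fastforce simp: dist_norm\<close>)+

lemma open_compl_Lat: "open (- Lat)"
  using closed_Lat by (simp add: open_Compl)

lemma connected_compl_Lat: "connected (- Lat)"
  using path_connected_complement_countable[of Lat] countable_Lat
  by (simp add: path_connected_imp_connected)

lemma punctured_disc_compl_Lat: "cmod z < 1 \<Longrightarrow> z \<noteq> 0 \<Longrightarrow> z \<notin> Lat"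
  using Lat_nonzero_norm by force

lemma Lat_reduce: "\<exists>l\<in>Lat. z + l \<in> fundamental_domain eq_tau"
proof -
  define t where "t = Im z / (sqrt 3 / 2)"
  define s where "s = Re z + t / 2"
  have z: "z = of_real s + of_real t * eq_tau"
    by (simp add: complex_eq_iff eq_tau_Complex s_def t_def)
  define l where "l = - (of_int \<lfloor>s\<rfloor> + of_int \<lfloor>t\<rfloor> * eq_tau)"
  have "l \<in> Lat"
    unfolding l_def by (simp only: Lat_uminus_iff) (auto simp: Lat_iff)
  moreover have "z + l = of_real (s - of_int \<lfloor>s\<rfloor>) + of_real (t - of_int \<lfloor>t\<rfloor>) * eq_tau"
    by (simp add: z l_def algebra_simps)
  then have "z + l \<in> fundamental_domain eq_tau"
    unfolding fundamental_domain_def mem_Collect_eq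
    by (intro exI[of _ "s - of_int \<lfloor>s\<rfloor>"] exI[of _ "t - of_int \<lfloor>t\<rfloor>"] conjI) (assumption | linarith)+
  ultimately show ?thesis by blast
qed

lemma fundamental_domain_eq_tau:
  "fundamental_domain eq_tau = {z. 0 \<le> Re z + Im z / sqrt 3 \<and> Re z + Im z / sqrt 3 < 1 \<and>
     0 \<le> Im z \<and> Im z < sqrt 3 / 2}"
proof (intro equalityI subsetI)
  fix z assume "z \<in> fundamental_domain eq_tau"
  then obtain s t where "z = of_real s + of_real t * eq_tau" "0 \<le> s" "s < 1" "0 \<le> t" "t < 1"
    by (auto simp: fundamental_domain_def)
  then show "z \<in> {z. 0 \<le> Re z + Im z / sqrt 3 \<and> Re z + Im z / sqrt 3 < 1 \<and> 0 \<le> Im z \<and> Im z < sqrt 3 / 2}"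
    by (auto simp: eq_tau_Complex)
next
  fix z assume z: "z \<in> {z. 0 \<le> Re z + Im z / sqrt 3 \<and> Re z + Im z / sqrt 3 < 1 \<and> 0 \<le> Im z \<and> Im z < sqrt 3 / 2}"
  define t where "t = Im z / (sqrt 3 / 2)"
  define s where "s = Re z + t / 2"
  have "z = of_real s + of_real t * eq_tau"
    by (simp add: complex_eq_iff eq_tau_Complex s_def t_def)
  moreover have "0 \<le> s" "s < 1" "0 \<le> t" "t < 1"
    using z by (auto simp: s_def t_def field_simps)
  ultimately show "z \<in> fundamental_domain eq_tau"
    by (auto simp: fundamental_domain_def)
qed

lemma fundamental_domain_inj:
  assumes z: "z \<in> fundamental_domain eq_tau" and w: "w \<in> fundamental_domain eq_tau" and "z - w \<in> Lat"
  shows "z = w"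
proof -
  obtain s t where 1: "z = of_real s + of_real t * eq_tau" "0 \<le> s" "s < 1" "0 \<le> t" "t < 1"
    using z by (auto simp: fundamental_domain_def)
  obtain s' t' where 2: "w = of_real s' + of_real t' * eq_tau" "0 \<le> s'" "s' < 1" "0 \<le> t'" "t' < 1"
    using w by (auto simp: fundamental_domain_def)
  obtain m n :: int where mn: "z - w = of_int m + of_int n * eq_tau" using assms(3) by (auto simp: Lat_iff)
  have "Im (z - w) = of_int n * (sqrt 3 / 2)" by (simp add: mn eq_tau_Complex)
  moreover have "Im (z - w) = (t - t') * (sqrt 3 / 2)" by (simp add: 1(1) 2(1) eq_tau_Complex left_diff_distrib)
  ultimately have tn: "t - t' = of_int n" by simp
  have "Re (z - w) = of_int m - of_int n / 2" by (simp add: mn eq_tau_Complex)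
  moreover have "Re (z - w) = (s - s') - (t - t') / 2" by (simp add: 1(1) 2(1) eq_tau_Complex field_simps)
  ultimately have sm: "s - s' = of_int m" using tn by simp
  have "n = 0" "m = 0" using 1 2 tn sm by linarith+
  then show ?thesis using mn by simp
qed

lemma sets_fundamental_domain: "fundamental_domain eq_tau \<in> sets borel"
  unfolding fundamental_domain_eq_tau by measurable

lemma equiv_lattice_rel: "equiv UNIV (lattice_rel eq_tau)"
proof (rule equivI)
  show "refl (lattice_rel eq_tau)" by (simp add: refl_on_def lattice_rel_def)
  show "sym (lattice_rel eq_tau)"
    unfolding sym_def lattice_rel_def using Lat_uminus by fastforce
  show "trans (lattice_rel eq_tau)"
    unfolding trans_def lattice_rel_def using Lat_add by fastforce
qed (auto simp: lattice_rel_def)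

lemma torus_proj_eq_iff: "torus_proj eq_tau z = torus_proj eq_tau w \<longleftrightarrow> z - w \<in> Lat"
  using eq_equiv_class_iff[OF equiv_lattice_rel, of z w]
  by (simp add: torus_proj_def lattice_rel_def)

lemma torus_proj_add: "l \<in> Lat \<Longrightarrow> torus_proj eq_tau (z + l) = torus_proj eq_tau z"
  by (simp add: torus_proj_eq_iff)

lemma torus_proj_preimage_compl:
  "torus_proj eq_tau -` (torus eq_tau - {torus_proj eq_tau p}) = {z. z - p \<notin> Lat}"
proof -
  have "torus_proj eq_tau z \<in> torus eq_tau" for z
    using range_torus_proj[of eq_tau] by blast
  then show ?thesis by (simp add: vimage_def torus_proj_eq_iff)
qed

text \<open>
  The preimage of a ball under a proper map is a compact part of the punctured torus, and so keeps a
  positive distance from the puncture.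
\<close>

lemma proper_imp_diverges:
  fixes X :: "complex set \<Rightarrow> 'a::euclidean_space"
  assumes proper: "proper_map (subtopology (torus_topology eq_tau) (torus eq_tau - {torus_proj eq_tau p})) euclidean X"
  shows "filterlim (\<lambda>z. norm (X (torus_proj eq_tau (z + p)))) at_top (at 0)"
proof (rule filterlim_at_top[THEN iffD2], rule allI)
  fix K :: real
  let ?T = "torus_topology eq_tau" and ?M = "torus eq_tau - {torus_proj eq_tau p}"
  define C where "C = {x \<in> topspace (subtopology ?T ?M). X x \<in> cball 0 K}"
  have "compactin (subtopology ?T ?M) C"
    unfolding C_def
    by (rule compactin_proper_map_preimage[OF proper]) (simp add: compact_cball)
  then have comp: "compactin ?T C" and CM: "C \<subseteq> ?M"
    by (auto simp: compactin_subtopology)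
  \<comment> \<open>The images of the sets \<open>V n\<close> are open and exhaust the punctured torus, so one of them
    contains the compact preimage of the ball.\<close>
  define V where "V n = {z. infdist (z - p) Lat > 1 / real (Suc n)}" for n
  define W where "W n = torus_proj eq_tau ` V n" for n
  have preW: "torus_proj eq_tau -` W n = V n" for n
  proof (intro equalityI subsetI)
    fix z assume "z \<in> torus_proj eq_tau -` W n"
    then obtain w where w: "w \<in> V n" "z - w \<in> Lat"
      by (auto simp: W_def torus_proj_eq_iff)
    have "(\<lambda>l. l + (z - w)) ` Lat = Lat"
    proof (intro equalityI subsetI)
      fix l assume "l \<in> Lat"
      then have "l - (z - w) \<in> Lat" using w(2) Lat_diff by blast
      then show "l \<in> (\<lambda>l. l + (z - w)) ` Lat" by (rule rev_image_eqI) simp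
    qed (use w(2) Lat_add in auto)
    then have "infdist (z - p) Lat = infdist (z - p) ((\<lambda>l. l + (z - w)) ` Lat)" by simp
    also have "\<dots> = infdist (w - p) Lat"
      using Lat_0 by (auto simp: infdist_def image_image dist_norm algebra_simps)
    finally show "z \<in> V n"
      using w(1) by (simp add: V_def)
  qed (auto simp: W_def)
  have opV: "open (V n)" for n
    unfolding V_def by (intro open_Collect_less continuous_intros)
  have opW: "openin ?T (W n)" for n
    unfolding openin_torus_topology preW using opV range_torus_proj[of eq_tau] by (auto simp: W_def)
  have cov: "C \<subseteq> \<Union>(range W)"
  proof
    fix c assume "c \<in> C"
    then have "c \<in> ?M" using CM by blast
    then obtain z where z: "c = torus_proj eq_tau z" "z - p \<notin> Lat"
      using range_torus_proj[of eq_tau] torus_proj_eq_iff[of _ p] by (metis DiffE imageE insertCI)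
    have "infdist (z - p) Lat > 0"
      using z(2) closed_Lat Lat_0 by (metis infdist_pos_not_in_closed empty_iff)
    then obtain n where "1 / real (Suc n) < infdist (z - p) Lat"
      using nat_approx_posE by (metis inverse_eq_divide of_nat_Suc add.commute)
    then show "c \<in> \<Union>(range W)" using z by (auto simp: W_def V_def)
  qed
  then obtain F where F: "finite F" "F \<subseteq> range W" "C \<subseteq> \<Union>F"
    using comp opW unfolding compactin_def by (metis (no_types, lifting) imageE)
  then obtain N where N: "finite N" "F = W ` N"
    by (meson finite_subset_image)
  define m where "m = Max (insert 0 N)"
  have mono: "V n \<subseteq> V m" if "n \<in> N" for n
  proof -
    have "n \<le> m" using that N by (simp add: m_def)
    then have "1 / real (Suc m) \<le> 1 / real (Suc n)" by (simp add: frac_le)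
    then show ?thesis by (auto simp: V_def)
  qed
  have key: "norm (X (torus_proj eq_tau (z + p))) > K" if z: "z \<noteq> 0" "cmod z < 1 / real (Suc m)" for z
  proof (rule ccontr)
    assume "\<not> norm (X (torus_proj eq_tau (z + p))) > K"
    moreover have "1 / real (Suc m) \<le> 1" by simp
    then have "cmod z < 1" using z(2) by linarith
    then have "z \<notin> Lat" using z(1) by (rule punctured_disc_compl_Lat)
    then have "z + p \<in> torus_proj eq_tau -` ?M"
      unfolding torus_proj_preimage_compl by simp
    then have "torus_proj eq_tau (z + p) \<in> ?M" by (rule vimageD)
    ultimately have "torus_proj eq_tau (z + p) \<in> C"
      by (auto simp: C_def topspace_torus_topology)
    then obtain n where "n \<in> N" "torus_proj eq_tau (z + p) \<in> W n"
      using F(3) N by auto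
    then have "z + p \<in> V m" using preW mono by blast
    then have "1 / real (Suc m) < infdist z Lat" by (simp add: V_def)
    also have "infdist z Lat \<le> dist z 0" by (rule infdist_le[OF Lat_0])
    finally show False using z by simp
  qed
  show "eventually (\<lambda>z. K \<le> norm (X (torus_proj eq_tau (z + p)))) (at 0)"
    unfolding eventually_at
    by (rule exI[of _ "1 / real (Suc m)"]) (use key in \<open>auto intro: less_imp_le\<close>)
qed

section \<open>Elliptic functions with one puncture\<close>

text \<open>
  A holomorphic function on the torus minus one point, lifted to the plane. The singularity at the lattice
  points may be essential, and the values there only have to be periodic.
\<close>

definition elliptic :: "(complex \<Rightarrow> complex) \<Rightarrow> bool" where
  "elliptic f \<longleftrightarrow> f holomorphic_on - Lat \<and> (\<forall>z. \<forall>l\<in>Lat. f (z + l) = f z)"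

lemma elliptic_deriv:
  assumes "elliptic f" shows "elliptic (deriv f)"
proof -
  have "deriv f (z + l) = deriv f z" if "l \<in> Lat" for z l
  proof -
    have "(\<lambda>x. f (x + l)) = f" using assms that by (auto simp: elliptic_def)
    then show ?thesis
      unfolding deriv_def DERIV_shift by simp
  qed
  then show ?thesis
    using assms holomorphic_deriv open_compl_Lat by (auto simp: elliptic_def)
qed

text \<open>
  The rectangle \<open>[-1/2, 1/2] \<times> [-cell_h, cell_h]\<close> is a fundamental domain with the lattice point \<open>0\<close> in its
  interior. Its upper edge is glued to the lower edge with a shift by \<open>1/2\<close>.
\<close>

definition cell_h :: real where "cell_h = sqrt 3 / 4"

lemma cell_h_bounds: "2/5 < cell_h" "cell_h < 9/20"
proof -
  have "8/5 < sqrt 3" by (rule real_less_rsqrt) (simp add: power2_eq_square)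
  then show "2/5 < cell_h" by (simp add: cell_h_def)
  have "sqrt 3 < 9/5" by (rule real_less_lsqrt) (auto simp: power2_eq_square)
  then show "cell_h < 9/20" by (simp add: cell_h_def)
qed

lemma Lat_ImE:
  assumes "z \<in> Lat"
  obtains m n :: int where "Re z = m - n / 2" "Im z = 2 * cell_h * n"
proof -
  obtain m n :: int where "z = of_int m + of_int n * eq_tau"
    using assms unfolding Lat_iff by auto
  then have "Re z = m - n / 2" "Im z = 2 * cell_h * n"
    by (simp_all add: eq_tau_Complex cell_h_def)
  then show thesis by (rule that)
qed

lemma Lat_Im_small:
  assumes "z \<in> Lat" "\<bar>Im z\<bar> < 2 * cell_h" shows "Im z = 0" and "\<exists>m::int. Re z = m"
proof -
  obtain m n :: int where mn: "Re z = m - n / 2" "Im z = 2 * cell_h * n"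
    using assms(1) by (rule Lat_ImE)
  have "2 * cell_h * \<bar>real_of_int n\<bar> < 2 * cell_h * 1"
    using assms(2) cell_h_bounds by (simp add: mn abs_mult)
  then have "\<bar>real_of_int n\<bar> < 1"
    using cell_h_bounds by (simp add: mult_less_cancel_left_pos)
  then have "n = 0" by linarith
  then show "Im z = 0" "\<exists>m::int. Re z = m" using mn by auto
qed

lemma cell_compl_Lat:
  assumes "\<bar>x\<bar> \<le> 1/2" "\<bar>y\<bar> \<le> cell_h" "x \<noteq> 0 \<or> y \<noteq> 0"
  shows "Complex x y \<notin> Lat"
proof
  assume L: "Complex x y \<in> Lat"
  then have "y = 0" using Lat_Im_small(1)[OF L] assms(2) cell_h_bounds by simp
  moreover obtain m :: int where "x = m"
    using Lat_Im_small(2)[OF L] assms(2) cell_h_bounds by auto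
  then have "m = 0" using assms(1) by linarith
  then have "x = 0" using \<open>x = m\<close> by simp
  ultimately show False using assms(3) by simp
qed

lemma cell_Lat_iff:
  assumes "\<bar>x\<bar> \<le> 1/2" "\<bar>y\<bar> \<le> cell_h"
  shows "Complex x y \<in> Lat \<longleftrightarrow> x = 0 \<and> y = 0"
  using cell_compl_Lat[OF assms] by (auto simp: zero_complex.code[symmetric])

lemma edge_compl_Lat: "Complex x (- cell_h) \<notin> Lat"
proof
  assume "Complex x (- cell_h) \<in> Lat"
  from Lat_Im_small(1)[OF this] show False using cell_h_bounds by simp
qed

lemma integral_periodic_1:
  fixes f :: "real \<Rightarrow> 'a::euclidean_space"
  assumes f: "continuous_on UNIV f" and per: "\<And>x. f (x + 1) = f x"
    and ab: "a \<le> b" "b \<le> a + 1"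
  shows "integral {a..a+1} f = integral {b..b+1} f"
proof -
  have int: "f integrable_on {x..y}" for x y
    by (intro integrable_continuous_real continuous_on_subset[OF f]) auto
  have "integral {a..b} f = integral {a..b} (f \<circ> (\<lambda>x. x + 1))"
    by (simp add: o_def per)
  also have "\<dots> = integral {a+1..b+1} f"
    using integral_shift[of a 1 b f] continuous_on_subset[OF f] by (simp add: add.commute)
  finally have 1: "integral {a..b} f = integral {a+1..b+1} f" .
  have "integral {a..a+1} f = integral {a..b} f + integral {b..a+1} f"
    using Henstock_Kurzweil_Integration.integral_combine[OF ab int] by simp
  also have "\<dots> = integral {b..a+1} f + integral {a+1..b+1} f"
    by (simp add: 1)
  also have "\<dots> = integral {b..b+1} f"
    using Henstock_Kurzweil_Integration.integral_combine[of b "a+1" "b+1" f] ab int by simp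
  finally show ?thesis .
qed

lemma rect_flux_edges:
  assumes "continuous_on U q" and ab: "a \<le> b" "c \<le> d"
    and "\<And>x y. x \<in> {a..b} \<Longrightarrow> y = c \<or> y = d \<Longrightarrow> Complex x y \<in> U"
    and "\<And>x y. y \<in> {c..d} \<Longrightarrow> x = a \<or> x = b \<Longrightarrow> Complex x y \<in> U"
  shows "rect_flux q a b c d = integral {c..d} (\<lambda>y. q (Complex b y)) - integral {c..d} (\<lambda>y. q (Complex a y)) +
     \<i> * (integral {a..b} (\<lambda>x. q (Complex x d)) - integral {a..b} (\<lambda>x. q (Complex x c)))"
proof -
  have "(\<lambda>y. q (Complex x y)) integrable_on {c..d}" if "x = a \<or> x = b" for x
    using assms that by (intro integrable_continuous_real continuous_on_compose2[OF assms(1)])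
      (auto intro!: continuous_intros)
  moreover have "(\<lambda>x. q (Complex x y)) integrable_on {a..b}" if "y = c \<or> y = d" for y
    using assms that by (intro integrable_continuous_real continuous_on_compose2[OF assms(1)])
      (auto intro!: continuous_intros)
  ultimately show ?thesis
    unfolding rect_flux_def by (simp add: integral_diff)
qed

text \<open>
  The cell minus a small square about \<open>0\<close> is cut into four rectangles. Inner edges cancel and the edges of the
  cell cancel by periodicity, which leaves the boundary of the small square.
\<close>

lemma rect_flux_punctured_cell:
  assumes q: "continuous_on (- Lat) q" and per: "\<And>z l. l \<in> Lat \<Longrightarrow> q (z + l) = q z"
    and r: "0 < r" "r < 1/4"
  shows "rect_flux q (-1/2) (-r) (-cell_h) cell_h + rect_flux q r (1/2) (-cell_h) cell_h +
     rect_flux q (-r) r r cell_h + rect_flux q (-r) r (-cell_h) (-r) = - rect_flux q (-r) r (-r) r"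
proof -
  let ?h = cell_h
  define V where "V x c d = integral {c..d} (\<lambda>y. q (Complex x y))" for x c d
  define H where "H y a b = integral {a..b} (\<lambda>x. q (Complex x y))" for y a b
  have h: "1/4 < ?h" "?h < 1/2" using cell_h_bounds by auto
  have VV: "V x c d + V x d e = V x c e" if "c \<le> d" "d \<le> e" "-?h \<le> c" "e \<le> ?h" "x \<noteq> 0" "\<bar>x\<bar> \<le> 1/2" for x c d e
    unfolding V_def
    by (rule Henstock_Kurzweil_Integration.integral_combine[OF that(1,2)], rule integrable_continuous_real,
        rule continuous_on_compose2[OF q])
      (use that in \<open>auto intro!: continuous_intros simp: cell_Lat_iff abs_le_iff\<close>)
  have HH: "H y c d + H y d e = H y c e" if "c \<le> d" "d \<le> e" "-1/2 \<le> c" "e \<le> 1/2" "y \<noteq> 0" "\<bar>y\<bar> \<le> ?h" for y c d e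
    unfolding H_def
    by (rule Henstock_Kurzweil_Integration.integral_combine[OF that(1,2)], rule integrable_continuous_real,
        rule continuous_on_compose2[OF q])
      (use that in \<open>auto intro!: continuous_intros simp: cell_Lat_iff abs_le_iff\<close>)
  have fl: "rect_flux q a b c d = V b c d - V a c d + \<i> * (H d a b - H c a b)"
    if "a \<le> b" "c \<le> d" "-1/2 \<le> a" "b \<le> 1/2" "-?h \<le> c" "d \<le> ?h" "a \<noteq> 0" "b \<noteq> 0" "c \<noteq> 0" "d \<noteq> 0" for a b c d
    unfolding V_def H_def
    by (rule rect_flux_edges[OF q]) (use that in \<open>auto simp: cell_Lat_iff abs_le_iff\<close>)
  have V1: "V (1/2) c d = V (-1/2) c d" for c d
  proof -
    have "q (Complex (1/2) y) = q (Complex (-1/2) y)" for y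
    proof -
      have "Complex (-1/2) y + 1 = Complex (1/2) y" by (simp add: complex_eq_iff)
      then show ?thesis using per[OF one_in_Lat, of "Complex (-1/2) y"] by simp
    qed
    then show ?thesis by (simp add: V_def)
  qed
  have H1: "H ?h (-1/2) (1/2) = H (-?h) (-1/2) (1/2)"
  proof -
    define f where "f x = q (Complex x (-?h))" for x
    have f: "continuous_on UNIV f"
      unfolding f_def
      by (rule continuous_on_compose2[OF q]) (auto intro!: continuous_intros simp: edge_compl_Lat)
    have f1: "f (x + 1) = f x" for x
    proof -
      have "Complex x (-?h) + 1 = Complex (x + 1) (-?h)" by (simp add: complex_eq_iff)
      then show ?thesis using per[OF one_in_Lat, of "Complex x (-?h)"] by (simp add: f_def)
    qed
    have "q (Complex x ?h) = f (x + 1/2)" for x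
    proof -
      have "Complex (x + 1/2) (-?h) + eq_tau = Complex x ?h"
        by (simp add: complex_eq_iff eq_tau_Complex cell_h_def)
      then show ?thesis using per[OF tau_in_Lat, of "Complex (x + 1/2) (-?h)"] by (simp add: f_def)
    qed
    then have "H ?h (-1/2) (1/2) = integral {-1/2..1/2} (f \<circ> (\<lambda>x. x + 1/2))"
      by (simp add: H_def o_def)
    also have "\<dots> = integral {0..0+1} f"
      using integral_shift[of "-1/2" "1/2" "1/2" f] continuous_on_subset[OF f]
      by (simp add: add.commute)
    also have "\<dots> = integral {-1/2..-1/2+1} f"
      by (rule integral_periodic_1[OF f f1, symmetric]) simp_all
    finally show ?thesis by (simp add: H_def f_def[abs_def])
  qed
  have e1: "V (-r) (-?h) ?h = V (-r) (-?h) (-r) + V (-r) (-r) r + V (-r) r ?h"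
    using VV[of "-?h" "-r" r "-r"] VV[of "-?h" r ?h "-r"] r h by simp
  have e2: "V r (-?h) ?h = V r (-?h) (-r) + V r (-r) r + V r r ?h"
    using VV[of "-?h" "-r" r r] VV[of "-?h" r ?h r] r h by simp
  have e3: "H ?h (-1/2) (1/2) = H ?h (-1/2) (-r) + H ?h (-r) r + H ?h r (1/2)"
    using HH[of "-1/2" "-r" r ?h] HH[of "-1/2" r "1/2" ?h] r h by simp
  have e4: "H (-?h) (-1/2) (1/2) = H (-?h) (-1/2) (-r) + H (-?h) (-r) r + H (-?h) r (1/2)"
    using HH[of "-1/2" "-r" r "-?h"] HH[of "-1/2" r "1/2" "-?h"] r h by simp
  have f1: "rect_flux q (-1/2) (-r) (-?h) ?h = V (-r) (-?h) ?h - V (-1/2) (-?h) ?h + \<i> * (H ?h (-1/2) (-r) - H (-?h) (-1/2) (-r))"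
    by (rule fl) (use r h in auto)
  have f2: "rect_flux q r (1/2) (-?h) ?h = V (1/2) (-?h) ?h - V r (-?h) ?h + \<i> * (H ?h r (1/2) - H (-?h) r (1/2))"
    by (rule fl) (use r h in auto)
  have f3: "rect_flux q (-r) r r ?h = V r r ?h - V (-r) r ?h + \<i> * (H ?h (-r) r - H r (-r) r)"
    by (rule fl) (use r h in auto)
  have f4: "rect_flux q (-r) r (-?h) (-r) = V r (-?h) (-r) - V (-r) (-?h) (-r) + \<i> * (H (-r) (-r) r - H (-?h) (-r) r)"
    by (rule fl) (use r h in auto)
  have f5: "rect_flux q (-r) r (-r) r = V r (-r) r - V (-r) (-r) r + \<i> * (H r (-r) r - H (-r) (-r) r)"
    by (rule fl) (use r h in auto)
  have "rect_flux q (-1/2) (-r) (-?h) ?h + rect_flux q r (1/2) (-?h) ?h +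
     rect_flux q (-r) r r ?h + rect_flux q (-r) r (-?h) (-r)
     = - rect_flux q (-r) r (-r) r + \<i> * (H ?h (-1/2) (1/2) - H (-?h) (-1/2) (1/2))"
    unfolding f1 f2 f3 f4 f5 e3 e4 unfolding e1 e2 V1 by (simp add: algebra_simps)
  then show ?thesis by (simp only: H1 diff_self mult_zero_right add_0_right)
qed

lemma C1_holomorphic:
  assumes "f holomorphic_on U" "open U"
  shows "C1_with_partials f (deriv f) (\<lambda>z. \<i> * deriv f z) U"
  unfolding C1_with_partials_def
proof (intro conjI ballI)
  fix z assume z: "z \<in> U"
  have "(\<lambda>v. Re v *\<^sub>R deriv f z + Im v *\<^sub>R (\<i> * deriv f z)) = (*) (deriv f z)"
    by (auto simp: fun_eq_iff complex_eq_iff algebra_simps)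
  then show "(f has_derivative (\<lambda>v. Re v *\<^sub>R deriv f z + Im v *\<^sub>R (\<i> * deriv f z))) (at z)"
    using holomorphic_derivI[OF assms z] by (simp add: has_field_derivative_def)
qed (intro continuous_intros holomorphic_on_imp_continuous_on holomorphic_deriv assms)+

text \<open>
  Cauchy's theorem, since \<open>q\<^sub>x + \<i> q\<^sub>y = 0\<close>.
\<close>

lemma rect_flux_holomorphic:
  assumes "f holomorphic_on U" "open U"
    and "\<And>x y. a \<le> x \<Longrightarrow> x \<le> b \<Longrightarrow> c \<le> y \<Longrightarrow> y \<le> d \<Longrightarrow> Complex x y \<in> U" "a \<le> b" "c \<le> d"
  shows "rect_flux f a b c d = 0"
  using rect_flux_eq_integral[OF C1_holomorphic[OF assms(1,2)] assms(3-5)] by (simp add: mult.assoc[symmetric])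

lemma contour_integral_linepath_horizontal:
  assumes "a < b"
  shows "contour_integral (linepath (Complex a c) (Complex b c)) f = integral {a..b} (\<lambda>x. f (Complex x c))"
proof -
  have "linepath (Complex a c) (Complex b c) = (+) (\<i> * of_real c) \<circ> linepath (of_real a) (of_real b)"
    by (auto simp: linepath_def fun_eq_iff complex_eq_iff algebra_simps)
  then have "contour_integral (linepath (Complex a c) (Complex b c)) f =
      contour_integral (linepath (of_real a) (of_real b)) (\<lambda>x. f (x + \<i> * of_real c))"
    by (simp add: contour_integral_translate)
  also have "\<dots> = integral {a..b} (\<lambda>x. f (of_real x + \<i> * of_real c))"
    using contour_integral_linepath_Reals_eq[of "of_real a" "of_real b"] assms by simp
  finally show ?thesis by (simp add: Complex_eq)
qed

lemma contour_integral_rectpath_flux: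
  assumes q: "continuous_on U q" and ab: "a < b" "c < d"
    and U1: "\<And>x y. x \<in> {a..b} \<Longrightarrow> y = c \<or> y = d \<Longrightarrow> Complex x y \<in> U"
    and U2: "\<And>x y. y \<in> {c..d} \<Longrightarrow> x = a \<or> x = b \<Longrightarrow> Complex x y \<in> U"
  shows "contour_integral (rectpath (Complex a c) (Complex b d)) q = \<i> * rect_flux q a b c d"
proof -
  have seg: "closed_segment (Complex x1 y1) (Complex x2 y2) \<subseteq> U"
    if "(x1 = x2 \<and> (x1 = a \<or> x1 = b) \<and> {y1, y2} = {c, d}) \<or> (y1 = y2 \<and> (y1 = c \<or> y1 = d) \<and> {x1, x2} = {a, b})"
    for x1 x2 y1 y2
  proof
    fix z assume z: "z \<in> closed_segment (Complex x1 y1) (Complex x2 y2)"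
    have "z \<in> U" if "Re z \<in> {a..b}" "Im z = c \<or> Im z = d"
      using U1[OF that] by simp
    moreover have "z \<in> U" if "Im z \<in> {c..d}" "Re z = a \<or> Re z = b"
      using U2[OF that] by simp
    ultimately show "z \<in> U"
      using that ab z
      by (auto simp: closed_segment_same_Re closed_segment_same_Im closed_segment_eq_real_ivl
          doubleton_eq_iff)
  qed
  have int: "q contour_integrable_on linepath (Complex x1 y1) (Complex x2 y2)"
    if "(x1 = x2 \<and> (x1 = a \<or> x1 = b) \<and> {y1, y2} = {c, d}) \<or> (y1 = y2 \<and> (y1 = c \<or> y1 = d) \<and> {x1, x2} = {a, b})"
    for x1 x2 y1 y2
    by (rule contour_integrable_continuous_linepath, rule continuous_on_subset[OF q seg[OF that]])
  have rev1: "contour_integral (linepath (Complex b d) (Complex a d)) q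
      = - contour_integral (linepath (Complex a d) (Complex b d)) q"
    by (rule contour_integral_reverse_linepath, rule continuous_on_subset[OF q seg]) auto
  have rev2: "contour_integral (linepath (Complex a d) (Complex a c)) q
      = - contour_integral (linepath (Complex a c) (Complex a d)) q"
    by (rule contour_integral_reverse_linepath, rule continuous_on_subset[OF q seg]) auto
  have 1: "contour_integral (linepath (Complex a c) (Complex b c)) q = integral {a..b} (\<lambda>x. q (Complex x c))"
    by (rule contour_integral_linepath_horizontal[OF ab(1)])
  have 2: "contour_integral (linepath (Complex b c) (Complex b d)) q = \<i> * integral {c..d} (\<lambda>y. q (Complex b y))"
    using contour_integral_linepath_same_Re[of "Complex b c" b "Complex b d" c d q] ab by simp
  have 3: "contour_integral (linepath (Complex a d) (Complex b d)) q = integral {a..b} (\<lambda>x. q (Complex x d))"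
    by (rule contour_integral_linepath_horizontal[OF ab(1)])
  have 4: "contour_integral (linepath (Complex a c) (Complex a d)) q = \<i> * integral {c..d} (\<lambda>y. q (Complex a y))"
    using contour_integral_linepath_same_Re[of "Complex a c" a "Complex a d" c d q] ab by simp
  have "contour_integral (rectpath (Complex a c) (Complex b d)) q
     = contour_integral (linepath (Complex a c) (Complex b c)) q
     + (contour_integral (linepath (Complex b c) (Complex b d)) q
     + (contour_integral (linepath (Complex b d) (Complex a d)) q
     + contour_integral (linepath (Complex a d) (Complex a c)) q))"
  proof -
    have "q contour_integrable_on linepath (Complex a c) (Complex b c)"
      "q contour_integrable_on linepath (Complex b c) (Complex b d)"
      "q contour_integrable_on linepath (Complex b d) (Complex a d)"
      "q contour_integrable_on linepath (Complex a d) (Complex a c)"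
      by (rule int, simp add: insert_commute)+
    then show ?thesis
      unfolding rectpath_def Let_def complex.sel by simp
  qed
  also have "\<dots> = \<i> * rect_flux q a b c d"
    unfolding rev1 rev2 1 2 3 4
    by (subst rect_flux_edges[OF q]) (use ab U1 U2 in \<open>auto simp: algebra_simps\<close>)
  finally show ?thesis .
qed

text \<open>
  With a single puncture the residue is the sum of all residues on the torus.
\<close>

lemma elliptic_residue_0:
  assumes "elliptic f"
  shows "residue f 0 = 0"
proof -
  have hol: "f holomorphic_on - Lat" and per: "\<And>z l. l \<in> Lat \<Longrightarrow> f (z + l) = f z"
    using assms by (auto simp: elliptic_def)
  have cont: "continuous_on (- Lat) f" using hol by (rule holomorphic_on_imp_continuous_on)
  let ?r = "1/8 :: real"
  have h: "1/4 < cell_h" "cell_h < 1/2" using cell_h_bounds by auto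
  have "rect_flux f (-1/2) (-?r) (-cell_h) cell_h = 0"
    by (rule rect_flux_holomorphic[OF hol open_compl_Lat]) (use h in \<open>auto simp: cell_Lat_iff abs_le_iff\<close>)
  moreover have "rect_flux f ?r (1/2) (-cell_h) cell_h = 0"
    by (rule rect_flux_holomorphic[OF hol open_compl_Lat]) (use h in \<open>auto simp: cell_Lat_iff abs_le_iff\<close>)
  moreover have "rect_flux f (-?r) ?r ?r cell_h = 0"
    by (rule rect_flux_holomorphic[OF hol open_compl_Lat]) (use h in \<open>auto simp: cell_Lat_iff abs_le_iff\<close>)
  moreover have "rect_flux f (-?r) ?r (-cell_h) (-?r) = 0"
    by (rule rect_flux_holomorphic[OF hol open_compl_Lat]) (use h in \<open>auto simp: cell_Lat_iff abs_le_iff\<close>)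
  ultimately have flux: "rect_flux f (-?r) ?r (-?r) ?r = 0"
    using rect_flux_punctured_cell[OF cont per, of ?r] by simp
  let ?p = "rectpath (Complex (-?r) (-?r)) (Complex ?r ?r)"
  have "contour_integral ?p f = \<i> * rect_flux f (-?r) ?r (-?r) ?r"
    by (rule contour_integral_rectpath_flux[OF cont]) (use h in \<open>auto simp: cell_Lat_iff abs_le_iff\<close>)
  then have "contour_integral ?p f = 0" using flux by simp
  moreover have "contour_integral ?p f = 2 * pi * \<i> * (\<Sum>p\<in>{0}. winding_number ?p p * residue f p)"
  proof (rule Residue_theorem[of "ball 0 1"])
    have sub: "path_image ?p \<subseteq> cbox (Complex (-?r) (-?r)) (Complex ?r ?r)"
      by (rule path_image_rectpath_subset_cbox) auto
    have cb: "cbox (Complex (-?r) (-?r)) (Complex ?r ?r) \<subseteq> ball 0 1"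
    proof
      fix z assume "z \<in> cbox (Complex (-?r) (-?r)) (Complex ?r ?r)"
      then show "z \<in> ball 0 1"
        using cmod_le[of z] by (auto simp: in_cbox_complex_iff)
    qed
    have "0 \<notin> path_image ?p"
      using path_image_rectpath_inter_box[of "Complex (-?r) (-?r)" "Complex ?r ?r"]
      by (auto simp: in_box_complex_iff)
    then show "path_image ?p \<subseteq> ball 0 1 - {0}"
      using sub cb by auto
    show "f holomorphic_on ball 0 1 - {0}"
      by (rule holomorphic_on_subset[OF hol]) (use punctured_disc_compl_Lat in auto)
    show "\<forall>z. z \<notin> ball 0 1 \<longrightarrow> winding_number ?p z = 0"
    proof (intro allI impI)
      fix z :: complex assume "z \<notin> ball 0 1"
      then have "z \<notin> cbox (Complex (-?r) (-?r)) (Complex ?r ?r)" using cb by blast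
      then show "winding_number ?p z = 0"
        by (intro winding_number_rectpath_outside) auto
    qed
  qed auto
  moreover have "winding_number ?p 0 = 1"
    by (rule winding_number_rectpath) (auto simp: in_box_complex_iff)
  ultimately show ?thesis by simp
qed

section \<open>Total mass and flux\<close>

lemma integral_nonneg_HK:
  fixes f :: "'a::euclidean_space \<Rightarrow> real"
  assumes "\<And>x. f x \<ge> 0" shows "integral A f \<ge> 0"
  by (cases "f integrable_on A")
    (auto intro: Henstock_Kurzweil_Integration.integral_nonneg assms simp: not_integrable_integral)

text \<open>
  The mass of the density \<open>lap_log_norm\<close> on the torus. As the integral of a nonnegative function it is
  meaningful without integrability.
\<close>

definition total_mass :: "'k set \<Rightarrow> ('k \<Rightarrow> complex \<Rightarrow> complex) \<Rightarrow> ennreal" where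
  "total_mass J \<Phi> = (\<integral>\<^sup>+z. ennreal (lap_log_norm J \<Phi> z) * indicator (- Lat) z *
     indicator (fundamental_domain eq_tau) z \<partial>lborel)"

locale elliptic_curve_map =
  fixes J :: "'k set" and \<Phi> :: "'k \<Rightarrow> complex \<Rightarrow> complex"
  assumes J: "finite J" and ell: "\<And>j. j \<in> J \<Longrightarrow> elliptic (\<Phi> j)"
    and pos: "\<And>z. z \<in> - Lat \<Longrightarrow> norm_sq J \<Phi> z > 0"
begin

lemma hol: "j \<in> J \<Longrightarrow> \<Phi> j holomorphic_on - Lat"
  using ell by (simp add: elliptic_def)

lemma per: "j \<in> J \<Longrightarrow> l \<in> Lat \<Longrightarrow> \<Phi> j (z + l) = \<Phi> j z"
  using ell by (simp add: elliptic_def)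

lemma per': "j \<in> J \<Longrightarrow> l \<in> Lat \<Longrightarrow> deriv (\<Phi> j) (z + l) = deriv (\<Phi> j) z"
  using elliptic_deriv[OF ell] by (simp add: elliptic_def)

lemma lap_per: "l \<in> Lat \<Longrightarrow> lap_log_norm J \<Phi> (z + l) = lap_log_norm J \<Phi> z"
  and dlog_per: "l \<in> Lat \<Longrightarrow> dlog_norm J \<Phi> (z + l) = dlog_norm J \<Phi> z"
  by (simp_all add: norm_sq_def herm_def lap_log_norm_def dlog_norm_def per per' cong: sum.cong)

lemma cont_lap: "continuous_on (- Lat) (lap_log_norm J \<Phi>)"
  using continuous_on_lap_log_norm[OF J open_compl_Lat hol pos] .

lemma measurable_mass_density:
  "(\<lambda>z. ennreal (lap_log_norm J \<Phi> z) * indicator (- Lat) z) \<in> borel_measurable borel"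
proof -
  have "(\<lambda>z. indicator (- Lat) z *\<^sub>R lap_log_norm J \<Phi> z) \<in> borel_measurable borel"
    by (rule borel_measurable_continuous_on_indicator[OF _ cont_lap]) (use open_compl_Lat in auto)
  then have "(\<lambda>z. ennreal (indicator (- Lat) z *\<^sub>R lap_log_norm J \<Phi> z)) \<in> borel_measurable borel"
    by measurable
  moreover have "(\<lambda>z. ennreal (indicator (- Lat) z *\<^sub>R lap_log_norm J \<Phi> z))
      = (\<lambda>z. ennreal (lap_log_norm J \<Phi> z) * indicator (- Lat) z)"
    by (auto simp: indicator_def fun_eq_iff)
  ultimately show ?thesis by simp
qed

text \<open>
  Mass may be compared on any two sets of which one injects into the torus and the other covers it.
\<close>

lemma mass_le_cover:
  assumes A: "A \<in> sets borel"
    and inj: "\<And>z w. z \<in> A \<Longrightarrow> w \<in> A \<Longrightarrow> z - w \<in> Lat \<Longrightarrow> z = w"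
    and B: "B \<in> sets borel" and cover: "\<And>z. \<exists>l\<in>Lat. z + l \<in> B"
  shows "(\<integral>\<^sup>+z. ennreal (lap_log_norm J \<Phi> z) * indicator (- Lat) z * indicator A z \<partial>lborel)
     \<le> (\<integral>\<^sup>+z. ennreal (lap_log_norm J \<Phi> z) * indicator (- Lat) z * indicator B z \<partial>lborel)"
  by (rule nn_integral_tiling_le[OF measurable_mass_density countable_Lat infinite_Lat Lat_diff _ B cover A inj])
    (auto simp: lap_per indicator_def)

lemma mass_le_total:
  assumes "A \<in> sets borel"
    and "\<And>z w. z \<in> A \<Longrightarrow> w \<in> A \<Longrightarrow> z - w \<in> Lat \<Longrightarrow> z = w"
  shows "(\<integral>\<^sup>+z. ennreal (lap_log_norm J \<Phi> z) * indicator (- Lat) z * indicator A z \<partial>lborel) \<le> total_mass J \<Phi>"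
  unfolding total_mass_def
  by (rule mass_le_cover[OF assms sets_fundamental_domain Lat_reduce])

text \<open>
  The four rectangles of the punctured cell have disjoint interiors in a set that injects into the torus,
  and by Green's formula their mass is the flux out of the small square with reversed sign.
\<close>

lemma flux_le_total:
  assumes r: "0 < r" "r < 1/4"
  shows "ennreal (- Re (rect_flux (dlog_norm J \<Phi>) (-r) r (-r) r)) \<le> total_mass J \<Phi>"
proof -
  let ?h = cell_h and ?q = "dlog_norm J \<Phi>" and ?L = "lap_log_norm J \<Phi>"
  have h: "1/4 < ?h" "?h < 1/2" using cell_h_bounds by auto
  define I where "I a b c d = integral {c..d} (\<lambda>y. integral {a..b} (\<lambda>x. ?L (Complex x y)))" for a b c d
  have cont: "continuous_on (- Lat) ?q"
    using C1_continuous[OF dlog_norm_C1[OF J open_compl_Lat hol pos]] .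
  have rect: "rect_flux ?q a b c d = of_real (I a b c d) \<and> crect a b c d \<subseteq> - Lat \<and> I a b c d \<ge> 0 \<and>
      ennreal (I a b c d) = (\<integral>\<^sup>+z. ennreal (?L z) * indicator (- Lat) z * indicator (crect a b c d) z \<partial>lborel)"
    if "a \<le> b" "c \<le> d" "-1/2 \<le> a" "b \<le> 1/2" "-?h \<le> c" "d \<le> ?h" "0 < a \<or> b < 0 \<or> 0 < c \<or> d < 0" for a b c d
  proof -
    have sub: "Complex x y \<in> - Lat" if "a \<le> x" "x \<le> b" "c \<le> y" "y \<le> d" for x y
    proof -
      have "\<bar>x\<bar> \<le> 1/2" "\<bar>y\<bar> \<le> ?h" using that \<open>-1/2 \<le> a\<close> \<open>b \<le> 1/2\<close> \<open>-?h \<le> c\<close> \<open>d \<le> ?h\<close> by auto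
      then show ?thesis
        using that \<open>0 < a \<or> b < 0 \<or> 0 < c \<or> d < 0\<close> by (auto simp: cell_Lat_iff)
    qed
    have 1: "rect_flux ?q a b c d = of_real (I a b c d)"
      unfolding I_def by (rule rect_flux_dlog_norm[OF J open_compl_Lat hol pos sub that(1,2)])
    have 2: "crect a b c d \<subseteq> - Lat"
    proof
      fix z assume "z \<in> crect a b c d"
      then show "z \<in> - Lat" using sub[of "Re z" "Im z"] by (simp add: crect_def)
    qed
    have "ennreal (I a b c d) = (\<integral>\<^sup>+z. ennreal (?L z) * indicator (crect a b c d) z \<partial>lborel)"
      unfolding I_def
      by (rule nn_integral_crect[symmetric]) (auto intro: continuous_on_subset[OF cont_lap 2] lap_log_norm_nonneg)
    also have "\<dots> = (\<integral>\<^sup>+z. ennreal (?L z) * indicator (- Lat) z * indicator (crect a b c d) z \<partial>lborel)"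
      using 2 by (intro nn_integral_cong) (auto simp: indicator_def)
    finally have 3: "ennreal (I a b c d) = (\<integral>\<^sup>+z. ennreal (?L z) * indicator (- Lat) z * indicator (crect a b c d) z \<partial>lborel)" .
    have 4: "I a b c d \<ge> 0"
      unfolding I_def by (intro integral_nonneg_HK lap_log_norm_nonneg)
    show ?thesis using 1 2 3 4 by blast
  qed
  let ?R1 = "crect (-1/2) (-r) (-?h) ?h" and ?R2 = "crect r (1/2) (-?h) ?h"
  let ?R3 = "crect (-r) r r ?h" and ?R4 = "crect (-r) r (-?h) (-r)"
  have R1: "rect_flux ?q (-1/2) (-r) (-?h) ?h = of_real (I (-1/2) (-r) (-?h) ?h) \<and> ?R1 \<subseteq> - Lat \<and> I (-1/2) (-r) (-?h) ?h \<ge> 0 \<and>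
      ennreal (I (-1/2) (-r) (-?h) ?h) = (\<integral>\<^sup>+z. ennreal (?L z) * indicator (- Lat) z * indicator ?R1 z \<partial>lborel)"
    by (rule rect) (use r h in auto)
  have R2: "rect_flux ?q r (1/2) (-?h) ?h = of_real (I r (1/2) (-?h) ?h) \<and> ?R2 \<subseteq> - Lat \<and> I r (1/2) (-?h) ?h \<ge> 0 \<and>
      ennreal (I r (1/2) (-?h) ?h) = (\<integral>\<^sup>+z. ennreal (?L z) * indicator (- Lat) z * indicator ?R2 z \<partial>lborel)"
    by (rule rect) (use r h in auto)
  have R3: "rect_flux ?q (-r) r r ?h = of_real (I (-r) r r ?h) \<and> ?R3 \<subseteq> - Lat \<and> I (-r) r r ?h \<ge> 0 \<and>
      ennreal (I (-r) r r ?h) = (\<integral>\<^sup>+z. ennreal (?L z) * indicator (- Lat) z * indicator ?R3 z \<partial>lborel)"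
    by (rule rect) (use r h in auto)
  have R4: "rect_flux ?q (-r) r (-?h) (-r) = of_real (I (-r) r (-?h) (-r)) \<and> ?R4 \<subseteq> - Lat \<and> I (-r) r (-?h) (-r) \<ge> 0 \<and>
      ennreal (I (-r) r (-?h) (-r)) = (\<integral>\<^sup>+z. ennreal (?L z) * indicator (- Lat) z * indicator ?R4 z \<partial>lborel)"
    by (rule rect) (use r h in auto)
  have "- rect_flux ?q (-r) r (-r) r = of_real (I (-1/2) (-r) (-?h) ?h + I r (1/2) (-?h) ?h + I (-r) r r ?h + I (-r) r (-?h) (-r))"
    using rect_flux_punctured_cell[OF cont dlog_per r] R1 R2 R3 R4 by simp
  then have "- Re (rect_flux ?q (-r) r (-r) r) = I (-1/2) (-r) (-?h) ?h + I r (1/2) (-?h) ?h + I (-r) r r ?h + I (-r) r (-?h) (-r)"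
    by (metis Re_complex_of_real uminus_complex.sel(1))
  then have "ennreal (- Re (rect_flux ?q (-r) r (-r) r)) =
     ennreal (I (-1/2) (-r) (-?h) ?h) + ennreal (I r (1/2) (-?h) ?h) + ennreal (I (-r) r r ?h) + ennreal (I (-r) r (-?h) (-r))"
    using R1 R2 R3 R4 by (simp only: ennreal_plus add_nonneg_nonneg)
  also have "\<dots> = (\<integral>\<^sup>+z. ennreal (?L z) * indicator (- Lat) z * indicator ?R1 z + ennreal (?L z) * indicator (- Lat) z * indicator ?R2 z
     + ennreal (?L z) * indicator (- Lat) z * indicator ?R3 z + ennreal (?L z) * indicator (- Lat) z * indicator ?R4 z \<partial>lborel)"
  proof -
    note [measurable] = measurable_mass_density
    show ?thesis
      using R1 R2 R3 R4 by (simp add: nn_integral_add)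
  qed
  also have "\<dots> \<le> (\<integral>\<^sup>+z. ennreal (?L z) * indicator (- Lat) z * indicator (box (Complex (-1/2) (-?h)) (Complex (1/2) ?h)) z \<partial>lborel)"
  proof (rule nn_integral_mono_AE)
    have "AE z in lborel. Re z \<noteq> -1/2 \<and> Re z \<noteq> 1/2 \<and> Re z \<noteq> r \<and> Re z \<noteq> -r \<and> Im z \<noteq> -?h \<and> Im z \<noteq> ?h \<and> Im z \<noteq> r \<and> Im z \<noteq> -r"
      by (intro AE_conjI AE_Re_neq AE_Im_neq)
    then show "AE z in lborel. ennreal (?L z) * indicator (- Lat) z * indicator ?R1 z + ennreal (?L z) * indicator (- Lat) z * indicator ?R2 z
     + ennreal (?L z) * indicator (- Lat) z * indicator ?R3 z + ennreal (?L z) * indicator (- Lat) z * indicator ?R4 z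
      \<le> ennreal (?L z) * indicator (- Lat) z * indicator (box (Complex (-1/2) (-?h)) (Complex (1/2) ?h)) z"
    proof (rule eventually_mono)
      fix z assume z: "Re z \<noteq> -1/2 \<and> Re z \<noteq> 1/2 \<and> Re z \<noteq> r \<and> Re z \<noteq> -r \<and> Im z \<noteq> -?h \<and> Im z \<noteq> ?h \<and> Im z \<noteq> r \<and> Im z \<noteq> -r"
      let ?b = "box (Complex (-1/2) (-?h)) (Complex (1/2) ?h)"
      consider "z \<in> ?R1" "z \<notin> ?R2" "z \<notin> ?R3" "z \<notin> ?R4" "z \<in> ?b"
        | "z \<notin> ?R1" "z \<in> ?R2" "z \<notin> ?R3" "z \<notin> ?R4" "z \<in> ?b"
        | "z \<notin> ?R1" "z \<notin> ?R2" "z \<in> ?R3" "z \<notin> ?R4" "z \<in> ?b"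
        | "z \<notin> ?R1" "z \<notin> ?R2" "z \<notin> ?R3" "z \<in> ?R4" "z \<in> ?b"
        | "z \<notin> ?R1" "z \<notin> ?R2" "z \<notin> ?R3" "z \<notin> ?R4"
      proof -
        have "z \<in> ?R1 \<Longrightarrow> z \<in> ?b \<and> z \<notin> ?R2 \<and> z \<notin> ?R3 \<and> z \<notin> ?R4"
          and "z \<in> ?R2 \<Longrightarrow> z \<in> ?b \<and> z \<notin> ?R1 \<and> z \<notin> ?R3 \<and> z \<notin> ?R4"
          and "z \<in> ?R3 \<Longrightarrow> z \<in> ?b \<and> z \<notin> ?R1 \<and> z \<notin> ?R2 \<and> z \<notin> ?R4"
          and "z \<in> ?R4 \<Longrightarrow> z \<in> ?b \<and> z \<notin> ?R1 \<and> z \<notin> ?R2 \<and> z \<notin> ?R3"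
          using z r h by (auto simp: crect_def in_box_complex_iff)
        then show thesis using that by blast
      qed
      then show "ennreal (?L z) * indicator (- Lat) z * indicator ?R1 z + ennreal (?L z) * indicator (- Lat) z * indicator ?R2 z
     + ennreal (?L z) * indicator (- Lat) z * indicator ?R3 z + ennreal (?L z) * indicator (- Lat) z * indicator ?R4 z
      \<le> ennreal (?L z) * indicator (- Lat) z * indicator ?b z"
        by cases simp_all
    qed
  qed
  also have "\<dots> \<le> total_mass J \<Phi>"
  proof (rule mass_le_total)
    fix z w assume "z \<in> box (Complex (-1/2) (-?h)) (Complex (1/2) ?h)" "w \<in> box (Complex (-1/2) (-?h)) (Complex (1/2) ?h)"
      and L: "z - w \<in> Lat"
    then have *: "\<bar>Im (z - w)\<bar> < 2 * ?h" "\<bar>Re (z - w)\<bar> < 1"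
      by (auto simp: in_box_complex_iff abs_less_iff)
    obtain m :: int where m: "Re (z - w) = m" using Lat_Im_small(2)[OF L *(1)] by blast
    then have "m = 0" using *(2) by linarith
    then show "z = w" using m Lat_Im_small(1)[OF L *(1)] by (simp add: complex_eq_iff)
  qed auto
  finally show ?thesis .
qed

lemma annulus_mass_le_total:
  assumes ab: "a \<le> b" "exp b < 1/2"
  shows "ennreal (integral {0..2*pi} (\<lambda>y. integral {a..b} (\<lambda>x.
     (cmod (exp (Complex x y)))\<^sup>2 * lap_log_norm J \<Phi> (exp (Complex x y))))) \<le> total_mass J \<Phi>"
proof -
  let ?A = "{z. exp a \<le> cmod z \<and> cmod z \<le> exp b}"
  have sub: "?A \<subseteq> - Lat"
  proof
    fix z assume z: "z \<in> ?A"
    then have "z \<noteq> 0" using not_exp_le_zero by auto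
    then show "z \<in> - Lat" using punctured_disc_compl_Lat[of z] z ab by auto
  qed
  have "ennreal (integral {0..2*pi} (\<lambda>y. integral {a..b} (\<lambda>x.
     (cmod (exp (Complex x y)))\<^sup>2 * lap_log_norm J \<Phi> (exp (Complex x y)))))
     = (\<integral>\<^sup>+z. ennreal (lap_log_norm J \<Phi> z) * indicator ?A z \<partial>lborel)"
    by (rule nn_integral_annulus_exp[OF ab(1)]) (auto intro: continuous_on_subset[OF cont_lap sub] lap_log_norm_nonneg)
  also have "\<dots> = (\<integral>\<^sup>+z. ennreal (lap_log_norm J \<Phi> z) * indicator (- Lat) z * indicator ?A z \<partial>lborel)"
    using sub by (intro nn_integral_cong) (auto simp: indicator_def)
  also have "\<dots> \<le> total_mass J \<Phi>"
  proof (rule mass_le_total)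
    have "closed ?A" by (intro closed_Collect_conj closed_Collect_le continuous_intros)
    then show "?A \<in> sets borel" by simp
    fix z w assume zw: "z \<in> ?A" "w \<in> ?A" "z - w \<in> Lat"
    have "cmod (z - w) \<le> cmod z + cmod w" by (rule norm_triangle_ineq4)
    then have "cmod (z - w) < 1" using zw ab by auto
    then show "z = w" using Lat_nonzero_norm[OF zw(3)] by fastforce
  qed
  finally show ?thesis .
qed

end

section \<open>Convexity of circle means\<close>

text \<open>
  Functions near a puncture are pulled back by \<open>exp\<close>, so that the circle of radius \<open>exp \<sigma>\<close> becomes a
  vertical segment of length \<open>2 * pi\<close>. The mean is not normalised.
\<close>

definition circle_mean :: "(complex \<Rightarrow> real) \<Rightarrow> real \<Rightarrow> real" where
  "circle_mean u \<sigma> = integral {0..2*pi} (\<lambda>y. u (Complex \<sigma> y))"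

lemma exp_Complex_periodic: "exp (s + 2 * of_real pi * \<i>) = exp s"
  by (simp add: exp_add exp_two_pi_i)

locale periodic_family =
  fixes J :: "'k set" and \<Psi> :: "'k \<Rightarrow> complex \<Rightarrow> complex" and b :: real
  assumes finJ: "finite J" and holo: "\<And>j. j \<in> J \<Longrightarrow> \<Psi> j holomorphic_on {s. Re s < b}"
    and posi: "\<And>s. Re s < b \<Longrightarrow> norm_sq J \<Psi> s > 0"
    and peri: "\<And>j s. j \<in> J \<Longrightarrow> \<Psi> j (s + 2 * of_real pi * \<i>) = \<Psi> j s"
begin

lemma open_half: "open {s. Re s < b}"
  by (rule open_halfspace_Re_lt)

lemma dlog_C1: "C1_with_partials (dlog_norm J \<Psi>) (dlog_norm_dir J \<Psi> 1) (dlog_norm_dir J \<Psi> \<i>) {s. Re s < b}"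
  by (rule dlog_norm_C1[OF finJ open_half holo]) (use posi in auto)

lemma cont_dlog: "continuous_on {s. Re s < b} (dlog_norm J \<Psi>)"
  by (rule C1_continuous[OF dlog_C1])

lemma cont_log: "continuous_on {s. Re s < b} (log_norm J \<Psi>)"
  unfolding continuous_on_eq_continuous_at[OF open_half]
  by (auto intro!: has_derivative_continuous[OF log_norm_has_derivative[OF finJ open_half holo]] posi)

lemma dlog_periodic: "dlog_norm J \<Psi> (s + 2 * of_real pi * \<i>) = dlog_norm J \<Psi> s"
proof -
  have "deriv (\<Psi> j) (s + 2 * of_real pi * \<i>) = deriv (\<Psi> j) s" if "j \<in> J" for j
  proof -
    have "(\<lambda>x. \<Psi> j (x + 2 * of_real pi * \<i>)) = \<Psi> j" using peri that by auto
    then show ?thesis unfolding deriv_def DERIV_shift by simp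
  qed
  then show ?thesis
    by (simp add: dlog_norm_def herm_def norm_sq_def peri cong: sum.cong)
qed

abbreviation M :: "real \<Rightarrow> real" where "M \<equiv> circle_mean (log_norm J \<Psi>)"
abbreviation M' :: "real \<Rightarrow> real" where "M' \<equiv> circle_mean (\<lambda>s. Re (dlog_norm J \<Psi> s))"

text \<open>
  Differentiation under the integral sign.
\<close>

lemma M_deriv:
  assumes "\<sigma> < b"
  shows "(M has_real_derivative M' \<sigma>) (at \<sigma>)"
proof -
  have "((\<lambda>x. integral (cbox 0 (2*pi)) (\<lambda>y. log_norm J \<Psi> (Complex x y))) has_vector_derivative
      integral (cbox 0 (2*pi)) (\<lambda>y. Re (dlog_norm J \<Psi> (Complex \<sigma> y)))) (at \<sigma> within {..<b})"
  proof (rule leibniz_rule_vector_derivative)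
    fix x t assume x: "x \<in> {..<b}"
    have 1: "((\<lambda>x. Complex x t) has_derivative (\<lambda>h. of_real h)) (at x within {..<b})"
      unfolding Complex_eq by (auto intro!: derivative_eq_intros)
    have 2: "(log_norm J \<Psi> has_derivative (\<lambda>v. Re (dlog_norm J \<Psi> (Complex x t) * v))) (at (Complex x t))"
      by (rule log_norm_has_derivative[OF finJ open_half holo]) (use x posi in auto)
    show "((\<lambda>x. log_norm J \<Psi> (Complex x t)) has_vector_derivative Re (dlog_norm J \<Psi> (Complex x t))) (at x within {..<b})"
      using has_derivative_compose[OF 1 2] by (simp add: has_vector_derivative_def mult.commute)
  next
    fix x assume x: "x \<in> {..<b}"
    show "(\<lambda>y. log_norm J \<Psi> (Complex x y)) integrable_on cbox 0 (2*pi)"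
      by (rule integrable_continuous, rule continuous_on_compose2[OF cont_log])
        (use x in \<open>auto intro!: continuous_intros\<close>)
  next
    have "continuous_on ({..<b} \<times> cbox 0 (2*pi)) (\<lambda>p. Re (dlog_norm J \<Psi> (Complex (fst p) (snd p))))"
      by (intro continuous_intros continuous_on_compose2[OF cont_dlog]) auto
    then show "continuous_on ({..<b} \<times> cbox 0 (2*pi)) (\<lambda>(x, t). Re (dlog_norm J \<Psi> (Complex x t)))"
      by (simp add: case_prod_unfold)
  qed (use assms in auto)
  moreover have "at \<sigma> within {..<b} = at \<sigma>"
    using assms by (intro at_within_open) auto
  ultimately show ?thesis
    unfolding circle_mean_def[abs_def] has_real_derivative_iff_has_vector_derivative cbox_interval
    by metis
qed

text \<open>
  Green's formula on a rectangle whose horizontal edges cancel by periodicity. As the increments of the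
  derivative are masses, the mean is a convex function of \<open>\<sigma>\<close>.
\<close>

lemma M'_increment:
  assumes "\<sigma>1 \<le> \<sigma>2" "\<sigma>2 < b"
  shows "M' \<sigma>2 - M' \<sigma>1 = integral {0..2*pi} (\<lambda>y. integral {\<sigma>1..\<sigma>2} (\<lambda>x. lap_log_norm J \<Psi> (Complex x y)))"
proof -
  have int: "(\<lambda>y. dlog_norm J \<Psi> (Complex \<sigma> y)) integrable_on {0..2*pi}" if "\<sigma> < b" for \<sigma>
    by (rule integrable_continuous_real, rule continuous_on_compose2[OF cont_dlog])
        (use that in \<open>auto intro!: continuous_intros\<close>)
  have Re_int: "Re (integral {0..2*pi} (\<lambda>y. dlog_norm J \<Psi> (Complex \<sigma> y))) = M' \<sigma>" if "\<sigma> < b" for \<sigma>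
    using integral_linear[OF int[OF that] bounded_linear_Re] by (simp add: circle_mean_def o_def)
  have top: "dlog_norm J \<Psi> (Complex x (2*pi)) = dlog_norm J \<Psi> (Complex x 0)" for x
  proof -
    have "Complex x 0 + 2 * of_real pi * \<i> = Complex x (2*pi)" by (simp add: complex_eq_iff)
    then show ?thesis using dlog_periodic[of "Complex x 0"] by simp
  qed
  have "rect_flux (dlog_norm J \<Psi>) \<sigma>1 \<sigma>2 0 (2*pi) =
      of_real (integral {0..2*pi} (\<lambda>y. integral {\<sigma>1..\<sigma>2} (\<lambda>x. lap_log_norm J \<Psi> (Complex x y))))"
    by (rule rect_flux_dlog_norm[OF finJ open_half holo]) (use assms posi in auto)
  moreover have "rect_flux (dlog_norm J \<Psi>) \<sigma>1 \<sigma>2 0 (2*pi) =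
      integral {0..2*pi} (\<lambda>y. dlog_norm J \<Psi> (Complex \<sigma>2 y)) - integral {0..2*pi} (\<lambda>y. dlog_norm J \<Psi> (Complex \<sigma>1 y))"
    unfolding rect_flux_def top using int assms by (simp add: integral_diff)
  ultimately have "Re (integral {0..2*pi} (\<lambda>y. dlog_norm J \<Psi> (Complex \<sigma>2 y)) - integral {0..2*pi} (\<lambda>y. dlog_norm J \<Psi> (Complex \<sigma>1 y)))
     = integral {0..2*pi} (\<lambda>y. integral {\<sigma>1..\<sigma>2} (\<lambda>x. lap_log_norm J \<Psi> (Complex x y)))"
    by simp
  then show ?thesis using Re_int assms by simp
qed

lemma M'_mono:
  assumes "\<sigma>1 \<le> \<sigma>2" "\<sigma>2 < b"
  shows "M' \<sigma>1 \<le> M' \<sigma>2"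
proof -
  have "0 \<le> integral {0..2*pi} (\<lambda>y. integral {\<sigma>1..\<sigma>2} (\<lambda>x. lap_log_norm J \<Psi> (Complex x y)))"
    by (intro integral_nonneg_HK lap_log_norm_nonneg)
  then show ?thesis using M'_increment[OF assms] by simp
qed

text \<open>
  A convex function that stays below a line of slope \<open>l\<close> for \<open>\<sigma> \<rightarrow> - \<infinity>\<close> has slope at least \<open>l\<close> everywhere.
\<close>

lemma slope_lower_bound:
  assumes ub: "\<And>\<sigma>. \<sigma> \<le> c \<Longrightarrow> M \<sigma> \<le> A + l * \<sigma>" and "\<sigma>0 < \<sigma>1" "\<sigma>1 < b"
  shows "M \<sigma>1 - M \<sigma>0 \<ge> l * (\<sigma>1 - \<sigma>0)"
proof -
  have ge: "M' \<sigma> \<ge> l" if "\<sigma> < b" for \<sigma>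
  proof (rule ccontr)
    assume "\<not> M' \<sigma> \<ge> l"
    define d where "d = l - M' \<sigma>"
    have d: "d > 0" using \<open>\<not> M' \<sigma> \<ge> l\<close> by (simp add: d_def)
    have lb: "M x \<ge> M \<sigma> + M' \<sigma> * (x - \<sigma>)" if "x < \<sigma>" for x
    proof -
      have "\<exists>z>x. z < \<sigma> \<and> M \<sigma> - M x = (\<sigma> - x) * M' z"
        by (rule MVT2[OF that]) (use \<open>\<sigma> < b\<close> in \<open>auto intro!: M_deriv\<close>)
      then obtain z where z: "x < z" "z < \<sigma>" "M \<sigma> - M x = (\<sigma> - x) * M' z"
        by blast
      have "M' z \<le> M' \<sigma>" using M'_mono z \<open>\<sigma> < b\<close> by simp
      then have "(\<sigma> - x) * M' z \<le> (\<sigma> - x) * M' \<sigma>" using that by (intro mult_left_mono) auto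
      then show ?thesis using z(3) by (simp add: algebra_simps)
    qed
    define E where "E = M \<sigma> - M' \<sigma> * \<sigma> - A"
    \<comment> \<open>far enough to the left for the tangent at \<open>\<sigma>\<close> to exceed the assumed upper bound\<close>
    define x where "x = min (min c (\<sigma> - 1)) ((E - 1) / d)"
    have x: "x \<le> c" "x < \<sigma>" "x \<le> (E - 1) / d" by (auto simp: x_def)
    have "d * x \<ge> E" using lb[OF x(2)] ub[OF x(1)] by (simp add: d_def E_def algebra_simps)
    moreover have "d * x \<le> E - 1" using x(3) d by (simp add: pos_le_divide_eq mult.commute)
    ultimately show False by simp
  qed
  have "\<exists>z>\<sigma>0. z < \<sigma>1 \<and> M \<sigma>1 - M \<sigma>0 = (\<sigma>1 - \<sigma>0) * M' z"
    by (rule MVT2[OF assms(2)]) (use assms(3) in \<open>auto intro!: M_deriv\<close>)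
  then obtain z where z: "\<sigma>0 < z" "z < \<sigma>1" "M \<sigma>1 - M \<sigma>0 = (\<sigma>1 - \<sigma>0) * M' z"
    by blast
  then show ?thesis using ge[of z] assms by (simp add: mult.commute)
qed

end

context elliptic_curve_map
begin

lemma exp_compl_Lat: "Re s < 0 \<Longrightarrow> exp s \<in> - Lat"
  using punctured_disc_compl_Lat[of "exp s"] by simp

lemma exp_family: "periodic_family J (\<lambda>j s. \<Phi> j (exp s)) 0"
proof
  show "finite J" by (rule J)
  show "(\<lambda>s. \<Phi> j (exp s)) holomorphic_on {s. Re s < 0}" if "j \<in> J" for j
    using holomorphic_on_compose_gen[OF holomorphic_on_exp hol[OF that], of "{s. Re s < 0}"] exp_compl_Lat
    by (auto simp: o_def)
  show "norm_sq J (\<lambda>j s. \<Phi> j (exp s)) s > 0" if "Re s < 0" for s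
    using pos[OF exp_compl_Lat[OF that]] by (simp add: norm_sq_def)
qed (simp add: exp_Complex_periodic)

text \<open>
  Conformal invariance of the Laplacian.
\<close>

lemma lap_exp:
  assumes "Re s < 0"
  shows "lap_log_norm J (\<lambda>j s. \<Phi> j (exp s)) s = (cmod (exp s))\<^sup>2 * lap_log_norm J \<Phi> (exp s)"
proof -
  have d: "deriv (\<lambda>s. \<Phi> j (exp s)) s = deriv (\<Phi> j) (exp s) * exp s" if "j \<in> J" for j
  proof (rule DERIV_imp_deriv)
    have "(\<Phi> j has_field_derivative deriv (\<Phi> j) (exp s)) (at (exp s))"
      using holomorphic_derivI[OF hol[OF that] open_compl_Lat exp_compl_Lat[OF assms]] .
    from DERIV_chain2[OF this DERIV_exp]
    show "((\<lambda>s. \<Phi> j (exp s)) has_field_derivative deriv (\<Phi> j) (exp s) * exp s) (at s)" .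
  qed
  have "herm J (\<lambda>j s. \<Phi> j (exp s)) s = exp s * herm J \<Phi> (exp s)"
    by (simp add: herm_def d sum_distrib_left mult_ac cong: sum.cong)
  moreover have "(\<Sum>j\<in>J. (cmod (deriv (\<lambda>s. \<Phi> j (exp s)) s))\<^sup>2) = (cmod (exp s))\<^sup>2 * (\<Sum>j\<in>J. (cmod (deriv (\<Phi> j) (exp s)))\<^sup>2)"
    by (simp add: d norm_mult power_mult_distrib sum_distrib_left mult_ac cong: sum.cong del: norm_exp_eq_Re)
  moreover have "norm_sq J (\<lambda>j s. \<Phi> j (exp s)) s = norm_sq J \<Phi> (exp s)"
    by (simp add: norm_sq_def)
  ultimately show ?thesis
    unfolding lap_log_norm_def by (simp add: norm_mult power_mult_distrib algebra_simps del: norm_exp_eq_Re)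
qed

abbreviation u_exp :: "complex \<Rightarrow> real" where
  "u_exp \<equiv> log_norm J (\<lambda>j s. \<Phi> j (exp s))"

text \<open>
  The slope of the mean decreases by at most the total mass towards the puncture, so the mean grows at most
  linearly in \<open>- \<sigma>\<close>.
\<close>

lemma circle_mean_growth:
  assumes "total_mass J \<Phi> < \<infinity>"
  obtains C where "\<And>\<sigma>. \<sigma> \<le> -1 \<Longrightarrow> circle_mean u_exp \<sigma> \<le> C * (1 - \<sigma>)"
proof -
  interpret E: periodic_family J "\<lambda>j s. \<Phi> j (exp s)" 0 by (rule exp_family)
  obtain T where T: "T \<ge> 0" "total_mass J \<Phi> = ennreal T"
    using assms by (metis ennreal_cases infinity_ennreal_def less_irrefl)
  have e1: "exp (-1 :: real) < 1/2"
  proof -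
    have "(1 + 1/2 :: real) \<le> exp (1/2)" by (rule exp_ge_add_one_self)
    then have "(1 + 1/2 :: real)\<^sup>2 \<le> (exp (1/2))\<^sup>2" by (rule power_mono) simp
    also have "(exp (1/2 :: real))\<^sup>2 = exp 1" by (simp add: power2_eq_square exp_add[symmetric])
    finally have "2 < exp (1::real)" by (simp add: power2_eq_square)
    then show ?thesis by (simp add: exp_minus field_simps)
  qed
  have "E.M' \<sigma> \<ge> E.M' (-1) - T" if "\<sigma> \<le> -1" for \<sigma>
  proof -
    have "E.M' (-1) - E.M' \<sigma> = integral {0..2*pi} (\<lambda>y. integral {\<sigma>..-1} (\<lambda>x.
       lap_log_norm J (\<lambda>j s. \<Phi> j (exp s)) (Complex x y)))"
      by (rule E.M'_increment) (use that in auto)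
    also have "\<dots> = integral {0..2*pi} (\<lambda>y. integral {\<sigma>..-1} (\<lambda>x.
       (cmod (exp (Complex x y)))\<^sup>2 * lap_log_norm J \<Phi> (exp (Complex x y))))"
      by (intro integral_cong lap_exp) auto
    finally have "ennreal (E.M' (-1) - E.M' \<sigma>) \<le> ennreal T"
      using annulus_mass_le_total[OF that e1] T by simp
    then show ?thesis using T by (simp add: ennreal_le_iff)
  qed note lb = this
  define c where "c = \<bar>E.M' (-1) - T\<bar>"
  have "E.M \<sigma> \<le> E.M (-1) + c * (- 1 - \<sigma>)" if "\<sigma> \<le> -1" for \<sigma>
  proof (cases "\<sigma> = -1")
    case False
    then have "\<sigma> < -1" using that by simp
    have "\<exists>z>\<sigma>. z < -1 \<and> E.M (-1) - E.M \<sigma> = (-1 - \<sigma>) * E.M' z"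
      by (rule MVT2[OF \<open>\<sigma> < -1\<close>]) (auto intro!: E.M_deriv)
    then obtain z where z: "\<sigma> < z" "z < -1" "E.M (-1) - E.M \<sigma> = (-1 - \<sigma>) * E.M' z"
      by blast
    have "E.M' z \<ge> - c" using lb[of z] z by (simp add: c_def abs_if split: if_splits)
    then have "(-1 - \<sigma>) * (- c) \<le> (-1 - \<sigma>) * E.M' z" using z by (intro mult_left_mono) auto
    then show ?thesis using z(3) by (simp add: algebra_simps)
  qed simp
  note up = this
  have "E.M \<sigma> \<le> (\<bar>E.M (-1)\<bar> + c) * (1 - \<sigma>)" if "\<sigma> \<le> -1" for \<sigma>
  proof -
    have "\<bar>E.M (-1)\<bar> * 1 \<le> \<bar>E.M (-1)\<bar> * (1 - \<sigma>)" using that by (intro mult_left_mono) auto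
    moreover have "c * (-1 - \<sigma>) \<le> c * (1 - \<sigma>)" by (intro mult_left_mono) (auto simp: c_def)
    ultimately show ?thesis using up[OF that] abs_ge_self[of "E.M (-1)"] unfolding ring_distribs by linarith
  qed
  then show thesis by (rule that)
qed

end

lemma factor_out_zeros:
  assumes "finite Z" "open V" "f holomorphic_on V" "Z \<subseteq> V" "\<And>a. a \<in> Z \<Longrightarrow> f a = 0"
  shows "\<exists>g. g holomorphic_on V \<and> (\<forall>z\<in>V. f z = (\<Prod>a\<in>Z. z - a) * g z)"
  using assms(1,4,5)
proof (induction Z)
  case empty
  then show ?case using assms(3) by auto
next
  case (insert a Z)
  obtain g where g: "g holomorphic_on V" "\<And>z. z \<in> V \<Longrightarrow> f z = (\<Prod>a\<in>Z. z - a) * g z"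
    using insert.IH insert.prems by auto
  have "(\<Prod>a'\<in>Z. a - a') \<noteq> 0" using insert.hyps by (auto simp: prod_zero_iff)
  then have ga: "g a = 0" using g(2)[of a] insert.prems by auto
  define h where "h z = (if z = a then deriv g a else (g z - g a) / (z - a))" for z
  have "h holomorphic_on V"
    unfolding h_def[abs_def] by (rule pole_lemma_open[OF g(1) assms(2)])
  moreover have "f z = (\<Prod>a\<in>insert a Z. z - a) * h z" if "z \<in> V" for z
    using g(2)[OF that] ga insert.hyps by (auto simp: h_def)
  ultimately show ?case by blast
qed

section \<open>Zeros near a puncture of finite mass\<close>

lemma circle_mean_mono:
  assumes "continuous_on {s. Re s = \<sigma>} h1" "continuous_on {s. Re s = \<sigma>} h2"
    and le: "\<And>s. Re s = \<sigma> \<Longrightarrow> h1 s \<le> h2 s + c"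
  shows "circle_mean h1 \<sigma> \<le> circle_mean h2 \<sigma> + 2 * pi * c"
proof -
  have int: "(\<lambda>y. h (Complex \<sigma> y)) integrable_on {0..2*pi}" if "continuous_on {s. Re s = \<sigma>} h" for h :: "complex \<Rightarrow> real"
    by (rule integrable_continuous_real, rule continuous_on_compose2[OF that]) (auto intro!: continuous_intros)
  have "circle_mean h1 \<sigma> \<le> integral {0..2*pi} (\<lambda>y. h2 (Complex \<sigma> y) + c)"
    unfolding circle_mean_def
    by (rule integral_le) (use le assms in \<open>auto intro!: int continuous_intros\<close>)
  also have "\<dots> = circle_mean h2 \<sigma> + 2 * pi * c"
    unfolding circle_mean_def by (subst integral_add) (auto intro!: int assms)
  finally show ?thesis .
qed

context elliptic_curve_map
begin

text \<open>
  A finite total mass plays the role that a growth condition plays for Jensen's formula. If \<open>f\<close> had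
  infinitely many zeros near the puncture, divide out \<open>K\<close> of them that are very small and multiply by \<open>z ^ K\<close>.
  The quotient \<open>ft\<close> is comparable with \<open>f\<close> on two fixed circles, but towards the puncture it is smaller than
  before by the factor \<open>cmod z ^ K\<close>. The circle mean of the logarithm is convex, so it has slope at least
  \<open>2 * pi * K - C\<close> between the two circles. Since \<open>K\<close> is arbitrary and the means of \<open>f\<close> are fixed, this is
  absurd. The family \<open>\<Psi>\<close> adds small multiples of \<open>z ^ K \<Phi> j\<close> to \<open>ft\<close> because the logarithm of \<open>ft\<close> alone is
  singular at the remaining zeros.
\<close>

theorem no_zeros_near_puncture:
  assumes fin: "total_mass J \<Phi> < \<infinity>" and f: "f holomorphic_on ball 0 1 - {0}"
    and dom: "\<And>z. z \<in> ball 0 1 - {0} \<Longrightarrow> (cmod (f z))\<^sup>2 \<le> B * norm_sq J \<Phi> z"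
    and nz: "z0 \<in> ball 0 1 - {0}" "f z0 \<noteq> 0"
  shows "\<exists>\<epsilon>>0. \<forall>z. z \<noteq> 0 \<and> cmod z < \<epsilon> \<longrightarrow> f z \<noteq> 0"
proof (rule ccontr)
  assume neg: "\<not> (\<exists>\<epsilon>>0. \<forall>z. z \<noteq> 0 \<and> cmod z < \<epsilon> \<longrightarrow> f z \<noteq> 0)"
  then have acc: "\<exists>z. z \<noteq> 0 \<and> cmod z < \<epsilon> \<and> f z = 0" if "\<epsilon> > 0" for \<epsilon>
    using that by blast
  define V :: "complex set" where "V = ball 0 1 - {0}"
  define N where "N = norm_sq J \<Phi>"
  have V: "open V" "connected V"
    by (auto simp: V_def intro!: open_delete connected_open_delete)
  have fV: "f holomorphic_on V" using f by (simp add: V_def)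
  have cf: "continuous_on V f" using fV by (rule holomorphic_on_imp_continuous_on)
  have expV: "exp s \<in> V" if "Re s < 0" for s using that by (simp add: V_def)
  have Npos: "N z > 0" if "z \<in> V" for z
    using that pos[of z] punctured_disc_compl_Lat[of z] by (simp add: V_def N_def)
  have contN: "continuous_on V N"
  proof -
    have "continuous_on (- Lat) N"
      unfolding N_def norm_sq_def
      by (intro continuous_intros holomorphic_on_imp_continuous_on hol)
    then show ?thesis
      by (rule continuous_on_subset) (use punctured_disc_compl_Lat in \<open>auto simp: V_def\<close>)
  qed
  \<comment> \<open>The zeros of \<open>f\<close> in a compact annulus are finite in number, so two circles of radii
    \<open>exp \<sigma>0 < exp \<sigma>1\<close> avoid them; the final comparison is made on these circles.\<close>
  define K0 where "K0 = {z::complex. exp (-3) \<le> cmod z \<and> cmod z \<le> exp (-1)}"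
  have K0: "compact K0" "K0 \<subseteq> V"
  proof -
    have "K0 = cball 0 (exp (-1)) - ball 0 (exp (-3))" by (auto simp: K0_def)
    then show "compact K0" by (simp add: compact_diff)
    show "K0 \<subseteq> V"
    proof
      fix z assume z: "z \<in> K0"
      then have "cmod z \<le> exp (-1)" by (simp add: K0_def)
      moreover have "exp (-1 :: real) < 1" by simp
      ultimately have "cmod z < 1" by linarith
      moreover have "z \<noteq> 0" using z not_exp_le_zero by (auto simp: K0_def)
      ultimately show "z \<in> V" by (simp add: V_def)
    qed
  qed
  have "\<not> f constant_on V"
  proof
    assume "f constant_on V"
    then obtain c where c: "\<And>z. z \<in> V \<Longrightarrow> f z = c" by (auto simp: constant_on_def)
    obtain z where "z \<noteq> 0" "cmod z < 1" "f z = 0" using acc[of 1] by auto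
    then show False using c[of z] c[of z0] nz by (simp add: V_def)
  qed
  then have finZ: "finite {z \<in> K0. f z = 0}"
    using holomorphic_compact_finite_zeros[OF fV V K0] by blast
  define bad where "bad = (\<lambda>z. ln (cmod z)) ` {z \<in> K0. f z = 0}"
  have finbad: "finite bad" using finZ by (simp add: bad_def)
  have "infinite ({-3<..<-2::real} - bad)" "infinite ({-2<..<-1::real} - bad)"
    using finbad by (simp_all add: Diff_infinite_finite infinite_Ioo)
  then have "{-3<..<-2::real} - bad \<noteq> {}" "{-2<..<-1::real} - bad \<noteq> {}"
    by force+
  then obtain \<sigma>0 \<sigma>1 where "\<sigma>0 \<in> {-3<..<-2::real} - bad" "\<sigma>1 \<in> {-2<..<-1::real} - bad"
    by (metis ex_in_conv)
  then have \<sigma>: "-3 < \<sigma>0" "\<sigma>0 < -2" "-2 < \<sigma>1" "\<sigma>1 < -1" "\<sigma>0 \<notin> bad" "\<sigma>1 \<notin> bad"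
    by auto
  have nzc: "f z \<noteq> 0" if "cmod z = exp \<sigma>'" "\<sigma>' = \<sigma>0 \<or> \<sigma>' = \<sigma>1" for z \<sigma>'
  proof
    assume "f z = 0"
    moreover have "z \<in> K0" using that \<sigma> by (auto simp: K0_def)
    ultimately have "ln (cmod z) \<in> bad" by (auto simp: bad_def)
    then show False using that \<sigma> by auto
  qed
  define L where "L = circle_mean (\<lambda>s. ln (cmod (f (exp s))))"
  have contL: "continuous_on {s. Re s = \<sigma>'} (\<lambda>s. ln (cmod (f (exp s))))" if "\<sigma>' = \<sigma>0 \<or> \<sigma>' = \<sigma>1" for \<sigma>'
  proof -
    have "continuous_on {s. Re s = \<sigma>'} (\<lambda>s. f (exp s))"
      by (rule continuous_on_compose2[OF cf]) (use that \<sigma> expV in \<open>auto intro!: continuous_intros\<close>)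
    moreover have "f (exp s) \<noteq> 0" if "Re s = \<sigma>'" for s
      using nzc[of "exp s" \<sigma>'] that \<open>\<sigma>' = \<sigma>0 \<or> \<sigma>' = \<sigma>1\<close> by simp
    ultimately show ?thesis by (intro continuous_intros) auto
  qed
  have sph: "compact (sphere (0::complex) (exp \<sigma>1))" "sphere (0::complex) (exp \<sigma>1) \<noteq> {}" "sphere (0::complex) (exp \<sigma>1) \<subseteq> V"
    using \<sigma> by (auto simp: V_def)
  have "continuous_on (sphere 0 (exp \<sigma>1)) (\<lambda>z. cmod (f z))"
    by (intro continuous_intros continuous_on_subset[OF cf sph(3)])
  then obtain zm where zm: "zm \<in> sphere 0 (exp \<sigma>1)" "\<And>z. z \<in> sphere 0 (exp \<sigma>1) \<Longrightarrow> cmod (f zm) \<le> cmod (f z)"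
    using continuous_attains_inf[OF sph(1,2), of "\<lambda>z. cmod (f z)"] by blast
  define fmin where "fmin = cmod (f zm)"
  have fmin: "fmin > 0" using nzc[of zm \<sigma>1] zm(1) by (simp add: fmin_def)
  obtain zx where zx: "zx \<in> sphere 0 (exp \<sigma>1)" "\<And>z. z \<in> sphere 0 (exp \<sigma>1) \<Longrightarrow> N z \<le> N zx"
    using continuous_attains_sup[OF sph(1,2), of N] continuous_on_subset[OF contN sph(3)] by blast
  have Nzx: "N zx > 0" using Npos zx(1) sph(3) by blast
  \<comment> \<open>The number \<open>K\<close> of zeros to be divided out is fixed before the zeros are chosen: their
    size \<open>\<eta>\<close> must depend on \<open>K\<close> for the product \<open>P\<close> below to stay in \<open>[1/2, 2]\<close>.\<close>
  obtain C where C: "\<And>\<sigma>. \<sigma> \<le> -1 \<Longrightarrow> circle_mean u_exp \<sigma> \<le> C * (1 - \<sigma>)"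
    using circle_mean_growth[OF fin] by blast
  obtain K :: nat where K: "real K > max 0 (((L \<sigma>1 - L \<sigma>0 + 2 * pi * 3) / (\<sigma>1 - \<sigma>0) + C) / (2 * pi))"
    using reals_Archimedean2 by blast
  then have K0': "K > 0" by simp
  have "(L \<sigma>1 - L \<sigma>0 + 2 * pi * 3) / (\<sigma>1 - \<sigma>0) < 2 * pi * K - C"
    using K by (simp add: pos_divide_less_eq mult.commute)
  then have KC: "L \<sigma>1 - L \<sigma>0 + 2 * pi * 3 < (2 * pi * K - C) * (\<sigma>1 - \<sigma>0)"
    using \<sigma> by (simp add: pos_divide_less_eq)
  define \<eta> where "\<eta> = exp \<sigma>0 / (2 * K)"
  have \<eta>: "\<eta> > 0" "\<eta> < 1"
  proof -
    show "\<eta> > 0" using K0' by (simp add: \<eta>_def)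
    have "\<eta> \<le> exp \<sigma>0" using K0' by (simp add: \<eta>_def divide_le_eq)
    also have "exp \<sigma>0 < 1" using \<sigma> by simp
    finally show "\<eta> < 1" .
  qed
  have "infinite {z. z \<noteq> 0 \<and> cmod z < \<eta> \<and> f z = 0}"
  proof
    assume fi: "finite {z. z \<noteq> 0 \<and> cmod z < \<eta> \<and> f z = 0}" (is "finite ?Z")
    define \<epsilon> where "\<epsilon> = Min (insert \<eta> (cmod ` ?Z))"
    have "\<epsilon> > 0" using fi \<eta> by (simp add: \<epsilon>_def)
    then obtain z where z: "z \<noteq> 0" "cmod z < \<epsilon>" "f z = 0" using acc by blast
    have "\<epsilon> \<le> \<eta>" using fi by (simp add: \<epsilon>_def)
    then have "z \<in> ?Z" using z by auto
    then have "\<epsilon> \<le> cmod z" using fi by (auto simp: \<epsilon>_def intro!: Min_le)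
    then show False using z by simp
  qed
  then obtain Z where Z: "finite Z" "card Z = K" "Z \<subseteq> {z. z \<noteq> 0 \<and> cmod z < \<eta> \<and> f z = 0}"
    using infinite_arbitrarily_large by blast
  have ZV: "Z \<subseteq> V" using Z(3) \<eta> by (auto simp: V_def)
  obtain g where g: "g holomorphic_on V" "\<And>z. z \<in> V \<Longrightarrow> f z = (\<Prod>a\<in>Z. z - a) * g z"
    using factor_out_zeros[OF Z(1) V(1) fV ZV] Z(3) by blast
  define ft where "ft z = g z * z ^ K" for z
  define P where "P z = (\<Prod>a\<in>Z. 1 - a / z)" for z
  have hft: "ft holomorphic_on V"
    unfolding ft_def by (intro holomorphic_intros g)
  have ftP: "f z = ft z * P z" if "z \<in> V" for z
  proof -
    have z: "z \<noteq> 0" using that by (simp add: V_def)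
    have "(\<Prod>a\<in>Z. z - a) = (\<Prod>a\<in>Z. z * (1 - a / z))"
      using z by (intro prod.cong) (auto simp: field_simps)
    also have "\<dots> = z ^ K * P z" by (simp add: prod.distrib Z(2) P_def)
    finally show ?thesis using g(2)[OF that] by (simp add: ft_def)
  qed
  have Pbounds: "1/2 \<le> cmod (P z) \<and> cmod (P z) \<le> 2" if z: "cmod z \<ge> exp \<sigma>0" for z
  proof -
    have z0: "cmod z > 0" using z exp_gt_zero[of \<sigma>0] by linarith
    have az: "cmod (a / z) \<le> 1 / (2 * K)" if "a \<in> Z" for a
    proof -
      have "cmod (a / z) \<le> \<eta> / exp \<sigma>0"
        unfolding norm_divide using that Z(3) z \<eta> by (intro frac_le) auto
      then show ?thesis by (simp add: \<eta>_def)
    qed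
    have K2: "1 / (2 * real K) \<le> 1/2" using K0' by (simp add: field_simps)
    have "(1 + - (1 / (2 * real K))) ^ K \<le> (\<Prod>a\<in>Z. cmod (1 - a / z))"
    proof -
      have "(\<Prod>a\<in>Z. 1 + - (1 / (2 * real K))) \<le> (\<Prod>a\<in>Z. cmod (1 - a / z))"
      proof (rule prod_mono, intro conjI)
        fix a assume "a \<in> Z"
        then show "1 + - (1 / (2 * real K)) \<le> cmod (1 - a / z)"
          using az[of a] norm_triangle_ineq2[of 1 "a / z"] by simp
        show "0 \<le> 1 + - (1 / (2 * real K))" using K2 by simp
      qed
      then show ?thesis by (simp add: Z(2))
    qed
    moreover have "1 + real K * (- (1 / (2 * real K))) \<le> (1 + - (1 / (2 * real K))) ^ K"
      by (rule Bernoulli_inequality) (use K2 in simp)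
    ultimately have 1: "1/2 \<le> cmod (P z)" using K0' by (simp add: P_def prod_norm)
    have "(\<Prod>a\<in>Z. cmod (1 - a / z)) \<le> (\<Prod>a\<in>Z. exp (1 / (2 * real K)))"
    proof (rule prod_mono, intro conjI)
      fix a assume "a \<in> Z"
      then have "cmod (1 - a / z) \<le> 1 + 1 / (2 * real K)"
        using az[of a] norm_triangle_ineq4[of 1 "a / z"] by simp
      also have "\<dots> \<le> exp (1 / (2 * real K))" by (rule exp_ge_add_one_self)
      finally show "cmod (1 - a / z) \<le> exp (1 / (2 * real K))" .
    qed simp
    also have "\<dots> = exp (1/2)"
      using K0' by (simp add: Z(2) exp_of_nat_mult[symmetric])
    also have "\<dots> \<le> 2" by (rule exp_half_le2)
    finally show ?thesis using 1 by (simp add: P_def prod_norm)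
  qed
  have ft_lb: "cmod (f z) / 2 \<le> cmod (ft z)" and ft_ub: "cmod (ft z) \<le> 2 * cmod (f z)"
    if "z \<in> V" "cmod z \<ge> exp \<sigma>0" for z
  proof -
    have eq: "cmod (f z) = cmod (ft z) * cmod (P z)" using ftP[OF that(1)] by (simp add: norm_mult)
    note p = Pbounds[OF that(2)]
    have "cmod (ft z) * cmod (P z) \<le> cmod (ft z) * 2" using p by (intro mult_left_mono) auto
    then show "cmod (f z) / 2 \<le> cmod (ft z)" using eq by simp
    have "cmod (ft z) * (1/2) \<le> cmod (ft z) * cmod (P z)" using p by (intro mult_left_mono) auto
    then show "cmod (ft z) \<le> 2 * cmod (f z)" using eq by simp
  qed
  \<comment> \<open>The extra components \<open>\<delta> z ^ K \<Phi> j\<close> keep the family without common zeros; \<open>\<delta>\<close> is so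
    small that \<open>ft\<close> still dominates on the outer circle.\<close>
  define \<delta> where "\<delta> = min 1 (fmin / (2 * (sqrt (N zx) + 1)))"
  have \<delta>: "0 < \<delta>" "\<delta> \<le> 1" "\<delta> * sqrt (N zx) \<le> fmin / 2"
  proof -
    show "0 < \<delta>" "\<delta> \<le> 1" using fmin Nzx by (auto simp: \<delta>_def intro!: divide_pos_pos add_pos_pos mult_pos_pos)
    have s: "sqrt (N zx) \<ge> 0" using Nzx by simp
    have "\<delta> * sqrt (N zx) \<le> fmin / (2 * (sqrt (N zx) + 1)) * (sqrt (N zx) + 1)"
      using s fmin by (intro mult_mono) (auto simp: \<delta>_def)
    also have "\<dots> = fmin / 2"
    proof -
      have "x / (2 * t) * t = x / 2" if "t \<noteq> 0" for x t :: real using that by simp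
      then show ?thesis using s by (metis add_nonneg_eq_0_iff zero_le_one zero_neq_one)
    qed
    finally show "\<delta> * sqrt (N zx) \<le> fmin / 2" .
  qed
  define J' where "J' = insert None (Some ` J)"
  define \<Psi> where "\<Psi> i s = (case i of None \<Rightarrow> ft (exp s) | Some j \<Rightarrow> of_real \<delta> * exp s ^ K * \<Phi> j (exp s))" for i s
  have ns: "norm_sq J' \<Psi> s = (cmod (ft (exp s)))\<^sup>2 + \<delta>\<^sup>2 * (exp (Re s)) ^ (2 * K) * N (exp s)" for s
  proof -
    have "(\<Sum>x\<in>J. \<delta>\<^sup>2 * ((exp (Re s) ^ K)\<^sup>2 * (cmod (\<Phi> x (exp s)))\<^sup>2)) = \<delta>\<^sup>2 * (exp (Re s)) ^ (2 * K) * N (exp s)"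
      by (simp add: N_def norm_sq_def sum_distrib_left power_mult mult_ac power_even_eq)
    then show ?thesis
      using J \<delta> unfolding J'_def norm_sq_def[of "insert None (Some ` J)"] \<Psi>_def
      by (subst sum.insert) (auto simp: sum.reindex norm_mult norm_power power_mult_distrib mult.assoc)
  qed
  interpret F: periodic_family J' \<Psi> 0
  proof
    show "finite J'" using J by (simp add: J'_def)
    have ho: "(\<lambda>s. h (exp s)) holomorphic_on {s. Re s < 0}" if "h holomorphic_on V" for h
      using holomorphic_on_compose_gen[OF holomorphic_on_exp that, of "{s. Re s < 0}"] expV
      by (auto simp: o_def)
    have "\<Phi> j holomorphic_on V" if "j \<in> J" for j
      by (rule holomorphic_on_subset[OF hol[OF that]]) (use punctured_disc_compl_Lat in \<open>auto simp: V_def\<close>)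
    then show "\<Psi> i holomorphic_on {s. Re s < 0}" if "i \<in> J'" for i
      using that ho[OF hft] ho unfolding \<Psi>_def[abs_def] J'_def
      by (auto intro!: holomorphic_intros)
    show "0 < norm_sq J' \<Psi> s" if "Re s < 0" for s
      unfolding ns using \<delta> Npos[OF expV[OF that]] by (intro add_nonneg_pos mult_pos_pos) auto
  qed (auto simp: \<Psi>_def exp_Complex_periodic split: option.split)
  have contv: "continuous_on {s. Re s = \<sigma>} (log_norm J' \<Psi>)" if "\<sigma> < 0" for \<sigma>
    by (rule continuous_on_subset[OF F.cont_log]) (use that in auto)
  interpret E: periodic_family J "\<lambda>j s. \<Phi> j (exp s)" 0 by (rule exp_family)
  have contu: "continuous_on {s. Re s = \<sigma>} u_exp" if "\<sigma> < 0" for \<sigma>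
    by (rule continuous_on_subset[OF E.cont_log]) (use that in auto)
  \<comment> \<open>Near the puncture \<open>ft\<close> is at most \<open>const * cmod z ^ K * sqrt N\<close>, since each factor of \<open>P\<close>
    has size about \<open>cmod a / cmod z\<close>. So \<open>K\<close> zeros contribute the slope \<open>2 * pi * K\<close>.\<close>
  have B0: "B \<ge> 0"
  proof -
    have "0 \<le> B * N z0" using dom[OF nz(1)] unfolding N_def by (meson order_trans zero_le_power2)
    then show ?thesis using Npos[of z0] nz(1) by (simp add: V_def zero_le_mult_iff)
  qed
  define Q where "Q = (\<Prod>a\<in>Z. cmod a / 2)"
  have Q: "Q > 0" unfolding Q_def using Z(3) by (intro prod_pos) auto
  define E where "E = B / Q\<^sup>2 + 1"
  have E1: "E \<ge> 1" using B0 Q by (simp add: E_def)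
  define c where "c = min (-1) (ln (Min (cmod ` Z) / 2))"
  have Zne: "Z \<noteq> {}" using Z K0' by auto
  have minZ: "Min (cmod ` Z) > 0" using Z Zne by (subst Min_gr_iff) auto
  have near: "log_norm J' \<Psi> s \<le> u_exp s + (K * Re s + ln E / 2)" if "Re s \<le> c" for s
  proof -
    define z where "z = exp s"
    have s: "Re s \<le> -1" "Re s \<le> ln (Min (cmod ` Z) / 2)" using that by (auto simp: c_def)
    have zV: "z \<in> V" using expV s by (simp add: z_def)
    have cz: "cmod z = exp (Re s)" by (simp add: z_def)
    then have cz0: "cmod z > 0" by simp
    have zMin: "cmod z \<le> Min (cmod ` Z) / 2"
      using s(2) minZ unfolding cz by (subst ln_ge_iff[symmetric]) auto
    have za: "cmod z \<le> cmod a / 2" if "a \<in> Z" for a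
    proof -
      have "Min (cmod ` Z) \<le> cmod a" using that Z(1) by (intro Min_le) auto
      then show ?thesis using zMin by linarith
    qed
    have "Q / cmod z ^ K = (\<Prod>a\<in>Z. cmod a / 2 / cmod z)"
      by (simp add: Q_def prod_dividef Z(2))
    also have "\<dots> \<le> (\<Prod>a\<in>Z. cmod (1 - a / z))"
    proof (rule prod_mono, intro conjI)
      fix a assume a: "a \<in> Z"
      have "1 \<le> cmod a / 2 / cmod z" using za[OF a] cz0 by (simp add: pos_le_divide_eq)
      then show "cmod a / 2 / cmod z \<le> cmod (1 - a / z)"
        using norm_triangle_ineq3[of 1 "a / z"] by (simp add: norm_divide abs_if split: if_splits)
    qed simp
    finally have QP: "Q / cmod z ^ K \<le> cmod (P z)" by (simp add: P_def prod_norm)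
    have "cmod (ft z) * (Q / cmod z ^ K) \<le> cmod (ft z) * cmod (P z)"
      using QP by (intro mult_left_mono) auto
    also have "\<dots> = cmod (f z)" using ftP[OF zV] by (simp add: norm_mult)
    finally have "cmod (ft z) \<le> cmod (f z) * cmod z ^ K / Q"
      using Q cz0 by (simp add: field_simps)
    then have "(cmod (ft z))\<^sup>2 \<le> (cmod (f z) * cmod z ^ K / Q)\<^sup>2" by (simp add: power_mono)
    also have "\<dots> = (cmod (f z))\<^sup>2 * (cmod z ^ (2 * K) / Q\<^sup>2)"
      by (simp add: power_mult_distrib power_divide power_mult[symmetric] mult.commute)
    also have "\<dots> \<le> (B * N z) * (cmod z ^ (2 * K) / Q\<^sup>2)"
      using dom[of z] zV by (intro mult_right_mono) (auto simp: V_def N_def)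
    finally have 1: "(cmod (ft z))\<^sup>2 \<le> cmod z ^ (2 * K) * N z * (B / Q\<^sup>2)" by (simp add: mult_ac)
    have "\<delta>\<^sup>2 \<le> 1" using \<delta> by (simp add: power_le_one)
    then have "\<delta>\<^sup>2 * (cmod z ^ (2 * K) * N z) \<le> 1 * (cmod z ^ (2 * K) * N z)"
      using Npos[OF zV] by (intro mult_right_mono) auto
    then have "norm_sq J' \<Psi> s \<le> cmod z ^ (2 * K) * N z * E"
      using 1 unfolding ns E_def z_def[symmetric] cz[symmetric] by (simp add: algebra_simps)
    then have "ln (norm_sq J' \<Psi> s) \<le> ln (cmod z ^ (2 * K) * N z * E)"
      using F.posi[of s] s by (intro ln_mono) (auto intro: order_less_le_trans)
    also have "\<dots> = 2 * K * Re s + ln (N z) + ln E"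
      using cz0 Npos[OF zV] E1 by (simp add: ln_mult ln_realpow cz)
    finally show ?thesis
      by (simp add: log_norm_def N_def z_def norm_sq_def)
  qed
  have "F.M \<sigma> \<le> (C + pi * ln E) + (2 * pi * K - C) * \<sigma>" if "\<sigma> \<le> c" for \<sigma>
  proof -
    have \<sigma>1: "\<sigma> \<le> -1" using that by (simp add: c_def)
    have "F.M \<sigma> \<le> circle_mean u_exp \<sigma> + 2 * pi * (K * \<sigma> + ln E / 2)"
      by (rule circle_mean_mono) (use \<sigma>1 that near contv contu in auto)
    also have "\<dots> \<le> C * (1 - \<sigma>) + 2 * pi * (K * \<sigma> + ln E / 2)"
      using C[OF \<sigma>1] by simp
    finally show ?thesis by (simp add: algebra_simps)
  qed
  then have "F.M \<sigma>1 - F.M \<sigma>0 \<ge> (2 * pi * K - C) * (\<sigma>1 - \<sigma>0)"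
    by (rule F.slope_lower_bound) (use \<sigma> in auto)
  moreover have "L \<sigma>0 \<le> F.M \<sigma>0 + 2 * pi * 1"
    unfolding L_def
  proof (rule circle_mean_mono)
    fix s assume s: "Re s = \<sigma>0"
    have zV: "exp s \<in> V" using expV s \<sigma> by simp
    have fz: "cmod (f (exp s)) > 0" using nzc[of "exp s" \<sigma>0] s by simp
    have "(cmod (f (exp s)) / 2)\<^sup>2 \<le> (cmod (ft (exp s)))\<^sup>2"
      using ft_lb[OF zV] s by (intro power_mono) auto
    also have "\<dots> \<le> norm_sq J' \<Psi> s" unfolding ns using Npos[OF zV] by simp
    finally have "ln ((cmod (f (exp s)) / 2)\<^sup>2) \<le> ln (norm_sq J' \<Psi> s)"
      using fz by (intro ln_mono) auto
    moreover have "ln ((cmod (f (exp s)) / 2)\<^sup>2) = 2 * (ln (cmod (f (exp s))) - ln 2)"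
      using fz by (simp add: ln_realpow ln_div)
    ultimately show "ln (cmod (f (exp s))) \<le> log_norm J' \<Psi> s + 1"
      using ln_le_minus_one[of 2] by (simp add: log_norm_def)
  qed (use contL contv \<sigma> in auto)
  moreover have "F.M \<sigma>1 \<le> L \<sigma>1 + 2 * pi * (3/2)"
    unfolding L_def
  proof (rule circle_mean_mono)
    fix s assume s: "Re s = \<sigma>1"
    have zV: "exp s \<in> V" using expV s \<sigma> by simp
    have fz: "cmod (f (exp s)) > 0" using nzc[of "exp s" \<sigma>1] s by simp
    have sp: "exp s \<in> sphere 0 (exp \<sigma>1)" using s by simp
    have ge: "cmod (exp s) \<ge> exp \<sigma>0" using s \<sigma> by simp
    have "\<delta> * sqrt (N (exp s)) \<le> \<delta> * sqrt (N zx)"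
      using zx(2)[OF sp] \<delta> by (intro mult_left_mono real_sqrt_le_mono) auto
    also have "\<dots> \<le> cmod (f (exp s)) / 2" using \<delta>(3) zm(2)[OF sp] by (simp add: fmin_def)
    also have "\<dots> \<le> cmod (ft (exp s))" by (rule ft_lb[OF zV ge])
    finally have "(\<delta> * sqrt (N (exp s)))\<^sup>2 \<le> (cmod (ft (exp s)))\<^sup>2"
      using \<delta> Npos[OF zV] by (intro power_mono) auto
    then have 1: "\<delta>\<^sup>2 * N (exp s) \<le> (cmod (ft (exp s)))\<^sup>2"
      using Npos[OF zV] by (simp add: power_mult_distrib)
    have "exp (Re s) ^ (2 * K) \<le> 1" using s \<sigma> by (intro power_le_one) auto
    then have "\<delta>\<^sup>2 * N (exp s) * exp (Re s) ^ (2 * K) \<le> \<delta>\<^sup>2 * N (exp s) * 1"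
      using Npos[OF zV] by (intro mult_left_mono) auto
    then have "norm_sq J' \<Psi> s \<le> 2 * (cmod (ft (exp s)))\<^sup>2"
      using 1 unfolding ns by (simp add: mult_ac)
    also have "\<dots> \<le> 2 * (2 * cmod (f (exp s)))\<^sup>2"
      using ft_ub[OF zV ge] by (intro mult_left_mono power_mono) auto
    also have "\<dots> = 2 ^ 3 * (cmod (f (exp s)))\<^sup>2" by (simp add: power_mult_distrib)
    finally have "ln (norm_sq J' \<Psi> s) \<le> ln (2 ^ 3 * (cmod (f (exp s)))\<^sup>2)"
      using F.posi[of s] s \<sigma> by (intro ln_mono) (auto intro: order_less_le_trans)
    also have "\<dots> = 3 * ln 2 + 2 * ln (cmod (f (exp s)))"
    proof -
      have "ln (8 :: real) = 3 * ln 2" using ln_realpow[of 2 3] by simp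
      then show ?thesis using fz by (subst ln_mult) (simp_all add: ln_realpow)
    qed
    finally show "log_norm J' \<Psi> s \<le> ln (cmod (f (exp s))) + 3/2"
      using ln_le_minus_one[of 2] by (simp add: log_norm_def)
  qed (use contL contv \<sigma> in auto)
  ultimately show False using KC pi_gt_zero by (simp add: algebra_simps)
qed

end

section \<open>Symmetry of order six\<close>

text \<open>
  The expansion of such a function at \<open>0\<close> contains only powers of \<open>z\<close> whose exponent is congruent to \<open>k\<close>
  modulo 6.
\<close>

definition rot_type :: "nat \<Rightarrow> (complex \<Rightarrow> complex) \<Rightarrow> bool" where
  "rot_type k f \<longleftrightarrow> (\<forall>z. f (eq_rho * z) = eq_rho ^ k * f z)"

definition pole_bound :: "nat \<Rightarrow> (complex \<Rightarrow> complex) \<Rightarrow> bool" where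
  "pole_bound n f \<longleftrightarrow> (\<exists>B \<epsilon>. \<epsilon> > 0 \<and> (\<forall>z. z \<noteq> 0 \<and> cmod z < \<epsilon> \<longrightarrow> cmod (z ^ n * f z) \<le> B))"

text \<open>
  The projection to rotation type \<open>k\<close>. The exponent \<open>6 - k mod 6\<close> stands for \<open>- k\<close>, which is legitimate
  because \<open>eq_rho\<close> has order 6.
\<close>

definition rot_part :: "nat \<Rightarrow> (complex \<Rightarrow> complex) \<Rightarrow> complex \<Rightarrow> complex" where
  "rot_part k f z = (\<Sum>j<6. eq_rho ^ (j * (6 - k mod 6)) * f (eq_rho ^ j * z)) / 6"

lemma elliptic_holD: "elliptic f \<Longrightarrow> f holomorphic_on - Lat"
  and elliptic_perD: "elliptic f \<Longrightarrow> l \<in> Lat \<Longrightarrow> f (z + l) = f z"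
  by (auto simp: elliptic_def)

lemma elliptic_compose_rho:
  assumes "elliptic f" shows "elliptic (\<lambda>z. f (eq_rho ^ j * z))"
  unfolding elliptic_def
proof (intro conjI allI ballI)
  have "(f \<circ> (\<lambda>z. eq_rho ^ j * z)) holomorphic_on - Lat"
    by (rule holomorphic_on_compose_gen[OF _ elliptic_holD[OF assms]])
      (auto intro!: holomorphic_intros simp: Lat_mult_rho_iff)
  then show "(\<lambda>z. f (eq_rho ^ j * z)) holomorphic_on - Lat" by (simp add: o_def)
  fix z l assume "l \<in> Lat"
  then have "eq_rho ^ j * l \<in> Lat" by (rule Lat_mult_rho_pow)
  then show "f (eq_rho ^ j * (z + l)) = f (eq_rho ^ j * z)"
    using elliptic_perD[OF assms] by (simp add: distrib_left)
qed

lemma elliptic_diff: "elliptic f \<Longrightarrow> elliptic g \<Longrightarrow> elliptic (\<lambda>z. f z - g z)"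
  and elliptic_mult: "elliptic f \<Longrightarrow> elliptic g \<Longrightarrow> elliptic (\<lambda>z. f z * g z)"
  and elliptic_const: "elliptic (\<lambda>z. c)"
  by (auto simp: elliptic_def intro!: holomorphic_intros)

lemma elliptic_sum: "(\<And>i. i \<in> I \<Longrightarrow> elliptic (f i)) \<Longrightarrow> elliptic (\<lambda>z. \<Sum>i\<in>I. f i z)"
  by (auto simp: elliptic_def intro!: holomorphic_intros sum.cong)

lemma elliptic_rot_part: "elliptic f \<Longrightarrow> elliptic (rot_part k f)"
proof -
  assume f: "elliptic f"
  have "elliptic (\<lambda>z. (\<Sum>j<6. eq_rho ^ (j * (6 - k mod 6)) * f (eq_rho ^ j * z)) * (1 / 6))"
    by (intro elliptic_mult elliptic_sum elliptic_const elliptic_compose_rho f)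
  then show ?thesis by (simp add: rot_part_def[abs_def])
qed

lemma pole_boundI: "\<epsilon> > 0 \<Longrightarrow> (\<And>z. z \<noteq> 0 \<Longrightarrow> cmod z < \<epsilon> \<Longrightarrow> cmod (z ^ n * f z) \<le> B) \<Longrightarrow> pole_bound n f"
  unfolding pole_bound_def by blast

lemma pole_bound_add:
  assumes "pole_bound n f" "pole_bound n g" shows "pole_bound n (\<lambda>z. f z + g z)"
proof -
  obtain B \<epsilon> where f: "\<epsilon> > 0" "\<And>z. z \<noteq> 0 \<Longrightarrow> cmod z < \<epsilon> \<Longrightarrow> cmod (z ^ n * f z) \<le> B"
    using assms(1) unfolding pole_bound_def by blast
  obtain B' \<epsilon>' where g: "\<epsilon>' > 0" "\<And>z. z \<noteq> 0 \<Longrightarrow> cmod z < \<epsilon>' \<Longrightarrow> cmod (z ^ n * g z) \<le> B'"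
    using assms(2) unfolding pole_bound_def by blast
  show ?thesis
  proof (rule pole_boundI[of "min \<epsilon> \<epsilon>'" _ _ "B + B'"])
    fix z :: complex assume z: "z \<noteq> 0" "cmod z < min \<epsilon> \<epsilon>'"
    have "cmod (z ^ n * (f z + g z)) \<le> cmod (z ^ n * f z) + cmod (z ^ n * g z)"
      unfolding distrib_left by (rule norm_triangle_ineq)
    then show "cmod (z ^ n * (f z + g z)) \<le> B + B'" using f(2)[of z] g(2)[of z] z by simp
  qed (use f g in auto)
qed

lemma pole_bound_mult:
  assumes "pole_bound n f" "pole_bound m g" shows "pole_bound (n + m) (\<lambda>z. f z * g z)"
proof -
  obtain B \<epsilon> where f: "\<epsilon> > 0" "\<And>z. z \<noteq> 0 \<Longrightarrow> cmod z < \<epsilon> \<Longrightarrow> cmod (z ^ n * f z) \<le> B"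
    using assms(1) unfolding pole_bound_def by blast
  obtain B' \<epsilon>' where g: "\<epsilon>' > 0" "\<And>z. z \<noteq> 0 \<Longrightarrow> cmod z < \<epsilon>' \<Longrightarrow> cmod (z ^ m * g z) \<le> B'"
    using assms(2) unfolding pole_bound_def by blast
  show ?thesis
  proof (rule pole_boundI[of "min \<epsilon> \<epsilon>'" _ _ "B * B'"])
    fix z :: complex assume z: "z \<noteq> 0" "cmod z < min \<epsilon> \<epsilon>'"
    have fz: "cmod (z ^ n * f z) \<le> B" and gz: "cmod (z ^ m * g z) \<le> B'" using f(2)[of z] g(2)[of z] z by auto
    have "B \<ge> 0" using fz norm_ge_zero order_trans by blast
    have "cmod (z ^ (n + m) * (f z * g z)) = cmod (z ^ n * f z) * cmod (z ^ m * g z)"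
      by (simp add: power_add norm_mult)
    also have "\<dots> \<le> B * B'" by (rule mult_mono[OF fz gz \<open>B \<ge> 0\<close>]) simp
    finally show "cmod (z ^ (n + m) * (f z * g z)) \<le> B * B'" .
  qed (use f g in auto)
qed

lemma pole_bound_const: "pole_bound 0 (\<lambda>z. c)"
  by (rule pole_boundI[of 1 _ _ "cmod c"]) auto

lemma pole_bound_cmult: "pole_bound n f \<Longrightarrow> pole_bound n (\<lambda>z. c * f z)"
  using pole_bound_mult[OF pole_bound_const[of c], of n f] by simp

lemma pole_bound_diff: "pole_bound n f \<Longrightarrow> pole_bound n g \<Longrightarrow> pole_bound n (\<lambda>z. f z - g z)"
  using pole_bound_add[of n f "\<lambda>z. (-1) * g z"] pole_bound_cmult[of n g "-1"] by simp

lemma pole_bound_mono: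
  assumes "pole_bound n f" "n \<le> m" shows "pole_bound m f"
proof -
  have "pole_bound (m - n) (\<lambda>z. 1)"
  proof (rule pole_boundI[of 1 _ _ 1])
    fix z :: complex assume "cmod z < 1"
    then show "cmod (z ^ (m - n) * 1) \<le> 1" by (simp add: norm_power power_le_one)
  qed simp
  from pole_bound_mult[OF this assms(1)] show ?thesis using assms(2) by simp
qed

lemma pole_bound_sum:
  "finite I \<Longrightarrow> (\<And>i. i \<in> I \<Longrightarrow> pole_bound n (f i)) \<Longrightarrow> pole_bound n (\<lambda>z. \<Sum>i\<in>I. f i z)"
proof (induction I rule: finite_induct)
  case empty
  show ?case using pole_bound_mono[OF pole_bound_const[of 0], of n] by simp
next
  case (insert i I)
  then have "pole_bound n (f i)" "pole_bound n (\<lambda>z. \<Sum>i\<in>I. f i z)" by auto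
  from pole_bound_add[OF this] show ?case using insert.hyps by simp
qed

lemma pole_bound_compose_rho:
  assumes "pole_bound n f" shows "pole_bound n (\<lambda>z. f (eq_rho ^ j * z))"
proof -
  obtain B \<epsilon> where f: "\<epsilon> > 0" "\<And>z. z \<noteq> 0 \<Longrightarrow> cmod z < \<epsilon> \<Longrightarrow> cmod (z ^ n * f z) \<le> B"
    using assms unfolding pole_bound_def by blast
  show ?thesis
  proof (rule pole_boundI[OF f(1), of _ _ B])
    fix z :: complex assume z: "z \<noteq> 0" "cmod z < \<epsilon>"
    have r: "eq_rho \<noteq> 0" using norm_eq_rho by force
    have "cmod ((eq_rho ^ j * z) ^ n * f (eq_rho ^ j * z)) \<le> B"
      by (rule f(2)) (use z r in \<open>auto simp: norm_mult norm_power norm_eq_rho\<close>)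
    then show "cmod (z ^ n * f (eq_rho ^ j * z)) \<le> B"
      by (simp add: norm_mult norm_power norm_eq_rho)
  qed
qed

lemma pole_bound_rot_part: "pole_bound n f \<Longrightarrow> pole_bound n (rot_part k f)"
proof -
  assume f: "pole_bound n f"
  have "pole_bound n (\<lambda>z. (1 / 6) * (\<Sum>j<6. eq_rho ^ (j * (6 - k mod 6)) * f (eq_rho ^ j * z)))"
    by (intro pole_bound_cmult pole_bound_sum pole_bound_compose_rho f) simp
  then show ?thesis by (simp add: rot_part_def[abs_def])
qed

lemma rot_type_rot_part: "rot_type k (rot_part k f)"
  unfolding rot_type_def
proof
  fix z
  define c where "c = 6 - k mod 6"
  define g where "g j = eq_rho ^ (j * c) * f (eq_rho ^ j * z)" for j
  have kc: "eq_rho ^ (k + c) = 1"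
  proof -
    have "k + c = 6 * (k div 6) + 6" using mult_div_mod_eq[of 6 k] unfolding c_def by linarith
    then show ?thesis by (simp only: eq_rho_pow_eq_1_iff) simp
  qed
  have step: "eq_rho ^ (j * c) * f (eq_rho ^ j * (eq_rho * z)) = eq_rho ^ k * g (Suc j)" for j
  proof -
    have "eq_rho ^ k * g (Suc j) = eq_rho ^ (k + c) * (eq_rho ^ (j * c) * f (eq_rho ^ Suc j * z))"
      by (simp add: g_def power_add mult_ac)
    then show ?thesis unfolding kc by (simp add: mult_ac)
  qed
  have rp: "rot_part k f w = (\<Sum>j<6. eq_rho ^ (j * c) * f (eq_rho ^ j * w)) / 6" for w
    by (simp only: rot_part_def c_def)
  have 1: "rot_part k f (eq_rho * z) = eq_rho ^ k * (\<Sum>j<6. g (Suc j)) / 6"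
    unfolding rp step by (simp only: sum_distrib_left)
  have g60: "g 6 = g 0" by (simp add: g_def eq_rho_pow6 power_mult)
  have 2: "(\<Sum>j<6. g (Suc j)) = (\<Sum>j<6. g j)"
    using sum.lessThan_Suc_shift[of g 6] sum.lessThan_Suc[of g 6] g60 by (metis add.commute add_left_cancel)
  show "rot_part k f (eq_rho * z) = eq_rho ^ k * rot_part k f z"
    by (simp only: 1 2) (simp only: rp g_def times_divide_eq_right)
qed

lemma sum_rot_part: "(\<Sum>k<6. rot_part k f z) = f z"
proof -
  have roots: "(\<Sum>k<6. eq_rho ^ (j * (6 - k mod 6))) = (if j = 0 then 6 else 0)" if "j < 6" for j
  proof (cases "j = 0")
    case False
    have "\<not> 6 dvd j" using False that by (metis dvd_imp_le not_gr_zero not_le)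
    then have ne: "eq_rho ^ j \<noteq> 1" by (simp add: eq_rho_pow_eq_1_iff)
    have "(\<Sum>k<6. eq_rho ^ (j * (6 - k mod 6))) = (\<Sum>k<6. (eq_rho ^ j) ^ Suc (6 - Suc k))"
    proof (rule sum.cong[OF refl])
      fix k :: nat assume "k \<in> {..<6}"
      then have "6 - k mod 6 = Suc (6 - Suc k)" by simp
      then show "eq_rho ^ (j * (6 - k mod 6)) = (eq_rho ^ j) ^ Suc (6 - Suc k)"
        by (simp only: power_mult)
    qed
    also have "\<dots> = (\<Sum>k<6. (eq_rho ^ j) ^ Suc k)"
      by (rule sum.nat_diff_reindex)
    also have "\<dots> = eq_rho ^ j * (\<Sum>k<6. (eq_rho ^ j) ^ k)"
      by (simp only: sum_distrib_left power_Suc)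
    also have "(\<Sum>k<6. (eq_rho ^ j) ^ k) = ((eq_rho ^ j) ^ 6 - 1) / (eq_rho ^ j - 1)"
      by (rule geometric_sum[OF ne])
    also have "(eq_rho ^ j) ^ 6 = 1"
      by (simp only: power_mult[symmetric] eq_rho_pow_eq_1_iff dvd_triv_right)
    finally show ?thesis using False by simp
  qed simp
  have "(\<Sum>k<6. rot_part k f z) = (\<Sum>k<6. \<Sum>j<6. eq_rho ^ (j * (6 - k mod 6)) * f (eq_rho ^ j * z)) / 6"
    by (simp add: rot_part_def sum_divide_distrib)
  also have "\<dots> = (\<Sum>j<6. (\<Sum>k<6. eq_rho ^ (j * (6 - k mod 6))) * f (eq_rho ^ j * z)) / 6"
    by (subst sum.swap) (simp add: sum_distrib_right)
  also have "\<dots> = (\<Sum>j<6. (if j = 0 then 6 else 0) * f (eq_rho ^ j * z)) / 6"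
    by (intro arg_cong2[of _ _ _ _ "(/)"] sum.cong refl) (simp only: roots lessThan_iff)
  also have "\<dots> = f z"
    by (simp add: sum.remove[of "{..<6}" "0::nat"])
  finally show ?thesis .
qed

text \<open>
  Riemann's theorem on removable singularities.
\<close>

lemma pole_bound_extend:
  assumes f: "elliptic f" and b: "pole_bound n f"
  shows "\<exists>g. g holomorphic_on ball 0 1 \<and> (\<forall>z. z \<noteq> 0 \<longrightarrow> cmod z < 1 \<longrightarrow> g z = z ^ n * f z)"
proof -
  obtain B \<epsilon> where B: "\<epsilon> > 0" "\<And>z. z \<noteq> 0 \<Longrightarrow> cmod z < \<epsilon> \<Longrightarrow> cmod (z ^ n * f z) \<le> B"
    using b unfolding pole_bound_def by blast
  have hol: "(\<lambda>z. z ^ n * f z) holomorphic_on ball 0 1 - {0}"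
    by (intro holomorphic_intros holomorphic_on_subset[OF elliptic_holD[OF f]])
      (use punctured_disc_compl_Lat in auto)
  have "eventually (\<lambda>z. cmod (z ^ n * f z) \<le> B) (at 0)"
    unfolding eventually_at using B by (intro exI[of _ \<epsilon>]) (auto simp: dist_norm)
  then have "\<exists>g. g holomorphic_on ball 0 1 \<and> (\<forall>z\<in>ball 0 1 - {0}. g z = z ^ n * f z)"
    using holomorphic_on_extend_bounded[OF hol] by auto
  then obtain g where "g holomorphic_on ball 0 1" "\<forall>z\<in>ball 0 1 - {0}. g z = z ^ n * f z" by blast
  then show ?thesis by (intro exI[of _ g]) auto
qed

lemma pole_bound_limit:
  assumes f: "elliptic f" and b: "pole_bound n f"
  obtains L where "((\<lambda>z. z ^ n * f z) \<longlongrightarrow> L) (at 0)"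
proof -
  obtain g where g: "g holomorphic_on ball 0 1" "\<And>z. z \<noteq> 0 \<Longrightarrow> cmod z < 1 \<Longrightarrow> g z = z ^ n * f z"
    using pole_bound_extend[OF f b] by blast
  have "isCont g 0"
    using holomorphic_on_imp_continuous_on[OF g(1)] by (simp add: continuous_on_eq_continuous_at)
  then have "(g \<longlongrightarrow> g 0) (at 0)" by (simp add: isCont_def)
  then have "((\<lambda>z. z ^ n * f z) \<longlongrightarrow> g 0) (at 0)"
    by (rule Lim_transform_eventually)
      (auto simp: eventually_at dist_norm g(2) intro!: exI[of _ 1])
  then show thesis by (rule that)
qed

lemma pole_bound_lower:
  assumes f: "elliptic f" and b: "pole_bound (Suc n) f" and L: "((\<lambda>z. z ^ Suc n * f z) \<longlongrightarrow> 0) (at 0)"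
  shows "pole_bound n f"
proof -
  obtain g where g: "g holomorphic_on ball 0 1" "\<And>z. z \<noteq> 0 \<Longrightarrow> cmod z < 1 \<Longrightarrow> g z = z ^ Suc n * f z"
    using pole_bound_extend[OF f b] by blast
  have "isCont g 0"
    using holomorphic_on_imp_continuous_on[OF g(1)] by (simp add: continuous_on_eq_continuous_at)
  then have 1: "(g \<longlongrightarrow> g 0) (at 0)" by (simp add: isCont_def)
  have 2: "(g \<longlongrightarrow> 0) (at 0)"
    by (rule Lim_transform_eventually[OF L])
      (auto simp: eventually_at dist_norm g(2) intro!: exI[of _ 1])
  have g0: "g 0 = 0" by (rule tendsto_unique[OF trivial_limit_at 1 2])
  define k where "k z = (if z = 0 then deriv g 0 else (g z - g 0) / (z - 0))" for z
  have "k holomorphic_on ball 0 1"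
    unfolding k_def[abs_def] by (rule pole_lemma_open[OF g(1) open_ball])
  then have "continuous_on (cball 0 (1/2)) k"
    by (intro continuous_on_subset[OF holomorphic_on_imp_continuous_on]) auto
  then have "bounded (k ` cball 0 (1/2))"
    by (intro compact_imp_bounded compact_continuous_image compact_cball)
  then obtain B where B0: "\<forall>x\<in>k ` cball 0 (1/2). cmod x \<le> B"
    unfolding bounded_iff by blast
  have B: "cmod (k z) \<le> B" if "cmod z \<le> 1/2" for z using B0 that by simp
  show ?thesis
  proof (rule pole_boundI[of "1/2" _ _ B])
    fix z :: complex assume z: "z \<noteq> 0" "cmod z < 1/2"
    have "k z = z ^ n * f z" using z g(2)[of z] by (simp add: k_def g0)
    then show "cmod (z ^ n * f z) \<le> B" using B[of z] z by simp
  qed simp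
qed

text \<open>
  Liouville's theorem for doubly periodic functions.
\<close>

lemma elliptic_bounded_const:
  assumes f: "elliptic f" and b: "pole_bound 0 f"
  shows "\<exists>c. \<forall>z. z \<notin> Lat \<longrightarrow> f z = c"
proof -
  obtain g where g: "g holomorphic_on ball 0 1" "\<And>z. z \<noteq> 0 \<Longrightarrow> cmod z < 1 \<Longrightarrow> g z = z ^ 0 * f z"
    using pole_bound_extend[OF f b] by blast
  define F where "F z = (if z \<in> Lat then g 0 else f z)" for z
  have Fper: "F (z + l) = F z" if "l \<in> Lat" for z l
    using that elliptic_perD[OF f] by (simp add: F_def)
  have F0: "F z = g z" if "cmod z < 1" for z
    using that g(2) punctured_disc_compl_Lat[of z] by (cases "z = 0") (auto simp: F_def)
  have diff: "F field_differentiable at z" for z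
  proof (cases "z \<in> Lat")
    case False
    have "F holomorphic_on - Lat"
      by (rule holomorphic_transform[OF elliptic_holD[OF f]]) (simp add: F_def)
    then show ?thesis using False open_compl_Lat holomorphic_on_imp_differentiable_at by blast
  next
    case True
    have "F holomorphic_on ball 0 1" by (rule holomorphic_transform[OF g(1)]) (simp add: F0)
    then have "F field_differentiable at 0" using holomorphic_on_imp_differentiable_at[of F "ball 0 1" 0] by simp
    then obtain d where "(F has_field_derivative d) (at 0)" by (auto simp: field_differentiable_def)
    then have "((\<lambda>w. F (w + (- z))) has_field_derivative d) (at z)"
      using DERIV_shift[of F d z "- z"] by simp
    moreover have "(\<lambda>w. F (w + (- z))) = F" using Fper[of "- z"] True by auto
    ultimately show ?thesis by (auto simp: field_differentiable_def)
  qed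
  then have hol: "F holomorphic_on UNIV" by (simp add: holomorphic_on_def field_differentiable_at_within)
  have "bounded (range F)"
  proof -
    define K where "K = cball (0::complex) 3"
    have "compact (F ` K)"
      unfolding K_def
      by (intro compact_continuous_image compact_cball continuous_on_subset[OF holomorphic_on_imp_continuous_on[OF hol]]) auto
    moreover have "range F \<subseteq> F ` K"
    proof clarify
      fix z
      obtain l where l: "l \<in> Lat" "z + l \<in> fundamental_domain eq_tau" using Lat_reduce by blast
      then have "\<bar>Re (z + l)\<bar> \<le> 2" "\<bar>Im (z + l)\<bar> \<le> 1"
      proof -
        obtain s t where st: "z + l = of_real s + of_real t * eq_tau" "0 \<le> s" "s < 1" "0 \<le> t" "t < 1"
          using l(2) by (auto simp: fundamental_domain_def)
        have "cell_h < 1/2" using cell_h_bounds by simp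
        then have "sqrt 3 / 2 \<le> 1" by (simp add: cell_h_def)
        then have "t * (sqrt 3 / 2) \<le> 1 * 1" using st by (intro mult_mono) auto
        then show "\<bar>Re (z + l)\<bar> \<le> 2" "\<bar>Im (z + l)\<bar> \<le> 1" using st by (auto simp: eq_tau_Complex abs_le_iff)
      qed
      then have "cmod (z + l) \<le> 3" using cmod_le[of "z + l"] by linarith
      then have "F (z + l) \<in> F ` K" by (simp add: K_def)
      then show "F z \<in> F ` K" using Fper[OF l(1)] by simp
    qed
    ultimately show ?thesis using compact_imp_bounded bounded_subset by blast
  qed
  then obtain c where c: "\<And>z. F z = c"
    using Liouville_theorem[OF hol] by (auto simp: constant_on_def)
  have "f z = c" if "z \<notin> Lat" for z using c[of z] that by (simp add: F_def)
  then show ?thesis by blast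
qed

lemma rot_type_pow: "rot_type k f \<Longrightarrow> f (eq_rho ^ j * z) = eq_rho ^ (j * k) * f z"
proof (induction j)
  case (Suc j)
  have "f (eq_rho ^ Suc j * z) = f (eq_rho * (eq_rho ^ j * z))" by (simp add: mult.assoc)
  also have "\<dots> = eq_rho ^ k * f (eq_rho ^ j * z)" using Suc.prems by (simp add: rot_type_def)
  finally show ?case using Suc by (simp add: power_add)
qed simp

text \<open>
  Substituting \<open>eq_rho * z\<close> for \<open>z\<close> multiplies the limit by \<open>eq_rho ^ (n + k)\<close>.
\<close>

lemma rot_type_limit_0:
  assumes k: "rot_type k f" and L: "((\<lambda>z. z ^ n * f z) \<longlongrightarrow> L) (at 0)" and nd: "\<not> 6 dvd (n + k)"
  shows "L = 0"
proof -
  have r0: "eq_rho \<noteq> 0" using norm_eq_rho by force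
  have "filterlim (\<lambda>z. eq_rho * z) (at 0) (at 0)"
  proof -
    have "((\<lambda>z. eq_rho * z) \<longlongrightarrow> eq_rho * 0) (at 0)" by (intro tendsto_intros)
    then show ?thesis
      unfolding filterlim_at using r0 by (auto simp: eventually_at intro!: exI[of _ 1])
  qed
  from filterlim_compose[OF L this]
  have "((\<lambda>z. (eq_rho * z) ^ n * f (eq_rho * z)) \<longlongrightarrow> L) (at 0)" .
  moreover have "(\<lambda>z. (eq_rho * z) ^ n * f (eq_rho * z)) = (\<lambda>z. eq_rho ^ (n + k) * (z ^ n * f z))"
    using k by (auto simp: rot_type_def power_mult_distrib power_add mult_ac)
  ultimately have 1: "((\<lambda>z. eq_rho ^ (n + k) * (z ^ n * f z)) \<longlongrightarrow> L) (at 0)" by simp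
  have 2: "((\<lambda>z. eq_rho ^ (n + k) * (z ^ n * f z)) \<longlongrightarrow> eq_rho ^ (n + k) * L) (at 0)"
    by (intro tendsto_intros L)
  have "eq_rho ^ (n + k) * L = L"
    by (rule tendsto_unique[OF trivial_limit_at 2 1])
  then show ?thesis using nd eq_rho_pow_eq_1_iff[of "n + k"] by auto
qed

lemma rot_type_pole_lower:
  assumes f: "elliptic f" and k: "rot_type k f" and b: "pole_bound (Suc n) f" and nd: "\<not> 6 dvd (Suc n + k)"
  shows "pole_bound n f"
proof -
  obtain L where L: "((\<lambda>z. z ^ Suc n * f z) \<longlongrightarrow> L) (at 0)" by (rule pole_bound_limit[OF f b])
  have "L = 0" by (rule rot_type_limit_0[OF k L nd])
  then show ?thesis using pole_bound_lower[OF f b] L by simp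
qed

lemma rot_type_bounded_zero:
  assumes f: "elliptic f" and k: "rot_type k f" and b: "pole_bound 0 f" and nd: "\<not> 6 dvd k" and z: "z \<notin> Lat"
  shows "f z = 0"
proof -
  obtain c where c: "\<And>z. z \<notin> Lat \<Longrightarrow> f z = c" using elliptic_bounded_const[OF f b] by blast
  have "((\<lambda>z. z ^ 0 * f z) \<longlongrightarrow> c) (at 0)"
    by (rule tendsto_eventually)
      (auto simp: eventually_at dist_norm c punctured_disc_compl_Lat intro!: exI[of _ 1])
  from rot_type_limit_0[OF k this] nd have "c = 0" by simp
  then show ?thesis using c[OF z] by simp
qed

text \<open>
  The leading coefficient of a simple pole is the residue.
\<close>

lemma elliptic_simple_pole_bounded:
  assumes f: "elliptic f" and b: "pole_bound 1 f"
  shows "pole_bound 0 f"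
proof -
  obtain L where L: "((\<lambda>z. z ^ 1 * f z) \<longlongrightarrow> L) (at 0)" by (rule pole_bound_limit[OF f b])
  have "residue f 0 = L"
  proof (rule residue_simple'[of "ball 0 1" 0 f L])
    show "f holomorphic_on ball 0 1 - {0}"
      by (rule holomorphic_on_subset[OF elliptic_holD[OF f]]) (use punctured_disc_compl_Lat in auto)
    show "((\<lambda>w. f w * (w - 0)) \<longlongrightarrow> L) (at 0)" using L by (simp add: mult.commute)
  qed auto
  then have "L = 0" using elliptic_residue_0[OF f] by simp
  then show ?thesis using pole_bound_lower[of f 0] f b L by simp
qed

lemma rot_type_mult: "rot_type k f \<Longrightarrow> rot_type m g \<Longrightarrow> rot_type (k + m) (\<lambda>z. f z * g z)"
  by (simp add: rot_type_def power_add mult_ac)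

lemma rot_type_add: "rot_type k f \<Longrightarrow> rot_type k g \<Longrightarrow> rot_type k (\<lambda>z. f z + g z)"
  by (simp add: rot_type_def algebra_simps)

lemma rot_type_diff: "rot_type k f \<Longrightarrow> rot_type k g \<Longrightarrow> rot_type k (\<lambda>z. f z - g z)"
  by (simp add: rot_type_def algebra_simps)

lemma rot_type_cmult: "rot_type k f \<Longrightarrow> rot_type k (\<lambda>z. c * f z)"
  by (simp add: rot_type_def algebra_simps)

lemma rot_type_sum: "(\<And>i. i \<in> I \<Longrightarrow> rot_type k (f i)) \<Longrightarrow> rot_type k (\<lambda>z. \<Sum>i\<in>I. f i z)"
  by (simp add: rot_type_def sum_distrib_left)

lemma rot_type_cong: "rot_type k f \<Longrightarrow> k mod 6 = m mod 6 \<Longrightarrow> rot_type m f"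
proof -
  assume f: "rot_type k f" and km: "k mod 6 = m mod 6"
  have "eq_rho ^ n = eq_rho ^ (n mod 6)" for n
  proof -
    have "eq_rho ^ n = eq_rho ^ (6 * (n div 6) + n mod 6)" by simp
    also have "\<dots> = (eq_rho ^ 6) ^ (n div 6) * eq_rho ^ (n mod 6)"
      by (simp only: power_add power_mult)
    finally show ?thesis by (simp add: eq_rho_pow6)
  qed
  then have "eq_rho ^ k = eq_rho ^ m" using km by metis
  then show "rot_type m f" using f by (simp add: rot_type_def)
qed

lemma rot_part_of_type:
  assumes "rot_type m f" "m < 6" "k < 6"
  shows "rot_part k f z = (if k = m then f z else 0)"
proof -
  have summand: "eq_rho ^ (j * c) * f (eq_rho ^ j * z) = (eq_rho ^ (c + m)) ^ j * f z" for j c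
    unfolding rot_type_pow[OF assms(1)]
    by (simp add: power_mult[symmetric] power_add[symmetric] algebra_simps)
  have "rot_part k f z = (\<Sum>j<6. (eq_rho ^ (6 - k + m)) ^ j) * f z / 6"
    unfolding rot_part_def summand using assms(3) by (simp add: sum_distrib_right)
  moreover have "(\<Sum>j<6. (eq_rho ^ (6 - k + m)) ^ j) = (if k = m then 6 else 0)"
  proof (cases "k = m")
    case True
    then have "6 - k + m = 6" using assms by simp
    then show ?thesis using True by (simp add: eq_rho_pow6)
  next
    case False
    have "\<not> 6 dvd (6 - k + m)"
    proof
      assume "6 dvd (6 - k + m)"
      then obtain q where "6 - k + m = 6 * q" by blast
      then show False using assms \<open>k \<noteq> m\<close> by presburger
    qed
    then have ne: "eq_rho ^ (6 - k + m) \<noteq> 1" by (simp add: eq_rho_pow_eq_1_iff)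
    have "(eq_rho ^ (6 - k + m)) ^ 6 = 1"
      by (simp only: power_mult[symmetric] eq_rho_pow_eq_1_iff dvd_triv_right)
    then show ?thesis using geometric_sum[OF ne, of 6] False by simp
  qed
  ultimately show ?thesis by (cases "k = m") (simp_all only: if_True if_False, simp_all)
qed

section \<open>Poles of order at most four and periods\<close>

lemma rot_type_descend:
  assumes "elliptic f" "rot_type k f" "pole_bound n f" "\<And>m. 0 < m \<Longrightarrow> m \<le> n \<Longrightarrow> \<not> 6 dvd (m + k)"
  shows "pole_bound 0 f"
  using assms(3,4)
proof (induction n)
  case (Suc n)
  have "pole_bound n f"
    by (rule rot_type_pole_lower[OF assms(1,2) Suc.prems(1)]) (use Suc.prems(2)[of "Suc n"] in simp)
  then show ?case using Suc by simp
qed simp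

text \<open>
  If \<open>n + k = 6\<close> then below the order \<open>n\<close> no pole and no constant term of type \<open>k\<close> is possible, so an elliptic
  function of type \<open>k\<close> with pole order at most \<open>n\<close> is determined by its leading coefficient. For
  \<open>(n, k) = (2, 4), (3, 3), (4, 2)\<close> the function \<open>P\<close> is a multiple of the Weierstrass function and its first two
  derivatives; here it is obtained as a multiple of a member of the family.
\<close>

lemma rot_type_leading_term:
  fixes T :: "'k \<Rightarrow> complex \<Rightarrow> complex"
  assumes T: "\<And>j. elliptic (T j)" "\<And>j. rot_type k (T j)" "\<And>j. pole_bound n (T j)"
    and nk: "n + k = 6" "0 < n" "0 < k"
  shows "\<exists>L P. (\<forall>j. ((\<lambda>z. z ^ n * T j z) \<longlongrightarrow> L j) (at 0)) \<and> (\<forall>z j. z \<notin> Lat \<longrightarrow> T j z = L j * P z)"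
proof -
  have "\<exists>L. ((\<lambda>z. z ^ n * T j z) \<longlongrightarrow> L) (at 0)" for j
    using pole_bound_limit[OF T(1,3)] by blast
  then obtain L where L: "\<And>j. ((\<lambda>z. z ^ n * T j z) \<longlongrightarrow> L j) (at 0)" by metis
  obtain n' where n': "n = Suc n'" using nk(2) by (cases n) auto
  have vanish: "g z = 0" if g: "elliptic g" "rot_type k g" "pole_bound n g" "((\<lambda>z. z ^ n * g z) \<longlongrightarrow> 0) (at 0)"
    and z: "z \<notin> Lat" for g z
  proof -
    have "pole_bound n' g" using pole_bound_lower[OF g(1), of n'] g(3,4) by (simp only: n')
    moreover have "\<not> 6 dvd (m + k)" if "0 < m" "m \<le> n'" for m
    proof
      assume "6 dvd (m + k)"
      then have "6 \<le> m + k" using that by (intro dvd_imp_le) auto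
      then show False using that nk(1) n' by simp
    qed
    ultimately have b: "pole_bound 0 g" by (rule rot_type_descend[OF g(1,2)])
    have "\<not> 6 dvd k"
    proof
      assume "6 dvd k"
      then have "6 \<le> k" using nk(3) by (rule dvd_imp_le)
      then show False using nk by simp
    qed
    then show ?thesis by (rule rot_type_bounded_zero[OF g(1,2) b _ z])
  qed
  show ?thesis
  proof (cases "\<exists>i. L i \<noteq> 0")
    case True
    then obtain i where i: "L i \<noteq> 0" by blast
    have "T j z = L j * (T i z / L i)" if z: "z \<notin> Lat" for j z
    proof -
      let ?g = "\<lambda>z. L i * T j z - L j * T i z"
      have "((\<lambda>z. L i * (z ^ n * T j z) - L j * (z ^ n * T i z)) \<longlongrightarrow> L i * L j - L j * L i) (at 0)"
        by (intro tendsto_intros L)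
      then have lim: "((\<lambda>z. z ^ n * ?g z) \<longlongrightarrow> 0) (at 0)" by (simp add: algebra_simps)
      have "?g z = 0"
        by (rule vanish[OF _ _ _ lim z])
          (intro elliptic_diff elliptic_mult elliptic_const T rot_type_diff rot_type_cmult pole_bound_diff pole_bound_cmult)+
      then show ?thesis using i by (simp add: field_simps)
    qed
    then show ?thesis using L by (intro exI[of _ L] exI[of _ "\<lambda>z. T i z / L i"]) blast
  next
    case False
    then have "T j z = 0" if "z \<notin> Lat" for j z
      by (intro vanish T that) (use L[of j] in simp)
    then show ?thesis using L by (intro exI[of _ L] exI[of _ "\<lambda>z. 0"]) simp
  qed
qed

text \<open>
  Integrate the derivative along the ray from the circle of radius \<open>\<delta>\<close>. The bound obtained for \<open>Q\<close> is
  not the best one, but it suffices for a reduction by rotation type.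
\<close>

lemma deriv_pole_bound:
  assumes Q: "elliptic Q" and b: "pole_bound 2 (deriv Q)"
  shows "pole_bound 2 Q"
proof -
  obtain B \<epsilon> where B: "\<epsilon> > 0" "\<And>z. z \<noteq> 0 \<Longrightarrow> cmod z < \<epsilon> \<Longrightarrow> cmod (z ^ 2 * deriv Q z) \<le> B"
    using b unfolding pole_bound_def by blast
  define \<delta> where "\<delta> = min \<epsilon> 1 / 2"
  have \<delta>: "\<delta> > 0" "\<delta> < \<epsilon>" "\<delta> < 1" using B(1) by (auto simp: \<delta>_def)
  have sph: "sphere 0 \<delta> \<subseteq> - Lat" using \<delta> punctured_disc_compl_Lat by auto
  have "bounded (Q ` sphere 0 \<delta>)"
    by (intro compact_imp_bounded compact_continuous_image compact_sphere
        continuous_on_subset[OF holomorphic_on_imp_continuous_on[OF elliptic_holD[OF Q]] sph])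
  then obtain M where M: "\<And>w. w \<in> sphere 0 \<delta> \<Longrightarrow> cmod (Q w) \<le> M" unfolding bounded_iff by blast
  show ?thesis
  proof (rule pole_boundI[OF \<delta>(1), of _ _ "B + M"])
    fix z :: complex assume z: "z \<noteq> 0" "cmod z < \<delta>"
    define w where "w = (\<delta> / cmod z) *\<^sub>R z"
    have w: "w \<in> sphere 0 \<delta>" using z \<delta> by (simp add: w_def)
    have seg: "cmod z \<le> cmod p \<and> cmod p \<le> \<delta>" if p: "p \<in> closed_segment z w" for p
    proof -
      obtain u where u: "0 \<le> u" "u \<le> 1" "p = (1 - u) *\<^sub>R z + u *\<^sub>R w"
        using p by (auto simp: in_segment)
      have "p = ((1 - u) + u * (\<delta> / cmod z)) *\<^sub>R z"
        by (simp add: u(3) w_def algebra_simps)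
      moreover have nn: "0 \<le> (1 - u) + u * (\<delta> / cmod z)" using u z \<delta> by simp
      ultimately have "cmod p = ((1 - u) + u * (\<delta> / cmod z)) * cmod z" by simp
      also have "\<dots> = (1 - u) * cmod z + u * \<delta>" using z by (simp add: distrib_right)
      finally have cp: "cmod p = (1 - u) * cmod z + u * \<delta>" .
      have "u * cmod z \<le> u * \<delta>" "(1 - u) * cmod z \<le> (1 - u) * \<delta>" using u z by (auto intro!: mult_left_mono)
      then show ?thesis unfolding cp by (simp add: algebra_simps)
    qed
    have bd: "cmod (Q z - Q w) \<le> B / (cmod z)\<^sup>2 * cmod (z - w)"
    proof (rule field_differentiable_bound[of "closed_segment z w" Q "deriv Q"])
      fix p assume p: "p \<in> closed_segment z w"
      have p0: "p \<noteq> 0" "cmod p < \<epsilon>" "cmod p < 1" using seg[OF p] z \<delta> by auto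
      then have "p \<in> - Lat" using punctured_disc_compl_Lat by simp
      then show "(Q has_field_derivative deriv Q p) (at p within closed_segment z w)"
        using holomorphic_derivI[OF elliptic_holD[OF Q] open_compl_Lat] by (blast intro: has_field_derivative_at_within)
      have "(cmod z)\<^sup>2 * cmod (deriv Q p) \<le> (cmod p)\<^sup>2 * cmod (deriv Q p)"
        using seg[OF p] by (intro mult_right_mono power_mono) auto
      also have "\<dots> \<le> B" using B(2)[OF p0(1,2)] by (simp add: norm_mult norm_power)
      finally show "cmod (deriv Q p) \<le> B / (cmod z)\<^sup>2" using z by (simp add: field_simps)
    qed auto
    have B0: "B \<ge> 0" using B(2)[of z] z \<delta> norm_ge_zero order_trans by (meson less_trans)
    have "z - w = (1 - \<delta> / cmod z) *\<^sub>R z" by (simp add: w_def algebra_simps)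
    then have "cmod (z - w) = \<bar>1 - \<delta> / cmod z\<bar> * cmod z" by simp
    also have "\<dots> = \<bar>(1 - \<delta> / cmod z) * cmod z\<bar>" by (simp only: abs_mult abs_norm_cancel)
    also have "(1 - \<delta> / cmod z) * cmod z = cmod z - \<delta>" using z by (simp add: left_diff_distrib)
    also have "\<bar>cmod z - \<delta>\<bar> \<le> 1" using z \<delta> norm_ge_zero[of z] by linarith
    finally have zw: "cmod (z - w) \<le> 1" .
    have z2: "(cmod z)\<^sup>2 \<le> 1" using z \<delta> by (simp add: power_le_one)
    have "(cmod z)\<^sup>2 * cmod (Q z - Q w) \<le> (cmod z)\<^sup>2 * (B / (cmod z)\<^sup>2 * cmod (z - w))"
      using bd by (intro mult_left_mono) auto
    also have "\<dots> = B * cmod (z - w)" using z by simp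
    also have "\<dots> \<le> B * 1" using zw B0 by (intro mult_left_mono)
    finally have 1: "(cmod z)\<^sup>2 * cmod (Q z - Q w) \<le> B" by simp
    have 2: "(cmod z)\<^sup>2 * cmod (Q w) \<le> 1 * M"
      using z2 M[OF w] by (intro mult_mono) auto
    have "(cmod z)\<^sup>2 * cmod (Q z) \<le> (cmod z)\<^sup>2 * (cmod (Q z - Q w) + cmod (Q w))"
      using norm_triangle_ineq[of "Q z - Q w" "Q w"] by (intro mult_left_mono) auto
    then show "cmod (z ^ 2 * Q z) \<le> B + M" using 1 2 by (simp add: norm_mult norm_power distrib_left)
  qed
qed

lemma constant_on_compl_Lat:
  assumes "\<And>z. z \<notin> Lat \<Longrightarrow> (f has_field_derivative 0) (at z)"
  shows "\<exists>c. \<forall>z. z \<notin> Lat \<longrightarrow> f z = c"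
proof -
  have "f constant_on - Lat"
    by (rule has_field_derivative_0_imp_constant_on[OF _ connected_compl_Lat open_compl_Lat]) (use assms in auto)
  then show ?thesis by (auto simp: constant_on_def)
qed

lemma eq_rho_nonzero: "eq_rho \<noteq> 0" using norm_eq_rho by force

lemma compl_Lat_half: "complex_of_real (1/2) \<notin> Lat"
  by (rule punctured_disc_compl_Lat) (simp_all add: norm_divide)

lemma cnj_eq_rho_pow: "cnj (eq_rho ^ (j * 5)) = eq_rho ^ j"
proof -
  have "cnj eq_rho = eq_rho ^ 5"
  proof -
    have "eq_rho ^ 5 * eq_rho = eq_rho ^ (5 + 1)" by (simp only: power_add power_one_right)
    then have "eq_rho ^ 5 * eq_rho = 1" using eq_rho_pow6 by simp
    moreover have "cnj eq_rho * eq_rho = 1"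
      using complex_norm_square[of eq_rho] norm_eq_rho by (simp add: mult.commute)
    ultimately show ?thesis using eq_rho_nonzero by (metis mult_right_cancel)
  qed
  then have "cnj (eq_rho ^ (j * 5)) = (eq_rho ^ 5) ^ (j * 5)" by simp
  also have "\<dots> = (eq_rho ^ 6) ^ (j * 4) * eq_rho ^ j"
    by (simp only: power_mult[symmetric] power_add[symmetric]) (simp add: algebra_simps)
  finally show ?thesis by (simp add: eq_rho_pow6)
qed

text \<open>
  Here the periods enter. The real part of \<open>\<integral> \<phi> dz\<close> is single-valued, so in its part of type 1 the periods
  contributed by \<open>a\<close>, of type 0, and by \<open>b P\<close>, of type 4, must cancel. The type-4 part has a primitive that changes by
  \<open>- cnj (a j * l) / 2\<close> under a lattice vector \<open>l\<close>. The primitives for two indices \<open>i, k\<close>, weighted by \<open>b k\<close>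
  and \<open>b i\<close>, have the same derivative and, being of type 5, no room for a constant; comparing their periods gives
  \<open>b i * cnj (a k) = b k * cnj (a i)\<close>. Multiplying by \<open>a i\<close> and summing over \<open>i\<close>, \<open>a \<bullet> b = 0\<close> yields \<open>b = 0\<close> or
  \<open>a = 0\<close>.
  If \<open>b = 0\<close> then the primitive is zero and its period gives \<open>a = 0\<close>. If \<open>a = 0\<close> then the primitive is elliptic of type
  5 with at most a double pole, hence zero, and \<open>b = 0\<close>.
\<close>

lemma harmonic_primitive_constraint:
  fixes f :: "complex \<Rightarrow> real^4" and \<phi> :: "4 \<Rightarrow> complex \<Rightarrow> complex" and a b :: "4 \<Rightarrow> complex"
  assumes ell: "\<And>j. elliptic (\<phi> j)"
    and per: "\<And>z l. l \<in> Lat \<Longrightarrow> f (z + l) = f z"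
    and der: "\<And>z. z \<notin> Lat \<Longrightarrow> (f has_derivative (\<lambda>v. \<chi> j. Re (\<phi> j z * v))) (at z)"
    and T0: "\<And>j z. z \<notin> Lat \<Longrightarrow> rot_part 0 (\<phi> j) z = a j"
    and T4: "\<And>j z. z \<notin> Lat \<Longrightarrow> rot_part 4 (\<phi> j) z = b j * P z"
    and T4lim: "\<And>j. ((\<lambda>z. z ^ 2 * rot_part 4 (\<phi> j) z) \<longlongrightarrow> b j) (at 0)"
    and T4b: "\<And>j. pole_bound 2 (rot_part 4 (\<phi> j))"
    and ab: "(\<Sum>j\<in>UNIV. a j * b j) = 0"
  shows "a j = 0 \<and> b j = 0"
proof -
  define F where "F j z = complex_of_real (f z $ j)" for j z
  \<comment> \<open>The type-1 part of the periodic function \<open>F j\<close> has differential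
    \<open>(a j dz + cnj (T4 dz)) / 2\<close>, so \<open>Q j\<close> is a holomorphic primitive of \<open>T4 / 2\<close>.\<close>
  define Y where "Y j = rot_part 1 (F j)" for j
  define Q where "Q j z = cnj (Y j z - a j * z / 2)" for j z
  have dF: "(F j has_derivative (\<lambda>v. (\<phi> j z * v + cnj (\<phi> j z * v)) / 2)) (at z)" if "z \<notin> Lat" for j z
  proof -
    have "((\<lambda>z. f z $ j) has_derivative (\<lambda>v. Re (\<phi> j z * v))) (at z)"
      using bounded_linear.has_derivative[OF bounded_linear_vec_nth der[OF that], of j] by simp
    then have "(F j has_derivative (\<lambda>v. of_real (Re (\<phi> j z * v)))) (at z)"
      unfolding F_def by (rule bounded_linear.has_derivative[OF bounded_linear_of_real])
    moreover have "complex_of_real (Re w) = (w + cnj w) / 2" for w by (simp add: complex_add_cnj)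
    ultimately show ?thesis by (simp only:)
  qed
  have dY: "(Y j has_derivative (\<lambda>v. (rot_part 0 (\<phi> j) z * v + cnj (rot_part 4 (\<phi> j) z * v)) / 2)) (at z)"
    if z: "z \<notin> Lat" for j z
  proof -
    have 1: "((\<lambda>z. F j (eq_rho ^ i * z)) has_derivative
       (\<lambda>v. (\<phi> j (eq_rho ^ i * z) * (eq_rho ^ i * v) + cnj (\<phi> j (eq_rho ^ i * z) * (eq_rho ^ i * v))) / 2)) (at z)" for i
    proof -
      have "((\<lambda>z. eq_rho ^ i * z) has_derivative (\<lambda>v. eq_rho ^ i * v)) (at z)"
        by (auto intro!: derivative_eq_intros)
      moreover have "eq_rho ^ i * z \<notin> Lat" using z by (simp add: Lat_mult_rho_iff)
      ultimately show ?thesis using has_derivative_compose dF by blast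
    qed
    have "((\<lambda>z. (\<Sum>i<6. eq_rho ^ (i * 5) * F j (eq_rho ^ i * z)) / 6) has_derivative
       (\<lambda>v. (\<Sum>i<6. eq_rho ^ (i * 5) * ((\<phi> j (eq_rho ^ i * z) * (eq_rho ^ i * v) + cnj (\<phi> j (eq_rho ^ i * z) * (eq_rho ^ i * v))) / 2)) / 6)) (at z)"
      unfolding divide_inverse
      by (intro has_derivative_mult_left has_derivative_sum has_derivative_mult_right 1[unfolded divide_inverse])
    moreover have "(\<lambda>z. (\<Sum>i<6. eq_rho ^ (i * 5) * F j (eq_rho ^ i * z)) / 6) = Y j"
      by (simp add: Y_def rot_part_def[abs_def])
    moreover have "(\<Sum>i<6. eq_rho ^ (i * 5) * ((\<phi> j (eq_rho ^ i * z) * (eq_rho ^ i * v) + cnj (\<phi> j (eq_rho ^ i * z) * (eq_rho ^ i * v))) / 2)) / 6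
       = (rot_part 0 (\<phi> j) z * v + cnj (rot_part 4 (\<phi> j) z * v)) / 2" for v
    proof -
      have s1: "eq_rho ^ (i * 5) * (\<phi> j (eq_rho ^ i * z) * (eq_rho ^ i * v)) = eq_rho ^ (i * 6) * \<phi> j (eq_rho ^ i * z) * v" for i
      proof -
        have "i * 6 = i * 5 + i" by simp
        then have "eq_rho ^ (i * 6) = eq_rho ^ (i * 5) * eq_rho ^ i" by (simp only: power_add)
        then show ?thesis by (simp only: mult_ac)
      qed
      have s2: "eq_rho ^ (i * 5) * cnj (\<phi> j (eq_rho ^ i * z) * (eq_rho ^ i * v)) = cnj (eq_rho ^ (i * 2) * \<phi> j (eq_rho ^ i * z) * v)" for i
      proof -
        have "eq_rho ^ (i * 5) = cnj (eq_rho ^ i)" using cnj_eq_rho_pow[of i] by (metis complex_cnj_cnj)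
        then have "eq_rho ^ (i * 5) * cnj (\<phi> j (eq_rho ^ i * z) * (eq_rho ^ i * v)) = cnj (eq_rho ^ i * (\<phi> j (eq_rho ^ i * z) * (eq_rho ^ i * v)))"
          by simp
        moreover have "eq_rho ^ (i * 2) = eq_rho ^ i * eq_rho ^ i" by (simp only: power_mult power2_eq_square)
        ultimately show ?thesis by (simp only: mult_ac)
      qed
      have "(\<Sum>i<6. eq_rho ^ (i * 5) * ((\<phi> j (eq_rho ^ i * z) * (eq_rho ^ i * v) + cnj (\<phi> j (eq_rho ^ i * z) * (eq_rho ^ i * v))) / 2))
        = (\<Sum>i<6. (eq_rho ^ (i * 6) * \<phi> j (eq_rho ^ i * z) * v + cnj (eq_rho ^ (i * 2) * \<phi> j (eq_rho ^ i * z) * v)) / 2)"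
        unfolding s1[symmetric] s2[symmetric] by (intro sum.cong refl) (simp add: field_simps)
      also have "\<dots> = ((\<Sum>i<6. eq_rho ^ (i * 6) * \<phi> j (eq_rho ^ i * z)) * v + cnj ((\<Sum>i<6. eq_rho ^ (i * 2) * \<phi> j (eq_rho ^ i * z)) * v)) / 2"
        by (simp only: sum_divide_distrib[symmetric] sum.distrib sum_distrib_right cnj_sum[symmetric])
      finally show ?thesis
        by (simp add: rot_part_def field_simps)
    qed
    ultimately show ?thesis by (simp only:)
  qed
  have dQ: "(Q j has_field_derivative rot_part 4 (\<phi> j) z / 2) (at z)" if z: "z \<notin> Lat" for j z
  proof -
    have "((\<lambda>z. a j * z / 2) has_derivative (\<lambda>v. a j * v / 2)) (at z)"
      by (auto intro!: derivative_eq_intros)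
    from has_derivative_diff[OF dY[OF z, of j] this]
    have "((\<lambda>z. Y j z - a j * z / 2) has_derivative (\<lambda>v. (a j * v + cnj (rot_part 4 (\<phi> j) z * v)) / 2 - a j * v / 2)) (at z)"
      by (simp only: T0[OF z])
    moreover have "(\<lambda>v. (a j * v + cnj (rot_part 4 (\<phi> j) z * v)) / 2 - a j * v / 2) = (\<lambda>v. cnj (rot_part 4 (\<phi> j) z * v) / 2)"
      by (simp add: add_divide_distrib)
    ultimately have "((\<lambda>z. Y j z - a j * z / 2) has_derivative (\<lambda>v. cnj (rot_part 4 (\<phi> j) z * v) / 2)) (at z)"
      by simp
    from bounded_linear.has_derivative[OF bounded_linear_cnj this]
    have "(Q j has_derivative (\<lambda>v. rot_part 4 (\<phi> j) z * v / 2)) (at z)"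
      by (simp add: Q_def[abs_def])
    then show ?thesis
      unfolding has_field_derivative_def by (rule has_derivative_eq_rhs) (auto simp: fun_eq_iff)
  qed
  have Qrot: "rot_type 5 (Q j)" for j
    unfolding rot_type_def
  proof
    fix z
    have "Y j (eq_rho * z) = eq_rho * Y j z"
      using rot_type_rot_part[of 1 "F j"] by (simp add: rot_type_def Y_def)
    moreover have "cnj eq_rho = eq_rho ^ 5" using cnj_eq_rho_pow[of 1] by (metis complex_cnj_cnj mult_1 power_one_right)
    ultimately show "Q j (eq_rho * z) = eq_rho ^ 5 * Q j z"
      by (simp add: Q_def algebra_simps)
  qed
  have Qper: "Q j (z + l) = Q j z - cnj (a j * l) / 2" if l: "l \<in> Lat" for j z l
  proof -
    have "Y j (z + l) = Y j z"
    proof -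
      have "F j (eq_rho ^ i * (z + l)) = F j (eq_rho ^ i * z)" for i
        using per[OF Lat_mult_rho_pow[OF l, of i]] by (simp add: F_def distrib_left)
      then show ?thesis by (simp add: Y_def rot_part_def)
    qed
    then show ?thesis by (simp add: Q_def algebra_simps add_divide_distrib)
  qed
  have Qzero: "g z = 0" if g: "rot_type 5 g" "\<And>z. z \<notin> Lat \<Longrightarrow> (g has_field_derivative 0) (at z)" and z: "z \<notin> Lat" for g z
  proof -
    obtain c where c: "\<And>z. z \<notin> Lat \<Longrightarrow> g z = c" using constant_on_compl_Lat[OF g(2)] by blast
    have "eq_rho * z \<notin> Lat" using z Lat_mult_rho_iff[of 1 z] by simp
    then have "c = eq_rho ^ 5 * c" using c[OF z] c[of "eq_rho * z"] g(1) by (simp add: rot_type_def)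
    moreover have "eq_rho ^ 5 \<noteq> 1" by (simp only: eq_rho_pow_eq_1_iff) simp
    ultimately show ?thesis using c[OF z] by simp
  qed
  obtain h where h: "h \<notin> Lat" "h + 1 \<notin> Lat"
    using compl_Lat_half Lat_add_iff[OF one_in_Lat, of "of_real (1/2)"] by blast
  have Qstep: "Q j (h + 1) = Q j h - cnj (a j) / 2" for j
    using Qper[OF one_in_Lat, of j h] by simp
  have relation: "b i * cnj (a k) = b k * cnj (a i)" for i k
  proof -
    define g where "g z = b i * Q k z - b k * Q i z" for z
    have "g z = 0" if "z \<notin> Lat" for z
    proof (rule Qzero[OF _ _ that])
      show "rot_type 5 g" unfolding g_def[abs_def] by (intro rot_type_diff rot_type_cmult Qrot)
      fix z assume z: "z \<notin> Lat"
      have "(g has_field_derivative b i * (rot_part 4 (\<phi> k) z / 2) - b k * (rot_part 4 (\<phi> i) z / 2)) (at z)"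
        unfolding g_def[abs_def] by (intro DERIV_diff DERIV_cmult dQ z)
      then show "(g has_field_derivative 0) (at z)" by (simp add: T4[OF z] mult_ac)
    qed
    then have "g h - g (h + 1) = 0" using h by simp
    moreover have "g h - g (h + 1) = (b i * cnj (a k) - b k * cnj (a i)) / 2"
      unfolding g_def Qstep by (simp add: algebra_simps diff_divide_distrib)
    ultimately show ?thesis by simp
  qed
  have "b k * of_real (\<Sum>j\<in>UNIV. (cmod (a j))\<^sup>2) = 0" for k
  proof -
    have "b k * of_real (\<Sum>j\<in>UNIV. (cmod (a j))\<^sup>2) = (\<Sum>j\<in>UNIV. a j * (b k * cnj (a j)))"
      by (simp add: sum_distrib_left complex_norm_square mult_ac del: of_real_power)
    also have "\<dots> = (\<Sum>j\<in>UNIV. a j * (b j * cnj (a k)))" by (simp only: relation[of k])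
    also have "\<dots> = (\<Sum>j\<in>UNIV. a j * b j) * cnj (a k)" by (simp add: sum_distrib_left mult_ac)
    finally show ?thesis by (simp add: ab)
  qed
  then consider "\<forall>k. b k = 0" | "(\<Sum>j\<in>UNIV. (cmod (a j))\<^sup>2) = 0" by (metis mult_eq_0_iff of_real_eq_0_iff)
  then show ?thesis
  proof cases
    case 1
    have "Q j z = 0" if "z \<notin> Lat" for z
    proof (rule Qzero[OF Qrot _ that])
      fix z assume z: "z \<notin> Lat"
      show "(Q j has_field_derivative 0) (at z)" using dQ[OF z, of j] T4[OF z, of j] 1 by simp
    qed
    then have "Q j (h + 1) = 0" "Q j h = 0" using h by blast+
    then show ?thesis using 1 Qstep[of j] by simp
  next
    case 2
    then have a0: "a k = 0" for k by (simp add: sum_nonneg_eq_0_iff)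
    have ellQ: "elliptic (Q j)"
      unfolding elliptic_def
    proof (intro conjI allI ballI)
      show "Q j holomorphic_on - Lat"
        unfolding holomorphic_on_open[OF open_compl_Lat] using dQ by blast
    qed (simp add: Qper a0)
    have dQ': "deriv (Q j) z = rot_part 4 (\<phi> j) z / 2" if "z \<notin> Lat" for z
      by (rule DERIV_imp_deriv[OF dQ[OF that]])
    have "pole_bound 2 (deriv (Q j))"
    proof -
      obtain B \<epsilon> where B: "\<epsilon> > 0" "\<And>z. z \<noteq> 0 \<Longrightarrow> cmod z < \<epsilon> \<Longrightarrow> cmod (z ^ 2 * ((1/2) * rot_part 4 (\<phi> j) z)) \<le> B"
        using pole_bound_cmult[OF T4b[of j], of "1/2"] unfolding pole_bound_def by blast
      show ?thesis
        by (rule pole_boundI[of "min \<epsilon> 1" _ _ B])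
          (use B in \<open>auto simp: dQ' punctured_disc_compl_Lat\<close>)
    qed
    then have "pole_bound 2 (Q j)" by (rule deriv_pole_bound[OF ellQ])
    then have "pole_bound (Suc 1) (Q j)" by (simp add: numeral_2_eq_2)
    then have "pole_bound 1 (Q j)" by (rule rot_type_pole_lower[OF ellQ Qrot]) simp
    then have "pole_bound 0 (Q j)" by (rule elliptic_simple_pole_bounded[OF ellQ])
    then have Q0: "Q j z = 0" if "z \<notin> Lat" for z
      by (rule rot_type_bounded_zero[OF ellQ Qrot _ _ that]) simp
    have T40: "rot_part 4 (\<phi> j) z = 0" if z: "z \<notin> Lat" for z
    proof -
      have "((\<lambda>z. 0) has_field_derivative rot_part 4 (\<phi> j) z / 2) (at z)"
        by (rule has_field_derivative_transform_within_open[OF dQ[OF z] open_compl_Lat]) (use z Q0 in auto)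
      then have "rot_part 4 (\<phi> j) z / 2 = 0" by (rule DERIV_unique) (rule DERIV_const)
      then show ?thesis by simp
    qed
    have "((\<lambda>z. z ^ 2 * rot_part 4 (\<phi> j) z) \<longlongrightarrow> 0) (at 0)"
      by (rule tendsto_eventually)
        (auto simp: eventually_at dist_norm T40 punctured_disc_compl_Lat intro!: exI[of _ 1])
    from tendsto_unique[OF trivial_limit_at T4lim[of j] this] show ?thesis using a0 by simp
  qed
qed

text \<open>
  With poles of order at most 4, rotation types 1 and 5 are impossible, and the other parts of \<open>\<phi>\<close> are
  constant vectors times scalar functions: \<open>\<phi> = a + b P2 + c P3 + d P4\<close>, where \<open>P2, P3, P4\<close> have types 4, 3, 2. Split
  \<open>\<Sum>j (\<phi> j)\<^sup>2 = 0\<close> by rotation type. Types 4 and 5 give \<open>d \<bullet> d = 0\<close>, \<open>a \<bullet> b = 0\<close> and \<open>c \<bullet> d = 0\<close>;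
  then the periods force \<open>a = b = 0\<close>, and type 0 reduces to \<open>c \<bullet> c = 0\<close>.
\<close>

theorem minimal_data_isotropic_plane:
  fixes f :: "complex \<Rightarrow> real^4" and \<phi> :: "4 \<Rightarrow> complex \<Rightarrow> complex"
  assumes ell: "\<And>j. elliptic (\<phi> j)" and pb: "\<And>j. pole_bound 4 (\<phi> j)"
    and iso: "\<And>z. z \<notin> Lat \<Longrightarrow> (\<Sum>j\<in>UNIV. (\<phi> j z)\<^sup>2) = 0"
    and per: "\<And>z l. l \<in> Lat \<Longrightarrow> f (z + l) = f z"
    and der: "\<And>z. z \<notin> Lat \<Longrightarrow> (f has_derivative (\<lambda>v. \<chi> j. Re (\<phi> j z * v))) (at z)"
  shows "\<exists>c d P3 P4. (\<forall>z j. z \<notin> Lat \<longrightarrow> \<phi> j z = c j * P3 z + d j * P4 z) \<and>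
     (\<Sum>j\<in>UNIV. c j * c j) = 0 \<and> (\<Sum>j\<in>UNIV. c j * d j) = 0 \<and> (\<Sum>j\<in>UNIV. d j * d j) = 0"
proof -
  define T where "T k j = rot_part k (\<phi> j)" for k j
  have T: "elliptic (T k j)" "rot_type k (T k j)" "pole_bound 4 (T k j)" for k j
    using ell pb by (simp_all add: T_def elliptic_rot_part rot_type_rot_part pole_bound_rot_part)
  have low: "pole_bound n (T k j)" if "n \<le> 4" "\<And>m. n < m \<Longrightarrow> m \<le> 4 \<Longrightarrow> \<not> 6 dvd (m + k)" for n k j
  proof -
    have "pole_bound (4 - i) (T k j)" if "i \<le> 4 - n" for i
      using that
    proof (induction i)
      case (Suc i)
      have "Suc (4 - Suc i) = 4 - i" using Suc.prems by simp
      then have "pole_bound (Suc (4 - Suc i)) (T k j)" using Suc by simp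
      then show ?case
        by (rule rot_type_pole_lower[OF T(1,2)]) (use Suc that(1) \<open>\<And>m. n < m \<Longrightarrow> m \<le> 4 \<Longrightarrow> \<not> 6 dvd (m + k)\<close>[of "Suc (4 - Suc i)"] in simp)
    qed (simp add: T)
    from this[of "4 - n"] show ?thesis using that(1) by simp
  qed
  have b0: "pole_bound 0 (T 0 j)" and b1: "pole_bound 0 (T 1 j)" and b3: "pole_bound 3 (T 3 j)"
    and b4: "pole_bound 2 (T 4 j)" and b5: "pole_bound 1 (T 5 j)" for j
    by (rule low; presburger)+
  have T1: "T 1 j z = 0" if "z \<notin> Lat" for j z
    by (rule rot_type_bounded_zero[OF T(1,2) b1 _ that]) simp
  have T5: "T 5 j z = 0" if "z \<notin> Lat" for j z
    by (rule rot_type_bounded_zero[OF T(1,2) elliptic_simple_pole_bounded[OF T(1) b5] _ that]) simp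
  have "\<exists>c. \<forall>z. z \<notin> Lat \<longrightarrow> T 0 j z = c" for j by (rule elliptic_bounded_const[OF T(1) b0])
  then obtain a where a: "\<And>j z. z \<notin> Lat \<Longrightarrow> T 0 j z = a j" by metis
  have lead: "\<exists>L P. (\<forall>j. ((\<lambda>z. z ^ n * T k j z) \<longlongrightarrow> L j) (at 0)) \<and> (\<forall>z j. z \<notin> Lat \<longrightarrow> T k j z = L j * P z)"
    if "n + k = 6 \<and> 0 < n \<and> 0 < k" "\<forall>j. pole_bound n (T k j)" for n k
    by (rule rot_type_leading_term) (use T that in auto)
  obtain d P4 where d': "\<forall>j. ((\<lambda>z. z ^ 4 * T 2 j z) \<longlongrightarrow> d j) (at 0)"
    and P4': "\<forall>z. z \<notin> Lat \<longrightarrow> (\<forall>j. T 2 j z = d j * P4 z)"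
    using lead[of 4 2, OF _ allI[OF T(3)]] by (simp, blast)
  note d = d'[rule_format] and P4 = P4'[rule_format]
  obtain c P3 where c': "\<forall>j. ((\<lambda>z. z ^ 3 * T 3 j z) \<longlongrightarrow> c j) (at 0)"
    and P3': "\<forall>z. z \<notin> Lat \<longrightarrow> (\<forall>j. T 3 j z = c j * P3 z)"
    using lead[of 3 3, OF _ allI[OF b3]] by (simp, blast)
  note c = c'[rule_format] and P3 = P3'[rule_format]
  obtain b P2 where b': "\<forall>j. ((\<lambda>z. z ^ 2 * T 4 j z) \<longlongrightarrow> b j) (at 0)"
    and P2': "\<forall>z. z \<notin> Lat \<longrightarrow> (\<forall>j. T 4 j z = b j * P2 z)"
    using lead[of 2 4, OF _ allI[OF b4]] by (simp, blast)
  note b = b'[rule_format] and P2 = P2'[rule_format]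
  have \<phi>: "\<phi> j z = T 0 j z + T 2 j z + T 3 j z + T 4 j z" if "z \<notin> Lat" for j z
  proof -
    have "\<phi> j z = (\<Sum>k<6. T k j z)" unfolding T_def by (rule sum_rot_part[symmetric])
    also have "\<dots> = T 0 j z + T 1 j z + T 2 j z + T 3 j z + T 4 j z + T 5 j z"
      by (simp add: eval_nat_numeral lessThan_Suc add_ac)
    finally show ?thesis using T1[OF that] T5[OF that] by simp
  qed
  define dot where "dot k l z = (\<Sum>j\<in>UNIV. T k j z * T l j z)" for k l z
  have dot_type: "rot_type m (dot k l)" if "(k + l) mod 6 = m mod 6" for k l m
    unfolding dot_def[abs_def] by (rule rot_type_cong[OF rot_type_sum[OF rot_type_mult[OF T(2) T(2)]] that])
  \<comment> \<open>\<open>E m\<close> is the part of type \<open>m\<close> of \<open>\<Sum>j (\<phi> j)\<^sup>2\<close>.\<close>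
  define E where "E m z = (if m = 0 then dot 0 0 z + 2 * dot 2 4 z + dot 3 3 z
     else if m = 1 then 2 * dot 3 4 z else if m = 2 then dot 4 4 z + 2 * dot 0 2 z
     else if m = 3 then 2 * dot 0 3 z else if m = 4 then dot 2 2 z + 2 * dot 0 4 z
     else 2 * dot 2 3 z)" for m :: nat and z
  have Etype: "rot_type m (E m)" if "m < 6" for m
  proof -
    have "m = 0 \<or> m = 1 \<or> m = 2 \<or> m = 3 \<or> m = 4 \<or> m = 5" using that by linarith
    then show ?thesis
      unfolding E_def[abs_def]
      by (elim disjE) (auto intro!: rot_type_add rot_type_cmult dot_type)
  qed
  have Esum: "(\<Sum>m<6. E m z) = 0" if z: "z \<notin> Lat" for z
  proof -
    have "(\<Sum>m<6. E m z) = dot 0 0 z + 2 * dot 2 4 z + dot 3 3 z + 2 * dot 3 4 z + (dot 4 4 z + 2 * dot 0 2 z)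
      + 2 * dot 0 3 z + (dot 2 2 z + 2 * dot 0 4 z) + 2 * dot 2 3 z"
      by (simp add: eval_nat_numeral lessThan_Suc E_def add_ac)
    also have "\<dots> = (\<Sum>j\<in>UNIV. (T 0 j z + T 2 j z + T 3 j z + T 4 j z)\<^sup>2)"
      by (simp add: dot_def sum_distrib_left sum.distrib[symmetric] power2_eq_square algebra_simps)
    also have "\<dots> = 0" using iso[OF z] \<phi>[OF z] by simp
    finally show ?thesis .
  qed
  have E0: "E m z = 0" if m: "m < 6" and z: "z \<notin> Lat" for m z
  proof -
    have "rot_part m (\<lambda>z. \<Sum>i<6. E i z) z = 0"
      using Esum z by (simp add: rot_part_def Lat_mult_rho_iff)
    moreover have "rot_part m (\<lambda>z. \<Sum>i<6. E i z) z = (\<Sum>i<6. rot_part m (E i) z)"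
      unfolding rot_part_def sum_distrib_left sum_divide_distrib by (rule sum.swap)
    moreover have "(\<Sum>i<6. rot_part m (E i) z) = (\<Sum>i<6. if i = m then E i z else 0)"
      by (intro sum.cong refl, subst rot_part_of_type[OF Etype]) (use m in auto)
    ultimately show ?thesis using m by simp
  qed
  have lim0: "L = 0" if "(h \<longlongrightarrow> L) (at 0)" "\<And>z. z \<notin> Lat \<Longrightarrow> h z = 0" for h :: "complex \<Rightarrow> complex" and L
  proof -
    have "(h \<longlongrightarrow> 0) (at 0)"
      by (rule tendsto_eventually)
        (auto simp: eventually_at dist_norm that(2) punctured_disc_compl_Lat intro!: exI[of _ 1])
    with that(1) show ?thesis by (rule tendsto_unique[OF trivial_limit_at])
  qed
  have Tlim0: "((\<lambda>z. T 0 j z) \<longlongrightarrow> a j) (at 0)" for j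
    by (rule tendsto_eventually)
      (auto simp: eventually_at dist_norm a punctured_disc_compl_Lat intro!: exI[of _ 1])
  \<comment> \<open>In the part of type 4 the square of the type-2 part has a pole of order 8, the mixed term
    one of order 2; so both vanish.\<close>
  have dd: "(\<Sum>j\<in>UNIV. d j * d j) = 0"
  proof (rule lim0)
    have "((\<lambda>z. (\<Sum>j\<in>UNIV. (z ^ 4 * T 2 j z) * (z ^ 4 * T 2 j z)) + 2 * (z ^ 6 * (\<Sum>j\<in>UNIV. T 0 j z * (z ^ 2 * T 4 j z))))
       \<longlongrightarrow> (\<Sum>j\<in>UNIV. d j * d j) + 2 * (0 ^ 6 * (\<Sum>j\<in>UNIV. a j * b j))) (at 0)"
      by (intro tendsto_intros d b Tlim0)
    then show "((\<lambda>z. (\<Sum>j\<in>UNIV. (z ^ 4 * T 2 j z) * (z ^ 4 * T 2 j z)) + 2 * (z ^ 6 * (\<Sum>j\<in>UNIV. T 0 j z * (z ^ 2 * T 4 j z))))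
       \<longlongrightarrow> (\<Sum>j\<in>UNIV. d j * d j)) (at 0)" by simp
    fix z assume z: "z \<notin> Lat"
    have "(\<Sum>j\<in>UNIV. (z ^ 4 * T 2 j z) * (z ^ 4 * T 2 j z)) + 2 * (z ^ 6 * (\<Sum>j\<in>UNIV. T 0 j z * (z ^ 2 * T 4 j z))) = z ^ 8 * E 4 z"
    proof -
      have p1: "z ^ 8 = z ^ 4 * z ^ 4" by (simp add: power_add[symmetric])
      have p2: "z ^ 8 = z ^ 6 * z ^ 2" by (simp add: power_add[symmetric])
      have "(z ^ 4 * T 2 j z) * (z ^ 4 * T 2 j z) = z ^ 8 * (T 2 j z * T 2 j z)" for j
        unfolding p1 by (simp only: mult_ac)
      moreover have "z ^ 6 * (T 0 j z * (z ^ 2 * T 4 j z)) = z ^ 8 * (T 0 j z * T 4 j z)" for j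
        unfolding p2 by (simp only: mult_ac)
      ultimately have "(\<Sum>j\<in>UNIV. (z ^ 4 * T 2 j z) * (z ^ 4 * T 2 j z)) = z ^ 8 * dot 2 2 z"
        and "z ^ 6 * (\<Sum>j\<in>UNIV. T 0 j z * (z ^ 2 * T 4 j z)) = z ^ 8 * dot 0 4 z"
        by (simp_all only: dot_def sum_distrib_left)
      then show ?thesis by (simp add: E_def algebra_simps)
    qed
    then show "(\<Sum>j\<in>UNIV. (z ^ 4 * T 2 j z) * (z ^ 4 * T 2 j z)) + 2 * (z ^ 6 * (\<Sum>j\<in>UNIV. T 0 j z * (z ^ 2 * T 4 j z))) = 0"
      using E0[of 4 z] z by simp
  qed
  have dot22: "dot 2 2 z = 0" if z: "z \<notin> Lat" for z
  proof -
    have "dot 2 2 z = (\<Sum>j\<in>UNIV. d j * d j) * (P4 z * P4 z)"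
      by (simp add: dot_def P4[OF z] sum_distrib_left mult_ac)
    then show ?thesis using dd by simp
  qed
  have dot04: "dot 0 4 z = 0" if z: "z \<notin> Lat" for z
    using E0[of 4 z] dot22[OF z] z by (simp add: E_def)
  have ab: "(\<Sum>j\<in>UNIV. a j * b j) = 0"
  proof (rule lim0)
    show "((\<lambda>z. \<Sum>j\<in>UNIV. T 0 j z * (z ^ 2 * T 4 j z)) \<longlongrightarrow> (\<Sum>j\<in>UNIV. a j * b j)) (at 0)"
      by (intro tendsto_intros b Tlim0)
    fix z assume z: "z \<notin> Lat"
    have "(\<Sum>j\<in>UNIV. T 0 j z * (z ^ 2 * T 4 j z)) = z ^ 2 * dot 0 4 z"
      by (simp add: dot_def sum_distrib_left mult_ac)
    then show "(\<Sum>j\<in>UNIV. T 0 j z * (z ^ 2 * T 4 j z)) = 0" using dot04[OF z] by simp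
  qed
  have cd: "(\<Sum>j\<in>UNIV. c j * d j) = 0"
  proof (rule lim0)
    show "((\<lambda>z. \<Sum>j\<in>UNIV. (z ^ 3 * T 3 j z) * (z ^ 4 * T 2 j z)) \<longlongrightarrow> (\<Sum>j\<in>UNIV. c j * d j)) (at 0)"
      by (intro tendsto_intros c d)
    fix z assume z: "z \<notin> Lat"
    have "(\<Sum>j\<in>UNIV. (z ^ 3 * T 3 j z) * (z ^ 4 * T 2 j z)) = z ^ 3 * z ^ 4 * dot 2 3 z"
      by (simp add: dot_def sum_distrib_left mult_ac)
    then show "(\<Sum>j\<in>UNIV. (z ^ 3 * T 3 j z) * (z ^ 4 * T 2 j z)) = 0" using E0[of 5 z] z by (simp add: E_def)
  qed
  have zero: "a j = 0 \<and> b j = 0" for j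
    by (rule harmonic_primitive_constraint[OF ell per der, where P = P2])
      (use a b P2 b4 ab in \<open>auto simp: T_def\<close>)
  have dot33: "dot 3 3 z = 0" if z: "z \<notin> Lat" for z
  proof -
    have "T 0 j z = 0" "T 4 j z = 0" for j using a[OF z] P2[OF z] zero by simp_all
    then have "E 0 z = dot 3 3 z" by (simp add: E_def dot_def)
    then show ?thesis using E0[of 0 z] z by simp
  qed
  have cc: "(\<Sum>j\<in>UNIV. c j * c j) = 0"
  proof (rule lim0)
    show "((\<lambda>z. \<Sum>j\<in>UNIV. (z ^ 3 * T 3 j z) * (z ^ 3 * T 3 j z)) \<longlongrightarrow> (\<Sum>j\<in>UNIV. c j * c j)) (at 0)"
      by (intro tendsto_intros c)
    fix z assume z: "z \<notin> Lat"
    have "(\<Sum>j\<in>UNIV. (z ^ 3 * T 3 j z) * (z ^ 3 * T 3 j z)) = z ^ 3 * z ^ 3 * dot 3 3 z"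
      by (simp add: dot_def sum_distrib_left mult_ac)
    then show "(\<Sum>j\<in>UNIV. (z ^ 3 * T 3 j z) * (z ^ 3 * T 3 j z)) = 0" using dot33[OF z] by simp
  qed
  have "\<phi> j z = c j * P3 z + d j * P4 z" if z: "z \<notin> Lat" for j z
    using \<phi>[OF z, of j] a[OF z, of j] P2[OF z, of j] P3[OF z, of j] P4[OF z, of j] zero[of j] by simp
  then show ?thesis using cc cd dd by (intro exI[of _ c] exI[of _ d] exI[of _ P3] exI[of _ P4]) blast
qed

section \<open>The behaviour at the puncture\<close>

text \<open>
  The flux of \<open>log\<close> around its singularity.
\<close>

lemma rect_flux_inverse:
  assumes r: "r > 0"
  shows "rect_flux (\<lambda>z. 1 / z) (-r) r (-r) r = of_real (2 * pi)"
proof -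
  have at: "((\<lambda>t. 2 * r / (r\<^sup>2 + t\<^sup>2)) has_integral pi) {-r..r}"
  proof -
    have "((\<lambda>t. 2 * r / (r\<^sup>2 + t\<^sup>2)) has_integral 2 * arctan (r / r) - 2 * arctan (- r / r)) {-r..r}"
    proof (rule fundamental_theorem_of_calculus)
      fix t
      have pos: "r\<^sup>2 + t\<^sup>2 > 0" using r by (simp add: add_pos_nonneg)
      have "((\<lambda>t. 2 * arctan (t / r)) has_real_derivative 2 * (inverse (1 + (t / r)\<^sup>2) * (1 / r))) (at t within {-r..r})"
        using r by (auto intro!: derivative_eq_intros)
      moreover have "2 * (inverse (1 + (t / r)\<^sup>2) * (1 / r)) = 2 * r / (r\<^sup>2 + t\<^sup>2)"
      proof -
        have "1 + (t / r)\<^sup>2 = (r\<^sup>2 + t\<^sup>2) / r\<^sup>2" using r by (simp add: field_simps)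
        then show ?thesis using r pos by (simp add: power2_eq_square)
      qed
      ultimately show "((\<lambda>t. 2 * arctan (t / r)) has_vector_derivative 2 * r / (r\<^sup>2 + t\<^sup>2)) (at t within {-r..r})"
        by (simp add: has_real_derivative_iff_has_vector_derivative)
    qed (use r in simp)
    then show ?thesis using r by (simp add: arctan_minus arctan_one)
  qed
  have e1: "1 / Complex r y - 1 / Complex (-r) y = of_real (2 * r / (r\<^sup>2 + y\<^sup>2))" for y
  proof -
    have "Complex r y \<noteq> 0" "Complex (-r) y \<noteq> 0" using r by (auto simp: complex_eq_iff)
    then have "1 / Complex r y - 1 / Complex (-r) y = (Complex (-r) y - Complex r y) / (Complex r y * Complex (-r) y)"
      by (simp add: diff_frac_eq)
    also have "Complex (-r) y - Complex r y = of_real (- (2 * r))" by (simp add: complex_eq_iff)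
    also have "Complex r y * Complex (-r) y = of_real (- (r\<^sup>2 + y\<^sup>2))" by (simp add: complex_eq_iff power2_eq_square)
    finally show ?thesis by (simp only: of_real_divide[symmetric]) (simp only: minus_divide_left[symmetric] minus_divide_right[symmetric] minus_minus)
  qed
  have e2: "\<i> * (1 / Complex x r - 1 / Complex x (-r)) = of_real (2 * r / (r\<^sup>2 + x\<^sup>2))" for x
  proof -
    have "Complex x r \<noteq> 0" "Complex x (-r) \<noteq> 0" using r by (auto simp: complex_eq_iff)
    then have "\<i> * (1 / Complex x r - 1 / Complex x (-r)) = \<i> * (Complex x (-r) - Complex x r) / (Complex x r * Complex x (-r))"
      by (simp add: diff_frac_eq)
    also have "\<i> * (Complex x (-r) - Complex x r) = of_real (2 * r)" by (simp add: complex_eq_iff)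
    also have "Complex x r * Complex x (-r) = of_real (r\<^sup>2 + x\<^sup>2)" by (simp add: complex_eq_iff power2_eq_square)
    finally show ?thesis by (simp only: of_real_divide)
  qed
  have "rect_flux (\<lambda>z. 1 / z) (-r) r (-r) r = integral {-r..r} (\<lambda>y. of_real (2 * r / (r\<^sup>2 + y\<^sup>2)))
      + integral {-r..r} (\<lambda>x. of_real (2 * r / (r\<^sup>2 + x\<^sup>2)))"
    unfolding rect_flux_def by (simp only: e1 e2 integral_mult_right[symmetric])
  also have "\<dots> = of_real pi + of_real pi"
    using integral_unique[OF at] by (simp only: integral_complex_of_real_HK)
  finally show ?thesis by simp
qed

lemma rect_flux_linear:
  assumes "continuous_on U q1" "continuous_on U q2" "a \<le> b" "c \<le> d"
    and "\<And>x y. x \<in> {a..b} \<Longrightarrow> y = c \<or> y = d \<Longrightarrow> Complex x y \<in> U"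
    and "\<And>x y. y \<in> {c..d} \<Longrightarrow> x = a \<or> x = b \<Longrightarrow> Complex x y \<in> U"
  shows "rect_flux (\<lambda>z. k * q1 z + q2 z) a b c d = k * rect_flux q1 a b c d + rect_flux q2 a b c d"
proof -
  have i1: "(\<lambda>y. q (Complex x y)) integrable_on {c..d}" if "x = a \<or> x = b" "continuous_on U q" for x and q :: "complex \<Rightarrow> complex"
    by (rule integrable_continuous_real, rule continuous_on_compose2[OF that(2)])
      (use assms(6) that(1) in \<open>auto intro!: continuous_intros\<close>)
  have i2: "(\<lambda>x. q (Complex x y)) integrable_on {a..b}" if "y = c \<or> y = d" "continuous_on U q" for y and q :: "complex \<Rightarrow> complex"
    by (rule integrable_continuous_real, rule continuous_on_compose2[OF that(2)])
      (use assms(5) that(1) in \<open>auto intro!: continuous_intros\<close>)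
  have l1: "integral {c..d} (\<lambda>y. k * q1 (Complex x y) + q2 (Complex x y)) = k * integral {c..d} (\<lambda>y. q1 (Complex x y)) + integral {c..d} (\<lambda>y. q2 (Complex x y))"
    if "x = a \<or> x = b" for x
    using that assms(1,2) by (subst integral_add) (auto intro!: i1 integrable_on_mult_right)
  have l2: "integral {a..b} (\<lambda>x. k * q1 (Complex x y) + q2 (Complex x y)) = k * integral {a..b} (\<lambda>x. q1 (Complex x y)) + integral {a..b} (\<lambda>x. q2 (Complex x y))"
    if "y = c \<or> y = d" for y
    using that assms(1,2) by (subst integral_add) (auto intro!: i2 integrable_on_mult_right)
  have "continuous_on U (\<lambda>z. k * q1 z + q2 z)" using assms(1,2) by (intro continuous_intros)
  then have c3: "continuous_on U (\<lambda>z. k * q1 z + q2 z)" .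
  have e: "rect_flux q a b c d = integral {c..d} (\<lambda>y. q (Complex b y)) - integral {c..d} (\<lambda>y. q (Complex a y)) +
     \<i> * (integral {a..b} (\<lambda>x. q (Complex x d)) - integral {a..b} (\<lambda>x. q (Complex x c)))"
    if "continuous_on U q" for q
    by (rule rect_flux_edges[OF that]) (use assms in auto)
  have l: "integral {c..d} (\<lambda>y. k * q1 (Complex b y) + q2 (Complex b y)) = k * integral {c..d} (\<lambda>y. q1 (Complex b y)) + integral {c..d} (\<lambda>y. q2 (Complex b y))"
    "integral {c..d} (\<lambda>y. k * q1 (Complex a y) + q2 (Complex a y)) = k * integral {c..d} (\<lambda>y. q1 (Complex a y)) + integral {c..d} (\<lambda>y. q2 (Complex a y))"
    "integral {a..b} (\<lambda>x. k * q1 (Complex x d) + q2 (Complex x d)) = k * integral {a..b} (\<lambda>x. q1 (Complex x d)) + integral {a..b} (\<lambda>x. q2 (Complex x d))"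
    "integral {a..b} (\<lambda>x. k * q1 (Complex x c) + q2 (Complex x c)) = k * integral {a..b} (\<lambda>x. q1 (Complex x c)) + integral {a..b} (\<lambda>x. q2 (Complex x c))"
    using l1 l2 by blast+
  show ?thesis
    unfolding e[OF c3] e[OF assms(1)] e[OF assms(2)] l by (simp only: algebra_simps)
qed

lemma rect_flux_cong:
  assumes "\<And>x y. x \<in> {a..b} \<Longrightarrow> y = c \<or> y = d \<Longrightarrow> q1 (Complex x y) = q2 (Complex x y)"
    and "\<And>x y. y \<in> {c..d} \<Longrightarrow> x = a \<or> x = b \<Longrightarrow> q1 (Complex x y) = q2 (Complex x y)"
  shows "rect_flux q1 a b c d = rect_flux q2 a b c d"
  unfolding rect_flux_def
  by (intro arg_cong2[of _ _ _ _ "(+)"] arg_cong[of _ _ "(*) \<i>"] integral_cong) (use assms in auto)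

context elliptic_curve_map
begin

text \<open>
  If \<open>n\<close> is the exact pole order then \<open>\<Phi> = g / z ^ n\<close> with a family \<open>g\<close> without common zero, so the flux of
  \<open>dlog_norm J \<Phi>\<close> out of a small square is \<open>- 2 * pi * n\<close> up to the small mass of \<open>g\<close>. The flux bound gives
  \<open>2 * pi * n \<le> 8 * pi\<close> up to an error below \<open>2 * pi\<close>.
\<close>

theorem pole_order_le_4:
  assumes mass: "total_mass J \<Phi> \<le> ennreal (8 * pi)"
    and mero: "\<exists>n. \<forall>j\<in>J. pole_bound n (\<Phi> j)"
  shows "\<forall>j\<in>J. pole_bound 4 (\<Phi> j)"
proof -
  define n where "n = (LEAST n. \<forall>j\<in>J. pole_bound n (\<Phi> j))"
  have n: "\<forall>j\<in>J. pole_bound n (\<Phi> j)" unfolding n_def using mero by (rule LeastI_ex)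
  have least: "n \<le> m" if "\<forall>j\<in>J. pole_bound m (\<Phi> j)" for m
    unfolding n_def using that by (rule Least_le)
  have "n \<le> 4"
  proof (rule ccontr)
    assume "\<not> n \<le> 4"
    then obtain n' where n': "n = Suc n'" "n \<ge> 5" by (cases n) auto
    have "\<forall>j\<in>J. \<exists>g. g holomorphic_on ball 0 1 \<and> (\<forall>z. z \<noteq> 0 \<longrightarrow> cmod z < 1 \<longrightarrow> g z = z ^ n * \<Phi> j z)"
      using pole_bound_extend[OF ell] n by blast
    then obtain g where g: "\<And>j. j \<in> J \<Longrightarrow> g j holomorphic_on ball 0 1"
      "\<And>j z. j \<in> J \<Longrightarrow> z \<noteq> 0 \<Longrightarrow> cmod z < 1 \<Longrightarrow> g j z = z ^ n * \<Phi> j z"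
      using bchoice[of J "\<lambda>j g. g holomorphic_on ball 0 1 \<and> (\<forall>z. z \<noteq> 0 \<longrightarrow> cmod z < 1 \<longrightarrow> g z = z ^ n * \<Phi> j z)"] by blast
    have nsg: "norm_sq J g z = (cmod z ^ n)\<^sup>2 * norm_sq J \<Phi> z" if "z \<noteq> 0" "cmod z < 1" for z
      using that by (simp add: norm_sq_def g(2) norm_mult norm_power power_mult_distrib sum_distrib_left)
    have g0: "\<exists>j\<in>J. g j 0 \<noteq> 0"
    proof (rule ccontr)
      assume neg: "\<not> (\<exists>j\<in>J. g j 0 \<noteq> 0)"
      have "pole_bound n' (\<Phi> j)" if j: "j \<in> J" for j
      proof (rule pole_bound_lower[OF ell[OF j]])
        show "pole_bound (Suc n') (\<Phi> j)" using n j by (simp only: n'(1))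
        have "isCont (g j) 0"
          using holomorphic_on_imp_continuous_on[OF g(1)[OF j]] by (simp add: continuous_on_eq_continuous_at)
        then have "(g j \<longlongrightarrow> 0) (at 0)" using neg j by (simp add: isCont_def)
        then show "((\<lambda>z. z ^ Suc n' * \<Phi> j z) \<longlongrightarrow> 0) (at 0)"
          by (rule Lim_transform_eventually)
            (auto simp: eventually_at dist_norm g(2)[OF j] n'(1) intro!: exI[of _ 1])
      qed
      then have "n \<le> n'" by (intro least) blast
      then show False using n'(1) by simp
    qed
    have posg: "norm_sq J g z > 0" if "z \<in> ball 0 1" for z
    proof (cases "z = 0")
      case True
      then show ?thesis using g0 norm_sq_pos_iff[OF J] by blast
    next
      case False
      then have "norm_sq J \<Phi> z > 0" using that punctured_disc_compl_Lat[of z] pos by simp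
      then show ?thesis using nsg[of z] False that by simp
    qed
    have dl: "dlog_norm J \<Phi> z = of_real (- real n) * (1 / z) + dlog_norm J g z" if z: "z \<noteq> 0" "cmod z < 1" for z
    proof -
      have zL: "z \<in> - Lat" using punctured_disc_compl_Lat[OF z(2,1)] by simp
      have dg: "deriv (g j) z = z ^ n * (of_nat n / z * \<Phi> j z + deriv (\<Phi> j) z)" if j: "j \<in> J" for j
      proof (rule DERIV_imp_deriv)
        have "((\<lambda>z. z ^ n * \<Phi> j z) has_field_derivative of_nat n * z ^ (n - 1) * \<Phi> j z + z ^ n * deriv (\<Phi> j) z) (at z)"
          using holomorphic_derivI[OF hol[OF j] open_compl_Lat zL] by (auto intro!: derivative_eq_intros)
        then have "(g j has_field_derivative of_nat n * z ^ (n - 1) * \<Phi> j z + z ^ n * deriv (\<Phi> j) z) (at z)"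
          by (rule has_field_derivative_transform_within_open[of _ _ _ "ball 0 1 - {0}"])
            (use z g(2)[OF j] in \<open>auto intro!: open_delete\<close>)
        moreover have "of_nat n * z ^ (n - 1) * \<Phi> j z + z ^ n * deriv (\<Phi> j) z = z ^ n * (of_nat n / z * \<Phi> j z + deriv (\<Phi> j) z)"
          using z n'(1) by (simp add: field_simps)
        ultimately show "(g j has_field_derivative z ^ n * (of_nat n / z * \<Phi> j z + deriv (\<Phi> j) z)) (at z)" by simp
      qed
      have zz: "z ^ n * cnj (z ^ n) = of_real ((cmod z ^ n)\<^sup>2)"
        using complex_norm_square[of "z ^ n"] by (simp add: norm_power)
      have "herm J g z = (\<Sum>j\<in>J. z ^ n * cnj (z ^ n) * (of_nat n / z * (\<Phi> j z * cnj (\<Phi> j z)) + deriv (\<Phi> j) z * cnj (\<Phi> j z)))"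
        unfolding herm_def by (intro sum.cong refl) (simp add: dg g(2) z algebra_simps)
      also have "\<dots> = z ^ n * cnj (z ^ n) * (of_nat n / z * (\<Sum>j\<in>J. \<Phi> j z * cnj (\<Phi> j z)) + herm J \<Phi> z)"
        by (simp only: sum_distrib_left[symmetric] sum.distrib herm_def)
      also have "\<dots> = of_real ((cmod z ^ n)\<^sup>2) * (of_nat n / z * of_real (norm_sq J \<Phi> z) + herm J \<Phi> z)"
        by (simp only: zz norm_sq_complex)
      finally have h: "herm J g z = of_real ((cmod z ^ n)\<^sup>2) * (of_nat n / z * of_real (norm_sq J \<Phi> z) + herm J \<Phi> z)" .
      have S: "norm_sq J \<Phi> z \<noteq> 0" "(cmod z ^ n)\<^sup>2 \<noteq> 0" using pos[OF zL] z by auto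
      have "dlog_norm J g z = (of_nat n / z * of_real (norm_sq J \<Phi> z) + herm J \<Phi> z) / of_real (norm_sq J \<Phi> z)"
        unfolding dlog_norm_def h nsg[OF z] of_real_mult using S(2) by (simp only: mult_divide_mult_cancel_left of_real_eq_0_iff not_False_eq_True)
      also have "\<dots> = of_nat n / z + dlog_norm J \<Phi> z"
        using S by (simp add: dlog_norm_def add_divide_distrib)
      finally show ?thesis by simp
    qed
    have cont_lapg: "continuous_on (ball 0 1) (lap_log_norm J g)"
      by (rule continuous_on_lap_log_norm[OF J open_ball g(1) posg])
    have "bounded (lap_log_norm J g ` cball 0 (1/2))"
      by (intro compact_imp_bounded compact_continuous_image compact_cball continuous_on_subset[OF cont_lapg]) auto
    then obtain M where M0: "\<forall>y\<in>lap_log_norm J g ` cball 0 (1/2). norm y \<le> M" unfolding bounded_iff by blast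
    have M: "lap_log_norm J g z \<le> M" if "cmod z \<le> 1/2" for z
      using M0 that by (force simp: abs_le_iff)
    have Mnn: "M \<ge> 0" using M[of 0] lap_log_norm_nonneg[of J g 0] by simp
    have key: "2 * pi * real n \<le> 8 * pi + M * (2 * r) * (2 * r)" if r: "0 < r" "r < 1/4" for r
    proof -
      have in_ball: "cmod (Complex x y) \<le> 1/2" if "\<bar>x\<bar> \<le> r" "\<bar>y\<bar> \<le> r" for x y
        using cmod_le[of "Complex x y"] that r by simp
      have nonz: "Complex x y \<noteq> 0" if "x = r \<or> x = -r \<or> y = r \<or> y = -r" for x y
        using that r by (auto simp: complex_eq_iff)
      define F where "F = integral {-r..r} (\<lambda>y. integral {-r..r} (\<lambda>x. lap_log_norm J g (Complex x y)))"
      have sub: "Complex x y \<in> ball 0 1" if "-r \<le> x" "x \<le> r" "-r \<le> y" "y \<le> r" for x y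
        using in_ball[of x y] that by (simp add: abs_le_iff)
      have fg: "rect_flux (dlog_norm J g) (-r) r (-r) r = of_real F"
        unfolding F_def by (rule rect_flux_dlog_norm[OF J open_ball g(1) posg sub]) (use r in auto)
      have "rect_flux (dlog_norm J \<Phi>) (-r) r (-r) r = rect_flux (\<lambda>z. of_real (- real n) * (1 / z) + dlog_norm J g z) (-r) r (-r) r"
      proof (rule rect_flux_cong)
        fix x y assume "x \<in> {-r..r}" "y = -r \<or> y = r"
        then show "dlog_norm J \<Phi> (Complex x y) = of_real (- real n) * (1 / Complex x y) + dlog_norm J g (Complex x y)"
          by (intro dl nonz) (use sub[of x y] r in auto)
      next
        fix x y assume "y \<in> {-r..r}" "x = -r \<or> x = r"
        then show "dlog_norm J \<Phi> (Complex x y) = of_real (- real n) * (1 / Complex x y) + dlog_norm J g (Complex x y)"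
          by (intro dl nonz) (use sub[of x y] r in auto)
      qed
      also have "\<dots> = of_real (- real n) * rect_flux (\<lambda>z. 1 / z) (-r) r (-r) r + rect_flux (dlog_norm J g) (-r) r (-r) r"
      proof (rule rect_flux_linear[of "ball 0 1 - {0}"])
        show "continuous_on (ball 0 1 - {0}) (\<lambda>z::complex. 1 / z)" by (intro continuous_intros) auto
        show "continuous_on (ball 0 1 - {0}) (dlog_norm J g)"
          by (rule continuous_on_subset[OF C1_continuous[OF dlog_norm_C1[OF J open_ball g(1) posg]]]) auto
        show "Complex x y \<in> ball 0 1 - {0}" if "x \<in> {-r..r}" "y = -r \<or> y = r" for x y
          using sub[of x y] nonz[of x y] that r by auto
        show "Complex x y \<in> ball 0 1 - {0}" if "y \<in> {-r..r}" "x = -r \<or> x = r" for x y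
          using sub[of x y] nonz[of x y] that r by auto
      qed (use r in auto)
      finally have "- Re (rect_flux (dlog_norm J \<Phi>) (-r) r (-r) r) = 2 * pi * real n - F"
        unfolding rect_flux_inverse[OF r(1)] fg by simp
      then have "ennreal (2 * pi * real n - F) \<le> ennreal (8 * pi)"
        using flux_le_total[OF r] mass by (metis order_trans)
      then have 1: "2 * pi * real n - F \<le> 8 * pi" by (simp add: ennreal_le_iff)
      have inner: "integral {-r..r} (\<lambda>x. lap_log_norm J g (Complex x y)) \<le> M * (2 * r)" if y: "y \<in> {-r..r}" for y
      proof -
        have "integral {-r..r} (\<lambda>x. lap_log_norm J g (Complex x y)) \<le> integral {-r..r} (\<lambda>x. M)"
        proof (rule integral_le)
          show "(\<lambda>x. lap_log_norm J g (Complex x y)) integrable_on {-r..r}"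
            by (rule integrable_continuous_real, rule continuous_on_compose2[OF cont_lapg])
              (use sub y in \<open>auto intro!: continuous_intros simp del: mem_ball\<close>)
        qed (use M in_ball y in \<open>auto simp: abs_le_iff\<close>)
        then show ?thesis using r by (simp add: mult_ac)
      qed
      have "F \<le> integral {-r..r} (\<lambda>y. M * (2 * r))"
        unfolding F_def
      proof (rule integral_le)
        have "continuous_on (cbox (-r, -r) (r, r)) (\<lambda>p. lap_log_norm J g (Complex (snd p) (fst p)))"
          unfolding cbox_Pair_eq
          by (rule continuous_on_compose2[OF cont_lapg]) (use sub in \<open>auto intro!: continuous_intros simp del: mem_ball\<close>)
        from integral_integrable_2dim[OF this]
        show "(\<lambda>y. integral {-r..r} (\<lambda>x. lap_log_norm J g (Complex x y))) integrable_on {-r..r}" by simp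
      qed (use inner in auto)
      then have "F \<le> M * (2 * r) * (2 * r)" using r by (simp add: mult_ac)
      then show ?thesis using 1 by linarith
    qed
    \<comment> \<open>so small that the mass of \<open>g\<close> in the square is at most \<open>1\<close>, less than \<open>2 * pi\<close>\<close>
    define r where "r = min (1/8) (1 / (4 * (M + 1)))"
    have r: "0 < r" "r < 1/4" using Mnn by (auto simp: r_def)
    have "M * (2 * r) * (2 * r) \<le> 1"
    proof -
      have "(M + 1) * r \<le> (M + 1) * (1 / (4 * (M + 1)))" using Mnn by (intro mult_left_mono) (auto simp: r_def)
      also have "\<dots> = 1/4" using Mnn by (simp add: field_simps)
      finally have "M * r \<le> 1/4" using r by (simp add: distrib_right)
      then have "M * r * (4 * r) \<le> 1/4 * 1" using r Mnn by (intro mult_mono) auto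
      then show ?thesis by (simp add: mult_ac)
    qed
    then have "2 * pi * real n \<le> 8 * pi + 1" using key[OF r] by linarith
    moreover have "2 * pi * 5 \<le> 2 * pi * real n" using n'(2) by (intro mult_left_mono) auto
    ultimately show False using pi_gt3 by linarith
  qed
  then show ?thesis using n pole_bound_mono by blast
qed

definition dominated :: "'k \<Rightarrow> 'k \<Rightarrow> bool" where
  "dominated i k \<longleftrightarrow> (\<exists>B \<epsilon>. \<epsilon> > 0 \<and> (\<forall>z. z \<noteq> 0 \<and> cmod z < \<epsilon> \<longrightarrow> cmod (\<Phi> i z) \<le> B * cmod (\<Phi> k z)))"

lemma dominatedI:
  "\<epsilon> > 0 \<Longrightarrow> (\<And>z. z \<noteq> 0 \<Longrightarrow> cmod z < \<epsilon> \<Longrightarrow> cmod (\<Phi> i z) \<le> B * cmod (\<Phi> k z)) \<Longrightarrow> dominated i k"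
  unfolding dominated_def by blast

lemma dominated_trans:
  assumes "dominated i k" "dominated k l" shows "dominated i l"
proof -
  obtain B \<epsilon> where 1: "\<epsilon> > 0" "\<And>z. z \<noteq> 0 \<Longrightarrow> cmod z < \<epsilon> \<Longrightarrow> cmod (\<Phi> i z) \<le> B * cmod (\<Phi> k z)"
    using assms(1) unfolding dominated_def by blast
  obtain B' \<epsilon>' where 2: "\<epsilon>' > 0" "\<And>z. z \<noteq> 0 \<Longrightarrow> cmod z < \<epsilon>' \<Longrightarrow> cmod (\<Phi> k z) \<le> B' * cmod (\<Phi> l z)"
    using assms(2) unfolding dominated_def by blast
  show ?thesis
  proof (rule dominatedI[of "min \<epsilon> \<epsilon>'" _ "\<bar>B\<bar> * B'"])
    fix z :: complex assume z: "z \<noteq> 0" "cmod z < min \<epsilon> \<epsilon>'"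
    have "cmod (\<Phi> i z) \<le> B * cmod (\<Phi> k z)" using 1(2) z by simp
    also have "\<dots> \<le> \<bar>B\<bar> * cmod (\<Phi> k z)" by (intro mult_right_mono) auto
    also have "\<dots> \<le> \<bar>B\<bar> * (B' * cmod (\<Phi> l z))" using 2(2) z by (intro mult_left_mono) auto
    finally show "cmod (\<Phi> i z) \<le> \<bar>B\<bar> * B' * cmod (\<Phi> l z)" by (simp add: mult.assoc)
  qed (use 1 2 in auto)
qed

lemma component_le_norm_sq: "i \<in> J \<Longrightarrow> (cmod (\<Phi> i z))\<^sup>2 \<le> norm_sq J \<Phi> z"
  unfolding norm_sq_def using J by (intro member_le_sum) auto

text \<open>
  Neither \<open>\<Phi> i\<close>, \<open>\<Phi> k\<close> nor their difference has zeros accumulating at the puncture, unless it vanishes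
  identically. So the quotient omits \<open>0\<close>, \<open>1\<close> and \<open>\<infinity>\<close>, and by the great Picard theorem the puncture is not an
  essential singularity of it.
\<close>

lemma dominated_total:
  assumes fin: "total_mass J \<Phi> < \<infinity>" and i: "i \<in> J" and k: "k \<in> J"
  shows "dominated i k \<or> dominated k i"
proof -
  let ?V = "ball (0::complex) 1 - {0}"
  have VL: "z \<in> - Lat" if "z \<in> ?V" for z using that punctured_disc_compl_Lat by auto
  have holV: "\<Phi> j holomorphic_on ?V" if "j \<in> J" for j
    by (rule holomorphic_on_subset[OF hol[OF that]]) (use VL in blast)
  have zero_case: "dominated j l" if "\<And>z. z \<in> ?V \<Longrightarrow> \<Phi> j z = 0" for j l
    by (rule dominatedI[of 1 _ 0]) (use that in auto)
  have alt: "(\<forall>z\<in>?V. g z = 0) \<or> (\<exists>\<epsilon>>0. \<forall>z. z \<noteq> 0 \<and> cmod z < \<epsilon> \<longrightarrow> g z \<noteq> 0)"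
    if "g holomorphic_on ?V" "\<And>z. z \<in> ?V \<Longrightarrow> (cmod (g z))\<^sup>2 \<le> B * norm_sq J \<Phi> z" for g B
    using no_zeros_near_puncture[OF fin that] by blast
  have hd: "(\<lambda>z. \<Phi> i z - \<Phi> k z) holomorphic_on ?V" using holV i k by (intro holomorphic_intros)
  have bd: "(cmod (\<Phi> i z - \<Phi> k z))\<^sup>2 \<le> 4 * norm_sq J \<Phi> z" for z
  proof -
    have "(cmod (\<Phi> i z - \<Phi> k z))\<^sup>2 \<le> (cmod (\<Phi> i z) + cmod (\<Phi> k z))\<^sup>2"
      by (intro power_mono norm_triangle_ineq4) auto
    also have "\<dots> \<le> 2 * (cmod (\<Phi> i z))\<^sup>2 + 2 * (cmod (\<Phi> k z))\<^sup>2"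
      using sum_squares_bound[of "cmod (\<Phi> i z)" "cmod (\<Phi> k z)"] by (simp add: power2_sum)
    also have "\<dots> \<le> 4 * norm_sq J \<Phi> z" using component_le_norm_sq[OF i, of z] component_le_norm_sq[OF k, of z] by simp
    finally show ?thesis .
  qed
  consider "\<forall>z\<in>?V. \<Phi> i z = 0" | "\<forall>z\<in>?V. \<Phi> k z = 0" | "\<forall>z\<in>?V. \<Phi> i z - \<Phi> k z = 0"
    | \<epsilon>1 \<epsilon>2 \<epsilon>3 where "\<epsilon>1 > 0" "\<forall>z. z \<noteq> 0 \<and> cmod z < \<epsilon>1 \<longrightarrow> \<Phi> i z \<noteq> 0"
       "\<epsilon>2 > 0" "\<forall>z. z \<noteq> 0 \<and> cmod z < \<epsilon>2 \<longrightarrow> \<Phi> k z \<noteq> 0"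
       "\<epsilon>3 > 0" "\<forall>z. z \<noteq> 0 \<and> cmod z < \<epsilon>3 \<longrightarrow> \<Phi> i z - \<Phi> k z \<noteq> 0"
    using alt[OF holV[OF i], of 1] alt[OF holV[OF k], of 1] alt[OF hd bd] component_le_norm_sq i k
    by (metis mult_1)
  then show ?thesis
  proof cases
    case 1
    then show ?thesis using zero_case by blast
  next
    case 2
    then show ?thesis using zero_case by blast
  next
    case 3
    then have "dominated i k" by (intro dominatedI[of 1 _ 1]) auto
    then show ?thesis by blast
  next
    case (4 \<epsilon>1 \<epsilon>2 \<epsilon>3)
    define \<epsilon> where "\<epsilon> = min 1 (min \<epsilon>1 (min \<epsilon>2 \<epsilon>3))"
    have \<epsilon>: "\<epsilon> > 0" using 4 by (simp add: \<epsilon>_def)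
    have nz: "\<Phi> i z \<noteq> 0" "\<Phi> k z \<noteq> 0" "\<Phi> i z \<noteq> \<Phi> k z" if "z \<noteq> 0" "cmod z < \<epsilon>" for z
      using 4 that by (auto simp: \<epsilon>_def)
    define q where "q z = \<Phi> i z / \<Phi> k z" for z
    have hq: "q holomorphic_on ball 0 \<epsilon> - {0}"
    proof -
      have sub: "ball 0 \<epsilon> - {0} \<subseteq> ?V" by (auto simp: \<epsilon>_def)
      show ?thesis unfolding q_def[abs_def]
        by (intro holomorphic_intros holomorphic_on_subset[OF holV[OF i] sub] holomorphic_on_subset[OF holV[OF k] sub])
          (use nz in auto)
    qed
    have avoid: "q w \<noteq> 0 \<and> q w \<noteq> 1" if "w \<in> ball 0 \<epsilon> - {0}" for w
      using nz[of w] that by (auto simp: q_def)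
    have bdd: "\<exists>d>0. \<exists>B. \<forall>z. z \<noteq> 0 \<and> cmod z < d \<longrightarrow> cmod (g z) \<le> B" if "(g \<longlongrightarrow> l) (at 0)" for g :: "complex \<Rightarrow> complex" and l
    proof -
      have "eventually (\<lambda>z. dist (g z) l < 1) (at 0)" using tendstoD[OF that, of 1] by simp
      then obtain d where d: "d > 0" "\<And>z. z \<noteq> 0 \<Longrightarrow> cmod z < d \<Longrightarrow> dist (g z) l < 1"
        unfolding eventually_at by (auto simp: dist_norm)
      have "cmod (g z) \<le> cmod l + 1" if "z \<noteq> 0" "cmod z < d" for z
        using d(2)[OF that] norm_triangle_ineq2[of "g z" l] by (simp add: dist_norm)
      then show ?thesis using d(1) by blast
    qed
    obtain l where "(q \<longlongrightarrow> l) (at 0) \<or> ((inverse \<circ> q) \<longlongrightarrow> l) (at 0)"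
      by (rule great_Picard[of "ball 0 \<epsilon>" 0 0 1 q]) (use \<epsilon> hq avoid in auto)
    then show ?thesis
    proof
      assume "(q \<longlongrightarrow> l) (at 0)"
      then obtain d B where d: "d > 0" "\<And>z. z \<noteq> 0 \<Longrightarrow> cmod z < d \<Longrightarrow> cmod (q z) \<le> B" using bdd by blast
      have "dominated i k"
      proof (rule dominatedI[of "min d \<epsilon>" _ B])
        fix z :: complex assume z: "z \<noteq> 0" "cmod z < min d \<epsilon>"
        then show "cmod (\<Phi> i z) \<le> B * cmod (\<Phi> k z)"
          using d(2)[of z] nz[of z] by (simp add: q_def norm_divide pos_divide_le_eq)
      qed (use d \<epsilon> in auto)
      then show ?thesis by blast
    next
      assume "((inverse \<circ> q) \<longlongrightarrow> l) (at 0)"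
      then obtain d B where d: "d > 0" "\<And>z. z \<noteq> 0 \<Longrightarrow> cmod z < d \<Longrightarrow> cmod ((inverse \<circ> q) z) \<le> B" using bdd by blast
      have "dominated k i"
      proof (rule dominatedI[of "min d \<epsilon>" _ B])
        fix z :: complex assume z: "z \<noteq> 0" "cmod z < min d \<epsilon>"
        then show "cmod (\<Phi> k z) \<le> B * cmod (\<Phi> i z)"
          using d(2)[of z] nz[of z] by (simp add: q_def norm_divide norm_inverse pos_divide_le_eq)
      qed (use d \<epsilon> in auto)
      then show ?thesis by blast
    qed
  qed
qed

lemma dominating_index:
  assumes fin: "total_mass J \<Phi> < \<infinity>" and ne: "J \<noteq> {}"
  shows "\<exists>m\<in>J. \<forall>i\<in>J. dominated i m"
proof -
  have "\<exists>m\<in>A. \<forall>i\<in>A. dominated i m" if "finite A" "A \<noteq> {}" "A \<subseteq> J" for A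
    using that
  proof (induction A rule: finite_ne_induct)
    case (singleton x)
    then show ?case using dominated_total[OF fin, of x x] by blast
  next
    case (insert x A)
    then obtain m where m: "m \<in> A" "\<And>i. i \<in> A \<Longrightarrow> dominated i m" by auto
    have "x \<in> J" "m \<in> J" using insert.prems m by auto
    show ?case
    proof (cases "dominated x m")
      case True
      then show ?thesis using m by blast
    next
      case False
      then have "dominated m x" using dominated_total[OF fin \<open>x \<in> J\<close> \<open>m \<in> J\<close>] by blast
      moreover have "dominated x x" using dominated_total[OF fin \<open>x \<in> J\<close> \<open>x \<in> J\<close>] by blast
      ultimately show ?thesis using m dominated_trans by blast
    qed
  qed
  from this[OF J ne order_refl] show ?thesis .
qed

text \<open>
  Let \<open>\<Phi> m\<close> dominate. Its residue vanishes, so it has a primitive \<open>h\<close>, and the derivative of \<open>f\<close> is bounded by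
  a multiple of that of \<open>h\<close>. As \<open>f\<close> is proper, \<open>h\<close> has a pole, and so \<open>\<Phi> m\<close> and all other components are of
  finite order.
\<close>

theorem meromorphic_at_puncture:
  fixes f :: "complex \<Rightarrow> 'b::real_normed_vector"
  assumes fin: "total_mass J \<Phi> < \<infinity>" and ne: "J \<noteq> {}"
    and f: "\<And>z. z \<in> - Lat \<Longrightarrow> (f has_derivative f' z) (at z)"
    and f': "\<And>z v. z \<in> - Lat \<Longrightarrow> norm (f' z v) \<le> sqrt (norm_sq J \<Phi> z) * cmod v"
    and inf: "filterlim (\<lambda>z. norm (f z)) at_top (at 0)"
  shows "\<exists>n. \<forall>j\<in>J. pole_bound n (\<Phi> j)"
proof -
  obtain m where m: "m \<in> J" "\<And>i. i \<in> J \<Longrightarrow> dominated i m" using dominating_index[OF fin ne] by blast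
  have "\<forall>i\<in>J. \<exists>p. snd p > 0 \<and> (\<forall>z. z \<noteq> 0 \<and> cmod z < snd p \<longrightarrow> cmod (\<Phi> i z) \<le> fst p * cmod (\<Phi> m z))"
    using m(2) unfolding dominated_def by fastforce
  then obtain p where p: "\<And>i. i \<in> J \<Longrightarrow> snd (p i) > 0"
     "\<And>i z. i \<in> J \<Longrightarrow> z \<noteq> 0 \<Longrightarrow> cmod z < snd (p i) \<Longrightarrow> cmod (\<Phi> i z) \<le> fst (p i) * cmod (\<Phi> m z)"
    by metis
  define \<epsilon> where "\<epsilon> = Min (insert 1 ((\<lambda>i. snd (p i)) ` J))"
  have \<epsilon>: "\<epsilon> > 0" "\<epsilon> \<le> 1" "\<And>i. i \<in> J \<Longrightarrow> \<epsilon> \<le> snd (p i)"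
    using J p(1) by (auto simp: \<epsilon>_def)
  define C where "C = sqrt (\<Sum>i\<in>J. (fst (p i))\<^sup>2)"
  have C0: "C \<ge> 0" by (simp add: C_def sum_nonneg)
  have dom: "sqrt (norm_sq J \<Phi> z) \<le> C * cmod (\<Phi> m z)" if z: "z \<noteq> 0" "cmod z < \<epsilon>" for z
  proof -
    have "norm_sq J \<Phi> z \<le> (\<Sum>i\<in>J. (fst (p i) * cmod (\<Phi> m z))\<^sup>2)"
      unfolding norm_sq_def
    proof (rule sum_mono)
      fix i assume i: "i \<in> J"
      have "cmod z < snd (p i)" using z \<epsilon>(3)[OF i] by linarith
      then show "(cmod (\<Phi> i z))\<^sup>2 \<le> (fst (p i) * cmod (\<Phi> m z))\<^sup>2" using p(2)[OF i z(1)] by (intro power_mono) auto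
    qed
    also have "\<dots> = (\<Sum>i\<in>J. (fst (p i))\<^sup>2) * (cmod (\<Phi> m z))\<^sup>2" by (simp add: power_mult_distrib sum_distrib_right)
    finally have "sqrt (norm_sq J \<Phi> z) \<le> sqrt ((\<Sum>i\<in>J. (fst (p i))\<^sup>2) * (cmod (\<Phi> m z))\<^sup>2)" by (rule real_sqrt_le_mono)
    then show ?thesis by (simp add: C_def real_sqrt_mult)
  qed
  have sub: "ball 0 \<epsilon> - {0} \<subseteq> - Lat" using \<epsilon>(2) punctured_disc_compl_Lat by fastforce
  have nz: "\<Phi> m z \<noteq> 0" if "z \<in> ball 0 \<epsilon> - {0}" for z
  proof
    assume "\<Phi> m z = 0"
    then have "sqrt (norm_sq J \<Phi> z) \<le> 0" using dom[of z] that by simp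
    moreover have "norm_sq J \<Phi> z > 0" using pos sub that by blast
    ultimately show False by simp
  qed
  have holm: "\<Phi> m holomorphic_on ball 0 \<epsilon> - {0}" by (rule holomorphic_on_subset[OF hol[OF m(1)] sub])
  have "\<exists>h. \<forall>z\<in>ball 0 \<epsilon> - {0}. (h has_field_derivative \<Phi> m z) (at z)"
  proof (rule primitive_punctured_disc[OF \<epsilon>(1) holm elliptic_residue_0[OF ell[OF m(1)]]])
    fix h assume "\<And>z. z \<in> ball 0 \<epsilon> - {0} \<Longrightarrow> (h has_field_derivative \<Phi> m z) (at z)"
    then show "\<exists>h. \<forall>z\<in>ball 0 \<epsilon> - {0}. (h has_field_derivative \<Phi> m z) (at z)" by (intro exI[of _ h] ballI)
  qed
  then obtain h where h0: "\<forall>z\<in>ball 0 \<epsilon> - {0}. (h has_field_derivative \<Phi> m z) (at z)" ..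
  note h = bspec[OF h0]
  have dh: "deriv h z = \<Phi> m z" if "z \<in> ball 0 \<epsilon> - {0}" for z by (rule DERIV_imp_deriv[OF h[OF that]])
  have holh: "h holomorphic_on ball 0 \<epsilon> - {0}"
    unfolding holomorphic_on_open[OF open_delete[OF open_ball]] by (intro ballI exI, rule h)
  have "filterlim h at_infinity (at 0)"
  proof (rule proper_implies_pole[OF \<epsilon>(1) holh _ _ _ C0 inf])
    fix z :: complex assume z: "z \<in> ball 0 \<epsilon> - {0}"
    show "deriv h z \<noteq> 0" using nz[OF z] dh[OF z] by simp
    show "(f has_derivative f' z) (at z)" using f sub z by blast
    fix v
    have "norm (f' z v) \<le> sqrt (norm_sq J \<Phi> z) * cmod v" using f' sub z by blast
    also have "\<dots> \<le> C * cmod (\<Phi> m z) * cmod v" using dom[of z] z by (intro mult_right_mono) auto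
    finally show "norm (f' z v) \<le> C * cmod (deriv h z) * cmod v" using dh[OF z] by simp
  qed
  \<comment> \<open>The function \<open>1 / h\<close> extends by \<open>0\<close> and vanishes to finite order \<open>N\<close>, so \<open>h\<close> and
    its derivative grow polynomially in \<open>1 / cmod z\<close>.\<close>
  then have inv0: "((\<lambda>z. inverse (h z)) \<longlongrightarrow> 0) (at 0)" by (rule filterlim_compose[OF tendsto_inverse_0])
  have "eventually (\<lambda>z. 1 \<le> cmod (h z)) (at 0)"
    using \<open>filterlim h at_infinity (at 0)\<close> unfolding filterlim_at_infinity[OF order_refl] by force
  then obtain d where d: "d > 0" "\<And>z. z \<noteq> 0 \<Longrightarrow> cmod z < d \<Longrightarrow> 1 \<le> cmod (h z)"
    unfolding eventually_at by (auto simp: dist_norm)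
  define \<delta> where "\<delta> = min d \<epsilon>"
  have \<delta>: "\<delta> > 0" "\<delta> \<le> d" "\<delta> \<le> \<epsilon>" using d \<epsilon> by (auto simp: \<delta>_def)
  define k where "k z = (if z = 0 then 0 else inverse (h z))" for z
  have hnz: "h z \<noteq> 0" if "z \<noteq> 0" "cmod z < \<delta>" for z using d(2)[of z] that \<delta> by force
  have holk0: "k holomorphic_on ball 0 \<delta> - {0}"
  proof -
    have "(\<lambda>z. inverse (h z)) holomorphic_on ball 0 \<delta> - {0}"
      by (intro holomorphic_intros holomorphic_on_subset[OF holh]) (use hnz \<delta> in auto)
    then show ?thesis by (rule holomorphic_transform) (simp add: k_def)
  qed
  have contk: "continuous_on (ball 0 \<delta>) k"
  proof -
    have "isCont k z" if "z \<in> ball 0 \<delta>" for z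
    proof (cases "z = 0")
      case True
      have "(k \<longlongrightarrow> 0) (at 0)"
        by (rule Lim_transform_eventually[OF inv0]) (auto simp: eventually_at k_def intro!: exI[of _ 1])
      then show ?thesis using True by (simp add: isCont_def k_def)
    next
      case False
      have "continuous_on (ball 0 \<delta> - {0}) k" by (rule holomorphic_on_imp_continuous_on[OF holk0])
      then show ?thesis using False that by (simp add: continuous_on_eq_continuous_at open_delete)
    qed
    then show ?thesis by (simp add: continuous_at_imp_continuous_on)
  qed
  have holk: "k holomorphic_on ball 0 \<delta>"
  proof (rule no_isolated_singularity'[of "{0}"])
    fix z :: complex assume "z \<in> {0}"
    then have "z \<in> ball 0 \<delta>" using \<delta>(1) by simp
    then show "(k \<longlongrightarrow> k z) (at z within ball 0 \<delta>)" using contk unfolding continuous_on_def by blast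
  qed (use holk0 in auto)
  have "\<exists>c N r. 0 < c \<and> 0 < r \<and> ball (0::complex) r \<subseteq> ball 0 \<delta> \<and> (\<forall>w\<in>ball 0 r. c * cmod w ^ N \<le> cmod (k w))"
    proof (rule holomorphic_lower_bound_difference[OF holk open_ball connected_ball, of 0 "of_real (\<delta>/2)"])
      show "k (complex_of_real (\<delta> / 2)) \<noteq> k 0" using hnz[of "of_real (\<delta>/2)"] \<delta>(1) by (simp add: k_def)
      fix c N r assume *: "0 < c" "0 < r" "ball (0::complex) r \<subseteq> ball 0 \<delta>" "\<And>w. w \<in> ball 0 r \<Longrightarrow> c * cmod (w - 0) ^ N \<le> cmod (k w - k 0)"
      have b: "c * cmod w ^ N \<le> cmod (k w)" if "w \<in> ball 0 r" for w using *(4)[OF that] by (simp add: k_def)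
      show "\<exists>c N r. 0 < c \<and> 0 < r \<and> ball (0::complex) r \<subseteq> ball 0 \<delta> \<and> (\<forall>w\<in>ball 0 r. c * cmod w ^ N \<le> cmod (k w))"
        by (rule exI[of _ c], rule exI[of _ N], rule exI[of _ r]) (intro conjI ballI *(1-3) b)
    qed (use \<delta>(1) in auto)
  then obtain c N r where cN0: "0 < c \<and> 0 < r \<and> ball (0::complex) r \<subseteq> ball 0 \<delta> \<and> (\<forall>w\<in>ball 0 r. c * cmod w ^ N \<le> cmod (k w))"
    by (elim exE) (rule that)
  then have cN: "0 < c" "0 < r" "ball (0::complex) r \<subseteq> ball 0 \<delta>" by simp_all
  have cN4: "c * cmod w ^ N \<le> cmod (k w)" if "w \<in> ball 0 r" for w using cN0 that by simp
  have "bounded (deriv k ` cball 0 (r/2))"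
  proof (intro compact_imp_bounded compact_continuous_image compact_cball)
    have "cball (0::complex) (r/2) \<subseteq> ball 0 r" using cN(2) by auto
    then have "cball (0::complex) (r/2) \<subseteq> ball 0 \<delta>" using cN(3) by blast
    then show "continuous_on (cball 0 (r/2)) (deriv k)"
      by (rule continuous_on_subset[OF holomorphic_on_imp_continuous_on[OF holomorphic_deriv[OF holk open_ball]]])
  qed
  then obtain D where D0: "\<forall>y\<in>deriv k ` cball 0 (r/2). cmod y \<le> D" unfolding bounded_iff by blast
  have bm: "cmod (z ^ (2 * N) * \<Phi> m z) \<le> D / c\<^sup>2" if z: "z \<noteq> 0" "cmod z < r/2" for z
  proof -
    have zr: "z \<in> ball 0 r" using z cN(2) by simp
    then have z\<delta>: "z \<in> ball 0 \<delta>" using cN(3) by blast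
    have z\<epsilon>: "z \<in> ball 0 \<epsilon> - {0}" using z\<delta> \<delta> z by auto
    have hz: "h z \<noteq> 0" using hnz[of z] z z\<delta> by simp
    have "((\<lambda>z. inverse (h z)) has_field_derivative - (inverse (h z) * \<Phi> m z * inverse (h z))) (at z)"
      by (rule DERIV_inverse'[OF h[OF z\<epsilon>] hz])
    then have "(k has_field_derivative - (inverse (h z) * \<Phi> m z * inverse (h z))) (at z)"
      by (rule has_field_derivative_transform_within_open[of _ _ _ "ball 0 \<delta> - {0}"])
        (use z\<delta> z in \<open>auto simp: k_def intro!: open_delete\<close>)
    then have dk: "deriv k z = - (k z * \<Phi> m z * k z)" using z by (simp add: DERIV_imp_deriv k_def)
    have "cmod (k z) ^ 2 * cmod (\<Phi> m z) = cmod (deriv k z)"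
      unfolding dk by (simp add: norm_mult power2_eq_square)
    also have "\<dots> \<le> D" using D0 z by simp
    finally have 1: "cmod (k z) ^ 2 * cmod (\<Phi> m z) \<le> D" .
    have "(c * cmod z ^ N)\<^sup>2 \<le> (cmod (k z))\<^sup>2" using cN(1) cN4[OF zr] by (intro power_mono) auto
    then have "(c * cmod z ^ N)\<^sup>2 * cmod (\<Phi> m z) \<le> (cmod (k z))\<^sup>2 * cmod (\<Phi> m z)" by (intro mult_right_mono) auto
    then have "c\<^sup>2 * cmod (z ^ (2 * N) * \<Phi> m z) \<le> D"
      using 1 by (simp add: norm_mult norm_power power_mult_distrib power_mult[symmetric] mult_ac)
    then show ?thesis using cN(1) by (simp add: pos_le_divide_eq mult.commute)
  qed
  have "pole_bound (2 * N) (\<Phi> i)" if i: "i \<in> J" for i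
  proof (rule pole_boundI[of "min (r/2) \<epsilon>" _ _ "C * (D / c\<^sup>2)"])
    show "min (r/2) \<epsilon> > 0" using cN(2) \<epsilon>(1) by simp
    fix z :: complex assume z: "z \<noteq> 0" "cmod z < min (r/2) \<epsilon>"
    have "cmod (\<Phi> i z) \<le> sqrt (norm_sq J \<Phi> z)" using component_le_norm_sq[OF i, of z] by (simp add: real_le_rsqrt)
    also have "\<dots> \<le> C * cmod (\<Phi> m z)" using dom[of z] z by simp
    finally have "cmod (z ^ (2 * N)) * cmod (\<Phi> i z) \<le> cmod (z ^ (2 * N)) * (C * cmod (\<Phi> m z))" by (intro mult_left_mono) auto
    also have "\<dots> = C * cmod (z ^ (2 * N) * \<Phi> m z)" by (simp add: norm_mult mult_ac)
    also have "\<dots> \<le> C * (D / c\<^sup>2)" using bm[of z] z C0 by (intro mult_left_mono) auto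
    finally show "cmod (z ^ (2 * N) * \<Phi> i z) \<le> C * (D / c\<^sup>2)" by (simp add: norm_mult)
  qed
  then show ?thesis by blast
qed

end

section \<open>Isotropic planes and complex structures\<close>

lemma orthonormal_frame_complex_structure:
  fixes P1 Q1 P2 Q2 :: "real^4"
  assumes [simp]: "P1 \<bullet> P1 = 1" "Q1 \<bullet> Q1 = 1" "P2 \<bullet> P2 = 1" "Q2 \<bullet> Q2 = 1"
    and o: "P1 \<bullet> Q1 = 0" "P1 \<bullet> P2 = 0" "P1 \<bullet> Q2 = 0" "Q1 \<bullet> P2 = 0" "Q1 \<bullet> Q2 = 0" "P2 \<bullet> Q2 = 0"
  shows "\<exists>J. orthogonal_complex_structure J \<and> J P1 = Q1 \<and> J Q1 = - P1 \<and> J P2 = Q2 \<and> J Q2 = - P2"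
proof -
  note [simp] = o o[THEN trans[OF inner_commute]]
  have ne: "P1 \<noteq> 0" "Q1 \<noteq> 0" "P2 \<noteq> 0" "Q2 \<noteq> 0"
    using assms(1-4) by (metis inner_zero_left zero_neq_one)+
  have di: "P1 \<noteq> Q1" "P1 \<noteq> P2" "P1 \<noteq> Q2" "Q1 \<noteq> P2" "Q1 \<noteq> Q2" "P2 \<noteq> Q2"
    using o assms(1-4) by (metis zero_neq_one)+
  define B where "B = {P1, Q1, P2, Q2}"
  have orth: "pairwise orthogonal B" by (auto simp: B_def pairwise_def orthogonal_def)
  have "0 \<notin> B" using ne by (auto simp: B_def)
  then have "independent B" by (rule pairwise_orthogonal_independent[OF orth])
  moreover have card: "card B = 4" using di by (simp add: B_def)
  ultimately have "UNIV \<subseteq> span B"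
    by (intro card_ge_dim_independent) auto
  then have "(\<Sum>i\<in>B. (v \<bullet> i) *\<^sub>R i) = v" for v
    by (intro orthonormal_basis_expand[OF orth]) (auto simp: B_def norm_eq_1)
  then have ex: "v = (v \<bullet> P1) *\<^sub>R P1 + (v \<bullet> Q1) *\<^sub>R Q1 + (v \<bullet> P2) *\<^sub>R P2 + (v \<bullet> Q2) *\<^sub>R Q2" for v
    using di by (simp add: B_def add.assoc)
  define J where "J v = (v \<bullet> P1) *\<^sub>R Q1 - (v \<bullet> Q1) *\<^sub>R P1 + (v \<bullet> P2) *\<^sub>R Q2 - (v \<bullet> Q2) *\<^sub>R P2" for v
  have "linear J"
    by (rule linearI) (simp_all add: J_def inner_add_left algebra_simps)
  moreover have "J v \<bullet> J w = v \<bullet> w" for v w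
  proof -
    have "J v \<bullet> J w = (v \<bullet> P1) * (w \<bullet> P1) + (v \<bullet> Q1) * (w \<bullet> Q1) + (v \<bullet> P2) * (w \<bullet> P2) + (v \<bullet> Q2) * (w \<bullet> Q2)"
      by (simp add: J_def inner_add_left inner_diff_left inner_add_right inner_diff_right)
    also have "\<dots> = v \<bullet> ((w \<bullet> P1) *\<^sub>R P1 + (w \<bullet> Q1) *\<^sub>R Q1 + (w \<bullet> P2) *\<^sub>R P2 + (w \<bullet> Q2) *\<^sub>R Q2)"
      by (simp add: inner_add_right mult.commute)
    also have "\<dots> = v \<bullet> w" by (simp only: ex[of w, symmetric])
    finally show ?thesis .
  qed
  moreover have "J (J v) = - v" for v
  proof -
    have c: "J v \<bullet> P1 = - (v \<bullet> Q1)" "J v \<bullet> Q1 = v \<bullet> P1" "J v \<bullet> P2 = - (v \<bullet> Q2)" "J v \<bullet> Q2 = v \<bullet> P2"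
      by (simp_all add: J_def inner_add_left inner_diff_left)
    have "J (J v) = - ((v \<bullet> P1) *\<^sub>R P1 + (v \<bullet> Q1) *\<^sub>R Q1 + (v \<bullet> P2) *\<^sub>R P2 + (v \<bullet> Q2) *\<^sub>R Q2)"
      unfolding J_def[of "J v"] c by simp
    then show ?thesis by (simp only: ex[of v, symmetric])
  qed
  ultimately have "orthogonal_complex_structure J"
    by (simp add: orthogonal_complex_structure_def orthogonal_transformation_def)
  moreover have "J P1 = Q1" "J Q1 = - P1" "J P2 = Q2" "J Q2 = - P2" by (simp_all add: J_def)
  ultimately show ?thesis by blast
qed

text \<open>
  The isotropic plane spanned by \<open>c\<close> and \<open>d\<close> meets its complex conjugate only in \<open>0\<close>, so it determines
  a complex structure \<open>J\<close> of the real space by \<open>J (Re a) = Re (\<i> a)\<close> for \<open>a\<close> in the plane, and isotropy makes it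
  orthogonal. Concretely, the real and imaginary parts of a Hermitian-orthogonal basis of the plane form an orthogonal
  frame of the real space.
\<close>

lemma isotropic_plane_complex_structure:
  fixes c d :: "4 \<Rightarrow> complex"
  assumes cc: "(\<Sum>j\<in>UNIV. c j * c j) = 0" and cd: "(\<Sum>j\<in>UNIV. c j * d j) = 0"
    and dd: "(\<Sum>j\<in>UNIV. d j * d j) = 0" and ind: "c i * d k \<noteq> c k * d i"
  shows "\<exists>J. orthogonal_complex_structure J \<and>
    (\<forall>\<alpha> \<beta>. J (\<chi> j. Re (\<alpha> * c j + \<beta> * d j)) = (\<chi> j. Re (\<i> * (\<alpha> * c j + \<beta> * d j))))"
proof -
  define N where "N = (\<Sum>j\<in>UNIV. c j * cnj (c j))"
  have Nre: "N = of_real (\<Sum>j\<in>UNIV. (cmod (c j))\<^sup>2)" by (simp add: N_def complex_norm_square del: of_real_power)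
  have "\<exists>j. c j \<noteq> 0" using ind by (metis mult_zero_left)
  then have "(\<Sum>j\<in>UNIV. (cmod (c j))\<^sup>2) \<noteq> 0" by (simp add: sum_nonneg_eq_0_iff finite_class.finite_UNIV)
  then have N: "N \<noteq> 0" by (simp only: Nre of_real_eq_0_iff not_False_eq_True)
  \<comment> \<open>One Gram-Schmidt step for the Hermitian product; \<open>e\<close> and \<open>c\<close> span the same isotropic plane.\<close>
  define \<kappa> where "\<kappa> = (\<Sum>j\<in>UNIV. d j * cnj (c j)) / N"
  define e where "e j = d j - \<kappa> * c j" for j
  have ecc: "(\<Sum>j\<in>UNIV. e j * cnj (c j)) = 0"
  proof -
    have "(\<Sum>j\<in>UNIV. e j * cnj (c j)) = (\<Sum>j\<in>UNIV. d j * cnj (c j)) - \<kappa> * N"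
      by (simp add: e_def N_def left_diff_distrib sum_subtractf sum_distrib_left mult.assoc)
    then show ?thesis using N by (simp add: \<kappa>_def)
  qed
  have ec: "(\<Sum>j\<in>UNIV. e j * c j) = 0"
  proof -
    have "(\<Sum>j\<in>UNIV. e j * c j) = (\<Sum>j\<in>UNIV. c j * d j) - \<kappa> * (\<Sum>j\<in>UNIV. c j * c j)"
      unfolding sum_distrib_left sum_subtractf[symmetric] by (simp add: e_def algebra_simps)
    then show ?thesis using cc cd by simp
  qed
  have ee: "(\<Sum>j\<in>UNIV. e j * e j) = 0"
  proof -
    have "(\<Sum>j\<in>UNIV. e j * e j) = (\<Sum>j\<in>UNIV. d j * d j) - \<kappa> * (\<Sum>j\<in>UNIV. c j * d j) - \<kappa> * (\<Sum>j\<in>UNIV. e j * c j)"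
      unfolding sum_distrib_left sum_subtractf[symmetric] by (intro sum.cong refl) (simp add: e_def algebra_simps)
    then show ?thesis using ec cd dd by simp
  qed
  have ene: "\<exists>j. e j \<noteq> 0"
  proof (rule ccontr)
    assume "\<not> ?thesis"
    then have "d j = \<kappa> * c j" for j by (simp add: e_def)
    then show False using ind by (simp add: mult_ac)
  qed
  \<comment> \<open>\<open>q a = p (\<i> a)\<close>, so that the desired \<open>J\<close> maps \<open>p a\<close> to \<open>q a\<close>\<close>
  define p q where "p a = (\<chi> j. Re (a j))" and "q a = (\<chi> j. - Im (a j))" for a :: "4 \<Rightarrow> complex"
  have iso: "p a \<bullet> q a = 0 \<and> q a \<bullet> q a = p a \<bullet> p a" if "(\<Sum>j\<in>UNIV. a j * a j) = 0" for a
  proof -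
    have "Re (\<Sum>j\<in>UNIV. a j * a j) = p a \<bullet> p a - q a \<bullet> q a" "Im (\<Sum>j\<in>UNIV. a j * a j) = - 2 * (p a \<bullet> q a)"
      by (simp_all add: p_def q_def inner_vec_def sum_subtractf sum_negf sum_distrib_left sum.distrib mult.commute)
    with that show ?thesis by simp
  qed
  have pos: "p a \<bullet> p a > 0" if "(\<Sum>j\<in>UNIV. a j * a j) = 0" "\<exists>j. a j \<noteq> 0" for a
  proof (rule ccontr)
    assume "\<not> ?thesis"
    then have "p a \<bullet> p a = 0" using inner_ge_zero[of "p a"] by linarith
    then have "p a = 0" "q a = 0" using iso[OF that(1)] by simp_all
    then show False using that(2) by (auto simp: p_def q_def vec_eq_iff complex_eq_iff)
  qed
  have o: "p e \<bullet> p c = 0" "q e \<bullet> q c = 0" "p e \<bullet> q c = 0" "q e \<bullet> p c = 0"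
  proof -
    have "Re (\<Sum>j\<in>UNIV. e j * c j) = p e \<bullet> p c - q e \<bullet> q c"
      "Im (\<Sum>j\<in>UNIV. e j * c j) = - (p e \<bullet> q c) - q e \<bullet> p c"
      "Re (\<Sum>j\<in>UNIV. e j * cnj (c j)) = p e \<bullet> p c + q e \<bullet> q c"
      "Im (\<Sum>j\<in>UNIV. e j * cnj (c j)) = p e \<bullet> q c - q e \<bullet> p c"
      by (simp_all add: p_def q_def inner_vec_def sum_subtractf sum_negf sum.distrib)
    then show "p e \<bullet> p c = 0" "q e \<bullet> q c = 0" "p e \<bullet> q c = 0" "q e \<bullet> p c = 0" using ec ecc by simp_all
  qed
  define s where "s a = 1 / sqrt (p a \<bullet> p a)" for a
  have s: "s a * (s a * (p a \<bullet> p a)) = 1" "s a \<noteq> 0" if "(\<Sum>j\<in>UNIV. a j * a j) = 0" "\<exists>j. a j \<noteq> 0" for a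
    using pos[OF that] by (simp_all add: s_def)
  have cne: "\<exists>j. c j \<noteq> 0" by fact
  have "\<exists>J. orthogonal_complex_structure J \<and> J (s c *\<^sub>R p c) = s c *\<^sub>R q c \<and> J (s c *\<^sub>R q c) = - (s c *\<^sub>R p c)
     \<and> J (s e *\<^sub>R p e) = s e *\<^sub>R q e \<and> J (s e *\<^sub>R q e) = - (s e *\<^sub>R p e)"
    by (rule orthonormal_frame_complex_structure)
      (use s[OF cc cne] s[OF ee ene] iso[OF cc] iso[OF ee] o in \<open>simp_all add: inner_commute\<close>)
  then obtain J where J: "orthogonal_complex_structure J" "J (s c *\<^sub>R p c) = s c *\<^sub>R q c" "J (s c *\<^sub>R q c) = - (s c *\<^sub>R p c)"
     "J (s e *\<^sub>R p e) = s e *\<^sub>R q e" "J (s e *\<^sub>R q e) = - (s e *\<^sub>R p e)" by blast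
  have lin: "linear J" using J(1) by (simp add: orthogonal_complex_structure_def orthogonal_transformation_def)
  have cancel: "J x = y" if "J (t *\<^sub>R x) = t *\<^sub>R y" "t \<noteq> 0" for t x y
    using that by (simp add: linear_cmul[OF lin])
  have Jpq: "J (p c) = q c" "J (q c) = - p c" "J (p e) = q e" "J (q e) = - p e"
    by (rule cancel[OF J(2) s(2)[OF cc cne]], rule cancel[OF _ s(2)[OF cc cne]], simp only: J(3) scaleR_minus_right,
        rule cancel[OF J(4) s(2)[OF ee ene]], rule cancel[OF _ s(2)[OF ee ene]], simp only: J(5) scaleR_minus_right)
  have span: "(\<chi> j. Re (\<alpha> * c j + \<beta> * e j)) = Re \<alpha> *\<^sub>R p c + Im \<alpha> *\<^sub>R q c + Re \<beta> *\<^sub>R p e + Im \<beta> *\<^sub>R q e" for \<alpha> \<beta>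
    by (simp add: vec_eq_iff p_def q_def)
  have "J (\<chi> j. Re (\<alpha> * c j + \<beta> * e j)) = (\<chi> j. Re ((\<i> * \<alpha>) * c j + (\<i> * \<beta>) * e j))" for \<alpha> \<beta>
    unfolding span by (simp add: linear_add[OF lin] linear_cmul[OF lin] Jpq)
  then have "J (\<chi> j. Re ((\<alpha> + \<beta> * \<kappa>) * c j + \<beta> * e j)) = (\<chi> j. Re ((\<i> * (\<alpha> + \<beta> * \<kappa>)) * c j + (\<i> * \<beta>) * e j))" for \<alpha> \<beta>
    by blast
  moreover have "(\<alpha> + \<beta> * \<kappa>) * c j + \<beta> * e j = \<alpha> * c j + \<beta> * d j" for \<alpha> \<beta> j
    by (simp add: e_def algebra_simps)
  moreover have "(\<i> * (\<alpha> + \<beta> * \<kappa>)) * c j + (\<i> * \<beta>) * e j = \<i> * (\<alpha> * c j + \<beta> * d j)" for \<alpha> \<beta> j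
    by (simp add: e_def algebra_simps)
  ultimately have "J (\<chi> j. Re (\<alpha> * c j + \<beta> * d j)) = (\<chi> j. Re (\<i> * (\<alpha> * c j + \<beta> * d j)))" for \<alpha> \<beta>
    by (simp only:)
  with J(1) show ?thesis by blast
qed

text \<open>
  The logarithm of a single holomorphic function is harmonic off its zeros.
\<close>

lemma lap_log_norm_proportional:
  assumes U: "open U" and hol: "\<Phi> m holomorphic_on U" and z: "z \<in> U"
    and prp: "\<And>j w. w \<in> U \<Longrightarrow> \<Phi> j w = \<kappa> j * \<Phi> m w"
  shows "lap_log_norm J \<Phi> z = 0"
proof -
  define K where "K = (\<Sum>j\<in>J. (cmod (\<kappa> j))\<^sup>2)"
  have d: "deriv (\<Phi> j) z = \<kappa> j * deriv (\<Phi> m) z" for j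
  proof (rule DERIV_imp_deriv)
    have "((\<lambda>w. \<kappa> j * \<Phi> m w) has_field_derivative \<kappa> j * deriv (\<Phi> m) z) (at z)"
      by (intro DERIV_cmult holomorphic_derivI[OF hol U z])
    then show "(\<Phi> j has_field_derivative \<kappa> j * deriv (\<Phi> m) z) (at z)"
      by (rule has_field_derivative_transform_within_open[OF _ U z]) (simp add: prp[symmetric])
  qed
  have S: "norm_sq J \<Phi> z = K * (cmod (\<Phi> m z))\<^sup>2"
    unfolding norm_sq_def K_def sum_distrib_right
    by (intro sum.cong refl) (subst prp[OF z], simp add: norm_mult power_mult_distrib)
  have D: "(\<Sum>j\<in>J. (cmod (deriv (\<Phi> j) z))\<^sup>2) = K * (cmod (deriv (\<Phi> m) z))\<^sup>2"
    unfolding K_def sum_distrib_right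
    by (intro sum.cong refl) (subst d, simp add: norm_mult power_mult_distrib)
  have "herm J \<Phi> z = (\<Sum>j\<in>J. \<kappa> j * cnj (\<kappa> j)) * (deriv (\<Phi> m) z * cnj (\<Phi> m z))"
    unfolding herm_def sum_distrib_right
    by (intro sum.cong refl) (subst d, subst prp[OF z], simp add: mult_ac)
  also have "(\<Sum>j\<in>J. \<kappa> j * cnj (\<kappa> j)) = of_real K" by (simp add: K_def complex_norm_square del: of_real_power)
  finally have "cmod (herm J \<Phi> z) = \<bar>K\<bar> * (cmod (deriv (\<Phi> m) z) * cmod (\<Phi> m z))" by (simp add: norm_mult)
  then have "(cmod (herm J \<Phi> z))\<^sup>2 = K\<^sup>2 * ((cmod (deriv (\<Phi> m) z))\<^sup>2 * (cmod (\<Phi> m z))\<^sup>2)"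
    by (simp add: power_mult_distrib)
  then show ?thesis unfolding lap_log_norm_def S D by (simp add: power2_eq_square)
qed

lemma dependent_imp_proportional:
  fixes c d :: "'k \<Rightarrow> complex"
  assumes dep: "\<And>i k. c i * d k = c k * d i" and ne: "c m \<noteq> 0 \<or> d m \<noteq> 0"
  shows "\<exists>\<kappa>. \<forall>j x y. c j * x + d j * y = \<kappa> j * (c m * x + d m * y)"
proof (cases "c m = 0")
  case False
  have "c j * x + d j * y = c j / c m * (c m * x + d m * y)" for j x y
  proof -
    have "d j = c j * d m / c m" using dep[of m j] False by (simp add: field_simps)
    then show ?thesis using False by (simp add: field_simps)
  qed
  then show ?thesis by (intro exI[of _ "\<lambda>j. c j / c m"]) blast
next
  case True
  then have dm: "d m \<noteq> 0" using ne by simp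
  have "c j * x + d j * y = d j / d m * (c m * x + d m * y)" for j x y
  proof -
    have "c j = 0" using dep[of m j] True dm by simp
    then show ?thesis using True dm by simp
  qed
  then show ?thesis by (intro exI[of _ "\<lambda>j. d j / d m"]) blast
qed

section \<open>Punctured minimal tori\<close>

text \<open>
  The coordinate is shifted so that the puncture lies at the lattice points: \<open>F\<close> is the lift of \<open>X\<close>, defined
  on \<open>V\<close>, and \<open>\<Phi> j z\<close> is its Weierstrass data at \<open>z + p\<close>. The value \<open>0\<close> at lattice points makes \<open>\<Phi>\<close> periodic
  everywhere, as the data of \<open>F\<close> are not controlled where \<open>F\<close> is not assumed to be differentiable.
\<close>

locale punctured_minimal_torus =
  fixes X :: "complex set \<Rightarrow> real^4" and p :: complex
  assumes minimal: "minimal_immersion eq_tau (torus eq_tau - {torus_proj eq_tau p}) X"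
begin

definition F where "F = X \<circ> torus_proj eq_tau"

definition V where "V = {z. z - p \<notin> Lat}"

definition \<Phi> where "\<Phi> j z = (if z \<in> Lat then 0 else weierstrass_data F j (z + p))"

lemma V_iff: "z + p \<in> V \<longleftrightarrow> z \<in> - Lat" by (simp add: V_def)

lemma V_add: "l \<in> Lat \<Longrightarrow> z + l \<in> V \<longleftrightarrow> z \<in> V"
  using Lat_add_iff[of l "z - p"] by (simp add: V_def diff_add_eq)

lemma open_V: "open V"
proof -
  have "V = (\<lambda>z. z - p) -` (- Lat)" by (auto simp: V_def)
  then show ?thesis by (simp add: open_vimage open_compl_Lat continuous_intros)
qed

lemma F_minimal: "immersion_on V F" "conformal_on V F" "harmonic_on V F"
  using minimal by (simp_all add: minimal_immersion_def torus_proj_preimage_compl F_def V_def)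

lemma F_per: "l \<in> Lat \<Longrightarrow> F (z + l) = F z"
  by (simp add: F_def torus_proj_add)

lemma F_derivative: "z \<in> V \<Longrightarrow> (F has_derivative (\<lambda>v. \<chi> j. Re (weierstrass_data F j z * v))) (at z)"
  using F_minimal(1) open_V by (intro weierstrass_data_derivative)
    (auto simp: immersion_on_def differentiable_on_eq_differentiable_at)

text \<open>
  The lift \<open>F\<close> is periodic, and its derivative determines the data.
\<close>

lemma weierstrass_data_per:
  assumes "l \<in> Lat" "z \<in> V" shows "weierstrass_data F j (z + l) = weierstrass_data F j z"
proof -
  have "(F has_derivative (\<lambda>v. \<chi> j. Re (weierstrass_data F j (z + l) * v))) (at (z + l))"
    using assms by (intro F_derivative) (simp add: V_add)
  moreover have "((\<lambda>w. w + l) has_derivative (\<lambda>v. v)) (at z)" by (auto intro!: derivative_eq_intros)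
  ultimately have "((\<lambda>w. F (w + l)) has_derivative (\<lambda>v. \<chi> j. Re (weierstrass_data F j (z + l) * v))) (at z)"
    using has_derivative_compose[of "\<lambda>w. w + l" "\<lambda>v. v" z UNIV F] by simp
  then have "(F has_derivative (\<lambda>v. \<chi> j. Re (weierstrass_data F j (z + l) * v))) (at z)"
    by (simp add: F_per[OF assms(1)])
  then have "dderiv v F z = (\<chi> j. Re (weierstrass_data F j (z + l) * v))" for v by (rule dderiv_eqI)
  then show ?thesis by (simp add: weierstrass_data_def[of F j z] complex_eq_iff)
qed

lemma holomorphic_weierstrass_data: "weierstrass_data F j holomorphic_on V"
  by (rule harmonic_imp_weierstrass_data_holomorphic[OF open_V F_minimal(3)])

lemma \<Phi>_off_Lat: "z \<notin> Lat \<Longrightarrow> \<Phi> j z = weierstrass_data F j (z + p)"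
  by (simp add: \<Phi>_def)

lemma \<Phi>_has_derivative:
  assumes "z \<notin> Lat"
  shows "(\<Phi> j has_field_derivative deriv (weierstrass_data F j) (z + p)) (at z)"
proof -
  have "(weierstrass_data F j has_field_derivative deriv (weierstrass_data F j) (z + p)) (at (z + p))"
    using assms V_iff[of z] by (intro holomorphic_derivI[OF holomorphic_weierstrass_data open_V]) simp
  then have "((\<lambda>w. weierstrass_data F j (w + p)) has_field_derivative deriv (weierstrass_data F j) (z + p)) (at z)"
    by (simp add: DERIV_shift)
  then show ?thesis
    by (rule has_field_derivative_transform_within_open[OF _ open_compl_Lat]) (use assms in \<open>auto simp: \<Phi>_def\<close>)
qed

lemma elliptic_\<Phi>: "elliptic (\<Phi> j)"
  unfolding elliptic_def
proof (intro conjI allI ballI)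
  show "\<Phi> j holomorphic_on - Lat"
    unfolding holomorphic_on_open[OF open_compl_Lat] using \<Phi>_has_derivative by blast
  fix z l assume l: "l \<in> Lat"
  show "\<Phi> j (z + l) = \<Phi> j z"
  proof (cases "z \<in> Lat")
    case False
    then have nl: "z + l \<notin> Lat" using l by simp
    have "weierstrass_data F j (z + p + l) = weierstrass_data F j (z + p)"
      by (rule weierstrass_data_per[OF l]) (use False V_iff[of z] in simp)
    moreover have "z + p + l = z + l + p" by simp
    ultimately show ?thesis by (simp only: \<Phi>_off_Lat[OF nl] \<Phi>_off_Lat[OF False])
  qed (use l in \<open>simp add: \<Phi>_def\<close>)
qed

lemma \<Phi>_isotropic: "z \<notin> Lat \<Longrightarrow> (\<Sum>j\<in>UNIV. (\<Phi> j z)\<^sup>2) = 0"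
  using weierstrass_data_conformal(1)[OF open_V F_minimal(2), of "z + p"] V_iff[of z] by (simp add: \<Phi>_off_Lat)

lemma norm_sq_\<Phi>: "z \<notin> Lat \<Longrightarrow> norm_sq UNIV \<Phi> z = norm_sq UNIV (weierstrass_data F) (z + p)"
  by (simp add: norm_sq_def \<Phi>_off_Lat)

lemma norm_sq_\<Phi>_pos: "z \<in> - Lat \<Longrightarrow> norm_sq UNIV \<Phi> z > 0"
  using weierstrass_data_conformal(2)[OF open_V F_minimal(2), of "z + p"] V_iff[of z] by (simp add: norm_sq_\<Phi>)

sublocale elliptic_curve_map UNIV \<Phi>
  by unfold_locales (use elliptic_\<Phi> norm_sq_\<Phi>_pos in \<open>simp_all add: finite_class.finite_UNIV\<close>)

lemma lap_log_norm_\<Phi>: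
  assumes "z \<notin> Lat"
  shows "lap_log_norm UNIV \<Phi> z = lap_log_norm UNIV (weierstrass_data F) (z + p)"
proof -
  have "deriv (\<Phi> j) z = deriv (weierstrass_data F j) (z + p)" for j
    by (rule DERIV_imp_deriv[OF \<Phi>_has_derivative[OF assms]])
  then show ?thesis using assms by (simp add: lap_log_norm_def norm_sq_def herm_def \<Phi>_off_Lat)
qed

lemma F_shift_derivative:
  assumes "z \<in> - Lat"
  shows "((\<lambda>z. F (z + p)) has_derivative (\<lambda>v. \<chi> j. Re (\<Phi> j z * v))) (at z)"
proof -
  have "(F has_derivative (\<lambda>v. \<chi> j. Re (weierstrass_data F j (z + p) * v))) (at (z + p))"
    using assms by (intro F_derivative) (simp add: V_iff)
  moreover have "((\<lambda>w. w + p) has_derivative (\<lambda>v. v)) (at z)" by (auto intro!: derivative_eq_intros)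
  ultimately show ?thesis
    using has_derivative_compose[of "\<lambda>w. w + p" "\<lambda>v. v" z UNIV F] assms by (simp add: \<Phi>_off_Lat)
qed

lemma curvature_form:
  assumes "z \<in> V"
  shows "gaussian_curvature (induced_metric F) z * sqrt (det (induced_metric F z)) = - lap_log_norm UNIV (weierstrass_data F) z"
  by (rule gaussian_curvature_conformal[OF open_V holomorphic_weierstrass_data
        weierstrass_data_conformal(2)[OF open_V F_minimal(2)]
        weierstrass_data_conformal(3)[OF open_V F_minimal(2)] assms])

lemma total_curvature_eq:
  "total_curvature eq_tau (torus eq_tau - {torus_proj eq_tau p}) X
    = - (LINT z|lborel. indicator (fundamental_domain eq_tau \<inter> V) z * lap_log_norm UNIV (weierstrass_data F) z)"
proof -
  have "indicator (fundamental_domain eq_tau \<inter> V) z *\<^sub>R (gaussian_curvature (induced_metric F) z * sqrt (det (induced_metric F z)))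
     = - (indicator (fundamental_domain eq_tau \<inter> V) z * lap_log_norm UNIV (weierstrass_data F) z)" for z
    using curvature_form[of z] by (auto simp: indicator_def)
  then show ?thesis
    unfolding total_curvature_def Let_def set_lebesgue_integral_def torus_proj_preimage_compl
      F_def[symmetric] V_def[symmetric]
    by (simp only: Bochner_Integration.integral_minus)
qed

text \<open>
  A nonzero total curvature entails that the curvature form is integrable, so that the Lebesgue integral over
  the fundamental domain is a true value. The translate of the fundamental domain by \<open>- p\<close> covers the torus, which allows
  the shift of the coordinate.
\<close>

lemma total_mass_le:
  assumes curv: "total_curvature eq_tau (torus eq_tau - {torus_proj eq_tau p}) X = - 8 * pi"
  shows "total_mass UNIV \<Phi> \<le> ennreal (8 * pi)"
proof -
  let ?D = "fundamental_domain eq_tau"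
  define h where "h z = indicator (?D \<inter> V) z * lap_log_norm UNIV (weierstrass_data F) z" for z
  have I: "integral\<^sup>L lborel h = 8 * pi" using curv unfolding total_curvature_eq h_def by simp
  then have int: "integrable lborel h" using not_integrable_integral_eq[of lborel h] by fastforce
  have "(\<integral>\<^sup>+z. ennreal (h z) \<partial>lborel) = ennreal (8 * pi)"
    unfolding I[symmetric] by (rule nn_integral_eq_integral[OF int]) (simp add: h_def lap_log_norm_nonneg)
  define q where "q z = ennreal (lap_log_norm UNIV \<Phi> z) * indicator (- Lat) z" for z
  define B where "B = {z. p + z \<in> ?D}"
  have hq: "ennreal (h (p + z)) = q z * indicator B z" for z
  proof (cases "z \<in> Lat")
    case True
    then have "p + z \<notin> V" using V_iff[of z] by (simp add: add.commute)
    then show ?thesis using True by (simp add: h_def q_def)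
  next
    case False
    then have "p + z \<in> V" using V_iff[of z] by (simp add: add.commute)
    then show ?thesis using False lap_log_norm_\<Phi>[OF False] by (auto simp: h_def q_def B_def indicator_def add.commute)
  qed
  have B: "B \<in> sets borel"
  proof -
    have "(\<lambda>z. p + z) \<in> borel_measurable borel" by measurable
    from measurable_sets[OF this sets_fundamental_domain] show ?thesis by (simp add: B_def vimage_def)
  qed
  have cover: "\<exists>l\<in>Lat. z + l \<in> B" for z
    using Lat_reduce[of "p + z"] by (simp add: B_def add.assoc)
  have "total_mass UNIV \<Phi> \<le> (\<integral>\<^sup>+z. q z * indicator B z \<partial>lborel)"
    unfolding total_mass_def q_def
    by (rule mass_le_cover[OF sets_fundamental_domain fundamental_domain_inj B cover])
  also have "\<dots> = (\<integral>\<^sup>+z. ennreal (h (p + z)) \<partial>lborel)" by (simp only: hq)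
  also have "\<dots> = (\<integral>\<^sup>+z. ennreal (h z) \<partial>distr lborel borel ((+) p))"
    using int by (intro nn_integral_distr[symmetric]) auto
  also have "\<dots> = (\<integral>\<^sup>+z. ennreal (h z) \<partial>lborel)" by (simp only: lborel_distr_plus)
  also have "\<dots> = ennreal (8 * pi)" by fact
  finally show ?thesis .
qed

lemma derivative_norm_bound: "norm (\<chi> j. Re (\<Phi> j z * v)) \<le> sqrt (norm_sq UNIV \<Phi> z) * cmod v"
proof -
  have "(norm (\<chi> j. Re (\<Phi> j z * v)))\<^sup>2 = (\<Sum>j\<in>UNIV. (Re (\<Phi> j z * v))\<^sup>2)"
    by (simp only: power2_norm_eq_inner) (simp add: inner_vec_def power2_eq_square)
  also have "\<dots> \<le> (\<Sum>j\<in>UNIV. (cmod (\<Phi> j z))\<^sup>2 * (cmod v)\<^sup>2)"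
  proof (rule sum_mono)
    fix j
    have "\<bar>Re (\<Phi> j z * v)\<bar>\<^sup>2 \<le> (cmod (\<Phi> j z * v))\<^sup>2" by (intro power_mono abs_Re_le_cmod) simp
    then show "(Re (\<Phi> j z * v))\<^sup>2 \<le> (cmod (\<Phi> j z))\<^sup>2 * (cmod v)\<^sup>2" by (simp only: power2_abs norm_mult power_mult_distrib)
  qed
  also have "\<dots> = (sqrt (norm_sq UNIV \<Phi> z) * cmod v)\<^sup>2"
    by (simp add: norm_sq_def sum_distrib_right power_mult_distrib sum_nonneg)
  finally show ?thesis by (rule power2_le_imp_le) (simp add: norm_sq_nonneg)
qed

text \<open>
  If the coefficient vectors \<open>c\<close> and \<open>d\<close> were linearly dependent, \<open>\<phi>\<close> would be a scalar function times
  a constant vector and the curvature would vanish. So they span an isotropic plane, and \<open>dF = Re (\<phi> dz)\<close> is complex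
  linear for its complex structure.
\<close>

theorem total_curvature_imp_holomorphic:
  assumes proper: "proper_map (subtopology (torus_topology eq_tau) (torus eq_tau - {torus_proj eq_tau p})) euclidean X"
    and curv: "total_curvature eq_tau (torus eq_tau - {torus_proj eq_tau p}) X = - 8 * pi"
  shows "\<exists>J. orthogonal_complex_structure J \<and> complex_curve J eq_tau (torus eq_tau - {torus_proj eq_tau p}) X"
proof -
  note mass = total_mass_le[OF curv]
  have fin: "total_mass UNIV \<Phi> < \<infinity>" using mass by (rule le_less_trans) simp
  have mero: "\<exists>n. \<forall>j\<in>UNIV. pole_bound n (\<Phi> j)"
  proof (rule meromorphic_at_puncture[OF fin])
    show "filterlim (\<lambda>z. norm (F (z + p))) at_top (at 0)"
      using proper_imp_diverges[OF proper] by (simp add: F_def)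
  qed (use F_shift_derivative derivative_norm_bound in auto)
  have pb: "pole_bound 4 (\<Phi> j)" for j using pole_order_le_4[OF mass mero] by blast
  have "\<exists>c d P3 P4. (\<forall>z j. z \<notin> Lat \<longrightarrow> \<Phi> j z = c j * P3 z + d j * P4 z) \<and>
     (\<Sum>j\<in>UNIV. c j * c j) = 0 \<and> (\<Sum>j\<in>UNIV. c j * d j) = 0 \<and> (\<Sum>j\<in>UNIV. d j * d j) = 0"
  proof (rule minimal_data_isotropic_plane[OF elliptic_\<Phi> pb \<Phi>_isotropic])
    show "F (z + l + p) = F (z + p)" if "l \<in> Lat" for z l
      using F_per[OF that, of "z + p"] by (simp add: add_ac)
    show "((\<lambda>z. F (z + p)) has_derivative (\<lambda>v. \<chi> j. Re (\<Phi> j z * v))) (at z)" if "z \<notin> Lat" for z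
      using F_shift_derivative that by simp
  qed
  then obtain c d P3 P4 where eq: "\<And>z j. z \<notin> Lat \<Longrightarrow> \<Phi> j z = c j * P3 z + d j * P4 z"
    and iso: "(\<Sum>j\<in>UNIV. c j * c j) = 0" "(\<Sum>j\<in>UNIV. c j * d j) = 0" "(\<Sum>j\<in>UNIV. d j * d j) = 0" by blast
  have "\<exists>i k. c i * d k \<noteq> c k * d i"
  proof (rule ccontr)
    assume "\<not> ?thesis"
    then have dep: "c i * d k = c k * d i" for i k by blast
    have "norm_sq UNIV \<Phi> (of_real (1/2)) > 0" using compl_Lat_half by (intro norm_sq_\<Phi>_pos) simp
    then obtain m where "\<Phi> m (of_real (1/2)) \<noteq> 0"
      unfolding norm_sq_pos_iff[OF finite_class.finite_UNIV] by blast
    then have "c m \<noteq> 0 \<or> d m \<noteq> 0" using eq[OF compl_Lat_half, of m] by auto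
    then obtain \<kappa> where \<kappa>: "\<And>j x y. c j * x + d j * y = \<kappa> j * (c m * x + d m * y)"
      using dependent_imp_proportional[of c d m] dep by blast
    have "lap_log_norm UNIV \<Phi> z = 0" if "z \<in> - Lat" for z
    proof (rule lap_log_norm_proportional[OF open_compl_Lat _ that])
      show "\<Phi> m holomorphic_on - Lat" by (rule hol) simp
      show "\<Phi> j w = \<kappa> j * \<Phi> m w" if "w \<in> - Lat" for j w
      proof -
        have "w \<notin> Lat" using that by simp
        then show ?thesis unfolding eq[OF \<open>w \<notin> Lat\<close>] by (intro \<kappa>)
      qed
    qed
    then have "lap_log_norm UNIV (weierstrass_data F) z = 0" if "z \<in> V" for z
      using lap_log_norm_\<Phi>[of "z - p"] that by (simp add: V_def)
    then have 0: "(\<lambda>z. indicator (fundamental_domain eq_tau \<inter> V) z * lap_log_norm UNIV (weierstrass_data F) z) = (\<lambda>z. 0 :: real)"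
      by (intro ext) (simp add: indicator_def)
    show False using curv unfolding total_curvature_eq 0 by simp
  qed
  then obtain i k where "c i * d k \<noteq> c k * d i" by blast
  from isotropic_plane_complex_structure[OF iso this] obtain J where J: "orthogonal_complex_structure J"
    "\<And>\<alpha> \<beta>. J (\<chi> j. Re (\<alpha> * c j + \<beta> * d j)) = (\<chi> j. Re (\<i> * (\<alpha> * c j + \<beta> * d j)))" by blast
  have "dderiv (\<i> * v) F z = J (dderiv v F z)" if z: "z \<in> V" for z v
  proof -
    have dd: "dderiv u F z = (\<chi> j. Re (weierstrass_data F j z * u))" for u
      by (rule dderiv_eqI[OF F_derivative[OF z]])
    have w: "weierstrass_data F j z * u = u * P3 (z - p) * c j + u * P4 (z - p) * d j" for j u
    proof -
      have "z - p \<notin> Lat" using z by (simp add: V_def)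
      from eq[OF this, of j] \<Phi>_off_Lat[OF this, of j] show ?thesis by (simp add: algebra_simps)
    qed
    have "J (dderiv v F z) = (\<chi> j. Re (\<i> * (weierstrass_data F j z * v)))"
      unfolding dd w by (rule J(2))
    then show ?thesis unfolding dd by (simp only: mult.left_commute)
  qed
  then have "complex_curve J eq_tau (torus eq_tau - {torus_proj eq_tau p}) X"
    unfolding complex_curve_def torus_proj_preimage_compl F_def[symmetric] V_def[symmetric] by blast
  with J(1) show ?thesis by blast
qed

end

theorem proposition6:
  fixes \<tau> :: complex
  assumes "\<tau> = exp (2 * of_real pi * \<i> / 3)"
  shows "\<not> (\<exists>P X. P \<in> torus \<tau> \<and>
           minimal_immersion \<tau> (torus \<tau> - {P}) X \<and>
           proper_map (subtopology (torus_topology \<tau>) (torus \<tau> - {P})) euclidean X \<and>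
           non_holomorphic \<tau> (torus \<tau> - {P}) X \<and>
           total_curvature \<tau> (torus \<tau> - {P}) X = - 8 * pi)"
proof
  have \<tau>: "\<tau> = eq_tau" using assms by (simp add: eq_tau_def)
  assume "\<exists>P X. P \<in> torus \<tau> \<and>
           minimal_immersion \<tau> (torus \<tau> - {P}) X \<and>
           proper_map (subtopology (torus_topology \<tau>) (torus \<tau> - {P})) euclidean X \<and>
           non_holomorphic \<tau> (torus \<tau> - {P}) X \<and>
           total_curvature \<tau> (torus \<tau> - {P}) X = - 8 * pi"
  then obtain P X where P: "P \<in> torus eq_tau"
    and X: "minimal_immersion eq_tau (torus eq_tau - {P}) X"
      "proper_map (subtopology (torus_topology eq_tau) (torus eq_tau - {P})) euclidean X"
      "non_holomorphic eq_tau (torus eq_tau - {P}) X"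
      "total_curvature eq_tau (torus eq_tau - {P}) X = - 8 * pi"
    unfolding \<tau> by blast
  obtain p where p: "P = torus_proj eq_tau p" using P range_torus_proj[of eq_tau] by blast
  interpret punctured_minimal_torus X p
    by unfold_locales (use X(1) p in simp)
  show False
    using total_curvature_imp_holomorphic X(2-4) unfolding p non_holomorphic_def by blast
qed

end
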